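(* Let $P_{\mathrm{Arch}}\in\mathcal P_3$ be a fixed Archimedean truncated octahedron, where $\mathcal P_3$ is the family of parallelohedra in $\mathbb R^3$ whose centers of symmetry are at the origin. There exist a neighborhood $\mathcal U$ of $P_{\mathrm{Arch}}$ in $\mathcal P_3$ with respect to the Hausdorff distance and a constant $c_{\mathrm{sim}}>0$ such that for every $P\in\mathcal U$ $$\mathcal I(P)-\mathcal I(P_{\mathrm{Arch}})\ \geq\ c_{\mathrm{sim}}\, d_{\mathrm{sim}}(P,P_{\mathrm{Arch}})^2 .$$ Moreover, for $P\in\mathcal U$, equality holds if and only if $P$ is similar to $P_{\mathrm{Arch}}$.
   Context: A parallelohedron is a (three-dimensional) convex polyhedron in $\mathbb R^3$ that admits a face-to-face tiling of $\mathbb R^3$ by translations; every parallelohedron is centrally symmetric. $\mathcal P_3$ denotes the family of parallelohedra in $\mathbb R^3$ whose centers of symmetry are at the origin, with the Hausdorff distance $d_H$. The Archimedean truncated octahedron is the Archimedean solid with 14 facets (8 regular hexagons and 6 squares, all edges of equal length). For a convex body $P\subset\mathbb R^3$, the isoperimetric quotient is $\mathcal I(P):=\operatorname{area}(\partial P)/\operatorname{vol}(P)^{2/3}$. For a centered convex body $K\subset\mathbb R^3$, its volume-normalized representative is $\widehat K:=\left(\operatorname{vol}(P_{\mathrm{Arch}})/\operatorname{vol}(K)\right)^{1/3}K$. Define $$d_{\mathrm{sim}}(P,P_{\mathrm{Arch}}):=\inf_{Q\in\mathrm{SO}(3)} d_H(Q\widehat P,P_{\mathrm{Arch}}).$$ Two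 bodies in $\mathcal P_3$ are called similar if they differ by a rotation and a uniform (positive) rescaling. *)

theory Defs
  imports "HOL-Analysis.Analysis"
begin

definition face_to_face_translation_tiling :: "(real^3) set \<Rightarrow> (real^3) set \<Rightarrow> bool" where
  "face_to_face_translation_tiling P T \<longleftrightarrow>
     (\<Union>t\<in>T. (+) t ` P) = UNIV \<and>
     (\<forall>s\<in>T. \<forall>t\<in>T. s \<noteq> t \<longrightarrow>
        interior ((+) s ` P) \<inter> interior ((+) t ` P) = {} \<and>
        ((+) s ` P \<inter> (+) t ` P) face_of ((+) s ` P) \<and>
        ((+) s ` P \<inter> (+) t ` P) face_of ((+) t ` P))"

definition parallelohedron :: "(real^3) set \<Rightarrow> bool" where
  "parallelohedron P \<longleftrightarrow>
     polytope P \<and> interior P \<noteq> {} \<and> (\<exists>T. face_to_face_translation_tiling P T)"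

definition centered_parallelohedra :: "(real^3) set set" where
  "centered_parallelohedra = {P. parallelohedron P \<and> uminus ` P = P}"

definition distance_preserving :: "('a::metric_space \<Rightarrow> 'b::metric_space) \<Rightarrow> bool" where
  "distance_preserving f \<longleftrightarrow> (\<forall>x y. dist (f x) (f y) = dist x y)"

definition regular_polygon :: "nat \<Rightarrow> (real^3) set \<Rightarrow> bool" where
  "regular_polygon n F \<longleftrightarrow> n \<ge> 3 \<and>
     (\<exists>c u v r. r > 0 \<and> norm u = 1 \<and> norm v = 1 \<and> u \<bullet> v = 0 \<and>
        F = convex hull ((\<lambda>k. c + (r * cos (2 * pi * real k / real n)) *\<^sub>R u
                               + (r * sin (2 * pi * real k / real n)) *\<^sub>R v) ` {..<n}))"

text \<open>The first and the last clause say that the solid is Archimedean (regular faces of more than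
  one kind, vertices equivalent under symmetries). Prisms and antiprisms, usually excluded from the
  Archimedean solids, cannot have this set of facets.\<close>

definition archimedean_truncated_octahedron :: "(real^3) set \<Rightarrow> bool" where
  "archimedean_truncated_octahedron P \<longleftrightarrow>
     polytope P \<and> interior P \<noteq> {} \<and>
     card {F. F facet_of P} = 14 \<and>
     card {F. F facet_of P \<and> regular_polygon 6 F} = 8 \<and>
     card {F. F facet_of P \<and> regular_polygon 4 F} = 6 \<and>
     (\<exists>l. \<forall>e. e edge_of P \<longrightarrow> diameter e = l) \<and>
     (\<forall>v w. v extreme_point_of P \<and> w extreme_point_of P \<longrightarrow>
        (\<exists>f :: real^3 \<Rightarrow> real^3. distance_preserving f \<and> f ` P = P \<and> f v = w))"

text \<open>The area of a subset of a plane is its two-dimensional Lebesgue measure in isometric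
  coordinates on that plane; the value does not depend on the coordinates chosen.\<close>

definition planar_area :: "(real^3) set \<Rightarrow> real" where
  "planar_area S =
     (let f = (SOME f :: real^2 \<Rightarrow> real^3. distance_preserving f \<and> S \<subseteq> range f)
      in measure lebesgue (f -` S))"

text \<open>For a three-dimensional polytope the boundary is the union of the facets, which overlap
  only in null sets.\<close>

definition surface_area :: "(real^3) set \<Rightarrow> real" where
  "surface_area P = (\<Sum>F\<in>{F. F facet_of P}. planar_area F)"

abbreviation volume :: "(real^3) set \<Rightarrow> real" where
  "volume P \<equiv> measure lebesgue P"

definition isoperimetric_quotient :: "(real^3) set \<Rightarrow> real" where
  "isoperimetric_quotient P = surface_area P / volume P powr (2/3)"

definition hausdorff_distance :: "'a::metric_space set \<Rightarrow> 'a set \<Rightarrow> real" where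
  "hausdorff_distance A B = max (SUP a\<in>A. infdist a B) (SUP b\<in>B. infdist b A)"

definition volume_normalized :: "(real^3) set \<Rightarrow> (real^3) set \<Rightarrow> (real^3) set" where
  "volume_normalized A K = (*\<^sub>R) (root 3 (volume A / volume K)) ` K"

definition similarity_distance :: "(real^3) set \<Rightarrow> (real^3) set \<Rightarrow> real" where
  "similarity_distance P A =
     (INF Q\<in>{Q :: real^3^3. rotation_matrix Q}.
        hausdorff_distance ((*v) Q ` volume_normalized A P) A)"

definition similar :: "(real^3) set \<Rightarrow> (real^3) set \<Rightarrow> bool" where
  "similar P A \<longleftrightarrow>
     (\<exists>(Q :: real^3^3) r. rotation_matrix Q \<and> r > 0 \<and> P = (\<lambda>x. r *\<^sub>R (Q *v x)) ` A)"

definition hausdorff_neighborhood :: "(real^3) set set \<Rightarrow> (real^3) set \<Rightarrow> (real^3) set set \<Rightarrow> bool"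
  where
  "hausdorff_neighborhood X A U \<longleftrightarrow>
     U \<subseteq> X \<and> (\<exists>e>0. \<forall>P\<in>X. hausdorff_distance P A < e \<longrightarrow> P \<in> U)"

end

theory Submission
 imports Defs "HOL-Analysis.Cross3"
begin

text \<open>The truncated octahedron is the Voronoi cell \<open>{x. v\<^sub>S \<bullet> x \<le> (v\<^sub>S \<bullet> v\<^sub>S) / 2 for all cuts S}\<close> of four
vectors \<open>v\<^sub>i\<close> with sum zero and equal mutual inner products, where \<open>v\<^sub>S\<close> is the sum over a proper
nonempty subset \<open>S\<close> of the four labels. A nearby parallelohedron \<open>P\<close> has a facet close to each of these 14
facets, and no others by Minkowski's bound. Face-to-face contact along the edges shows that its facet
normals and facet vectors can be scaled to \<open>N\<^sub>S\<close> and \<open>t\<^sub>S\<close>, again sums over \<open>S\<close>, with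
\<open>p\<^sub>i\<^sub>j = - N\<^sub>i \<bullet> t\<^sub>j\<close> symmetric. With \<open>\<gamma>\<^sub>i\<^sub>j = - N\<^sub>i \<bullet> N\<^sub>j\<close>, the area of each facet of \<open>P\<close> is bounded below and
the volume above by explicit functions of the twelve numbers \<open>p\<^sub>i\<^sub>j\<close>, \<open>\<gamma>\<^sub>i\<^sub>j\<close>. After scaling both families
to mean 1, the resulting bound for the isoperimetric quotient has a nondegenerate minimum at the
point where all of them are 1, so the deficit controls the square of their deviation from 1.
Gram-Schmidt orthonormalization bounds the similarity distance linearly by this deviation.\<close>

text \<open>The tiling set is not assumed to be a lattice. All facet vectors are periods of it,
  because the offset across a given facet is the same at every tile; the lattice they generate
  carries Minkowski's argument and the volume bound. The obstacle is that a nearby parallelohedron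
  need not be the Voronoi cell of its lattice: normals and facet vectors are two different families,
  linked only by the symmetry of \<open>p\<close>. The metric therefore enters through the \<gamma>
  weights, which the real inequality treats as independent variables; the minimum is nondegenerate
  even in this larger space. For a nearby body, area is bounded below and volume above; for the
  truncated octahedron itself the opposite bounds hold with the same value. Nearness is expressed by
  sequences: since periods are uniformly separated, relations between them that hold in the limit
  hold exactly from some index on. The radius of the neighbourhood then comes from a proof by
  contradiction.\<close>

notation scaleR (infixr "*R" 75)

section \<open>Packings, coverings and lattices\<close>

lemma emeasure_lebesgue_translate:
 "emeasure lebesgue ((+) a ` S) = emeasure lebesgue S" for a :: "'a::euclidean_space"
 using emeasure_lebesgue_affine[of 1 a S] by (simp add: image_def add.commute)

text \<open>A dissection argument: \<open>X\<close> is cut into the pieces first hit by the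
  translates of \<open>D\<close>, every piece is moved back into \<open>D\<close>, and the packing
  condition makes the moved pieces overlap only in the null set \<open>N\<close>.\<close>

lemma emeasure_covering_ge_packing:
 fixes \<Gamma> :: "'a::euclidean_space set"
 assumes "countable \<Gamma>" and X: "X \<in> sets lebesgue" and D: "D \<in> sets lebesgue"
  and cover: "\<And>x. x \<in> X \<Longrightarrow> \<exists>g\<in>\<Gamma>. x - g \<in> D"
  and pack: "\<And>g h. \<lbrakk>g \<in> \<Gamma>; h \<in> \<Gamma>; g \<noteq> h\<rbrakk> \<Longrightarrow> negligible ({x. x + g \<in> X} \<inter> {x. x + h \<in> X})"
 shows "emeasure lebesgue X \<le> emeasure lebesgue D"
proof (cases "X = {}")
 case False
 then have "\<Gamma> \<noteq> {}" using cover by blast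
 then obtain g :: "nat \<Rightarrow> 'a" where g: "range g = \<Gamma>"
  using range_from_nat_into[of \<Gamma>] \<open>countable \<Gamma>\<close> by blast
 define A where "A n = X \<inter> (+) (g n) ` D" for n :: nat
 define B where "B = disjointed A"
 define C where "C n = (+) (- g n) ` B n" for n
 define N where "N = (\<Union>m. \<Union>n\<in>{n. g m \<noteq> g n}. C m \<inter> C n)"
 have A: "A n \<in> sets lebesgue" for n
  unfolding A_def using X D lebesgue_sets_translation by blast
 then have B: "B n \<in> sets lebesgue" for n
  unfolding B_def using sets.range_disjointed_sets[of A lebesgue] by blast
 have C: "C n \<in> sets lebesgue" for n
  unfolding C_def using B lebesgue_sets_translation by blast
 have BA: "B n \<subseteq> A n" for n unfolding B_def by (rule disjointed_subset)
 have CX: "C n \<subseteq> {x. x + g n \<in> X}" for n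
  using BA[of n] by (auto simp: C_def A_def)
 have CD: "C n \<subseteq> D" for n
  using BA[of n] by (auto simp: C_def A_def)
 have "X \<subseteq> (\<Union>n. A n)"
 proof
  fix x assume "x \<in> X"
  then obtain n where "x - g n \<in> D" using cover g by (metis imageE)
  then have "x \<in> (+) (g n) ` D" by (metis add.commute diff_add_cancel image_eqI)
  then show "x \<in> (\<Union>n. A n)" using \<open>x \<in> X\<close> by (auto simp: A_def)
 qed
 then have "X = (\<Union>n. A n)" by (auto simp: A_def)
 also have "\<dots> = (\<Union>n. B n)" by (simp add: B_def UN_disjointed_eq)
 finally have XB: "X = (\<Union>n. B n)" .
 \<comment> \<open>The enumeration \<open>g\<close> of \<open>\<Gamma>\<close> may repeat;
   \<open>disjointed\<close> leaves nothing for a repeated vector.\<close>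
 have Bempty: "B n = {}" if "m < n" "g m = g n" for m n
  using that by (auto simp: B_def disjointed_def A_def)
 have "negligible (C m \<inter> C n)" if "g m \<noteq> g n" for m n
  using pack[of "g m" "g n"] g that CX[of m] CX[of n]
  by (metis Int_mono negligible_subset rangeI)
 then have N: "N \<in> null_sets lebesgue"
  unfolding N_def negligible_iff_null_sets by (intro null_sets_UN') auto
 have "disjoint_family (\<lambda>n. C n - N)"
 unfolding disjoint_family_on_def
 proof (intro ballI impI)
  fix m n :: nat assume "m \<noteq> n"
  show "(C m - N) \<inter> (C n - N) = {}"
  proof (cases "g m = g n")
   case True
   then have "B m = {} \<or> B n = {}"
    using Bempty \<open>m \<noteq> n\<close> by (metis nat_neq_iff)
   then show ?thesis by (auto simp: C_def)
  qed (auto simp: N_def)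
 qed
 moreover have CN: "C n - N \<in> sets lebesgue" for n
  using C N by (meson null_setsD2 sets.Diff)
 ultimately have "(\<Sum>n. emeasure lebesgue (C n - N)) = emeasure lebesgue (\<Union>n. C n - N)"
  by (intro suminf_emeasure) auto
 also have "\<dots> \<le> emeasure lebesgue D"
  using CD D by (intro emeasure_mono) auto
 also have "emeasure lebesgue (C n - N) = emeasure lebesgue (B n)" for n
  using emeasure_Diff_null_set[OF N C] by (simp only: C_def emeasure_lebesgue_translate)
 then have "(\<Sum>n. emeasure lebesgue (C n - N)) = (\<Sum>n. emeasure lebesgue (B n))"
  by simp
 also have "\<dots> = emeasure lebesgue X"
  unfolding XB using B by (intro suminf_emeasure) (auto simp: B_def disjoint_family_disjointed)
 finally show ?thesis .
qed simp

definition int_span :: "real^'n^'n \<Rightarrow> (real^'n) set"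
 where "int_span M = {M *v z | z. \<forall>i. z $ i \<in> \<int>}"

lemma countable_int_span: "countable (int_span (M :: real^'n^'n))"
proof -
 have "int_span M \<subseteq> range (\<lambda>k :: 'n \<Rightarrow> int. M *v (\<chi> i. of_int (k i)))"
 proof
  fix x assume "x \<in> int_span M"
  then obtain z where z: "x = M *v z" "\<forall>i. z $ i \<in> \<int>" by (auto simp: int_span_def)
  have "z = (\<chi> i. of_int \<lfloor>z $ i\<rfloor>)"
   using z(2) by (simp add: vec_eq_iff)
  then show "x \<in> range (\<lambda>k :: 'n \<Rightarrow> int. M *v (\<chi> i. of_int (k i)))"
   using z(1) by (metis rangeI)
 qed
 moreover have "countable (UNIV :: ('n \<Rightarrow> int) set)" by simp
 ultimately show ?thesis by (rule countable_subset[OF _ countable_image])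
qed

lemma int_span_diff: "\<lbrakk>x \<in> int_span M; y \<in> int_span M\<rbrakk> \<Longrightarrow> x - y \<in> int_span M"
proof -
 assume "x \<in> int_span M" "y \<in> int_span M"
 then obtain z w where "x = M *v z" "y = M *v w" "\<forall>i. z $ i \<in> \<int>" "\<forall>i. w $ i \<in> \<int>"
  by (auto simp: int_span_def)
 then have "x - y = M *v (z - w)" "\<forall>i. (z - w) $ i \<in> \<int>"
  by (auto simp: matrix_vector_mult_diff_distrib)
 then show ?thesis by (auto simp: int_span_def)
qed

lemma int_span_uminus: "x \<in> int_span M \<Longrightarrow> - x \<in> int_span M"
proof -
 have "0 \<in> int_span M" unfolding int_span_def by clarsimp (metis Ints_0 matrix_vector_mult_0_right zero_index)
 then show "x \<in> int_span M \<Longrightarrow> - x \<in> int_span M" using int_span_diff[of 0 M x] by simp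
qed

text \<open>Lattice translates of the closed parallelepiped cover space and those of the open one
  are disjoint; each version is one side of a comparison below.\<close>

lemma parallelepiped_measure:
 fixes M :: "real^3^3"
 shows "(*v) M ` cbox 0 1 \<in> lmeasurable" "measure lebesgue ((*v) M ` cbox 0 1) = \<bar>det M\<bar>"
  "(*v) M ` box 0 1 \<in> lmeasurable" "measure lebesgue ((*v) M ` box 0 1) = \<bar>det M\<bar>"
proof -
 have "measure lborel (cbox 0 (1::real^3)) = 1"
  by (subst content_cbox_cart) (auto simp: interval_ne_empty_cart)
 then have 1: "measure lebesgue (cbox 0 (1::real^3)) = 1" by simp
 have "measure lebesgue (interior (cbox 0 (1::real^3))) = measure lebesgue (cbox 0 (1::real^3))"
  by (intro measure_interior bounded_cbox negligible_convex_frontier convex_box)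
 then have 2: "measure lebesgue (box 0 (1::real^3)) = 1" by (simp add: 1 interior_cbox)
 show "(*v) M ` cbox 0 1 \<in> lmeasurable" "measure lebesgue ((*v) M ` cbox 0 1) = \<bar>det M\<bar>"
  "(*v) M ` box 0 1 \<in> lmeasurable" "measure lebesgue ((*v) M ` box 0 1) = \<bar>det M\<bar>"
 using measurable_linear_image[of "(*v) M" "cbox 0 1"] measure_linear_image[of "(*v) M" "cbox 0 1"]
  measurable_linear_image[of "(*v) M" "box 0 1"] measure_linear_image[of "(*v) M" "box 0 1"]
 using 1 2 by (simp_all add: lmeasurable_cbox lmeasurable_box del: measure_lborel_box_eq measure_lborel_cbox_eq)
qed

lemma int_span_cover:
 fixes M :: "real^'n^'n"
 assumes "det M \<noteq> 0"
 shows "\<exists>g\<in>int_span M. x - g \<in> (*v) M ` cbox 0 1"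
proof -
 obtain N where N: "M ** N = mat 1" using assms invertible_det_nz[of M] by (auto simp: invertible_def)
 define y where "y = N *v x"
 have y: "x = M *v y" by (simp add: y_def matrix_vector_mul_assoc N)
 let ?z = "\<chi> i. of_int \<lfloor>y $ i\<rfloor>"
 have "M *v ?z \<in> int_span M" by (auto simp: int_span_def)
 moreover have "y - ?z \<in> cbox 0 1"
 proof -
  have "0 \<le> r - of_int \<lfloor>r\<rfloor> \<and> r - of_int \<lfloor>r\<rfloor> \<le> 1" for r :: real by linarith
  then show ?thesis by (simp add: mem_box_cart)
 qed
 then have "x - M *v ?z \<in> (*v) M ` cbox 0 1"
  unfolding y matrix_vector_mult_diff_distrib[symmetric] by (rule imageI)
 ultimately show ?thesis by blast
qed

lemma int_span_pack:
 fixes M :: "real^'n^'n"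
 assumes "det M \<noteq> 0" "g \<in> int_span M" "h \<in> int_span M" "g \<noteq> h"
 shows "{x. x + g \<in> (*v) M ` box 0 1} \<inter> {x. x + h \<in> (*v) M ` box 0 1} = {}"
proof (rule ccontr)
 assume "\<not> ?thesis"
 then obtain x p q where pq: "x + g = M *v p" "x + h = M *v q" "p \<in> box 0 1" "q \<in> box 0 1" by auto
 obtain z where z: "g - h = M *v z" "\<forall>i. z $ i \<in> \<int>"
  using int_span_diff[OF assms(2,3)] by (auto simp: int_span_def)
 have "M *v (p - q) = (x + g) - (x + h)" by (simp only: pq matrix_vector_mult_diff_distrib)
 then have "M *v (p - q) = M *v z" using z(1) by simp
 moreover obtain N where N: "N ** M = mat 1" using assms invertible_det_nz[of M] by (auto simp: invertible_def)
 ultimately have "N *v (M *v (p - q)) = N *v (M *v z)" by simp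
 then have "p - q = z" by (simp add: matrix_vector_mul_assoc N)
 have "z $ i = 0" for i
 proof -
  have "0 < p $ i" "p $ i < 1" "0 < q $ i" "q $ i < 1"
   using pq(3,4) by (auto simp: mem_box_cart)
  then have "\<bar>p $ i - q $ i\<bar> < 1" by linarith
  then have "\<bar>z $ i\<bar> < 1" using \<open>p - q = z\<close> by auto
  then show ?thesis using z(2) by (metis Ints_nonzero_abs_less1)
 qed
 then have "z = 0" by (simp add: vec_eq_iff)
 then show False using z \<open>g \<noteq> h\<close> by simp
qed

text \<open>The closed fundamental parallelepiped covers space, so it is at least as large as any
  packing set. The form with \<open>emeasure\<close> serves a set whose measure is not known to be
  finite in advance.\<close>

lemma measure_packing_le_det:
 fixes M :: "real^3^3"
 assumes "det M \<noteq> 0" "X \<in> sets lebesgue"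
  and "\<And>g. \<lbrakk>g \<in> int_span M; g \<noteq> 0\<rbrakk> \<Longrightarrow> negligible (X \<inter> {x. x + g \<in> X})"
 shows "emeasure lebesgue X \<le> ennreal \<bar>det M\<bar>" "measure lebesgue X \<le> \<bar>det M\<bar>"
proof -
 have "emeasure lebesgue X \<le> emeasure lebesgue ((*v) M ` cbox 0 1)"
 proof (rule emeasure_covering_ge_packing[of "int_span M"])
  fix g h assume gh: "g \<in> int_span M" "h \<in> int_span M" "g \<noteq> h"
  have "{x. x + g \<in> X} \<inter> {x. x + h \<in> X} = (+) (- g) ` (X \<inter> {x. x + (h - g) \<in> X})"
   by (force simp: algebra_simps image_iff intro: exI[of _ "x + g" for x])
  moreover have "negligible (X \<inter> {x. x + (h - g) \<in> X})"
   using gh int_span_diff[of h M g] assms(3)[of "h - g"] by simp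
  ultimately show "negligible ({x. x + g \<in> X} \<inter> {x. x + h \<in> X})"
   by (metis negligible_translation)
 next
  show "(*v) M ` cbox 0 1 \<in> sets lebesgue" using parallelepiped_measure(1)[of M] by blast
 qed (use assms countable_int_span int_span_cover in auto)
 also have "\<dots> = ennreal \<bar>det M\<bar>"
  using parallelepiped_measure(1,2)[of M] by (metis emeasure_eq_measure2)
 finally show "emeasure lebesgue X \<le> ennreal \<bar>det M\<bar>" .
 then show "measure lebesgue X \<le> \<bar>det M\<bar>"
  by (simp add: measure_def enn2real_leI)
qed

lemma det_le_measure_covering:
 fixes M :: "real^3^3"
 assumes "det M \<noteq> 0" "D \<in> lmeasurable" and "\<And>x. \<exists>g\<in>int_span M. x - g \<in> D"
 shows "\<bar>det M\<bar> \<le> measure lebesgue D"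
proof -
 have "emeasure lebesgue ((*v) M ` box 0 1) \<le> emeasure lebesgue D"
 proof (rule emeasure_covering_ge_packing[of "int_span M"])
  show "(*v) M ` box 0 1 \<in> sets lebesgue" using parallelepiped_measure(3)[of M] by blast
 qed (use assms countable_int_span int_span_pack[of M] in \<open>auto simp: fmeasurableD\<close>)
 then have "measure lebesgue ((*v) M ` box 0 1) \<le> measure lebesgue D"
  using parallelepiped_measure(3)[of M] assms(2) by (simp add: emeasure_eq_measure2)
 then show ?thesis by (simp add: parallelepiped_measure)
qed

section \<open>Voronoi cells and congruence modulo a doubled lattice\<close>

lemma uniform_discrete_imp_countable:
 fixes L :: "'a::heine_borel set"
 assumes "uniform_discrete L" shows "countable L"
proof (cases "L = {}")
 case False
 then obtain a where "a \<in> L" by blast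
 have "L = (\<Union>n::nat. L \<inter> cball a (real n))"
  by (auto simp: real_arch_simple)
 moreover have "finite (L \<inter> cball a (real n))" for n
  using assms uniform_discrete_finite_iff uniform_discrete_subset
  by (metis bounded_Int bounded_cball inf_le1)
 ultimately show ?thesis
  by (metis countable_UN countableI_type countable_finite)
qed simp

lemma negligible_UN_finite:
 "\<lbrakk>finite I; \<And>i. i \<in> I \<Longrightarrow> negligible (E i)\<rbrakk> \<Longrightarrow> negligible (\<Union>i\<in>I. E i)"
 by (rule negligible_Union) auto

text \<open>The bound \<open>2^3\<close> for the index of \<open>2 L\<close> in \<open>L\<close> is
  obtained from volumes instead of a lattice basis. The translates of the Voronoi cell
  \<open>V\<close> by \<open>R\<close> pack under \<open>2 L\<close>, while the doubled cell covers
  space under \<open>2 L\<close> and has 8 times the volume of \<open>V\<close>. The sublattice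
  \<open>int_span M\<close> makes the volume of \<open>V\<close> finite.\<close>

lemma card_incongruent_mod_double_le:
 fixes L :: "(real^3) set" and M :: "real^3^3"
 assumes "uniform_discrete L" and zero: "0 \<in> L"
  and diff: "\<And>x y. \<lbrakk>x \<in> L; y \<in> L\<rbrakk> \<Longrightarrow> x - y \<in> L"
  and M: "det M \<noteq> 0" "int_span M \<subseteq> L"
  and R: "finite R" "R \<subseteq> L" "\<And>x y m. \<lbrakk>x \<in> R; y \<in> R; m \<in> L; x - y = 2 *R m\<rbrakk> \<Longrightarrow> x = y"
 shows "card R \<le> 8"
proof -
 have add: "x + y \<in> L" if "x \<in> L" "y \<in> L" for x y
  using diff[OF that(1) diff[OF zero that(2)]] by simp
 define V where "V = {x :: real^3. \<forall>l\<in>L. norm x \<le> norm (x - l)}"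
 have "closed L" using assms(1) uniform_discrete_imp_closed by blast
 have near: "\<exists>l\<in>L. x - l \<in> V" for x
 proof -
  obtain l where l: "l \<in> L" "\<And>y. y \<in> L \<Longrightarrow> dist x l \<le> dist x y"
   using distance_attains_inf[OF \<open>closed L\<close>, of x] zero by blast
  have "norm (x - l) \<le> norm (x - l - k)" if "k \<in> L" for k
   using l(2)[OF add[OF l(1) that]] by (simp add: dist_norm algebra_simps)
  then show ?thesis using l(1) by (auto simp: V_def)
 qed
 have "closed V"
 proof -
  have "V = (\<Inter>l\<in>L. {x. norm x \<le> norm (x - l)})" by (auto simp: V_def)
  then show ?thesis
   by (auto intro!: closed_INT closed_Collect_le continuous_intros)
 qed
 then have Vm: "V \<in> sets lebesgue" by (intro sets_completionI_sets) (simp add: borel_closed)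
 \<comment> \<open>Two translates of the cell meet only in the bisecting hyperplane of their
   centres.\<close>
 have hyper: "negligible ({x. x + g \<in> V} \<inter> {x. x + h \<in> V})" if "g - h \<in> L" "g \<noteq> h" for g h
 proof (rule negligible_subset)
  show "negligible {x. (g - h) \<bullet> x = (h \<bullet> h - g \<bullet> g) / 2}"
   using that negligible_hyperplane[of "g - h" "(h \<bullet> h - g \<bullet> g) / 2"] by simp
  show "{x. x + g \<in> V} \<inter> {x. x + h \<in> V} \<subseteq> {x. (g - h) \<bullet> x = (h \<bullet> h - g \<bullet> g) / 2}"
  proof
   fix x assume "x \<in> {x. x + g \<in> V} \<inter> {x. x + h \<in> V}"
   then have x: "x + g \<in> V" "x + h \<in> V" by auto
   have "h - g \<in> L" using that(1) diff[OF zero that(1)] by simp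
   have "norm (x + g) \<le> norm (x + g - (g - h))" using x(1) that(1) unfolding V_def by blast
   moreover have "norm (x + h) \<le> norm (x + h - (h - g))"
    using x(2) \<open>h - g \<in> L\<close> unfolding V_def by blast
   ultimately have "norm (x + g) = norm (x + h)" by (simp add: algebra_simps)
   then have "(x + g) \<bullet> (x + g) = (x + h) \<bullet> (x + h)" by (simp add: norm_eq)
   then show "x \<in> {x. (g - h) \<bullet> x = (h \<bullet> h - g \<bullet> g) / 2}"
    by (simp add: inner_add inner_diff inner_commute algebra_simps)
  qed
 qed
 have "emeasure lebesgue V \<le> ennreal \<bar>det M\<bar>"
 proof (rule measure_packing_le_det(1)[OF M(1) Vm])
  fix g assume "g \<in> int_span M" "g \<noteq> 0"
  then show "negligible (V \<inter> {x. x + g \<in> V})"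
   using hyper[of 0 g] M(2) diff[OF zero, of g] by auto
 qed
 then have "emeasure lebesgue V < \<infinity>" by (simp add: le_less_trans)
 then have Vl: "V \<in> lmeasurable" using Vm by (simp add: fmeasurable_def)
 obtain e where e: "e > 0" "\<And>x y. \<lbrakk>x \<in> L; y \<in> L; dist x y < e\<rbrakk> \<Longrightarrow> x = y"
  using assms(1) by (auto simp: uniform_discrete_def)
 \<comment> \<open>Half the minimal distance of \<open>L\<close> is an inner radius of
   \<open>V\<close>, so the volume of \<open>V\<close> is positive and can be cancelled at the
   end.\<close>
 have "ball 0 (e/2) \<subseteq> V"
  unfolding V_def
 proof (intro subsetI CollectI ballI)
  fix x l :: "real^3" assume "x \<in> ball 0 (e / 2)" "l \<in> L"
  then have "norm x < e / 2" by simp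
  show "norm x \<le> norm (x - l)"
  proof (cases "l = 0")
   case False
   then have "e \<le> norm l" using e(2)[OF \<open>l \<in> L\<close> zero] by force
   then show ?thesis
    using \<open>norm x < e / 2\<close> norm_triangle_ineq2[of l x] by (simp add: norm_minus_commute)
  qed simp
 qed
 then have "measure lebesgue (ball (0::real^3) (e/2)) \<le> measure lebesgue V"
  using Vl by (intro measure_mono_fmeasurable) auto
 moreover have "measure lebesgue (ball (0::real^3) (e/2)) > 0"
  using \<open>e > 0\<close> by (simp add: content_ball_pos)
 ultimately have Vpos: "measure lebesgue V > 0" by (rule less_le_trans[rotated])
 define X where "X = (\<Union>r\<in>R. (+) r ` V)"
 define D where "D = (*R) 2 ` V"
 have trV: "(+) r ` V \<in> lmeasurable" for r using Vl by (simp add: measurable_translation)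
 have Xm: "X \<in> lmeasurable" unfolding X_def using R(1) trV by (intro fmeasurable.finite_UN) auto
 have Dm: "D \<in> lmeasurable"
  unfolding D_def using Vl by (intro measurable_linear_image) (simp_all add: linear_scaleR)
 have L2: "(\<lambda>l. 2 *R l) ` L \<subseteq> L"
  using add scaleR_2 by (metis image_subsetI)
 have memV: "x \<in> (+) r ` V \<longleftrightarrow> x - r \<in> V" for x r
  by (force simp: image_iff intro: bexI[of _ "x - r"])
 have "emeasure lebesgue X \<le> emeasure lebesgue D"
 proof (rule emeasure_covering_ge_packing[of "(\<lambda>l. 2 *R l) ` L"])
  have "countable L"
   by (rule uniform_discrete_imp_countable[OF assms(1)])
  then show "countable ((\<lambda>l. 2 *R l) ` L)" by simp
 next
  fix x
  obtain l where "l \<in> L" "(1/2) *R x - l \<in> V" using near by blast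
  then have "x - 2 *R l \<in> D"
   unfolding D_def by (force simp: image_iff algebra_simps intro!: bexI[of _ "(1/2) *R x - l"])
  then show "\<exists>g\<in>(\<lambda>l. 2 *R l) ` L. x - g \<in> D" using \<open>l \<in> L\<close> by blast
 next
  fix g h assume "g \<in> (\<lambda>l. 2 *R l) ` L" "h \<in> (\<lambda>l. 2 *R l) ` L" "g \<noteq> h"
  then obtain g' h' where gh: "g = 2 *R g'" "h = 2 *R h'" "g' \<in> L" "h' \<in> L" by auto
  have "{x. x + g \<in> X} \<inter> {x. x + h \<in> X}
    = (\<Union>r\<in>R. \<Union>s\<in>R. {x. x + (g - r) \<in> V} \<inter> {x. x + (h - s) \<in> V})"
   by (auto simp: X_def memV add_diff_eq)
  moreover have "negligible (\<Union>r\<in>R. \<Union>s\<in>R. {x. x + (g - r) \<in> V} \<inter> {x. x + (h - s) \<in> V})"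
  proof -
   have "negligible ({x. x + (g - r) \<in> V} \<inter> {x. x + (h - s) \<in> V})" if rs: "r \<in> R" "s \<in> R" for r s
   proof (rule hyper)
    have "g \<in> L" "h \<in> L" using gh L2 by auto
    then show "g - r - (h - s) \<in> L" using rs R(2) diff by (meson subsetD)
    show "g - r \<noteq> h - s"
    proof
     assume "g - r = h - s"
     then have "r - s = 2 *R (g' - h')" using gh by (simp add: algebra_simps)
     then have "r = s" using R(3)[OF rs diff[OF gh(3,4)]] by blast
     then show False using \<open>g - r = h - s\<close> \<open>g \<noteq> h\<close> by simp
    qed
   qed
   then show ?thesis by (intro negligible_UN_finite R(1))
  qed
  ultimately show "negligible ({x. x + g \<in> X} \<inter> {x. x + h \<in> X})" by simp
 qed (use Xm Dm in \<open>auto simp: fmeasurableD\<close>)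
 then have "measure lebesgue X \<le> measure lebesgue D"
  using Xm Dm by (simp add: emeasure_eq_measure2)
 also have "measure lebesgue D = 8 * measure lebesgue V"
  using measure_lebesgue_affine[of 2 "0::real^3" V] by (simp add: D_def)
 also have "measure lebesgue X = (\<Sum>r\<in>R. measure lebesgue ((+) r ` V))"
  unfolding X_def
 proof (rule measure_negligible_finite_Union_image[OF R(1) trV])
  show "pairwise (\<lambda>r s. negligible ((+) r ` V \<inter> (+) s ` V)) R"
  proof (rule pairwiseI)
   fix r s assume rs: "r \<in> R" "s \<in> R" "r \<noteq> s"
   have "(+) r ` V \<inter> (+) s ` V = {x. x + (- r) \<in> V} \<inter> {x. x + (- s) \<in> V}"
    unfolding set_eq_iff Int_iff memV mem_Collect_eq by simp
   moreover have "s - r \<in> L" using rs R(2) diff by blast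
   ultimately show "negligible ((+) r ` V \<inter> (+) s ` V)"
    using hyper[of "-r" "-s"] rs by simp
  qed
 qed
 also have "\<dots> = real (card R) * measure lebesgue V"
  by (simp add: measure_translation)
 finally show ?thesis using Vpos by simp
qed

section \<open>Centrally symmetric tiles\<close>

lemma translate_mem_iff: "x \<in> (+) t ` S \<longleftrightarrow> x - t \<in> S" for t :: "'a::ab_group_add"
 by (metis add_diff_cancel_left' diff_add_cancel add.commute image_iff)

lemma bounded_translate_invariant_imp_zero:
 fixes S :: "'a::real_normed_vector set"
 assumes "bounded S" "y \<in> S" "\<And>y. y \<in> S \<Longrightarrow> y + w \<in> S"
 shows "w = 0"
proof (rule ccontr)
 assume "w \<noteq> 0"
 have *: "y + real n *R w \<in> S" for n
 proof (induction n)
  case (Suc n)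
  have "y + real (Suc n) *R w = (y + real n *R w) + w"
   by (simp add: algebra_simps)
  then show ?case
   using assms(3)[OF Suc] by (simp only:)
 qed (use assms in simp)
 obtain B where B: "\<And>x. x \<in> S \<Longrightarrow> norm x \<le> B"
  using \<open>bounded S\<close> bounded_iff by blast
 obtain n where n: "real n * norm w > B + norm y"
  using \<open>w \<noteq> 0\<close> reals_Archimedean3 [of "norm w"] by auto
 have "norm (real n *R w) \<le> norm (y + real n *R w) + norm y"
  by (metis add_diff_cancel_left' norm_triangle_ineq4)
 with B[OF *[of n]] n show False
  by simp
qed

lemma face_to_face_tiling_translate:
 assumes "face_to_face_translation_tiling P T"
 shows "face_to_face_translation_tiling P ((+) u ` T)"
proof -
 have eq: "(+) (u + t) ` P = (+) u ` (+) t ` P" for t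
  by (simp add: image_image add.assoc)
 have int: "(+) u ` A \<inter> (+) u ` B = (+) u ` (A \<inter> B)" for A B
  by (auto simp: translate_mem_iff)
 have "(\<Union>t\<in>(+) u ` T. (+) t ` P) = (+) u ` (\<Union>t\<in>T. (+) t ` P)"
  by (auto simp: image_image add.assoc)
 also have "\<dots> = UNIV"
  using assms by (simp add: face_to_face_translation_tiling_def)
 finally have 1: "(\<Union>t\<in>(+) u ` T. (+) t ` P) = UNIV" .
 show ?thesis
  unfolding face_to_face_translation_tiling_def
 proof (intro conjI 1 ballI impI)
  fix s t assume "s \<in> (+) u ` T" "t \<in> (+) u ` T" "s \<noteq> t"
  then obtain s' t' where st: "s = u + s'" "t = u + t'" "s' \<in> T" "t' \<in> T" "s' \<noteq> t'"
   by auto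
  then have *: "interior ((+) s' ` P) \<inter> interior ((+) t' ` P) = {}"
    "((+) s' ` P \<inter> (+) t' ` P) face_of ((+) s' ` P)"
    "((+) s' ` P \<inter> (+) t' ` P) face_of ((+) t' ` P)"
   using assms by (auto simp: face_to_face_translation_tiling_def)
  show "interior ((+) s ` P) \<inter> interior ((+) t ` P) = {}"
   unfolding st eq interior_translation[of u] int using *(1) by simp
  show "(+) s ` P \<inter> (+) t ` P face_of (+) s ` P" "(+) s ` P \<inter> (+) t ` P face_of (+) t ` P"
   unfolding st eq int using *(2,3) by simp_all
 qed
qed

text \<open>\<open>T\<close> is any set of translation vectors; the condition
  \<open>0 \<in> T\<close> is reached by shifting a given tiling with
  \<open>face_to_face_tiling_translate\<close>.\<close>

locale centered_tile =
 fixes P :: "(real^3) set" and T :: "(real^3) set"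
 assumes polytope: "polytope P" and interior_nonempty: "interior P \<noteq> {}"
  and symmetric: "uminus ` P = P"
  and tiling: "face_to_face_translation_tiling P T"
  and zero_in: "0 \<in> T"
begin

lemma uminus_mem: "x \<in> P \<Longrightarrow> - x \<in> P"
 using symmetric by blast

lemma convex: "convex P"
 by (simp add: polytope polytope_imp_convex)

lemma compact: "compact P"
 by (simp add: polytope polytope_imp_compact)

lemma zero_interior: "0 \<in> interior P"
proof -
 obtain x where x: "x \<in> interior P" using interior_nonempty by blast
 have "- x \<in> interior P"
  using x symmetric interior_negations[of P] by (metis image_eqI)
 moreover have "convex (interior P)" by (simp add: convex)
 ultimately have "(1/2) *R x + (1/2) *R (- x) \<in> interior P"
  using x convexD[of "interior P" x "-x" "1/2" "1/2"] by simp
 then show ?thesis by simp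
qed

lemma zero_mem: "0 \<in> P"
 using zero_interior interior_subset by blast

lemma covers: "\<exists>t\<in>T. x - t \<in> P"
 using tiling by (auto simp: face_to_face_translation_tiling_def translate_mem_iff set_eq_iff)

lemma interiors_disjoint:
 "\<lbrakk>s \<in> T; t \<in> T; s \<noteq> t; x - s \<in> interior P\<rbrakk> \<Longrightarrow> x - t \<notin> interior P"
 using tiling
 by (auto simp: face_to_face_translation_tiling_def interior_translation translate_mem_iff set_eq_iff)

lemma face_to_face: "\<lbrakk>t \<in> T; t \<noteq> 0\<rbrakk> \<Longrightarrow> (P \<inter> (+) t ` P) face_of P"
proof -
 assume t: "t \<in> T" "t \<noteq> 0"
 then have "((+) 0 ` P \<inter> (+) t ` P) face_of ((+) 0 ` P)"
  using tiling zero_in unfolding face_to_face_translation_tiling_def by metis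
 then show ?thesis by simp
qed

lemma translate: "u \<in> T \<Longrightarrow> centered_tile P ((+) (- u) ` T)"
proof
 assume "u \<in> T"
 then show "0 \<in> (+) (- u) ` T" by (simp add: translate_mem_iff del: uminus_add_conv_diff)
qed (rule polytope interior_nonempty symmetric face_to_face_tiling_translate[OF tiling])+

lemma separated:
 assumes "ball 0 r \<subseteq> P" "s \<in> T" "t \<in> T" "dist s t < r" shows "s = t"
proof (rule ccontr)
 assume "s \<noteq> t"
 have "ball 0 r \<subseteq> interior P"
  using assms(1) by (simp add: interior_maximal)
 then have "s - t \<in> interior P"
  using assms(4) by (auto simp: dist_norm)
 moreover have "s - s \<in> interior P" using zero_interior by simp
 ultimately show False
  using interiors_disjoint[OF assms(2,3) \<open>s \<noteq> t\<close>] by blast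
qed

lemma uniform_discrete: "uniform_discrete T"
proof -
 obtain r where "r > 0" "ball 0 r \<subseteq> P"
  using zero_interior mem_interior by blast
 then show ?thesis
  by (auto intro!: uniformI1 separated)
qed

text \<open>By the face-to-face condition the intersection of \<open>P\<close> with
  \<open>P + t\<close> is a face of \<open>P\<close>. It contains a relative interior point of
  \<open>G\<close>, hence all of \<open>G\<close>, and a larger face would be \<open>P\<close>
  itself. This intersection is symmetric about \<open>t / 2\<close> because \<open>P\<close> is
  symmetric about 0.\<close>

lemma contact:
 assumes G: "G facet_of P" and "t \<in> T" "t \<noteq> 0" "x \<in> rel_interior G" "x - t \<in> P"
 shows "P \<inter> (+) t ` P = G" "\<And>y. y \<in> G \<Longrightarrow> t - y \<in> G"
proof -
 let ?F = "P \<inter> (+) t ` P"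
 have face: "?F face_of P" by (rule face_to_face) fact+
 have GP: "G \<subseteq> P" using G facet_of_imp_subset by blast
 have "x \<in> ?F" using assms GP rel_interior_subset by (auto simp: translate_mem_iff)
 then have GF: "G \<subseteq> ?F"
  using subset_of_face_of[OF face GP] assms(4) by blast
 show eq: "?F = G"
 proof (rule ccontr)
  assume "?F \<noteq> G"
  have "G face_of ?F" using G GF by (meson face_of_subset facet_of_imp_face_of inf_le1)
  then have "aff_dim G < aff_dim ?F"
   using \<open>?F \<noteq> G\<close> face face_of_imp_convex by (metis face_of_aff_dim_lt)
  then have "aff_dim P \<le> aff_dim ?F" using G by (simp add: facet_of_def)
  then have "?F = P" using face_of_aff_dim_lt[OF convex face] by linarith
  then have "interior P \<subseteq> (+) t ` interior P"
   by (metis inf_le2 interior_mono interior_translation)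
  then have "0 - t \<in> interior P" using zero_interior translate_mem_iff by blast
  then show False
   using interiors_disjoint[OF zero_in \<open>t \<in> T\<close>, of 0] zero_interior \<open>t \<noteq> 0\<close> by simp
 qed
 fix y assume "y \<in> G"
 then have "y \<in> P" "y - t \<in> P" using eq by (auto simp: translate_mem_iff)
 then have "t - y \<in> P" "t - y - t \<in> P"
  using uminus_mem[of "y - t"] uminus_mem[of y] by simp_all
 then show "t - y \<in> G" unfolding eq[symmetric] by (simp add: translate_mem_iff)
qed

text \<open>Points just outside \<open>P\<close> over a relative interior point \<open>x\<close> of
  \<open>G\<close> lie in other tiles. Only finitely many tiles come near, and their union
  \<open>W\<close> is closed, so one of them contains \<open>x\<close>.\<close>

lemma facet_neighbour:
 assumes G: "G facet_of P"
 obtains t where "t \<in> T" "t \<noteq> 0" "P \<inter> (+) t ` P = G" "\<And>y. y \<in> G \<Longrightarrow> t - y \<in> G"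
proof -
 obtain a b where ab: "a \<noteq> 0" "P \<subseteq> {x. a \<bullet> x \<le> b}" "G = P \<inter> {x. a \<bullet> x = b}"
  using facet_of_polyhedron polytope polytope_imp_polyhedron G by blast
 have "convex G" using G face_of_imp_convex facet_of_imp_face_of by blast
 moreover have "G \<noteq> {}" using G by (simp add: facet_of_def)
 ultimately obtain x where x: "x \<in> rel_interior G" using rel_interior_eq_empty by blast
 then have xb: "a \<bullet> x = b" using ab rel_interior_subset by blast
 define y where "y n = x + (1 / real (Suc n)) *R a" for n
 have yP: "y n \<notin> P" for n
 proof
  assume "y n \<in> P"
  then have "a \<bullet> y n \<le> b" using ab by blast
  then have "(1 / real (Suc n)) * (a \<bullet> a) \<le> 0" using xb by (simp add: y_def inner_add_right)
  then have "a \<bullet> a \<le> 0" by (simp add: divide_le_0_iff)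
  then show False using \<open>a \<noteq> 0\<close> inner_gt_zero_iff[of a] by linarith
 qed
 obtain B where B: "\<And>z. z \<in> P \<Longrightarrow> norm z \<le> B"
  using compact compact_imp_bounded bounded_iff by metis
 define F where "F = T \<inter> cball 0 (B + norm x + norm a) - {0}"
 have "finite (T \<inter> cball 0 (B + norm x + norm a))"
  using uniform_discrete uniform_discrete_finite_iff uniform_discrete_subset
  by (metis bounded_Int bounded_cball inf_le1)
 then have "finite F" by (simp add: F_def)
 define W where "W = (\<Union>t\<in>F. (+) t ` P)"
 have "closed W"
  unfolding W_def using \<open>finite F\<close> compact
  by (intro closed_UN) (auto intro: compact_imp_closed compact_translation)
 moreover have "y n \<in> W" for n
 proof -
  obtain t where t: "t \<in> T" "y n - t \<in> P" using covers by blast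
  have "t \<noteq> 0" using t yP by auto
  have "norm t \<le> norm (y n - t) + norm (y n)"
   using norm_triangle_ineq4[of "y n" "y n - t"] by simp
  moreover have "norm (y n) \<le> norm x + norm ((1 / real (Suc n)) *R a)"
   unfolding y_def by (rule norm_triangle_ineq)
  moreover have "norm ((1 / real (Suc n)) *R a) \<le> norm a"
   by (simp add: divide_le_eq mult_left_le_one_le field_simps)
  ultimately have "t \<in> F" using t B[OF t(2)] \<open>t \<noteq> 0\<close> by (simp add: F_def)
  then show ?thesis using t by (auto simp: W_def translate_mem_iff)
 qed
 moreover have "y \<longlonglongrightarrow> x"
 proof -
  have "(\<lambda>n. x + (1 / real (Suc n)) *R a) \<longlonglongrightarrow> x + 0 *R a"
   by (intro tendsto_intros lim_1_over_n filterlim_compose[OF lim_1_over_n filterlim_Suc])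
  then show ?thesis by (simp add: y_def[abs_def])
 qed
 ultimately have "x \<in> W" by (meson closed_sequentially)
 then obtain t where "t \<in> T" "t \<noteq> 0" "x - t \<in> P"
  by (auto simp: W_def F_def translate_mem_iff)
 then show ?thesis using contact[OF G \<open>t \<in> T\<close> \<open>t \<noteq> 0\<close> x \<open>x - t \<in> P\<close>] by (intro that)
qed

text \<open>Two point reflections of \<open>G\<close> compose to a translation by
  \<open>s - t\<close>, and a bounded set admits only the trivial one.\<close>

lemma symmetry_vector_unique:
 assumes "G facet_of P" "\<And>y. y \<in> G \<Longrightarrow> s - y \<in> G" "\<And>y. y \<in> G \<Longrightarrow> t - y \<in> G"
 shows "s = t"
proof -
 have "bounded G"
  using bounded_subset[OF compact_imp_bounded[OF compact] facet_of_imp_subset[OF assms(1)]] .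
 moreover obtain y where "y \<in> G" using assms(1) by (auto simp: facet_of_def)
 moreover have "y + (s - t) \<in> G" if "y \<in> G" for y
  using assms(2)[OF assms(3)[OF that]] by (simp add: algebra_simps)
 ultimately have "s - t = 0" by (rule bounded_translate_invariant_imp_zero)
 then show ?thesis by simp
qed

definition "periods = {m. (+) m ` T = T}"

lemma periods_subset: "periods \<subseteq> T"
 using zero_in by (force simp: periods_def)

lemma zero_period: "0 \<in> periods"
 by (simp add: periods_def)

lemma period_add: "\<lbrakk>m \<in> periods; n \<in> periods\<rbrakk> \<Longrightarrow> m + n \<in> periods"
proof -
 assume "m \<in> periods" "n \<in> periods"
 then have "(+) m ` (+) n ` T = T" by (simp add: periods_def)
 then show ?thesis by (simp add: periods_def image_image add.assoc)
qed

lemma period_uminus: "m \<in> periods \<Longrightarrow> - m \<in> periods"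
proof -
 assume "m \<in> periods"
 then have "(+) (- m) ` T = (+) (- m) ` (+) m ` T" by (simp only: periods_def mem_Collect_eq)
 also have "\<dots> = T" by (simp add: image_image)
 finally show ?thesis by (simp only: periods_def mem_Collect_eq)
qed

lemma period_diff: "\<lbrakk>m \<in> periods; n \<in> periods\<rbrakk> \<Longrightarrow> m - n \<in> periods"
 using period_add[of m "-n"] period_uminus by simp

lemma uminus_facet: "G facet_of P \<Longrightarrow> uminus ` G facet_of P"
proof -
 assume G: "G facet_of P"
 have "linear (uminus :: real^3 \<Rightarrow> real^3)" "inj (uminus :: real^3 \<Rightarrow> real^3)"
  by (simp_all add: linear_uminus)
 then have "uminus ` G face_of uminus ` P"
  using G by (simp add: face_of_linear_image facet_of_imp_face_of)
 moreover have "aff_dim (uminus ` G) = aff_dim G"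
  by (simp add: aff_dim_injective_linear_image linear_uminus)
 ultimately show ?thesis using G symmetric by (auto simp: facet_of_def)
qed

text \<open>Seen from the tile at \<open>u\<close>, the neighbour across \<open>G\<close> is again
  reached by a vector that reflects \<open>G\<close> into itself, and that vector is unique.\<close>

lemma facet_vector_step:
 assumes "G facet_of P" "\<And>y. y \<in> G \<Longrightarrow> t - y \<in> G" "u \<in> T"
 shows "t + u \<in> T"
proof -
 interpret U: centered_tile P "(+) (- u) ` T" by (rule translate[OF \<open>u \<in> T\<close>])
 obtain t' where t': "t' \<in> (+) (- u) ` T" "\<And>y. y \<in> G \<Longrightarrow> t' - y \<in> G"
  using U.facet_neighbour[OF assms(1)] by metis
 have "t' = t" using symmetry_vector_unique[OF assms(1) t'(2) assms(2)] by simp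
 then show ?thesis using t'(1) by (auto simp: translate_mem_iff)
qed

text \<open>Steps across \<open>G\<close> and across the opposite facet are inverse to each other,
  so both inclusions between \<open>T\<close> and its translate by \<open>t\<close> hold.\<close>

lemma facet_vector_period:
 assumes "G facet_of P" "\<And>y. y \<in> G \<Longrightarrow> t - y \<in> G"
 shows "t \<in> periods"
proof -
 have "- t - y \<in> uminus ` G" if "y \<in> uminus ` G" for y
  using assms(2) that by (force simp: image_iff)
 then have "- t + u \<in> T" if "u \<in> T" for u
  using facet_vector_step[OF uminus_facet[OF assms(1)]] that by blast
 moreover have "t + u \<in> T" if "u \<in> T" for u
  using facet_vector_step[OF assms] that by blast
 ultimately show ?thesis
  by (auto simp: periods_def translate_mem_iff)
qed

lemma symmetry_center_rel_interior:
 assumes "G facet_of P" "\<And>y. y \<in> G \<Longrightarrow> t - y \<in> G"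
 shows "(1/2) *R t \<in> rel_interior G"
proof -
 have cG: "convex G" using assms(1) face_of_imp_convex facet_of_imp_face_of by blast
 have "G \<noteq> {}" using assms(1) by (simp add: facet_of_def)
 then obtain x where x: "x \<in> rel_interior G" using cG rel_interior_eq_empty by blast
 then have xG: "x \<in> G" using rel_interior_subset by blast
 have "t - x \<in> closure G" using assms(2)[OF xG] closure_subset by blast
 then have "t - x - (1/2) *R (t - x - x) \<in> rel_interior G"
  using rel_interior_closure_convex_shrink[OF cG x, of "t - x" "1/2"] by simp
 moreover have "t - x - (1/2) *R (t - x - x) = (1/2) *R t"
  by (simp add: algebra_simps flip: scaleR_2)
 ultimately show ?thesis by simp
qed

text \<open>Minkowski's parity argument: two facet vectors congruent modulo twice the period lattice
 belong to equal or opposite facets.\<close>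

lemma facet_vectors_congruent:
 assumes G: "G facet_of P" "\<And>y. y \<in> G \<Longrightarrow> t - y \<in> G"
  and G': "G' facet_of P" "\<And>y. y \<in> G' \<Longrightarrow> t' - y \<in> G'"
  and m: "m \<in> periods" "t - t' = 2 *R m"
 shows "t' = t \<or> t' = - t"
proof (cases "m = 0")
 case False
 have c: "(1/2) *R t \<in> rel_interior G" "(1/2) *R t' \<in> rel_interior G'"
  by (auto intro!: symmetry_center_rel_interior assms)
 \<comment> \<open>The centre of \<open>G\<close>, seen from the tile at \<open>m\<close>, becomes
   the centre of \<open>G'\<close>; so that tile touches the relative interior of
   \<open>G\<close>.\<close>
 have "(1/2) *R t - m = (1/2) *R (t - 2 *R m)" by (simp add: algebra_simps)
 also have "\<dots> = (1/2) *R t'" using m(2) by (metis diff_diff_eq2 add_diff_cancel_left')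
 finally have "(1/2) *R t - m \<in> P"
  using c(2) G'(1) facet_of_imp_subset rel_interior_subset by (metis subsetD)
 then have "\<And>y. y \<in> G \<Longrightarrow> m - y \<in> G"
  using contact[OF G(1) _ False c(1)] m(1) periods_subset by blast
 then have "m = t" using symmetry_vector_unique[OF G(1) _ G(2)] by blast
 then have "t' = - t" using m(2) by (simp add: scaleR_2 algebra_simps eq_neg_iff_add_eq_0)
 then show ?thesis ..
qed (use m in simp)

text \<open>If \<open>t = 2 m\<close>, the centre \<open>t / 2\<close> of \<open>G\<close> is the
  centre of the tile at \<open>m\<close>. Then that tile touches \<open>G\<close>, so
  \<open>m\<close> reflects \<open>G\<close> into itself, which forces \<open>m = t\<close>.\<close>

lemma facet_vector_not_even:
 assumes G: "G facet_of P" "\<And>y. y \<in> G \<Longrightarrow> t - y \<in> G" and "t \<noteq> 0"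
  and m: "m \<in> periods" shows "t \<noteq> 2 *R m"
proof
 assume t: "t = 2 *R m"
 then have "m \<noteq> 0" using \<open>t \<noteq> 0\<close> by auto
 have c: "(1/2) *R t \<in> rel_interior G"
  by (auto intro!: symmetry_center_rel_interior assms)
 have "(1/2) *R t - m \<in> P" using t zero_mem by simp
 then have "\<And>y. y \<in> G \<Longrightarrow> m - y \<in> G"
  using contact[OF G(1) _ \<open>m \<noteq> 0\<close> c] m(1) periods_subset by blast
 then have "m = t" using symmetry_vector_unique[OF G(1) _ G(2)] by blast
 then show False using t \<open>m \<noteq> 0\<close> by (simp add: scaleR_2)
qed

end

section \<open>Normalised facet equations and Minkowski's bound\<close>

lemma facet_normal_unique:
 fixes P :: "'a::euclidean_space set"
 assumes "F facet_of P" "interior P \<noteq> {}" "F \<subseteq> {x. a \<bullet> x = 1}" "F \<subseteq> {x. b \<bullet> x = 1}"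
 shows "a = b"
proof (rule ccontr)
 assume "a \<noteq> b"
 have dim: "aff_dim F = DIM('a) - 1"
  using assms(1,2) aff_dim_nonempty_interior[of P] by (simp add: facet_of_def)
 have hull: "affine hull F = {x. e \<bullet> x = r}" if "e \<noteq> 0" "F \<subseteq> {x. e \<bullet> x = r}" for e r
 proof -
  have "affine hull F = affine hull {x. e \<bullet> x = r}"
   using aff_dim_eq_full_gen[OF that(2)] dim aff_dim_hyperplane[OF that(1)] by simp
  then show ?thesis by (simp add: affine_hull_eq affine_hyperplane)
 qed
 obtain x where "x \<in> F" using assms(1) by (auto simp: facet_of_def)
 then have "a \<noteq> 0" using assms(3) by auto
 then have "affine hull F = {x. a \<bullet> x = 1}" using hull assms(3) by blast
 moreover have "affine hull F = {x. (a - b) \<bullet> x = 0}"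
 proof (rule hull)
  show "F \<subseteq> {x. (a - b) \<bullet> x = 0}"
  proof
   fix x assume "x \<in> F"
   then have "a \<bullet> x = 1" "b \<bullet> x = 1" using assms(3,4) by blast+
   then show "x \<in> {x. (a - b) \<bullet> x = 0}" by (simp add: inner_diff_left)
  qed
 qed (use \<open>a \<noteq> b\<close> in simp)
 ultimately have "(0::'a) \<in> {x. a \<bullet> x = 1}" by (metis (mono_tags, lifting) inner_zero_right mem_Collect_eq)
 then show False by simp
qed

lemma polytope_halfspace_normalize:
 fixes P :: "'a::euclidean_space set"
 assumes "0 \<in> interior P" "a \<noteq> 0" "P \<subseteq> {x. a \<bullet> x \<le> b}"
 shows "b > 0"
proof -
 obtain e where e: "e > 0" "ball 0 e \<subseteq> P" using assms(1) mem_interior by blast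
 have "(e / 2 / norm a) *R a \<in> ball 0 e" using e assms(2) by simp
 then have "a \<bullet> ((e / 2 / norm a) *R a) \<le> b" using e(2) assms(3) by blast
 moreover have "a \<bullet> ((e / 2 / norm a) *R a) > 0" using e assms(2) by simp
 ultimately show ?thesis by linarith
qed

text \<open>In a minimal system of half-spaces every member defines a facet, so the inequality
  violated by \<open>x\<close> can be taken to be that of a facet. The right-hand side 1 is possible
  because 0 is an interior point.\<close>

lemma not_mem_polyhedron_facet:
 fixes P :: "'a::euclidean_space set"
 assumes P: "polyhedron P" and 0: "0 \<in> interior P" and x: "x \<notin> P"
 obtains a where "P \<subseteq> {y. a \<bullet> y \<le> 1}" "(P \<inter> {y. a \<bullet> y = 1}) facet_of P" "a \<bullet> x > 1"
proof -
 have ne: "interior P \<noteq> {}" using 0 by blast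
 obtain F where "finite F" and seq: "P = affine hull P \<inter> \<Inter>F"
       and faces: "\<And>h. h \<in> F \<Longrightarrow> \<exists>a b. a \<noteq> 0 \<and> h = {x. a \<bullet> x \<le> b}"
       and min: "\<And>F'. F' \<subset> F \<Longrightarrow> P \<subset> (affine hull P) \<inter> \<Inter>F'"
  using P by (simp add: polyhedron_Int_affine_minimal) meson
 then obtain a b where ab: "\<And>h. h \<in> F \<Longrightarrow> a h \<noteq> 0 \<and> h = {x. a h \<bullet> x \<le> b h}"
  by metis
 have "affine hull P = UNIV" using ne by (rule affine_hull_nonempty_interior)
 then obtain h where h: "h \<in> F" "x \<notin> h" using seq x by blast
 have Ph: "P \<subseteq> h" using seq h by blast
 have fac: "(P \<inter> {y. a h \<bullet> y = b h}) facet_of P"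
  using facet_of_polyhedron_explicit[OF \<open>finite F\<close> seq ab min] h by blast
 have hh: "h = {x. a h \<bullet> x \<le> b h}" "a h \<noteq> 0" using ab[OF h(1)] by auto
 have b: "b h > 0" using polytope_halfspace_normalize[OF 0 hh(2)] Ph hh(1) by blast
 have eq: "{y. a h \<bullet> y = b h} = {y. ((1 / b h) *R a h) \<bullet> y = 1}" using b by (auto simp: field_simps)
 show ?thesis
 proof (rule that[of "(1 / b h) *R a h"])
  have "P \<subseteq> {x. a h \<bullet> x \<le> b h}" using Ph hh(1) by simp
  then show "P \<subseteq> {y. (1 / b h) *R a h \<bullet> y \<le> 1}" using b by (auto simp: field_simps)
  show "P \<inter> {y. (1 / b h) *R a h \<bullet> y = 1} facet_of P" using fac eq by simp
  have "\<not> a h \<bullet> x \<le> b h" using h(2) hh(1) by blast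
  then show "1 < (1 / b h) *R a h \<bullet> x" using b by (simp add: field_simps)
 qed
qed

context centered_tile
begin

text \<open>The number is \<open>2 (2^3 - 1)\<close>. One facet vector from each opposite pair,
  together with 0, makes a set of vectors pairwise incongruent modulo doubled periods, which has at
  most 8 members.\<close>

lemma card_facets_le_14:
 assumes M: "det M \<noteq> 0" "int_span M \<subseteq> periods"
 shows "card {G. G facet_of P} \<le> 14"
proof -
 let ?F = "{G. G facet_of P}"
 have finF: "finite ?F" using polytope finite_polytope_facets by blast
 have "\<forall>G\<in>?F. \<exists>t. t \<in> T \<and> t \<noteq> 0 \<and> P \<inter> (+) t ` P = G \<and> (\<forall>y\<in>G. t - y \<in> G)"
  using facet_neighbour by (metis mem_Collect_eq)
 then have "\<exists>\<tau>. \<forall>G\<in>?F. \<tau> G \<in> T \<and> \<tau> G \<noteq> 0 \<and> P \<inter> (+) (\<tau> G) ` P = G \<and> (\<forall>y\<in>G. \<tau> G - y \<in> G)"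
  by (rule bchoice)
 then obtain \<tau> where \<tau>0: "\<forall>G\<in>?F. \<tau> G \<in> T \<and> \<tau> G \<noteq> 0 \<and> P \<inter> (+) (\<tau> G) ` P = G \<and> (\<forall>y\<in>G. \<tau> G - y \<in> G)"
  by (rule exE)
 have \<tau>: "\<tau> G \<in> T \<and> \<tau> G \<noteq> 0 \<and> P \<inter> (+) (\<tau> G) ` P = G \<and> (\<forall>y\<in>G. \<tau> G - y \<in> G)" if "G \<in> ?F" for G
  using \<tau>0 that by (rule bspec)
 have inj: "inj_on \<tau> ?F"
 proof (rule inj_onI)
  fix G H assume GH: "G \<in> ?F" "H \<in> ?F" "\<tau> G = \<tau> H"
  have "G = P \<inter> (+) (\<tau> G) ` P" using \<tau>[OF GH(1)] by blast
  also have "\<dots> = P \<inter> (+) (\<tau> H) ` P" by (simp only: GH(3))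
  also have "\<dots> = H" using \<tau>[OF GH(2)] by blast
  finally show "G = H" .
 qed
 let ?Ts = "\<tau> ` ?F"
 have neg: "- t \<in> ?Ts" if t: "t \<in> ?Ts" for t
 proof -
  obtain G where G: "G facet_of P" "t = \<tau> G" using t by auto
  have G': "uminus ` G facet_of P" using uminus_facet G(1) by blast
  have "\<tau> (uminus ` G) = - t"
  proof (rule symmetry_vector_unique[OF G'])
   show "\<tau> (uminus ` G) - y \<in> uminus ` G" if "y \<in> uminus ` G" for y
    using \<tau>[of "uminus ` G"] G' that by blast
   show "- t - y \<in> uminus ` G" if "y \<in> uminus ` G" for y
   proof -
    have "t - (- y) \<in> G" using \<tau>[of G] G that by auto
    then have "- (t - (- y)) \<in> uminus ` G" by (rule imageI)
    then show ?thesis by simp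
   qed
  qed
  then show ?thesis using G' by (metis image_eqI mem_Collect_eq)
 qed
 \<comment> \<open>A lexicographic sign selects one vector of each pair \<open>t\<close>,
   \<open>- t\<close>.\<close>
 define pos where "pos t \<longleftrightarrow> t $ 1 > 0 \<or> t $ 1 = 0 \<and> (t $ 2 > 0 \<or> t $ 2 = 0 \<and> t $ 3 > 0)" for t :: "real^3"
 have pos_or: "pos t \<or> pos (- t)" if "t \<noteq> 0" for t
  using that by (auto simp: pos_def vec_eq_iff forall_3)
 have not_both: "\<not> (pos t \<and> pos (- t))" for t by (auto simp: pos_def)
 have npos0: "\<not> pos 0" by (simp add: pos_def)
 define Q where "Q = {t \<in> ?Ts. pos t}"
 have finQ: "finite Q" using finF by (simp add: Q_def)
 have "card (insert 0 Q) \<le> 8"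
 proof (rule card_incongruent_mod_double_le[OF _ zero_period period_diff M])
  show "uniform_discrete periods" using uniform_discrete periods_subset uniform_discrete_subset by blast
  show "insert 0 Q \<subseteq> periods"
  proof -
   have "\<tau> G \<in> periods" if "G facet_of P" for G
    using facet_vector_period[OF that] \<tau>[of G] that by blast
   then show ?thesis using zero_period by (auto simp: Q_def)
  qed
  have fv: "\<exists>G. G facet_of P \<and> (\<forall>y\<in>G. x - y \<in> G) \<and> x \<noteq> 0 \<and> pos x" if "x \<in> Q" for x
   using that \<tau> by (auto simp: Q_def)
  have even: False if "x \<in> Q" "m \<in> periods" "x = 2 *R m" for x m
   using fv[OF that(1)] facet_vector_not_even[of _ x m] that by blast
  fix x y m assume xy: "x \<in> insert 0 Q" "y \<in> insert 0 Q" "m \<in> periods" "x - y = 2 *R m"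
  show "x = y"
  proof (cases "x = 0 \<or> y = 0")
   case True
   have "y = 2 *R (- m)" if "x = 0" using xy(4) that by (simp add: algebra_simps)
    (metis add.inverse_inverse)
   then show ?thesis using True xy even[of x m] even[of y "-m"] period_uminus[of m] by auto
  next
   case False
   then have "x \<in> Q" "y \<in> Q" using xy by auto
   then obtain G G' where "G facet_of P" "\<forall>z\<in>G. x - z \<in> G" "G' facet_of P" "\<forall>z\<in>G'. y - z \<in> G'"
    using fv by metis
   then have "y = x \<or> y = - x"
    using facet_vectors_congruent[of G x G' y m] xy by blast
   then show ?thesis using fv[OF \<open>x \<in> Q\<close>] fv[OF \<open>y \<in> Q\<close>] not_both[of x] by auto
  qed
 qed (use finQ in auto)
 moreover have "0 \<notin> Q" using npos0 by (simp add: Q_def)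
 ultimately have Q7: "card Q \<le> 7" using finQ by simp
 have "?Ts \<subseteq> Q \<union> uminus ` Q"
 proof
  fix t assume t: "t \<in> ?Ts"
  then have "t \<noteq> 0" using \<tau> by auto
  show "t \<in> Q \<union> uminus ` Q"
  proof (cases "pos t")
   case False
   then have "- t \<in> Q" using pos_or[OF \<open>t \<noteq> 0\<close>] neg[OF t] by (simp add: Q_def)
   then show ?thesis by (metis UnI2 add.inverse_inverse image_eqI)
  qed (use t in \<open>simp add: Q_def\<close>)
 qed
 then have "card ?Ts \<le> card (Q \<union> uminus ` Q)" using finQ by (intro card_mono) auto
 also have "\<dots> \<le> card Q + card (uminus ` Q)" by (rule card_Un_le)
 also have "\<dots> \<le> 14" using Q7 card_image_le[OF finQ, of uminus] by linarith
 finally show ?thesis using card_image[OF inj] by simp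
qed

end

section \<open>Regular hexagons and squares\<close>

text \<open>In a \<open>hexagon_frame\<close> the vector \<open>p\<close> leads from the centre
  \<open>c\<close> to a vertex, and \<open>q\<close> has the length of the height of an equilateral
  triangle with side \<open>p\<close>. This keeps square roots out of the coordinates.\<close>

definition hexagon_points :: "real^3 \<Rightarrow> real^3 \<Rightarrow> real^3 \<Rightarrow> (real^3) set" where
 "hexagon_points c p q = {c + p, c + (1/2) *R p + q, c - (1/2) *R p + q, c - p,
   c - (1/2) *R p - q, c + (1/2) *R p - q}"

definition square_points :: "real^3 \<Rightarrow> real^3 \<Rightarrow> real^3 \<Rightarrow> (real^3) set" where
 "square_points c p q = {c + p, c + q, c - p, c - q}"

lemma regular_polygon_6:
 assumes "regular_polygon 6 F"
 obtains c p q where "F = convex hull (hexagon_points c p q)" "p \<noteq> 0" "p \<bullet> q = 0" "q \<bullet> q = 3/4 * (p \<bullet> p)"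
proof -
 obtain c u v r where r: "r > 0" "norm u = 1" "norm v = 1" "u \<bullet> v = 0" and
  F: "F = convex hull ((\<lambda>k. c + (r * cos (2 * pi * real k / 6)) *R u
                + (r * sin (2 * pi * real k / 6)) *R v) ` {..<6::nat})"
  using assms unfolding regular_polygon_def by auto
 let ?p = "r *R u" and ?q = "(r * (sqrt 3 / 2)) *R v"
 have six: "{..<6::nat} = {0,1,2,3,4,5}" by auto
 have t: "2 * pi * real 1 / 6 = pi / 3" "2 * pi * real 2 / 6 = pi - pi / 3" "2 * pi * real 3 / 6 = pi"
  "2 * pi * real 4 / 6 = pi / 3 + pi" "2 * pi * real 5 / 6 = 2 * pi - pi / 3" by simp_all
 have 1: "cos (2 * pi * real 1 / 6) = 1/2" "sin (2 * pi * real 1 / 6) = sqrt 3 / 2"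
  unfolding t by (rule cos_60 sin_60)+
 have 2: "cos (2 * pi * real 2 / 6) = -(1/2)" "sin (2 * pi * real 2 / 6) = sqrt 3 / 2"
  unfolding t cos_diff sin_diff cos_60 sin_60 by simp_all
 have 3: "cos (2 * pi * real 3 / 6) = -1" "sin (2 * pi * real 3 / 6) = 0"
  unfolding t by simp_all
 have 4: "cos (2 * pi * real 4 / 6) = -(1/2)" "sin (2 * pi * real 4 / 6) = - (sqrt 3 / 2)"
  unfolding t cos_periodic_pi sin_periodic_pi cos_60 sin_60 by simp_all
 have 5: "cos (2 * pi * real 5 / 6) = 1/2" "sin (2 * pi * real 5 / 6) = - (sqrt 3 / 2)"
  unfolding t cos_diff sin_diff cos_60 sin_60 by simp_all
 have "(\<lambda>k. c + (r * cos (2 * pi * real k / 6)) *R u + (r * sin (2 * pi * real k / 6)) *R v) ` {..<6::nat}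
   = hexagon_points c ?p ?q"
  unfolding six image_insert image_empty 1 2 3 4 5 hexagon_points_def
  by (simp add: insert_commute)
 then have "F = convex hull (hexagon_points c ?p ?q)" using F by simp
 moreover have "?p \<noteq> 0" "?p \<bullet> ?q = 0" using r by auto
 moreover have "?q \<bullet> ?q = 3/4 * (?p \<bullet> ?p)"
  using r by (simp add: dot_square_norm power2_eq_square)
 ultimately show ?thesis by (rule that)
qed

lemma regular_polygon_4:
 assumes "regular_polygon 4 F"
 obtains c p q where "F = convex hull (square_points c p q)" "p \<noteq> 0" "p \<bullet> q = 0" "q \<bullet> q = p \<bullet> p"
proof -
 obtain c u v r where r: "r > 0" "norm u = 1" "norm v = 1" "u \<bullet> v = 0" and
  F: "F = convex hull ((\<lambda>k. c + (r * cos (2 * pi * real k / 4)) *R u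
                + (r * sin (2 * pi * real k / 4)) *R v) ` {..<4::nat})"
  using assms unfolding regular_polygon_def by auto
 have four: "{..<4::nat} = {0,1,2,3}" by auto
 have 1: "cos (2 * pi * real 1 / 4) = 0" "sin (2 * pi * real 1 / 4) = 1"
  using cos_pi_half sin_pi_half by (simp_all add: mult.commute)
 have 2: "cos (2 * pi * real 2 / 4) = -1" "sin (2 * pi * real 2 / 4) = 0"
  by simp_all
 have t3: "2 * pi * real 3 / 4 = pi / 2 + pi" by simp
 have 3: "cos (2 * pi * real 3 / 4) = 0" "sin (2 * pi * real 3 / 4) = -1"
  unfolding t3 cos_periodic_pi sin_periodic_pi by simp_all
 have "(\<lambda>k. c + (r * cos (2 * pi * real k / 4)) *R u + (r * sin (2 * pi * real k / 4)) *R v) ` {..<4::nat}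
   = square_points c (r *R u) (r *R v)"
  unfolding four image_insert image_empty 1 2 3 square_points_def
  by (simp add: insert_commute)
 then have "F = convex hull (square_points c (r *R u) (r *R v))" using F by simp
 moreover have "r *R u \<noteq> 0" "r *R u \<bullet> r *R v = 0" "r *R v \<bullet> r *R v = r *R u \<bullet> r *R u"
  using r by (auto simp: dot_square_norm)
 ultimately show ?thesis by (rule that)
qed

lemma regular_polygon_linear_image:
 assumes "regular_polygon n F" "linear f" "\<And>x. norm (f x) = s * norm x" "s > 0"
 shows "regular_polygon n (f ` F)"
proof -
 obtain c u v r where r: "n \<ge> 3" "r > 0" "norm u = 1" "norm v = 1" "u \<bullet> v = 0" and
  F: "F = convex hull ((\<lambda>k. c + (r * cos (2 * pi * real k / real n)) *R u
                + (r * sin (2 * pi * real k / real n)) *R v) ` {..<n})"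
  using assms(1) unfolding regular_polygon_def by auto
 have "norm (f u + f v) = s * norm (u + v)" "norm (f u - f v) = s * norm (u - v)"
  using assms(3) linear_add[OF assms(2)] linear_diff[OF assms(2)] by metis+
 moreover have "norm (u + v) = norm (u - v)"
  using r(5) by (simp add: norm_eq inner_add inner_diff inner_commute)
 ultimately have "norm (f u + f v) = norm (f u - f v)" by simp
 then have "(f u + f v) \<bullet> (f u + f v) = (f u - f v) \<bullet> (f u - f v)" by (simp add: norm_eq)
 then have uv: "f u \<bullet> f v = 0" by (simp add: inner_add inner_diff inner_commute)
 let ?u = "(1/s) *R f u" and ?v = "(1/s) *R f v"
 have "f ` F = convex hull (f ` ((\<lambda>k. c + (r * cos (2 * pi * real k / real n)) *R u
                + (r * sin (2 * pi * real k / real n)) *R v) ` {..<n}))"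
  unfolding F by (simp add: assms(2) convex_hull_linear_image)
 also have "f ` ((\<lambda>k. c + (r * cos (2 * pi * real k / real n)) *R u
                + (r * sin (2 * pi * real k / real n)) *R v) ` {..<n})
  = ((\<lambda>k. f c + ((s * r) * cos (2 * pi * real k / real n)) *R ?u
                + ((s * r) * sin (2 * pi * real k / real n)) *R ?v) ` {..<n})"
  unfolding image_image
  using assms(4) by (intro image_cong refl) (simp add: linear_add[OF assms(2)] linear_scale[OF assms(2)])
 finally show ?thesis
  unfolding regular_polygon_def
  using r uv assms(3,4)
  by (intro conjI exI[of _ "f c"] exI[of _ ?u] exI[of _ ?v] exI[of _ "s * r"]) auto
qed

text \<open>For a regular frame the new pair of vectors is the old one turned by 60 degrees.\<close>

lemma hexagon_points_rotate:
 "hexagon_points c ((1/2) *R p + q) ((1/2) *R q - (3/4) *R p) = hexagon_points c p q"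
proof -
 have e: "c + (1/2) *R ((1/2) *R p + q) + ((1/2) *R q - (3/4) *R p) = c - (1/2) *R p + q"
  "c - (1/2) *R ((1/2) *R p + q) + ((1/2) *R q - (3/4) *R p) = c - p"
  "c - (1/2) *R ((1/2) *R p + q) - ((1/2) *R q - (3/4) *R p) = c + (1/2) *R p - q"
  "c + (1/2) *R ((1/2) *R p + q) - ((1/2) *R q - (3/4) *R p) = c + p"
  "c + ((1/2) *R p + q) = c + (1/2) *R p + q"
  "c - ((1/2) *R p + q) = c - (1/2) *R p - q"
  by (auto simp: vec_eq_iff field_simps)
 show ?thesis
  unfolding hexagon_points_def e by blast
qed

lemma hexagon_points_reflect: "hexagon_points c p (- q) = hexagon_points c p q"
 unfolding hexagon_points_def by auto

lemma square_points_rotate: "square_points c q (- p) = square_points c p q"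
 unfolding square_points_def by auto

definition hexagon_frame :: "real^3 \<Rightarrow> real^3 \<Rightarrow> real^3 \<Rightarrow> bool" where
 "hexagon_frame c p q \<longleftrightarrow> p \<noteq> 0 \<and> p \<bullet> q = 0 \<and> q \<bullet> q = 3/4 * (p \<bullet> p)"

definition square_frame :: "real^3 \<Rightarrow> real^3 \<Rightarrow> real^3 \<Rightarrow> bool" where
 "square_frame c p q \<longleftrightarrow> p \<noteq> 0 \<and> p \<bullet> q = 0 \<and> q \<bullet> q = p \<bullet> p"

lemma hexagon_frame_rotate:
 assumes "hexagon_frame c p q"
 shows "hexagon_frame c ((1/2) *R p + q) ((1/2) *R q - (3/4) *R p)"
  "((1/2) *R p + q) \<bullet> ((1/2) *R p + q) = p \<bullet> p"
proof -
 show 1: "((1/2) *R p + q) \<bullet> ((1/2) *R p + q) = p \<bullet> p"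
  using assms by (simp add: hexagon_frame_def inner_add inner_commute)
 then have "(1/2) *R p + q \<noteq> 0" using assms by (metis hexagon_frame_def inner_eq_zero_iff)
 then show "hexagon_frame c ((1/2) *R p + q) ((1/2) *R q - (3/4) *R p)"
  using assms 1 by (simp add: hexagon_frame_def inner_add inner_diff inner_commute algebra_simps)
qed

lemma hexagon_frame_reflect: "hexagon_frame c p q \<Longrightarrow> hexagon_frame c p (- q)"
 by (simp add: hexagon_frame_def)

text \<open>Repeated turns by 60 degrees carry \<open>p\<close> to every vertex, so a prescribed
  vertex \<open>x\<close> can be put in the place of \<open>c + p\<close>.\<close>

lemma hexagon_frame_at:
 assumes "hexagon_frame c p q" "x \<in> hexagon_points c p q"
 obtains q' where "hexagon_frame c (x - c) q'" "hexagon_points c (x - c) q' = hexagon_points c p q"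
  "(x - c) \<bullet> (x - c) = p \<bullet> p"
proof -
 define step where "step = (\<lambda>(p::real^3,q). ((1/2) *R p + q, (1/2) *R q - (3/4) *R p))"
 define P where "P n = fst ((step ^^ n) (p, q))" for n
 define Q where "Q n = snd ((step ^^ n) (p, q))" for n
 have rec: "P (Suc n) = (1/2) *R P n + Q n" "Q (Suc n) = (1/2) *R Q n - (3/4) *R P n" for n
  by (simp_all add: P_def Q_def step_def split_def)
 have 0: "P 0 = p" "Q 0 = q" by (simp_all add: P_def Q_def)
 have inv: "hexagon_frame c (P n) (Q n) \<and> hexagon_points c (P n) (Q n) = hexagon_points c p q
   \<and> P n \<bullet> P n = p \<bullet> p" for n
 proof (induction n)
  case (Suc n)
  then show ?case
   unfolding rec using hexagon_frame_rotate[of c "P n" "Q n"] hexagon_points_rotate[of c "P n" "Q n"]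
   by metis
 qed (use 0 assms in simp)
 have PQ: "P 1 = (1/2) *R p + q" "P 2 = - (1/2) *R p + q" "P 3 = - p" "P 4 = - (1/2) *R p - q" "P 5 = (1/2) *R p - q"
 proof -
  have st: "P 1 = (1/2) *R P 0 + Q 0" "Q 1 = (1/2) *R Q 0 - (3/4) *R P 0"
   "P 2 = (1/2) *R P 1 + Q 1" "Q 2 = (1/2) *R Q 1 - (3/4) *R P 1"
   "P 3 = (1/2) *R P 2 + Q 2" "Q 3 = (1/2) *R Q 2 - (3/4) *R P 2"
   "P 4 = (1/2) *R P 3 + Q 3" "Q 4 = (1/2) *R Q 3 - (3/4) *R P 3"
   "P 5 = (1/2) *R P 4 + Q 4"
   using rec[of 0] rec[of 1] rec[of 2] rec[of 3] rec[of 4] by (simp_all add: eval_nat_numeral)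
  have r: "P 1 = (1/2) *R p + q" "Q 1 = (1/2) *R q - (3/4) *R p"
   using st(1,2) 0 by simp_all
  have e2: "P 2 = - (1/2) *R p + q" "Q 2 = - (1/2) *R q - (3/4) *R p"
   unfolding st(3,4) r by (simp_all add: vec_eq_iff field_simps)
  have e3: "P 3 = - p" "Q 3 = - q"
   unfolding st(5,6) e2 by (simp_all add: vec_eq_iff field_simps)
  have e4: "P 4 = - (1/2) *R p - q" "Q 4 = - (1/2) *R q + (3/4) *R p"
   unfolding st(7,8) e3 by (simp_all add: vec_eq_iff field_simps)
  have e5: "P 5 = (1/2) *R p - q"
   unfolding st(9) e4 by (simp_all add: vec_eq_iff field_simps)
  show "P 1 = (1/2) *R p + q" "P 2 = - (1/2) *R p + q" "P 3 = - p" "P 4 = - (1/2) *R p - q" "P 5 = (1/2) *R p - q"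
   by fact+
 qed
 have "\<exists>n. x - c = P n"
  using assms(2) unfolding hexagon_points_def
  apply (elim insertE emptyE)
     apply (rule exI[of _ 0], simp add: 0)
    apply (rule exI[of _ 1], simp add: PQ del: One_nat_def)
    apply (rule exI[of _ 2], simp add: PQ del: One_nat_def)
   apply (rule exI[of _ 3], simp add: PQ del: One_nat_def)
   apply (rule exI[of _ 4], simp add: PQ del: One_nat_def)
  apply (rule exI[of _ 5], simp add: PQ del: One_nat_def)
  done
 then show ?thesis using inv that by metis
qed

lemma square_frame_at:
 assumes "square_frame c p q" "x \<in> square_points c p q"
 obtains q' where "square_frame c (x - c) q'" "square_points c (x - c) q' = square_points c p q"
  "(x - c) \<bullet> (x - c) = p \<bullet> p"
proof -
 have "q \<noteq> 0" using assms(1) by (auto simp: square_frame_def)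
 consider "x = c + p" | "x = c + q" | "x = c - p" | "x = c - q"
  using assms(2) by (auto simp: square_points_def)
 then show ?thesis
 proof cases
  case 1 then show ?thesis using assms by (intro that[of q]) auto
 next
  case 2 then show ?thesis using assms \<open>q \<noteq> 0\<close> square_points_rotate[of c q p]
   by (intro that[of "-p"]) (auto simp: square_frame_def inner_commute)
 next
  case 3 then show ?thesis using assms by (intro that[of "-q"]) (auto simp: square_frame_def square_points_def)
 next
  case 4 then show ?thesis using assms \<open>q \<noteq> 0\<close>
   by (intro that[of p]) (auto simp: square_frame_def square_points_def inner_commute)
 qed
qed

text \<open>Balls are strictly convex, so a point of the sphere lies inside no segment of the
  hull.\<close>

lemma extreme_points_convex_hull_sphere:
 fixes S :: "'a::euclidean_space set"
 assumes "\<And>x. x \<in> S \<Longrightarrow> dist c x = r"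
 shows "{x. x extreme_point_of (convex hull S)} = S"
proof -
 have "convex hull S \<subseteq> cball c r"
  using assms by (intro hull_minimal) auto
 moreover have "x \<notin> open_segment a b" if "x \<in> S" "a \<in> cball c r" "b \<in> cball c r" for x a b
  using dist_decreases_open_segment[of x a b c] that assms[of x] by (auto simp: dist_commute)
 ultimately have "x extreme_point_of (convex hull S)" if "x \<in> S" for x
  using that unfolding extreme_point_of_def by (meson hull_inc subsetD)
 then show ?thesis using extreme_point_of_convex_hull by blast
qed

lemma hexagon_points_dist:
 assumes "hexagon_frame c p q" "x \<in> hexagon_points c p q" shows "dist c x = norm p"
proof -
 have "(x - c) \<bullet> (x - c) = p \<bullet> p" using hexagon_frame_at[OF assms] by metis
 then show ?thesis by (simp add: dist_norm norm_minus_commute[of c] norm_eq)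
qed

lemma square_points_dist:
 assumes "square_frame c p q" "x \<in> square_points c p q" shows "dist c x = norm p"
proof -
 have "(x - c) \<bullet> (x - c) = p \<bullet> p" using square_frame_at[OF assms] by metis
 then show ?thesis by (simp add: dist_norm norm_minus_commute[of c] norm_eq)
qed

lemma card_hexagon_points:
 assumes "hexagon_frame c p q" shows "card (hexagon_points c p q) = 6"
proof -
 have pp: "p \<bullet> p > 0" using assms by (simp add: hexagon_frame_def)
 have ne: "a *R p + b *R q \<noteq> a' *R p + b' *R q" if "a \<noteq> a' \<or> b \<noteq> b'" for a b a' b' :: real
 proof
  assume "a *R p + b *R q = a' *R p + b' *R q"
  then have e: "(a *R p + b *R q) \<bullet> p = (a' *R p + b' *R q) \<bullet> p" "(a *R p + b *R q) \<bullet> q = (a' *R p + b' *R q) \<bullet> q" by simp_all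
  have pq: "p \<bullet> q = 0" "q \<bullet> p = 0" using assms by (simp_all add: hexagon_frame_def inner_commute)
  have "a * (p \<bullet> p) = a' * (p \<bullet> p)" "b * (q \<bullet> q) = b' * (q \<bullet> q)"
   using e unfolding inner_add_left inner_scaleR_left pq by simp_all
  then show False using that pp assms by (auto simp: hexagon_frame_def)
 qed
 have d: "p \<noteq> (1/2) *R p + q" "p \<noteq> - (1/2) *R p + q" "p \<noteq> - p" "p \<noteq> - (1/2) *R p - q" "p \<noteq> (1/2) *R p - q"
  "(1/2) *R p + q \<noteq> - (1/2) *R p + q" "(1/2) *R p + q \<noteq> - p" "(1/2) *R p + q \<noteq> - (1/2) *R p - q" "(1/2) *R p + q \<noteq> (1/2) *R p - q"
  "- (1/2) *R p + q \<noteq> - p" "- (1/2) *R p + q \<noteq> - (1/2) *R p - q" "- (1/2) *R p + q \<noteq> (1/2) *R p - q"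
  "- p \<noteq> - (1/2) *R p - q" "- p \<noteq> (1/2) *R p - q" "- (1/2) *R p - q \<noteq> (1/2) *R p - q"
  using ne[of 1 "1/2" 0 1] ne[of 1 "-(1/2)" 0 1] ne[of 1 "-1" 0 0] ne[of 1 "-(1/2)" 0 "-1"] ne[of 1 "1/2" 0 "-1"]
   ne[of "1/2" "-(1/2)" 1 1] ne[of "1/2" "-1" 1 0] ne[of "1/2" "-(1/2)" 1 "-1"] ne[of "1/2" "1/2" 1 "-1"]
   ne[of "-(1/2)" "-1" 1 0] ne[of "-(1/2)" "-(1/2)" 1 "-1"] ne[of "-(1/2)" "1/2" 1 "-1"]
   ne[of "-1" "-(1/2)" 0 "-1"] ne[of "-1" "1/2" 0 "-1"] ne[of "-(1/2)" "1/2" "-1" "-1"]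
  by simp_all
 have "hexagon_points c p q = (+) c ` {p, (1/2) *R p + q, - (1/2) *R p + q, - p, - (1/2) *R p - q, (1/2) *R p - q}"
  by (simp add: hexagon_points_def algebra_simps)
 also have "card \<dots> = card {p, (1/2) *R p + q, - (1/2) *R p + q, - p, - (1/2) *R p - q, (1/2) *R p - q}"
  by (intro card_image) (simp add: inj_on_def)
 also have "\<dots> = 6" using d by (simp del: scaleR_minus_left)
 finally show ?thesis .
qed

lemma card_square_points:
 assumes "square_frame c p q" shows "card (square_points c p q) = 4"
proof -
 have pp: "p \<bullet> p > 0" "q \<bullet> q > 0" "p \<bullet> q = 0" using assms by (auto simp: square_frame_def)
 have "p \<noteq> q" "p \<noteq> - q" "p \<noteq> - p" "q \<noteq> - q" "q \<noteq> - p" "- p \<noteq> - q"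
 proof -
  show a: "p \<noteq> q" using pp by auto
  then show "- p \<noteq> - q" by simp
  show b: "p \<noteq> - q" using pp by auto
  then show "q \<noteq> - p" by auto
  have "x \<noteq> - x" if "x \<bullet> x > 0" for x :: "real^3"
  proof
   assume "x = - x"
   then have "x \<bullet> x = (- x) \<bullet> x" by (rule arg_cong)
   then have "x \<bullet> x = - (x \<bullet> x)" by (simp only: inner_minus_left)
   then show False using that by linarith
  qed
  then show "p \<noteq> - p" "q \<noteq> - q" using pp by auto
 qed
 then have "card {p, q, - p, - q} = 4" by simp
 moreover have "square_points c p q = (+) c ` {p, q, - p, - q}" by (simp add: square_points_def)
 moreover have "card ((+) c ` {p, q, - p, - q}) = card {p, q, - p, - q}" by (intro card_image) (simp add: inj_on_def)
 ultimately show ?thesis by simp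
qed

section \<open>The Archimedean truncated octahedron\<close>

lemma orthogonal_three_imp_zero:
 fixes p q c d :: "real^3"
 assumes "p \<noteq> 0" "q \<noteq> 0" "c \<noteq> 0" "p \<bullet> q = 0" "c \<bullet> p = 0" "c \<bullet> q = 0"
  "d \<bullet> p = 0" "d \<bullet> q = 0" "d \<bullet> c = 0"
 shows "d = 0"
proof (rule ccontr)
 assume "d \<noteq> 0"
 have "p \<noteq> q" "p \<noteq> c" "p \<noteq> d" "q \<noteq> c" "q \<noteq> d" "c \<noteq> d"
  using assms \<open>d \<noteq> 0\<close> by auto
 then have "card {p, q, c, d} = 4" by simp
 moreover have "independent {p, q, c, d}"
  using assms \<open>d \<noteq> 0\<close>
  by (intro pairwise_orthogonal_independent) (auto simp: pairwise_def orthogonal_def inner_commute)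
 then have "card {p, q, c, d} \<le> DIM(real^3)" by (rule independent_card_le)
 ultimately show False by simp
qed

lemma orthogonal_three_decompose:
 fixes p q c x :: "real^3"
 assumes "p \<noteq> 0" "q \<noteq> 0" "c \<noteq> 0" "p \<bullet> q = 0" "c \<bullet> p = 0" "c \<bullet> q = 0"
 obtains \<alpha> \<beta> \<gamma> where "x = \<alpha> *R p + \<beta> *R q + \<gamma> *R c"
proof -
 let ?a = "(x \<bullet> p) / (p \<bullet> p)" and ?b = "(x \<bullet> q) / (q \<bullet> q)" and ?c = "(x \<bullet> c) / (c \<bullet> c)"
 have o: "q \<bullet> p = 0" "p \<bullet> c = 0" "q \<bullet> c = 0" using assms by (simp_all add: inner_commute)
 have "x - (?a *R p + ?b *R q + ?c *R c) = 0"
 proof (rule orthogonal_three_imp_zero[OF assms])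
  show "(x - (?a *R p + ?b *R q + ?c *R c)) \<bullet> p = 0"
   "(x - (?a *R p + ?b *R q + ?c *R c)) \<bullet> q = 0"
   "(x - (?a *R p + ?b *R q + ?c *R c)) \<bullet> c = 0"
   unfolding inner_diff_left inner_add_left inner_scaleR_left assms o using assms by simp_all
 qed
 then show ?thesis using that by (metis eq_iff_diff_eq_0)
qed

lemma diameter_closed_segment: "diameter (closed_segment x y) = dist x y" for x y :: "'a::euclidean_space"
proof (rule antisym)
 show "diameter (closed_segment x y) \<le> dist x y"
 proof (rule diameter_le)
  fix a b assume ab: "a \<in> closed_segment x y" "b \<in> closed_segment x y"
  then have "norm (a - b) \<le> norm (a - x) \<or> norm (a - b) \<le> norm (a - y)"
   using segment_furthest_le by blast
  moreover have "norm (a - x) \<le> norm (y - x)" "norm (a - y) \<le> norm (y - x)"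
   using segment_bound[OF ab(1)] norm_minus_commute[of a y] by auto
  ultimately show "norm (a - b) \<le> dist x y"
   by (auto simp: dist_norm norm_minus_commute[of y])
 qed simp
 have "bounded (closed_segment x y)" by (rule compact_imp_bounded[OF compact_segment])
 then show "dist x y \<le> diameter (closed_segment x y)"
  by (intro diameter_bounded_bound) auto
qed

text \<open>The face exposed by \<open>w\<close> is the hull of those points of \<open>V\<close> at
  which \<open>w\<close> is maximal, here just two.\<close>

lemma exposed_edge_convex_hull:
 fixes V :: "'a::euclidean_space set"
 assumes "finite V" "x \<in> V" "y \<in> V" "x \<noteq> y" "w \<bullet> x = m" "w \<bullet> y = m"
  and less: "\<And>z. \<lbrakk>z \<in> V; z \<noteq> x; z \<noteq> y\<rbrakk> \<Longrightarrow> w \<bullet> z < m"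
 shows "closed_segment x y edge_of (convex hull V)"
proof -
 let ?T = "convex hull V \<inter> {z. w \<bullet> z = m}"
 have le: "w \<bullet> z \<le> m" if "z \<in> V" for z
  using less[OF that] assms by (cases "z = x"; cases "z = y") auto
 have "convex hull V \<subseteq> {z. w \<bullet> z \<le> m}"
  using le by (intro hull_minimal) (auto simp: convex_halfspace_le)
 then have T: "?T face_of convex hull V"
  by (intro face_of_Int_supporting_hyperplane_le) auto
 then obtain s where s: "s \<subseteq> V" "?T = convex hull s"
  using face_of_convex_hull_subset assms(1) finite_imp_compact by metis
 have "s \<subseteq> {x, y}"
 proof
  fix z assume "z \<in> s"
  then have "z \<in> V" "z \<in> ?T" using s hull_inc[of z s] by auto
  then show "z \<in> {x, y}" using less[of z] by auto
 qed
 then have "?T \<subseteq> convex hull {x, y}" using s(2) hull_mono by metis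
 moreover have "convex hull {x, y} \<subseteq> ?T"
  using assms by (intro hull_minimal) (auto simp: hull_inc convex_hyperplane convex_Int)
 ultimately have "?T = closed_segment x y" by (simp add: segment_convex_hull)
 moreover have "aff_dim (closed_segment x y) = 1"
  using \<open>x \<noteq> y\<close> by (simp add: segment_convex_hull aff_dim_convex_hull aff_dim_2)
 ultimately show ?thesis using T by (simp add: edge_of_def)
qed

lemma hexagon_edge:
 assumes "hexagon_frame c p q"
 shows "closed_segment (c + p) (c + (1/2) *R p + q) edge_of (convex hull (hexagon_points c p q))"
proof -
 have pp: "p \<bullet> p > 0" and pq: "p \<bullet> q = 0" "q \<bullet> p = 0" and qq: "q \<bullet> q = 3/4 * (p \<bullet> p)"
  using assms by (auto simp: hexagon_frame_def inner_commute)
 \<comment> \<open>The sum of the two endpoints seen from \<open>c\<close>; it is orthogonal to the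
   edge.\<close>
 let ?w = "(3/2) *R p + q"
 have ip: "?w \<bullet> (c + s *R p + t *R q) = ?w \<bullet> c + (3/2 * s + 3/4 * t) * (p \<bullet> p)" for s t
  by (simp add: inner_add_left inner_add_right pq qq algebra_simps)
 have pts: "c + p = c + 1 *R p + 0 *R q" "c + (1/2) *R p + q = c + (1/2) *R p + 1 *R q"
  "c - (1/2) *R p + q = c + (-(1/2)) *R p + 1 *R q" "c - p = c + (-1) *R p + 0 *R q"
  "c - (1/2) *R p - q = c + (-(1/2)) *R p + (-1) *R q" "c + (1/2) *R p - q = c + (1/2) *R p + (-1) *R q"
  by simp_all
 have w: "?w \<bullet> (c + p) = ?w \<bullet> c + 3/2 * (p \<bullet> p)" "?w \<bullet> (c + (1/2) *R p + q) = ?w \<bullet> c + 3/2 * (p \<bullet> p)"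
   "?w \<bullet> (c - (1/2) *R p + q) < ?w \<bullet> c + 3/2 * (p \<bullet> p)" "?w \<bullet> (c - p) < ?w \<bullet> c + 3/2 * (p \<bullet> p)"
   "?w \<bullet> (c - (1/2) *R p - q) < ?w \<bullet> c + 3/2 * (p \<bullet> p)" "?w \<bullet> (c + (1/2) *R p - q) < ?w \<bullet> c + 3/2 * (p \<bullet> p)"
  unfolding pts ip using pp by (simp_all add: field_simps)
 show ?thesis
 proof (rule exposed_edge_convex_hull[OF _ _ _ _ w(1,2)])
  show "c + p \<noteq> c + (1/2) *R p + q"
  proof
   assume "c + p = c + (1/2) *R p + q"
   then have "p = (1/2) *R p + q" by simp
   then have "p \<bullet> q = ((1/2) *R p + q) \<bullet> q" by simp
   then have "q \<bullet> q = 0" using pq by (simp add: inner_add_left)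
   then show False using pp qq by simp
  qed
 qed (use w in \<open>auto simp: hexagon_points_def\<close>)
qed

lemma square_edge:
 assumes "square_frame c p q"
 shows "closed_segment (c + p) (c + q) edge_of (convex hull (square_points c p q))"
proof -
 have pp: "p \<bullet> p > 0" and pq: "p \<bullet> q = 0" "q \<bullet> p = 0" and qq: "q \<bullet> q = p \<bullet> p"
  using assms by (auto simp: square_frame_def inner_commute)
 let ?w = "p + q"
 have w: "?w \<bullet> (c + p) = ?w \<bullet> c + p \<bullet> p" "?w \<bullet> (c + q) = ?w \<bullet> c + p \<bullet> p"
   "?w \<bullet> (c - p) < ?w \<bullet> c + p \<bullet> p" "?w \<bullet> (c - q) < ?w \<bullet> c + p \<bullet> p"
  using pp by (simp_all add: inner_add_left inner_add_right inner_diff_right pq qq)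
 show ?thesis
 proof (rule exposed_edge_convex_hull[OF _ _ _ _ w(1,2)])
  show "c + p \<noteq> c + q" using pp pq by auto
 qed (use w in \<open>auto simp: square_points_def\<close>)
qed

lemma symmetric_convex_zero_interior:
 fixes P :: "'a::euclidean_space set"
 assumes "convex P" "interior P \<noteq> {}" "uminus ` P = P"
 shows "0 \<in> interior P"
proof -
 obtain x where x: "x \<in> interior P" using assms(2) by blast
 have "- x \<in> interior P"
  using x assms(3) interior_negations[of P] by (metis image_eqI)
 moreover have "convex (interior P)" by (simp add: assms)
 ultimately have "(1/2) *R x + (1/2) *R (- x) \<in> interior P"
  using x convexD[of "interior P" x "-x" "1/2" "1/2"] by simp
 then show ?thesis by simp
qed

locale archimedean =
 fixes A :: "(real^3) set"
 assumes poly: "polytope A" and int_ne: "interior A \<noteq> {}" and sym: "uminus ` A = A"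
  and arch: "archimedean_truncated_octahedron A"
begin

lemma convex_A: "convex A" and compact_A: "compact A" and polyhedron_A: "polyhedron A"
 using poly polytope_imp_convex polytope_imp_compact polytope_imp_polyhedron by auto

lemma zero_int: "0 \<in> interior A"
 by (rule symmetric_convex_zero_interior[OF convex_A int_ne sym])

lemma uminus_A: "x \<in> A \<Longrightarrow> - x \<in> A"
 using sym by blast

definition "E = {v. v extreme_point_of A}"
definition "Hex = {F. F facet_of A \<and> regular_polygon 6 F}"
definition "Sqr = {F. F facet_of A \<and> regular_polygon 4 F}"

lemma finite_E: "finite E"
 unfolding E_def using polyhedron_A by (rule finite_polyhedron_extreme_points)

lemma E_subset: "E \<subseteq> A"
 by (auto simp: E_def extreme_point_of_def)

lemma E_ne: "E \<noteq> {}"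
 using Krein_Milman_Minkowski[OF compact_A convex_A] int_ne by (auto simp: E_def)

lemma finite_facets: "finite {F. F facet_of A}"
 by (rule finite_polytope_facets[OF poly])

lemma finite_Hex: "finite Hex" and finite_Sqr: "finite Sqr"
 using finite_facets by (auto simp: Hex_def Sqr_def)

lemma card_Hex: "card Hex = 8" and card_Sqr: "card Sqr = 6"
 using arch by (auto simp: archimedean_truncated_octahedron_def Hex_def Sqr_def)

text \<open>A bounded set has at most one centre of symmetry: \<open>A\<close> is symmetric about 0
  and about \<open>f 0\<close>, hence invariant under a translation by a multiple of
  \<open>f 0\<close>, so \<open>f 0 = 0\<close>.\<close>

lemma symmetry_orthogonal:
 assumes "distance_preserving f" "f ` A = A"
 shows "orthogonal_transformation (f :: real^3 \<Rightarrow> real^3)"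
proof -
 define g where "g x = f x - f 0" for x
 have "orthogonal_transformation g"
  unfolding orthogonal_transformation_isometry using assms(1)
  by (simp add: g_def distance_preserving_def dist_norm)
 then have lin: "linear g" by (simp add: orthogonal_transformation_def)
 have "y + (- 2 *R f 0) \<in> A" if y: "y \<in> A" for y
 proof -
  obtain x where x: "x \<in> A" "y = f x" using assms(2) y by blast
  have "f (- x) \<in> A" using uminus_A[OF x(1)] assms(2) by blast
  then have "- f (- x) \<in> A" by (rule uminus_A)
  moreover have "- f (- x) = y + (- 2 *R f 0)"
   using linear_neg[OF lin, of x] x(2) by (simp add: g_def scaleR_2 algebra_simps)
  ultimately show ?thesis by simp
 qed
 then have "- 2 *R f 0 = 0"
  using bounded_translate_invariant_imp_zero[of A 0 "- 2 *R f 0"] compact_A compact_imp_bounded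
   zero_int interior_subset by blast
 then have "g = f" by (auto simp: g_def fun_eq_iff)
 then show ?thesis using \<open>orthogonal_transformation g\<close> by simp
qed

lemma vertex_symmetry:
 assumes "v \<in> E" "w \<in> E"
 obtains f :: "real^3 \<Rightarrow> real^3" where "orthogonal_transformation f" "f ` A = A" "f v = w"
 using arch assms symmetry_orthogonal unfolding archimedean_truncated_octahedron_def E_def
 by (metis mem_Collect_eq)

lemma norm_E: "v \<in> E \<Longrightarrow> w \<in> E \<Longrightarrow> norm v = norm w"
 using vertex_symmetry orthogonal_transformation_norm by metis

text \<open>The squared circumradius, common to all vertices by \<open>norm_E\<close>.\<close>

definition "R2 = (let v = (SOME v. v \<in> E) in v \<bullet> v)"

lemma inner_E: "v \<in> E \<Longrightarrow> v \<bullet> v = R2"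
 using norm_E[of v "SOME v. v \<in> E"] some_in_eq[of E] E_ne
 by (simp add: R2_def Let_def norm_eq)

lemma facet_extreme: "F facet_of A \<Longrightarrow> v extreme_point_of F \<longleftrightarrow> v \<in> E \<and> v \<in> F"
 by (simp add: extreme_point_of_face facet_of_imp_face_of E_def)

text \<open>The facet normal is orthogonal to \<open>p\<close> and \<open>q\<close>, as is
  \<open>c\<close>, so it is a multiple of \<open>c\<close>. Thus \<open>c\<close> is the foot of
  the perpendicular from 0 to the facet plane.\<close>

lemma facet_center_aux:
 assumes F: "F facet_of A" and o: "p \<noteq> 0" "q \<noteq> 0" "p \<bullet> q = 0" "c \<bullet> p = 0" "c \<bullet> q = 0"
  and pts: "c + p \<in> F" "c - p \<in> F" "c + s *R p + q \<in> F"
 shows "c \<noteq> 0" "F = A \<inter> {x. c \<bullet> x = c \<bullet> c}" "A \<subseteq> {x. c \<bullet> x \<le> c \<bullet> c}"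
proof -
 obtain a b where ab: "a \<noteq> 0" "A \<subseteq> {x. a \<bullet> x \<le> b}" "F = A \<inter> {x. a \<bullet> x = b}"
  using facet_of_polyhedron[OF polyhedron_A F] by blast
 have "a \<bullet> (c + p) = b" "a \<bullet> (c - p) = b" "a \<bullet> (c + s *R p + q) = b"
  using pts ab by auto
 then have acb: "a \<bullet> c = b" "a \<bullet> p = 0" by (simp_all add: inner_add_right inner_diff_right)
 with \<open>a \<bullet> (c + s *R p + q) = b\<close> have acb: "a \<bullet> c = b" "a \<bullet> p = 0" "a \<bullet> q = 0"
  by (simp_all add: inner_add_right)
 have "b > 0"
 proof -
  obtain e where e: "e > 0" "ball 0 e \<subseteq> A" using zero_int mem_interior by blast
  have "(e / 2 / norm a) *R a \<in> ball 0 e" using e ab by simp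
  then have "a \<bullet> ((e / 2 / norm a) *R a) \<le> b" using e(2) ab(2) by blast
  moreover have "a \<bullet> ((e / 2 / norm a) *R a) > 0" using e ab by simp
  ultimately show ?thesis by linarith
 qed
 then show c0: "c \<noteq> 0" using acb by auto
 then have cc: "c \<bullet> c > 0" by simp
 have "a - (b / (c \<bullet> c)) *R c = 0"
 proof (rule orthogonal_three_imp_zero[OF o(1,2) c0 o(3-5)])
  show "(a - (b / (c \<bullet> c)) *R c) \<bullet> p = 0" "(a - (b / (c \<bullet> c)) *R c) \<bullet> q = 0"
   using acb o by (simp_all add: inner_diff_left)
  show "(a - (b / (c \<bullet> c)) *R c) \<bullet> c = 0"
   using acb cc by (simp add: inner_diff_left)
 qed
 then have a: "a = (b / (c \<bullet> c)) *R c" by simp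
 have iff: "a \<bullet> x \<le> b \<longleftrightarrow> c \<bullet> x \<le> c \<bullet> c" "a \<bullet> x = b \<longleftrightarrow> c \<bullet> x = c \<bullet> c" for x
  unfolding a using \<open>b > 0\<close> cc by (auto simp: field_simps)
 show "F = A \<inter> {x. c \<bullet> x = c \<bullet> c}" "A \<subseteq> {x. c \<bullet> x \<le> c \<bullet> c}"
  using ab iff by auto
qed

definition "hexf F c p q \<longleftrightarrow> F \<in> Hex \<and> hexagon_frame c p q \<and> F = convex hull (hexagon_points c p q)
 \<and> c \<bullet> p = 0 \<and> c \<bullet> q = 0"

definition "sqrf F c p q \<longleftrightarrow> F \<in> Sqr \<and> square_frame c p q \<and> F = convex hull (square_points c p q)
 \<and> c \<bullet> p = 0 \<and> c \<bullet> q = 0"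

lemma hexf_points:
 assumes "hexf F c p q"
 shows "hexagon_points c p q = {v \<in> E. v \<in> F}"
proof -
 have "F facet_of A" using assms unfolding hexf_def Hex_def by blast
 moreover have "{x. x extreme_point_of F} = hexagon_points c p q"
  using assms hexagon_points_dist unfolding hexf_def by (metis extreme_points_convex_hull_sphere)
 ultimately show ?thesis using facet_extreme by blast
qed

lemma sqrf_points:
 assumes "sqrf F c p q"
 shows "square_points c p q = {v \<in> E. v \<in> F}"
proof -
 have "F facet_of A" using assms unfolding sqrf_def Sqr_def by blast
 moreover have "{x. x extreme_point_of F} = square_points c p q"
  using assms square_points_dist unfolding sqrf_def by (metis extreme_points_convex_hull_sphere)
 ultimately show ?thesis using facet_extreme by blast
qed

text \<open>All vertices lie on one sphere about 0. Equal norms of \<open>c + p\<close> and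
  \<open>c - p\<close>, and of two vertices that differ by \<open>2 q\<close>, make \<open>c\<close>
  orthogonal to the plane of the hexagon.\<close>

lemma hexf_exists:
 assumes "F \<in> Hex" obtains c p q where "hexf F c p q"
proof -
 obtain c p q where F: "F = convex hull (hexagon_points c p q)" and fr: "hexagon_frame c p q"
  using regular_polygon_6 assms unfolding Hex_def hexagon_frame_def by blast
 have fac: "F facet_of A" using assms by (simp add: Hex_def)
 have "{x. x extreme_point_of F} = hexagon_points c p q"
  using F fr hexagon_points_dist by (metis extreme_points_convex_hull_sphere)
 then have sub: "hexagon_points c p q \<subseteq> E" using facet_extreme[OF fac] by blast
 then have "(c + p) \<bullet> (c + p) = R2" "(c - p) \<bullet> (c - p) = R2"
  "(c + (1/2) *R p + q) \<bullet> (c + (1/2) *R p + q) = R2" "(c + (1/2) *R p - q) \<bullet> (c + (1/2) *R p - q) = R2"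
  by (auto intro!: inner_E simp: hexagon_points_def)
 then have "c \<bullet> p = 0" "c \<bullet> q = 0"
  using fr by (auto simp: hexagon_frame_def inner_add inner_diff inner_commute)
 then show ?thesis using that assms F fr by (simp add: hexf_def)
qed

lemma sqrf_exists:
 assumes "F \<in> Sqr" obtains c p q where "sqrf F c p q"
proof -
 obtain c p q where F: "F = convex hull (square_points c p q)" and fr: "square_frame c p q"
  using regular_polygon_4 assms unfolding Sqr_def square_frame_def by blast
 have fac: "F facet_of A" using assms by (simp add: Sqr_def)
 have "{x. x extreme_point_of F} = square_points c p q"
  using F fr square_points_dist by (metis extreme_points_convex_hull_sphere)
 then have sub: "square_points c p q \<subseteq> E" using facet_extreme[OF fac] by blast
 then have "(c + p) \<bullet> (c + p) = R2" "(c - p) \<bullet> (c - p) = R2" "(c + q) \<bullet> (c + q) = R2" "(c - q) \<bullet> (c - q) = R2"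
  by (auto intro!: inner_E simp: square_points_def)
 then have "c \<bullet> p = 0" "c \<bullet> q = 0"
  by (auto simp: inner_add inner_diff inner_commute)
 then show ?thesis using that assms F fr by (simp add: sqrf_def)
qed

lemma Hex_Sqr_disjoint: "Hex \<inter> Sqr = {}"
proof (rule ccontr)
 assume "Hex \<inter> Sqr \<noteq> {}"
 then obtain F where "F \<in> Hex" "F \<in> Sqr" by blast
 then obtain c p q c' p' q' where f: "hexf F c p q" "sqrf F c' p' q'" using hexf_exists sqrf_exists by metis
 then have "hexagon_points c p q = square_points c' p' q'" using hexf_points sqrf_points by metis
 moreover have "hexagon_frame c p q" "square_frame c' p' q'"
  using f unfolding hexf_def sqrf_def by blast+
 ultimately show False using card_hexagon_points[of c p q] card_square_points[of c' p' q'] by simp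
qed

lemma facets_Hex_Sqr: "{F. F facet_of A} = Hex \<union> Sqr"
proof -
 have "card (Hex \<union> Sqr) = 14"
  using card_Un_disjoint[OF finite_Hex finite_Sqr Hex_Sqr_disjoint] card_Hex card_Sqr by simp
 moreover have "Hex \<union> Sqr \<subseteq> {F. F facet_of A}" by (auto simp: Hex_def Sqr_def)
 moreover have "card {F. F facet_of A} = 14" using arch by (simp add: archimedean_truncated_octahedron_def)
 ultimately show ?thesis using card_subset_eq[OF finite_facets] by metis
qed

lemma hexf_rotate:
 "hexf F c p q \<Longrightarrow> hexf F c ((1/2) *R p + q) ((1/2) *R q - (3/4) *R p)"
 unfolding hexf_def hexagon_points_rotate
 by (elim conjE, intro conjI hexagon_frame_rotate(1)) (simp_all only: inner_add_right inner_diff_right inner_scaleR_right)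

lemma hexf_reflect: "hexf F c p q \<Longrightarrow> hexf F c p (- q)"
 unfolding hexf_def hexagon_points_reflect
 by (elim conjE, intro conjI hexagon_frame_reflect) (simp_all only: inner_minus_right)

lemma hexf_plane:
 assumes "hexf F c p q"
 shows "c \<noteq> 0" "F = A \<inter> {x. c \<bullet> x = c \<bullet> c}" "A \<subseteq> {x. c \<bullet> x \<le> c \<bullet> c}"
proof -
 have q: "q \<noteq> 0" and p: "p \<noteq> 0" using assms by (auto simp: hexf_def hexagon_frame_def)
 have "{c + p, c - p, c + (1/2) *R p + q} \<subseteq> F" using hexf_points[OF assms] by (auto simp: hexagon_points_def)
 then show "c \<noteq> 0" "F = A \<inter> {x. c \<bullet> x = c \<bullet> c}" "A \<subseteq> {x. c \<bullet> x \<le> c \<bullet> c}"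
  using facet_center_aux[of F p q c "1/2"] assms p q by (auto simp: hexf_def hexagon_frame_def Hex_def)
qed

lemma sqrf_plane:
 assumes "sqrf F c p q"
 shows "c \<noteq> 0" "F = A \<inter> {x. c \<bullet> x = c \<bullet> c}" "A \<subseteq> {x. c \<bullet> x \<le> c \<bullet> c}"
proof -
 have q: "q \<noteq> 0" and p: "p \<noteq> 0" using assms by (auto simp: sqrf_def square_frame_def)
 have "{c + p, c - p, c + 0 *R p + q} \<subseteq> F" using sqrf_points[OF assms] by (auto simp: square_points_def)
 then show "c \<noteq> 0" "F = A \<inter> {x. c \<bullet> x = c \<bullet> c}" "A \<subseteq> {x. c \<bullet> x \<le> c \<bullet> c}"
  using facet_center_aux[of F p q c 0] assms p q by (auto simp: sqrf_def square_frame_def Sqr_def)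
qed

lemma facet_edge: "\<lbrakk>F facet_of A; e edge_of F\<rbrakk> \<Longrightarrow> e edge_of A"
 unfolding edge_of_def using face_of_trans facet_of_imp_face_of by blast

lemma edge_length_exists: "\<exists>l. (\<forall>F c p q. hexf F c p q \<longrightarrow> p \<bullet> p = l) \<and> (\<forall>F c p q. sqrf F c p q \<longrightarrow> 2 * (p \<bullet> p) = l) \<and> l > 0"
proof -
 obtain l where l: "\<And>e. e edge_of A \<Longrightarrow> diameter e = l"
  using arch unfolding archimedean_truncated_octahedron_def by blast
 have h: "p \<bullet> p = l\<^sup>2" if "hexf F c p q" for F c p q
 proof -
  have fr: "hexagon_frame c p q" "F facet_of A" "F = convex hull (hexagon_points c p q)"
   using that by (auto simp: hexf_def Hex_def)
  have "dist (c + p) (c + (1/2) *R p + q) = l"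
   using l[OF facet_edge[OF fr(2)], of "closed_segment (c + p) (c + (1/2) *R p + q)"] hexagon_edge[OF fr(1)] fr(3)
   by (simp add: diameter_closed_segment)
  then have "norm ((1/2) *R p - q) = l"
  proof -
   have "c + p - (c + (1/2) *R p + q) = (1/2) *R p - q" by (simp add: vec_eq_iff)
   then show ?thesis using \<open>dist (c + p) (c + (1/2) *R p + q) = l\<close> by (simp only: dist_norm)
  qed
  then have "((1/2) *R p - q) \<bullet> ((1/2) *R p - q) = l\<^sup>2" by (simp add: dot_square_norm)
  then show ?thesis using fr(1) by (simp add: hexagon_frame_def inner_diff inner_commute)
 qed
 have s: "2 * (p \<bullet> p) = l\<^sup>2" if "sqrf F c p q" for F c p q
 proof -
  have fr: "square_frame c p q" "F facet_of A" "F = convex hull (square_points c p q)"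
   using that by (auto simp: sqrf_def Sqr_def)
  have "dist (c + p) (c + q) = l"
   using l[OF facet_edge[OF fr(2)], of "closed_segment (c + p) (c + q)"] square_edge[OF fr(1)] fr(3)
   by (simp add: diameter_closed_segment)
  then have "norm (p - q) = l" by (simp add: dist_norm)
  then have "(p - q) \<bullet> (p - q) = l\<^sup>2" by (simp add: dot_square_norm)
  then show ?thesis using fr(1) by (simp add: square_frame_def inner_diff inner_commute)
 qed
 obtain F where "F \<in> Hex" using card_Hex by fastforce
 then obtain c p q where f: "hexf F c p q" by (rule hexf_exists)
 then have "l\<^sup>2 > 0" using h[OF f] by (metis hexagon_frame_def hexf_def inner_gt_zero_iff)
 then show ?thesis using h s by blast
qed

text \<open>The squared edge length: a hexagon has circumradius equal to its edge, while a square
  has half of \<open>l2\<close> as squared circumradius.\<close>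

definition "l2 = (SOME l. (\<forall>F c p q. hexf F c p q \<longrightarrow> p \<bullet> p = l) \<and> (\<forall>F c p q. sqrf F c p q \<longrightarrow> 2 * (p \<bullet> p) = l) \<and> l > 0)"

lemma l2: "hexf F c p q \<Longrightarrow> p \<bullet> p = l2" "sqrf F c p q \<Longrightarrow> 2 * (p \<bullet> p) = l2" "l2 > 0"
 using someI_ex[OF edge_length_exists] unfolding l2_def[symmetric] by blast+

lemma hexf_norms:
 assumes "hexf F c p q"
 shows "p \<bullet> p = l2" "q \<bullet> q = 3/4 * l2" "p \<bullet> q = 0" "c \<bullet> p = 0" "c \<bullet> q = 0" "c \<bullet> c = R2 - l2"
proof -
 show 1: "p \<bullet> p = l2" "q \<bullet> q = 3/4 * l2" "p \<bullet> q = 0" "c \<bullet> p = 0" "c \<bullet> q = 0"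
  using assms l2(1)[OF assms] by (auto simp: hexf_def hexagon_frame_def)
 have "c + p \<in> E" using hexf_points[OF assms] by (auto simp: hexagon_points_def)
 then have "(c + p) \<bullet> (c + p) = R2" by (rule inner_E)
 then show "c \<bullet> c = R2 - l2" using 1 by (simp add: inner_add inner_commute)
qed

end

section \<open>Incidences and the facets at a vertex\<close>

context archimedean
begin

text \<open>A proper face is the intersection of the facets containing it, and \<open>F\<close>
  alone has dimension 2.\<close>

lemma facet_through_edge:
 assumes F: "F facet_of A" and e: "closed_segment x y edge_of F"
 obtains F' where "F' facet_of A" "F' \<noteq> F" "x \<in> F'" "y \<in> F'"
proof -
 let ?e = "closed_segment x y"
 have eA: "?e edge_of A" by (rule facet_edge[OF F e])
 have dims: "aff_dim A = 3" using int_ne aff_dim_nonempty_interior[of A] by simp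
 then have "aff_dim F = 2" using F by (simp add: facet_of_def)
 have "?e \<noteq> A" using eA dims by (auto simp: edge_of_def)
 then have "?e = \<Inter>{F. F facet_of A \<and> ?e \<subseteq> F}"
  using face_of_polyhedron[OF polyhedron_A, of ?e] eA by (simp add: edge_of_def)
 moreover have "?e \<noteq> F" using e \<open>aff_dim F = 2\<close> by (auto simp: edge_of_def)
 ultimately have "{F. F facet_of A \<and> ?e \<subseteq> F} \<noteq> {F}" by (metis cInf_singleton)
 moreover have "F \<in> {F. F facet_of A \<and> ?e \<subseteq> F}" using F edge_of_imp_subset[OF e] by simp
 ultimately obtain F' where "F' facet_of A" "?e \<subseteq> F'" "F' \<noteq> F" by blast
 then show ?thesis using that[of F'] by auto
qed

definition "fplane F c \<longleftrightarrow> F facet_of A \<and> c \<noteq> 0 \<and> F = A \<inter> {x. c \<bullet> x = c \<bullet> c} \<and> A \<subseteq> {x. c \<bullet> x \<le> c \<bullet> c}"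

lemma hexf_fplane: "hexf F c p q \<Longrightarrow> fplane F c"
 unfolding fplane_def using hexf_plane[of F c p q] by (auto simp: hexf_def Hex_def)

lemma sqrf_fplane: "sqrf F c p q \<Longrightarrow> fplane F c"
 unfolding fplane_def using sqrf_plane[of F c p q] by (auto simp: sqrf_def Sqr_def)

lemma facet_cases:
 assumes "F facet_of A" obtains "F \<in> Hex" | "F \<in> Sqr"
 using assms facets_Hex_Sqr by blast

lemma facet_fplane: "F facet_of A \<Longrightarrow> \<exists>c. fplane F c"
 by (erule facet_cases) (meson hexf_exists sqrf_exists hexf_fplane sqrf_fplane)+

lemma facet_eq_of_three_vertices:
 assumes h: "hexf F c p q" and F': "F' facet_of A"
  and "c + p \<in> F'" "c + (1/2) *R p + q \<in> F'" "c - (1/2) *R p + q \<in> F'"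
 shows "F' = F"
proof -
 obtain c' where c': "fplane F' c'" using facet_fplane[OF F'] by blast
 note n = hexf_norms[OF h]
 have ne: "p \<noteq> 0" "q \<noteq> 0" "c \<noteq> 0" using n l2(3) hexf_plane(1)[OF h] by auto
 obtain \<alpha> \<beta> \<gamma> where d: "c' = \<alpha> *R p + \<beta> *R q + \<gamma> *R c"
  using orthogonal_three_decompose[OF ne n(3,4,5)] by blast
 have e: "c' \<bullet> (c + p) = c' \<bullet> c'" "c' \<bullet> (c + (1/2) *R p + q) = c' \<bullet> c'" "c' \<bullet> (c - (1/2) *R p + q) = c' \<bullet> c'"
  using assms c' by (auto simp: fplane_def)
 then have "c' \<bullet> p = 0" "c' \<bullet> q = 0" by (simp_all add: inner_add_right inner_diff_right)
 moreover have "c' \<bullet> p = \<alpha> * l2" "c' \<bullet> q = \<beta> * (3/4 * l2)"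
  unfolding d inner_add_left inner_scaleR_left n using n(3) by (simp_all add: n inner_commute)
 ultimately have "\<alpha> = 0" "\<beta> = 0" using l2(3) by auto
 then have d': "c' = \<gamma> *R c" using d by simp
 have "c' \<bullet> c = c' \<bullet> c'" using e \<open>c' \<bullet> p = 0\<close> by (simp add: inner_add_right)
 then have "\<gamma> * (c \<bullet> c) = \<gamma> * \<gamma> * (c \<bullet> c)" unfolding d' by auto
 then have "\<gamma> = 0 \<or> \<gamma> = 1" using ne(3) by auto
 then have "c' = c" using d' c' by (auto simp: fplane_def)
 then show ?thesis using c' hexf_fplane[OF h] by (auto simp: fplane_def)
qed

definition "hexes v = {F \<in> Hex. v \<in> F}"
definition "squares v = {F \<in> Sqr. v \<in> F}"

lemma facet_image:
 assumes f: "orthogonal_transformation f" "f ` A = A" and F: "F facet_of A"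
 shows "f ` F facet_of A"
proof -
 have lin: "linear f" "inj f" using f(1) orthogonal_transformation_linear orthogonal_transformation_inj by auto
 have "f ` F face_of f ` A"
  using F lin by (simp add: face_of_linear_image facet_of_imp_face_of)
 moreover have "aff_dim (f ` F) = aff_dim F" using lin by (simp add: aff_dim_injective_linear_image)
 ultimately show ?thesis using F f(2) by (auto simp: facet_of_def)
qed

text \<open>A symmetry taking \<open>v\<close> to \<open>w\<close> maps the facets at
  \<open>v\<close> injectively to facets of the same kind at \<open>w\<close>.\<close>

lemma card_at_vertex_le:
 assumes "v \<in> E" "w \<in> E"
 shows "card (hexes v) \<le> card (hexes w)" "card (squares v) \<le> card (squares w)"
proof -
 obtain f :: "real^3 \<Rightarrow> real^3" where f: "orthogonal_transformation f" "f ` A = A" "f v = w"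
  using vertex_symmetry assms by blast
 have lin: "linear f" "inj f" using f(1) orthogonal_transformation_linear orthogonal_transformation_inj by auto
 have rp: "regular_polygon n (f ` F)" if "regular_polygon n F" for n F
  using regular_polygon_linear_image[OF that lin(1), of 1] f(1) orthogonal_transformation_norm by auto
 have inj: "inj_on ((`) f) X" for X using lin(2) by (meson inj_image_eq_iff inj_onI)
 show "card (hexes v) \<le> card (hexes w)"
 proof (rule card_inj_on_le[OF inj])
  show "(`) f ` hexes v \<subseteq> hexes w" using facet_image[OF f(1,2)] rp f(3) by (auto simp: hexes_def Hex_def)
 qed (use finite_Hex in \<open>simp add: hexes_def\<close>)
 show "card (squares v) \<le> card (squares w)"
 proof (rule card_inj_on_le[OF inj])
  show "(`) f ` squares v \<subseteq> squares w" using facet_image[OF f(1,2)] rp f(3) by (auto simp: squares_def Sqr_def)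
 qed (use finite_Sqr in \<open>simp add: squares_def\<close>)
qed

text \<open>Double counting of vertices in facets, \<open>8 * 6\<close> and \<open>6 * 4\<close>;
  vertex transitivity makes the counts at all vertices equal.\<close>

lemma incidences:
 assumes "v \<in> E"
 shows "card E * card (hexes v) = 48" "card E * card (squares v) = 24"
proof -
 have "card (hexes w) = card (hexes v)" "card (squares w) = card (squares v)" if "w \<in> E" for w
  using card_at_vertex_le assms that by (simp_all add: eq_iff)
 then have "card E * card (hexes v) = (\<Sum>w\<in>E. card (hexes w))" "card E * card (squares v) = (\<Sum>w\<in>E. card (squares w))"
  by simp_all
 moreover have "(\<Sum>w\<in>E. card (hexes w)) = (\<Sum>F\<in>Hex. card {w\<in>E. w \<in> F})"
  unfolding hexes_def using sum_multicount_gen[OF finite_E finite_Hex, of "\<lambda>w F. w \<in> F" "\<lambda>F. card {w\<in>E. w \<in> F}"] by simp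
 moreover have "(\<Sum>w\<in>E. card (squares w)) = (\<Sum>F\<in>Sqr. card {w\<in>E. w \<in> F})"
  unfolding squares_def using sum_multicount_gen[OF finite_E finite_Sqr, of "\<lambda>w F. w \<in> F" "\<lambda>F. card {w\<in>E. w \<in> F}"] by simp
 moreover have "card {w\<in>E. w \<in> F} = 6" if "F \<in> Hex" for F
  using hexf_exists[OF that] hexf_points card_hexagon_points by (metis hexf_def)
 moreover have "card {w\<in>E. w \<in> F} = 4" if "F \<in> Sqr" for F
  using sqrf_exists[OF that] sqrf_points card_square_points by (metis sqrf_def)
 ultimately show "card E * card (hexes v) = 48" "card E * card (squares v) = 24"
  using card_Hex card_Sqr by simp_all
qed

lemma hexf_at:
 assumes "F \<in> Hex" "v \<in> E" "v \<in> F"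
 obtains c q where "hexf F c (v - c) q"
proof -
 obtain c p q where h: "hexf F c p q" using hexf_exists[OF assms(1)] by blast
 then have fr: "hexagon_frame c p q" and n: "c \<bullet> p = 0" "c \<bullet> q = 0" by (auto simp: hexf_def)
 have v: "v \<in> hexagon_points c p q" using hexf_points[OF h] assms by blast
 obtain q' where q': "hexagon_frame c (v - c) q'" "hexagon_points c (v - c) q' = hexagon_points c p q"
  using hexagon_frame_at[OF fr v] by blast
 have h': "F \<in> Hex" "F = convex hull (hexagon_points c (v - c) q')" using h q'(2) by (auto simp: hexf_def)
 have "hexagon_points c (v - c) q' \<subseteq> F" using h'(2) hull_subset by metis
 then have "c + (v - c) \<in> F" "c + (1/2) *R (v - c) + q' \<in> F" by (auto simp: hexagon_points_def)
 then have "c \<bullet> (c + (v - c)) = c \<bullet> c" "c \<bullet> (c + (1/2) *R (v - c) + q') = c \<bullet> c"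
  using hexf_plane(2)[OF h] by blast+
 then have "c \<bullet> (v - c) = 0" "c \<bullet> q' = 0" by (simp_all add: inner_add_right inner_diff_right)
 then show ?thesis using that q'(1) h' by (simp add: hexf_def)
qed

lemma sqrf_at:
 assumes "F \<in> Sqr" "v \<in> E" "v \<in> F"
 obtains c q where "sqrf F c (v - c) q"
proof -
 obtain c p q where h: "sqrf F c p q" using sqrf_exists[OF assms(1)] by blast
 then have fr: "square_frame c p q" and n: "c \<bullet> p = 0" "c \<bullet> q = 0" by (auto simp: sqrf_def)
 have v: "v \<in> square_points c p q" using sqrf_points[OF h] assms by blast
 obtain q' where q': "square_frame c (v - c) q'" "square_points c (v - c) q' = square_points c p q"
  using square_frame_at[OF fr v] by blast
 have h': "F \<in> Sqr" "F = convex hull (square_points c (v - c) q')" using h q'(2) by (auto simp: sqrf_def)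
 have "square_points c (v - c) q' \<subseteq> F" using h'(2) hull_subset by metis
 then have "c + (v - c) \<in> F" "c + q' \<in> F" by (auto simp: square_points_def)
 then have "c \<bullet> (c + (v - c)) = c \<bullet> c" "c \<bullet> (c + q') = c \<bullet> c"
  using sqrf_plane(2)[OF h] by blast+
 then have "c \<bullet> (v - c) = 0" "c \<bullet> q' = 0" by (simp_all add: inner_add_right inner_diff_right)
 then show ?thesis using that q'(1) h' by (simp add: sqrf_def)
qed

text \<open>Here \<open>\<alpha>\<close>, \<open>\<beta>\<close>, \<open>\<gamma>\<close> are the
  coordinates of a second hexagon centre in an orthogonal frame with squared lengths
  \<open>l\<close>, \<open>3/4 * l\<close>, \<open>u\<close>. The norm equation \<open>S\<close> and
  the bound on \<open>\<beta>\<close> combine after multiplication by \<open>l\<close>; the common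
  factor \<open>u * (1 - \<gamma>)\<close> is positive and cancels.\<close>

lemma wide_angle_algebra:
 fixes u l \<alpha> \<beta> \<gamma> :: real
 assumes "u > 0" "l > 0" "\<gamma> \<noteq> 1" and al: "\<alpha> * l = u * (1 - \<gamma>)"
  and S: "u = \<alpha>\<^sup>2 * l + \<beta>\<^sup>2 * (3/4 * l) + \<gamma>\<^sup>2 * u"
  and i: "\<bar>\<beta> * (3/4 * l)\<bar> \<le> u / 2 * (1 - \<gamma>)"
 shows "3/4 * l * (1 + \<gamma>) \<le> u * (1 - \<gamma>)"
proof -
 have g1: "\<gamma> < 1"
 proof -
  have "0 \<le> u / 2 * (1 - \<gamma>)" using i by (meson abs_ge_zero order_trans)
  then have "1 - \<gamma> \<ge> 0" using \<open>u > 0\<close> by (simp add: zero_le_mult_iff)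
  then show ?thesis using \<open>\<gamma> \<noteq> 1\<close> by simp
 qed
 have "\<bar>\<beta> * (3/4 * l)\<bar>\<^sup>2 \<le> (u / 2 * (1 - \<gamma>))\<^sup>2" using i by (intro power_mono) auto
 then have i2: "9/16 * (l\<^sup>2 * \<beta>\<^sup>2) \<le> 1/4 * (u * (1 - \<gamma>))\<^sup>2"
  by (simp add: power_mult_distrib power_divide mult_ac)
 have "l * u = l * (\<alpha>\<^sup>2 * l + \<beta>\<^sup>2 * (3/4 * l) + \<gamma>\<^sup>2 * u)" using S by simp
 then have "l * u * (1 - \<gamma>\<^sup>2) = (\<alpha> * l)\<^sup>2 + 3/4 * (l\<^sup>2 * \<beta>\<^sup>2)"
  by (simp add: power2_eq_square algebra_simps)
 then have "3/4 * (l * u * (1 - \<gamma>\<^sup>2)) \<le> (u * (1 - \<gamma>))\<^sup>2"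
  using i2 unfolding al by linarith
 then have "(u * (1 - \<gamma>)) * (3/4 * l * (1 + \<gamma>)) \<le> (u * (1 - \<gamma>)) * (u * (1 - \<gamma>))"
  by (simp add: power2_eq_square field_simps)
 moreover have "u * (1 - \<gamma>) > 0" using \<open>u > 0\<close> g1 by simp
 ultimately show ?thesis by (simp only: mult_le_cancel_left_pos)
qed

text \<open>Two hexagons at a common vertex: their centres make a wide angle around the vertex axis,
 because the edges of one of them at the vertex lie below the plane of the other.\<close>

lemma two_hexagons_angle:
 assumes "F \<in> hexes v" "G \<in> hexes v" "F \<noteq> G" "v \<in> E" and cF: "fplane F c" and cG: "fplane G d"
 shows "c \<bullet> c = R2 - l2" "c \<bullet> v = R2 - l2"
  "(c \<bullet> d) * (4 * R2 - l2) \<le> (R2 - l2) * (4 * R2 - 7 * l2)"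
proof -
 let ?u = "R2 - l2"
 have mem: "F \<in> Hex" "v \<in> F" "G \<in> Hex" "v \<in> G" using assms by (auto simp: hexes_def)
 obtain c' q where h: "hexf F c' (v - c') q" using hexf_at[OF mem(1) \<open>v \<in> E\<close> mem(2)] .
 obtain d' q' where h': "hexf G d' (v - d') q'" using hexf_at[OF mem(3) \<open>v \<in> E\<close> mem(4)] .
 have fplane_unique: "b = b'" if "fplane H b" "fplane H b'" "H \<in> Hex" for H b b'
 proof -
  have *: "b = e" if hb: "fplane H b" and hf: "hexf H e p q" for b e p q
  proof -
   note n = hexf_norms[OF hf]
   have ne: "p \<noteq> 0" "q \<noteq> 0" "e \<noteq> 0" using n l2(3) hexf_plane(1)[OF hf] by auto
   have "hexagon_points e p q \<subseteq> H" using hexf_points[OF hf] by blast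
   then have i: "b \<bullet> (e + p) = b \<bullet> b" "b \<bullet> (e - p) = b \<bullet> b" "b \<bullet> (e + (1/2) *R p + q) = b \<bullet> b"
    using hb by (auto simp: hexagon_points_def fplane_def)
   then have bp: "b \<bullet> e = b \<bullet> b" "b \<bullet> p = 0" by (simp_all add: inner_add_right inner_diff_right)
   then have bq: "b \<bullet> q = 0" using i(3) by (simp add: inner_add_right)
   have "b - (b \<bullet> e / (e \<bullet> e)) *R e = 0"
    by (rule orthogonal_three_imp_zero[OF ne n(3,4,5)]) (use bp bq n(4,5) ne in \<open>simp_all add: inner_diff_left\<close>)
   then obtain g where g: "b = g *R e" by (metis eq_iff_diff_eq_0)
   then have "g * (e \<bullet> e) = g * g * (e \<bullet> e)" using bp(1) by auto
   then have "g = 0 \<or> g = 1" using ne(3) by auto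
   then show ?thesis using g hb by (auto simp: fplane_def)
  qed
  obtain e p q where "hexf H e p q" using hexf_exists \<open>H \<in> Hex\<close> by blast
  then show ?thesis using * that by metis
 qed
 have "c' = c" using fplane_unique[OF hexf_fplane[OF h] cF] assms(1) by (simp add: hexes_def)
 with h have h: "hexf F c (v - c) q" by simp
 have "d' = d" using fplane_unique[OF hexf_fplane[OF h'] cG] assms(2) by (simp add: hexes_def)
 with h' have h': "hexf G d (v - d) q'" by simp
 note n = hexf_norms[OF h] and n' = hexf_norms[OF h']
 let ?X = "c \<bullet> d"
 show uc: "c \<bullet> c = ?u" using n by simp
 show vc: "c \<bullet> v = ?u" using n(4) uc by (simp add: inner_diff_right)
 have vd: "d \<bullet> v = ?u" and ud: "d \<bullet> d = ?u" using n'(4,6) by (simp_all add: inner_diff_right)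
 have vv: "v \<bullet> v = R2" using inner_E[OF \<open>v \<in> E\<close>] .
 have ne: "v - c \<noteq> 0" "q \<noteq> 0" "c \<noteq> 0" using n l2(3) hexf_plane(1)[OF h] by auto
 have upos: "?u > 0" using ne(3) uc by (metis inner_gt_zero_iff)
 \<comment> \<open>The two neighbours of \<open>v\<close> in the first hexagon satisfy the
   inequality of the second facet.\<close>
 have "hexagon_points c (v - c) q \<subseteq> A" using hexf_points[OF h] E_subset by blast
 then have "d \<bullet> (c + (1/2) *R (v - c) + q) \<le> d \<bullet> d" "d \<bullet> (c + (1/2) *R (v - c) - q) \<le> d \<bullet> d"
  using cG by (auto simp: hexagon_points_def fplane_def)
 then have ineq: "?X / 2 + \<bar>d \<bullet> q\<bar> \<le> ?u / 2"
 proof -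
  have "d \<bullet> (c + (1/2) *R (v - c) + q) = ?X + (?u - ?X) / 2 + d \<bullet> q"
   "d \<bullet> (c + (1/2) *R (v - c) - q) = ?X + (?u - ?X) / 2 - d \<bullet> q"
   using vd by (simp_all add: inner_add_right inner_diff_right inner_commute[of d c])
  then have "d \<bullet> q \<le> ?u / 2 - ?X / 2" "- (d \<bullet> q) \<le> ?u / 2 - ?X / 2"
  proof -
   have gen: "q \<le> u / 2 - X / 2" "- r \<le> u / 2 - X / 2"
    if "a \<le> u" "b \<le> u" "a = X + (u - X) / 2 + q" "b = X + (u - X) / 2 - r" for a b u X q r :: real
    using that by (simp_all add: field_simps)
   assume *: "d \<bullet> (c + (1/2) *R (v - c) + q) = ?X + (?u - ?X) / 2 + d \<bullet> q"
    "d \<bullet> (c + (1/2) *R (v - c) - q) = ?X + (?u - ?X) / 2 - d \<bullet> q"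
   show "d \<bullet> q \<le> ?u / 2 - ?X / 2" "- (d \<bullet> q) \<le> ?u / 2 - ?X / 2"
    using gen[OF _ _ *] \<open>d \<bullet> (c + (1/2) *R (v - c) + q) \<le> d \<bullet> d\<close>
     \<open>d \<bullet> (c + (1/2) *R (v - c) - q) \<le> d \<bullet> d\<close> unfolding ud by blast+
  qed
  then have "\<bar>d \<bullet> q\<bar> \<le> ?u / 2 - ?X / 2" by (rule abs_leI)
  then show ?thesis by (simp add: field_simps)
 qed
 obtain \<alpha> \<beta> \<gamma> where dd: "d = \<alpha> *R (v - c) + \<beta> *R q + \<gamma> *R c"
  using orthogonal_three_decompose[OF ne n(3,4,5)] by blast
 have co: "d \<bullet> (v - c) = \<alpha> * l2" "d \<bullet> q = \<beta> * (3/4 * l2)" "d \<bullet> c = \<gamma> * ?u"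
  unfolding dd inner_add_left inner_scaleR_left n using n by (simp_all add: n inner_commute)
 have "d \<bullet> d = \<alpha> * (d \<bullet> (v - c)) + \<beta> * (d \<bullet> q) + \<gamma> * (d \<bullet> c)"
  by (subst (2) dd) (simp add: inner_add_right)
 then have S: "?u = \<alpha>\<^sup>2 * l2 + \<beta>\<^sup>2 * (3/4 * l2) + \<gamma>\<^sup>2 * ?u"
  unfolding ud co by (simp add: power2_eq_square algebra_simps)
 have X: "?X = \<gamma> * ?u" using co(3) by (simp add: inner_commute)
 have al: "\<alpha> * l2 = ?u * (1 - \<gamma>)"
  using co(1,3) vd by (simp add: inner_diff_right algebra_simps)
 have "\<gamma> \<noteq> 1"
 proof
  assume "\<gamma> = 1"
  then have "\<alpha> = 0" using al l2(3) by simp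
  then have "\<beta> = 0" using S \<open>\<gamma> = 1\<close> l2(3) by simp
  then have "d = c" using dd \<open>\<alpha> = 0\<close> \<open>\<gamma> = 1\<close> by simp
  then show False using cF cG \<open>F \<noteq> G\<close> by (auto simp: fplane_def)
 qed
 have "?u / 2 * (1 - \<gamma>) \<ge> \<bar>\<beta> * (3/4 * l2)\<bar>"
 proof -
  have "u / 2 * (1 - g) \<ge> y" if "g * u / 2 + y \<le> u / 2" for g u y :: real
   using that by (simp add: field_simps)
  from this[of \<gamma> ?u] show ?thesis using ineq unfolding X co(2) by blast
 qed
 note wide = this
 have "3/4 * l2 * (1 + \<gamma>) \<le> ?u * (1 - \<gamma>)"
  by (rule wide_angle_algebra[OF upos l2(3) \<open>\<gamma> \<noteq> 1\<close> al S wide])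
 then have "\<gamma> * (4 * R2 - l2) \<le> 4 * R2 - 7 * l2" by (simp add: field_simps)
 then have "?u * (\<gamma> * (4 * R2 - l2)) \<le> ?u * (4 * R2 - 7 * l2)" using upos by simp
 then show "?X * (4 * R2 - l2) \<le> ?u * (4 * R2 - 7 * l2)" unfolding X by (simp add: mult_ac)
qed

text \<open>Three hexagons at a vertex would use up 120 degrees each. Quantitatively, three wide
  angles would make the sum of the centres shorter than its own projection onto the line of
  \<open>v\<close>.\<close>

lemma hexes_le_2:
 assumes "v \<in> E" shows "card (hexes v) \<le> 2"
proof (rule ccontr)
 assume "\<not> card (hexes v) \<le> 2"
 then have "3 \<le> card (hexes v)" by linarith
 then obtain S where S: "S \<subseteq> hexes v" "card S = 3" by (rule obtain_subset_with_card_n)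
 then obtain F G H where "S = {F, G, H}" "F \<noteq> G" "G \<noteq> H" "F \<noteq> H" unfolding card_3_iff by blast
 then have FGH: "F \<in> hexes v" "G \<in> hexes v" "H \<in> hexes v" "F \<noteq> G" "G \<noteq> H" "F \<noteq> H"
  using S by auto
 have "F facet_of A" "G facet_of A" "H facet_of A" using FGH by (auto simp: hexes_def Hex_def)
 then obtain a b c where p: "fplane F a" "fplane G b" "fplane H c" using facet_fplane by metis
 let ?u = "R2 - l2"
 note ab = two_hexagons_angle[OF FGH(1,2,4) assms p(1,2)]
 note bc = two_hexagons_angle[OF FGH(2,3,5) assms p(2,3)]
 note ac = two_hexagons_angle[OF FGH(1,3,6) assms p(1,3)]
 have cc: "c \<bullet> c = ?u" "c \<bullet> v = ?u" using two_hexagons_angle(1,2)[OF FGH(3,1) _ assms p(3,1)] FGH by auto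
 have vv: "v \<bullet> v = R2" using inner_E[OF assms] .
 have u: "?u > 0" using ab(1) p(1) by (metis fplane_def inner_gt_zero_iff)
 then have R: "R2 > 0" using l2(3) by simp
 have D: "4 * R2 - l2 > 0" using u R by simp
 \<comment> \<open>The multiple of \<open>v\<close> by \<open>t\<close> is the orthogonal projection
   of \<open>a + b + c\<close> onto the line of \<open>v\<close>.\<close>
 define t where "t = 3 * ?u / R2"
 let ?w = "a + b + c - t *R v"
 have "0 \<le> ?w \<bullet> ?w" by simp
 also have "?w \<bullet> ?w = 3 * ?u + 2 * (a \<bullet> b + b \<bullet> c + a \<bullet> c) - 9 * ?u\<^sup>2 / R2"
 proof -
  have "?w \<bullet> ?w = (a \<bullet> a + b \<bullet> b + c \<bullet> c) + 2 * (a \<bullet> b + b \<bullet> c + a \<bullet> c)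
    - 2 * t * (a \<bullet> v + b \<bullet> v + c \<bullet> v) + t\<^sup>2 * (v \<bullet> v)"
   by (simp add: inner_add inner_diff inner_commute power2_eq_square algebra_simps)
  also have "\<dots> = 3 * ?u + 2 * (a \<bullet> b + b \<bullet> c + a \<bullet> c) - 9 * ?u\<^sup>2 / R2"
  proof -
   have "(u + u + u) + 2 * s - 2 * (3 * u / r) * (u + u + u) + (3 * u / r)\<^sup>2 * r = 3 * u + 2 * s - 9 * u\<^sup>2 / r"
    if "r > 0" for u s r :: real
    using that by (simp add: power2_eq_square field_simps)
   from this[OF R, of ?u] show ?thesis unfolding t_def ab(1,2) bc(1,2) cc vv .
  qed
  finally show ?thesis .
 qed
 finally have "9 * ?u\<^sup>2 \<le> R2 * (3 * ?u + 2 * (a \<bullet> b + b \<bullet> c + a \<bullet> c))"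
  using R by (simp add: field_simps)
 then have "9 * ?u\<^sup>2 * (4 * R2 - l2) \<le> R2 * (3 * ?u + 2 * (a \<bullet> b + b \<bullet> c + a \<bullet> c)) * (4 * R2 - l2)"
  using D by (simp add: mult_right_mono)
 also have "\<dots> = R2 * (3 * ?u * (4 * R2 - l2) + 2 * ((a \<bullet> b) * (4 * R2 - l2) + (b \<bullet> c) * (4 * R2 - l2) + (a \<bullet> c) * (4 * R2 - l2)))"
  by (simp add: algebra_simps)
 also have "\<dots> \<le> R2 * (3 * ?u * (4 * R2 - l2) + 2 * (?u * (4 * R2 - 7 * l2) + ?u * (4 * R2 - 7 * l2) + ?u * (4 * R2 - 7 * l2)))"
  using ab(3) bc(3) ac(3) R by (intro mult_left_mono add_mono order_refl) auto
 finally have "?u * (9 * ?u * (4 * R2 - l2)) \<le> ?u * (R2 * (3 * (4 * R2 - l2) + 6 * (4 * R2 - 7 * l2)))"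
  by (simp add: power2_eq_square algebra_simps)
 then have "9 * ?u * (4 * R2 - l2) \<le> R2 * (3 * (4 * R2 - l2) + 6 * (4 * R2 - 7 * l2))"
  using u by (simp only: mult_le_cancel_left_pos)
 then have "9 * l2 * l2 \<le> 0" by (simp add: algebra_simps)
 then show False using l2(3) by (simp add: mult_le_0_iff)
qed

text \<open>From \<open>48 = 2 * 24\<close> there are twice as many hexagons as squares at a vertex;
  with at most 2 hexagons and at least one square this leaves 2 and 1.\<close>

lemma vertex_figure:
 assumes "v \<in> E" shows "card (hexes v) = 2" "card (squares v) = 1"
proof -
 have "card E > 0" using finite_E assms by (metis card_gt_0_iff empty_iff)
 have "card E * card (hexes v) = card E * (2 * card (squares v))" using incidences[OF assms] by linarith
 then have "card (hexes v) = 2 * card (squares v)" using \<open>card E > 0\<close> by simp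
 moreover have "card (squares v) \<noteq> 0"
 proof
  assume "card (squares v) = 0"
  then show False using incidences(2)[OF assms] by (simp only:)
 qed
 ultimately show "card (hexes v) = 2" "card (squares v) = 1" using hexes_le_2[OF assms] by auto
qed

end

section \<open>Neighbours of a hexagon and their centres\<close>

context archimedean
begin

lemma facets_at_vertex:
 assumes "v \<in> E" "F facet_of A" "v \<in> F" "M facet_of A" "v \<in> M" "N facet_of A" "v \<in> N"
  "F \<noteq> M" "F \<noteq> N" "M \<noteq> N"
 shows "{G. G facet_of A \<and> v \<in> G} = {F, M, N}"
proof -
 have eq: "{G. G facet_of A \<and> v \<in> G} = hexes v \<union> squares v"
  using facets_Hex_Sqr by (auto simp: hexes_def squares_def)
 have "hexes v \<inter> squares v = {}" using Hex_Sqr_disjoint by (auto simp: hexes_def squares_def)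
 then have "card (hexes v \<union> squares v) = 3"
  using vertex_figure[OF assms(1)] finite_Hex finite_Sqr
  by (subst card_Un_disjoint) (auto simp: hexes_def squares_def)
 moreover have "finite {G. G facet_of A \<and> v \<in> G}" using finite_facets by (rule finite_subset[rotated]) auto
 moreover have "{F, M, N} \<subseteq> {G. G facet_of A \<and> v \<in> G}" using assms by blast
 moreover have "card {F, M, N} = 3" using assms by simp
 ultimately show ?thesis using card_subset_eq[of "{G. G facet_of A \<and> v \<in> G}" "{F, M, N}"] eq by metis
qed

lemma hexf_vertices:
 assumes "hexf F c p q"
 shows "c + p \<in> E" "c + p \<in> F" "c + (1/2) *R p + q \<in> E" "c + (1/2) *R p + q \<in> F"
  "c - (1/2) *R p + q \<in> E" "c - (1/2) *R p + q \<in> F" "F facet_of A" "F \<in> Hex"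
 using hexf_points[OF assms] assms by (auto simp: hexagon_points_def hexf_def Hex_def)

text \<open>At the vertex shared by the two edges only one further hexagon and one square are
  present, so the neighbours around a hexagon alternate in type.\<close>

lemma neighbours_differ:
 assumes h: "hexf F c p q" and M: "M facet_of A" "M \<noteq> F" "c + p \<in> M" "c + (1/2) *R p + q \<in> M"
  and N: "N facet_of A" "N \<noteq> F" "c + (1/2) *R p + q \<in> N" "c - (1/2) *R p + q \<in> N"
 shows "M \<noteq> N" "{G. G facet_of A \<and> c + (1/2) *R p + q \<in> G} = {F, M, N}" "M \<in> Hex \<longleftrightarrow> N \<in> Sqr"
proof -
 let ?v = "c + (1/2) *R p + q"
 note hv = hexf_vertices[OF h]
 show MN: "M \<noteq> N" using facet_eq_of_three_vertices[OF h M(1,3,4)] N M by blast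
 show eq: "{G. G facet_of A \<and> ?v \<in> G} = {F, M, N}"
  by (rule facets_at_vertex) (use hv M N MN in auto)
 have Fh: "F \<in> hexes ?v" using hv by (simp add: hexes_def)
 have "card (hexes ?v) = 2" "card (squares ?v) = 1" using vertex_figure hv(3) by auto
 show "M \<in> Hex \<longleftrightarrow> N \<in> Sqr"
 proof
  assume "M \<in> Hex"
  show "N \<in> Sqr"
  proof (rule ccontr)
   assume "N \<notin> Sqr"
   then have "N \<in> Hex" using N(1) facet_cases by blast
   then have "{F, M, N} \<subseteq> hexes ?v" using \<open>M \<in> Hex\<close> Fh M N by (auto simp: hexes_def)
   moreover have "card {F, M, N} = 3" using M N MN by auto
   moreover have "finite (hexes ?v)" using finite_Hex by (simp add: hexes_def)
   ultimately show False using \<open>card (hexes ?v) = 2\<close> card_mono[of "hexes ?v" "{F, M, N}"] by simp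
  qed
 next
  assume "N \<in> Sqr"
  show "M \<in> Hex"
  proof (rule ccontr)
   assume "M \<notin> Hex"
   then have "M \<in> Sqr" using M(1) facet_cases by blast
   then have "{M, N} \<subseteq> squares ?v" using \<open>N \<in> Sqr\<close> M N by (auto simp: squares_def)
   moreover have "card {M, N} = 2" using MN by auto
   moreover have "finite (squares ?v)" using finite_Sqr by (simp add: squares_def)
   ultimately show False using \<open>card (squares ?v) = 1\<close> card_mono[of "squares ?v" "{M, N}"] by simp
  qed
 qed
qed

text \<open>The point \<open>c' + x1 - x0\<close> is the vertex of the neighbouring hexagon that follows
 \<open>x0\<close>, \<open>x1\<close>; it lies on the square at \<open>x1\<close>, and the right angle of that
 square at \<open>x1\<close> fixes the ratio of the edge length to the circumradius.\<close>

lemma neighbour_centres: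
 assumes h: "hexf F c p q" and M: "M facet_of A" "M \<noteq> F" "c + p \<in> M" "c + (1/2) *R p + q \<in> M"
  and N: "N facet_of A" "N \<noteq> F" "c + (1/2) *R p + q \<in> N" "c - (1/2) *R p + q \<in> N"
  and hex: "M \<in> Hex"
 shows "R2 = 5/2 * l2" "fplane M (p + (2/3) *R q + (1/3) *R c)" "fplane N ((2/3) *R c + (4/3) *R q)"
proof -
 note n = hexf_norms[OF h] and hv = hexf_vertices[OF h] and nd = neighbours_differ[OF h M N]
 define x0 x1 x2 where "x0 = c + p" and "x1 = c + (1/2) *R p + q" and "x2 = c - (1/2) *R p + q"
 have xE: "x0 \<in> E" "x1 \<in> E" "x2 \<in> E" "x0 \<in> M" "x1 \<in> M" "x1 \<in> N" "x2 \<in> N" "x0 \<in> F" "x1 \<in> F" "x2 \<in> F"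
  using hv M N by (simp_all add: x0_def x1_def x2_def)
 have ne: "p \<noteq> 0" "q \<noteq> 0" "c \<noteq> 0" using n l2(3) hexf_plane(1)[OF h] by auto
 have d01: "(x0 - x1) \<bullet> (x0 - x1) = l2" and d12: "(x2 - x1) \<bullet> (x2 - x1) = l2"
 proof -
  have e: "x0 - x1 = (1/2) *R p - q" "x2 - x1 = - p" by (simp_all add: x0_def x1_def x2_def vec_eq_iff)
  show "(x0 - x1) \<bullet> (x0 - x1) = l2" "(x2 - x1) \<bullet> (x2 - x1) = l2"
   unfolding e using n by (simp_all add: inner_diff inner_commute)
 qed
 obtain c' q0 where "hexf M c' (x1 - c') q0" using hexf_at[OF hex xE(2,5)] .
 moreover define p' where "p' = x1 - c'"
 ultimately have h0: "hexf M c' p' q0" by simp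
 have x1': "x1 = c' + p'" by (simp add: p'_def)
 have "\<exists>q'. hexf M c' p' q' \<and> x0 = c' + (1/2) *R p' - q'"
 proof -
  note n0 = hexf_norms[OF h0]
  have "x0 \<in> hexagon_points c' p' q0" using hexf_points[OF h0] xE by blast
  then consider "x0 = c' + p'" | "x0 = c' + (1/2) *R p' + q0" | "x0 = c' - (1/2) *R p' + q0" | "x0 = c' - p'"
   | "x0 = c' - (1/2) *R p' - q0" | "x0 = c' + (1/2) *R p' - q0"
   by (auto simp: hexagon_points_def)
  then show ?thesis
  proof cases
   case 1
   then have "x0 - x1 = 0" using x1' by simp
   then show ?thesis using d01 l2(3) by simp
  next
   case 2
   then show ?thesis using hexf_reflect[OF h0] by (intro exI[of _ "- q0"]) simp
  next
   case 3
   then have "x0 - x1 = q0 - (3/2) *R p'" using x1' by (simp add: vec_eq_iff)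
   then have "(x0 - x1) \<bullet> (x0 - x1) = 3 * l2" using n0 by (simp add: inner_diff inner_commute)
   then show ?thesis using d01 l2(3) by simp
  next
   case 4
   then have "x0 - x1 = - (2 *R p')" using x1' by (simp add: vec_eq_iff)
   then have "(x0 - x1) \<bullet> (x0 - x1) = 4 * l2" using n0 by simp
   then show ?thesis using d01 l2(3) by simp
  next
   case 5
   then have "x0 - x1 = - q0 - (3/2) *R p'" using x1' by (simp add: vec_eq_iff)
   then have "(x0 - x1) \<bullet> (x0 - x1) = 3 * l2" using n0 by (simp add: inner_diff inner_commute)
   then show ?thesis using d01 l2(3) by simp
  next
   case 6
   then show ?thesis using h0 by blast
  qed
 qed
 then obtain q' where h': "hexf M c' p' q'" and x0': "x0 = c' + (1/2) *R p' - q'" by blast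
 define y where "y = c' + (1/2) *R p' + q'"
 have y: "y = c' + x1 - x0" unfolding y_def x0' x1' by (simp add: vec_eq_iff)
 have yM: "y \<in> M" "y \<in> E" using hexf_vertices[OF h'] by (simp_all add: y_def)
 have "closed_segment x1 y edge_of M"
  using hexagon_edge[of c' p' q'] h' unfolding hexf_def x1' y_def by metis
 \<comment> \<open>The facet beyond the edge from \<open>x1\<close> to \<open>y\<close> of
   \<open>M\<close> contains \<open>x1\<close>; it is neither \<open>M\<close> nor \<open>F\<close>,
   which leaves \<open>N\<close>.\<close>
 then obtain G where G: "G facet_of A" "G \<noteq> M" "x1 \<in> G" "y \<in> G"
  using facet_through_edge[OF M(1)] by blast
 have yF: "y \<notin> F"
 proof
  assume "y \<in> F"
  let ?P = "(1/2) *R p' + q'" and ?Q = "- ((1/2) *R q' - (3/4) *R p')"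
  have hr: "hexf M c' ?P ?Q" using hexf_reflect[OF hexf_rotate[OF h']] .
  have "c' + ?P = y" "c' + (1/2) *R ?P + ?Q = x1" "c' - (1/2) *R ?P + ?Q = x0"
   unfolding x0' x1' y_def by (simp_all add: vec_eq_iff field_simps)
  then have "F = M" using facet_eq_of_three_vertices[OF hr hv(7)] \<open>y \<in> F\<close> xE by simp
  then show False using M(2) by simp
 qed
 have "G \<in> {F, M, N}" using nd(2) G(1,3) unfolding x1_def by blast
 then have "G = N" using G yF by blast
 then have yN: "y \<in> N" using G by simp
 have Nsq: "N \<in> Sqr" using nd(3) hex by simp
 obtain c'' q'' where "sqrf N c'' (x1 - c'') q''" using sqrf_at[OF Nsq xE(2,6)] .
 moreover define p'' where "p'' = x1 - c''"
 ultimately have s: "sqrf N c'' p'' q''" by simp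
 have x1'': "x1 = c'' + p''" by (simp add: p''_def)
 have ns: "2 * (p'' \<bullet> p'') = l2" "q'' \<bullet> q'' = p'' \<bullet> p''" "p'' \<bullet> q'' = 0"
  using l2(2)[OF s] s by (auto simp: sqrf_def square_frame_def)
 have dy: "(y - x1) \<bullet> (y - x1) = l2"
 proof -
  have "y - x1 = q' - (1/2) *R p'" unfolding y_def x1' by (simp add: vec_eq_iff)
  then show ?thesis using hexf_norms[OF h'] by (simp add: inner_diff inner_commute)
 qed
 have adj: "z = c'' + q'' \<or> z = c'' - q''" if z: "z \<in> N" "z \<in> E" "(z - x1) \<bullet> (z - x1) = l2" for z
 proof -
  have "z \<in> square_points c'' p'' q''" using sqrf_points[OF s] z by blast
  then consider "z = c'' + p''" | "z = c'' + q''" | "z = c'' - p''" | "z = c'' - q''"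
   by (auto simp: square_points_def)
  then show ?thesis
  proof cases
   case 1
   then show ?thesis using z(3) x1'' l2(3) by simp
  next
   case 3
   then have "z - x1 = - (2 *R p'')" using x1'' by (simp add: vec_eq_iff)
   then have "(z - x1) \<bullet> (z - x1) = 2 * l2" using ns(1) by simp
   then show ?thesis using z(3) l2(3) by simp
  qed auto
 qed
 have "y \<noteq> x2" using yF xE by blast
 \<comment> \<open>\<open>y\<close> and \<open>x2\<close> are the two corners next to
   \<open>x1\<close> in the square, hence opposite to each other: their sum is twice the centre, and
   the angle at \<open>x1\<close> is right.\<close>
 then have "(y = c'' + q'' \<and> x2 = c'' - q'') \<or> (y = c'' - q'' \<and> x2 = c'' + q'')"
  using adj[OF yN yM(2) dy] adj[OF xE(7,3) d12] by blast
 then have "y + x2 = 2 *R c'' \<and> (x2 - x1) \<bullet> (y - x1) = 0"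
  unfolding x1'' by (elim disjE) (use ns in \<open>auto simp: scaleR_2 inner_diff inner_add inner_commute\<close>)
 then have c'': "y + x2 = 2 *R c''" and perp: "(x2 - x1) \<bullet> (y - x1) = 0" by auto
 have "x2 - x1 = - p" "y - x1 = c' - c - p" unfolding y by (simp_all add: x0_def x1_def x2_def vec_eq_iff)
 then have cp: "c' \<bullet> p = l2" using perp n by (simp add: inner_diff inner_commute)
 obtain \<alpha> \<beta> \<gamma> where d: "c' = \<alpha> *R p + \<beta> *R q + \<gamma> *R c"
  using orthogonal_three_decompose[OF ne n(3,4,5)] by blast
 let ?u = "R2 - l2"
 have qp: "q \<bullet> p = 0" "p \<bullet> c = 0" "q \<bullet> c = 0" using n by (simp_all add: inner_commute)
 have co: "c' \<bullet> p = \<alpha> * l2" "c' \<bullet> q = \<beta> * (3/4 * l2)" "c' \<bullet> c = \<gamma> * ?u"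
  unfolding d inner_add_left inner_scaleR_left n qp by simp_all
 have a1: "\<alpha> = 1" using co(1) cp l2(3) by simp
 have uM: "c' \<bullet> c' = ?u" using hexf_norms(6)[OF h'] .
 have "c' \<bullet> x0 = ?u" "c' \<bullet> x1 = ?u"
  using hexf_fplane[OF h'] xE uM by (auto simp: fplane_def)
 then have e1: "\<gamma> * ?u + l2 = ?u" and e2: "\<gamma> * ?u + l2 / 2 + \<beta> * (3/4 * l2) = ?u"
  using co a1 by (simp_all add: x0_def x1_def inner_add_right)
 have "\<beta> * (3/4 * l2) = l2 / 2" using e1 e2 by linarith
 then have b1: "\<beta> = 2/3" using l2(3) by (simp add: field_simps)
 have "c' \<bullet> c' = \<alpha> * (c' \<bullet> p) + \<beta> * (c' \<bullet> q) + \<gamma> * (c' \<bullet> c)"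
  by (subst (2) d) (simp add: inner_add_right)
 \<comment> \<open>\<open>e1\<close> says that \<open>x0\<close> lies in the plane of
   \<open>M\<close>, and \<open>e3\<close> that \<open>c'\<close> has squared norm
   \<open>R2 - l2\<close>; together they fix \<open>\<gamma>\<close> and the ratio of
   \<open>R2\<close> to \<open>l2\<close>.\<close>
 then have e3: "?u = 4/3 * l2 + \<gamma> * (\<gamma> * ?u)" unfolding uM co a1 b1 by simp
 have "\<gamma> * ?u = ?u - l2" using e1 by simp
 then have "\<gamma> * (\<gamma> * ?u) = \<gamma> * ?u - \<gamma> * l2" by (metis right_diff_distrib)
 then have "\<gamma> * l2 = (1/3) * l2" using e1 e3 by linarith
 then have g1: "\<gamma> = 1/3" using l2(3) by simp
 show R: "R2 = 5/2 * l2" using e1 g1 by (simp add: field_simps)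
 have "c' = p + (2/3) *R q + (1/3) *R c" using d a1 b1 g1 by simp
 then show "fplane M (p + (2/3) *R q + (1/3) *R c)" using hexf_fplane[OF h'] by simp
 have "2 *R c'' = 2 *R ((2/3) *R c + (4/3) *R q)"
  unfolding c''[symmetric] y d a1 b1 g1 by (simp add: x0_def x1_def x2_def vec_eq_iff)
 then have "c'' = (2/3) *R c + (4/3) *R q" by simp
 then show "fplane N ((2/3) *R c + (4/3) *R q)" using sqrf_fplane[OF s] by simp
qed

lemma neighbour_exists:
 assumes "hexf F c p q"
 obtains M where "M facet_of A" "M \<noteq> F" "c + p \<in> M" "c + (1/2) *R p + q \<in> M"
proof -
 have "closed_segment (c + p) (c + (1/2) *R p + q) edge_of F"
  using hexagon_edge[of c p q] assms unfolding hexf_def by metis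
 then show ?thesis using facet_through_edge[OF hexf_vertices(7)[OF assms]] that by blast
qed

lemma fplane_uminus: "fplane F c \<Longrightarrow> fplane (uminus ` F) (- c)"
proof -
 assume f: "fplane F c"
 have lin: "linear (uminus :: real^3 \<Rightarrow> real^3)" "inj (uminus :: real^3 \<Rightarrow> real^3)"
  by (simp_all add: linear_uminus)
 have FA: "F facet_of A" using f unfolding fplane_def by blast
 then have "uminus ` F face_of uminus ` A"
  using lin by (simp only: face_of_linear_image facet_of_imp_face_of)
 moreover have "aff_dim (uminus ` F) = aff_dim F"
  by (simp add: aff_dim_injective_linear_image linear_uminus)
 ultimately have "uminus ` F facet_of A" using FA sym by (auto simp: facet_of_def)
 moreover have "uminus ` F = A \<inter> {x. - c \<bullet> x = - c \<bullet> - c}"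
 proof
  show "uminus ` F \<subseteq> A \<inter> {x. - c \<bullet> x = - c \<bullet> - c}" using f uminus_A by (auto simp: fplane_def)
  show "A \<inter> {x. - c \<bullet> x = - c \<bullet> - c} \<subseteq> uminus ` F"
  proof
   fix x assume "x \<in> A \<inter> {x. - c \<bullet> x = - c \<bullet> - c}"
   then have "- x \<in> F" using f uminus_A by (auto simp: fplane_def)
   then show "x \<in> uminus ` F" by (metis add.inverse_inverse image_eqI)
  qed
 qed
 moreover have "A \<subseteq> {x. - c \<bullet> x \<le> - c \<bullet> - c}"
 proof
  fix x assume "x \<in> A"
  then have "- x \<in> A" by (rule uminus_A)
  then have "c \<bullet> (- x) \<le> c \<bullet> c" using f unfolding fplane_def by blast
  then show "x \<in> {x. - c \<bullet> x \<le> - c \<bullet> - c}" by simp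
 qed
 ultimately show ?thesis using f by (simp add: fplane_def)
qed

text \<open>Different centres give different facets, so 14 centres account for all facets, and a
  point outside \<open>A\<close> violates the inequality of some facet.\<close>

lemma A_eq_halfspaces:
 assumes "finite C" "card C = 14" "\<And>c. c \<in> C \<Longrightarrow> \<exists>F. fplane F c"
 shows "A = {x. \<forall>c\<in>C. c \<bullet> x \<le> c \<bullet> c}"
proof
 show "A \<subseteq> {x. \<forall>c\<in>C. c \<bullet> x \<le> c \<bullet> c}" using assms(3) by (fastforce simp: fplane_def)
 have "\<exists>\<phi>. \<forall>c\<in>C. fplane (\<phi> c) c" using assms(3) by metis
 then obtain \<phi> where \<phi>: "\<And>c. c \<in> C \<Longrightarrow> fplane (\<phi> c) c" by blast
 have norm1: "\<phi> c \<subseteq> {x. ((1 / (c \<bullet> c)) *R c) \<bullet> x = 1}" if "c \<in> C" for c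
  using \<phi>[OF that] by (auto simp: fplane_def)
 have inv: "(1 / (c \<bullet> c)) *R c = (1 / (d \<bullet> d)) *R d \<Longrightarrow> c \<noteq> 0 \<Longrightarrow> d \<noteq> 0 \<Longrightarrow> c = d" for c d :: "real^3"
 proof -
  assume e: "(1 / (c \<bullet> c)) *R c = (1 / (d \<bullet> d)) *R d" and ne: "c \<noteq> 0" "d \<noteq> 0"
  then have "((1 / (c \<bullet> c)) *R c) \<bullet> ((1 / (c \<bullet> c)) *R c) = ((1 / (d \<bullet> d)) *R d) \<bullet> ((1 / (d \<bullet> d)) *R d)" by simp
  then have "1 / (c \<bullet> c) = 1 / (d \<bullet> d)" using ne by (simp add: field_simps)
  then show "c = d" using e ne by simp
 qed
 have inj: "inj_on \<phi> C"
 proof (rule inj_onI)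
  fix c d assume cd: "c \<in> C" "d \<in> C" "\<phi> c = \<phi> d"
  have "\<phi> c facet_of A" using \<phi>[OF cd(1)] unfolding fplane_def by blast
  moreover have "\<phi> c \<subseteq> {x. ((1 / (d \<bullet> d)) *R d) \<bullet> x = 1}" using norm1[OF cd(2)] cd(3) by (simp only:)
  ultimately have "(1 / (c \<bullet> c)) *R c = (1 / (d \<bullet> d)) *R d"
   using facet_normal_unique[OF _ int_ne norm1[OF cd(1)]] by blast
  moreover have "c \<noteq> 0" "d \<noteq> 0" using \<phi> cd(1,2) unfolding fplane_def by blast+
  ultimately show "c = d" by (rule inv)
 qed
 have "\<phi> ` C = {F. F facet_of A}"
 proof (rule card_subset_eq[OF finite_facets])
  show "\<phi> ` C \<subseteq> {F. F facet_of A}" using \<phi> unfolding fplane_def by blast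
  show "card (\<phi> ` C) = card {F. F facet_of A}"
   using card_image[OF inj] assms(2) arch by (simp add: archimedean_truncated_octahedron_def)
 qed
 then have all: "\<exists>c\<in>C. F = \<phi> c" if "F facet_of A" for F using that by blast
 show "{x. \<forall>c\<in>C. c \<bullet> x \<le> c \<bullet> c} \<subseteq> A"
 proof (rule subsetI, rule ccontr)
  fix x assume x: "x \<in> {x. \<forall>c\<in>C. c \<bullet> x \<le> c \<bullet> c}" "x \<notin> A"
  obtain a where a: "A \<subseteq> {y. a \<bullet> y \<le> 1}" "(A \<inter> {y. a \<bullet> y = 1}) facet_of A" "a \<bullet> x > 1"
   using not_mem_polyhedron_facet[OF polyhedron_A zero_int x(2)] by blast
  obtain c where c: "c \<in> C" "A \<inter> {y. a \<bullet> y = 1} = \<phi> c" using all[OF a(2)] by blast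
  have "a = (1 / (c \<bullet> c)) *R c"
   using facet_normal_unique[OF a(2) int_ne, of a "(1 / (c \<bullet> c)) *R c"] norm1[OF c(1)] c(2) by blast
  moreover have "c \<bullet> c > 0" using \<phi>[OF c(1)] by (simp add: fplane_def)
  moreover have "c \<bullet> x \<le> c \<bullet> c" using x(1) c(1) by blast
  ultimately show False using a(3) by (simp add: field_simps)
 qed
qed

end

text \<open>The four vectors point to the vertices of a regular tetrahedron and generate a
  body-centred cubic lattice. The seven vectors in the last clause represent the pairs of opposite
  facets, each being twice a facet centre.\<close>

definition to_shape :: "(real^3) set \<Rightarrow> real \<Rightarrow> real^3 \<Rightarrow> real^3 \<Rightarrow> real^3 \<Rightarrow> real^3 \<Rightarrow> bool" where
 "to_shape A k v0 v1 v2 v3 \<longleftrightarrow> k > 0 \<and> v0 + v1 + v2 + v3 = 0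
   \<and> v0 \<bullet> v0 = 3 * k \<and> v1 \<bullet> v1 = 3 * k \<and> v2 \<bullet> v2 = 3 * k \<and> v3 \<bullet> v3 = 3 * k
   \<and> v0 \<bullet> v1 = - k \<and> v0 \<bullet> v2 = - k \<and> v0 \<bullet> v3 = - k \<and> v1 \<bullet> v2 = - k \<and> v1 \<bullet> v3 = - k \<and> v2 \<bullet> v3 = - k
   \<and> A = {x. \<forall>v\<in>{v0, v1, v2, v3, v0 + v1, v0 + v2, v0 + v3}. \<bar>v \<bullet> x\<bar> \<le> v \<bullet> v / 2}"

context archimedean
begin

text \<open>Around a hexagon \<open>F\<close>, hexagons and squares alternate. A frame whose first
  edge borders a hexagon is turned twice by 120 degrees, which gives the centres of all six
  neighbours; with \<open>F\<close> and the opposite facets these are all 14.\<close>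

lemma classification:
 obtains v0 v1 v2 v3 where "to_shape A (2 * l2) v0 v1 v2 v3"
proof -
 obtain F where "F \<in> Hex" using card_Hex by fastforce
 then obtain c pa qa where ha: "hexf F c pa qa" by (rule hexf_exists)
 obtain M0 where M0: "M0 facet_of A" "M0 \<noteq> F" "c + pa \<in> M0" "c + (1/2) *R pa + qa \<in> M0"
  using neighbour_exists[OF ha] .
 have "\<exists>p q M. hexf F c p q \<and> M facet_of A \<and> M \<noteq> F \<and> c + p \<in> M \<and> c + (1/2) *R p + q \<in> M \<and> M \<in> Hex"
 proof (cases "M0 \<in> Hex")
  case True
  then show ?thesis using ha M0 by blast
 next
  case False
  have hb: "hexf F c pa (- qa)" using hexf_reflect[OF ha] .
  \<comment> \<open>The reflected and turned frame makes the preceding edge, from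
    \<open>c + ?p\<close> to \<open>c + pa\<close>, the first one; its neighbour is a hexagon if
    \<open>M0\<close> is a square.\<close>
  let ?p = "(1/2) *R pa + (- qa)" and ?q = "(1/2) *R (- qa) - (3/4) *R pa"
  have hc: "hexf F c ?p (- ?q)" using hexf_reflect[OF hexf_rotate[OF hb]] .
  obtain M where M: "M facet_of A" "M \<noteq> F" "c + ?p \<in> M" "c + (1/2) *R ?p + (- ?q) \<in> M"
   using neighbour_exists[OF hc] .
  have e: "c + (1/2) *R ?p + (- ?q) = c + pa" "c - (1/2) *R ?p + (- ?q) = c + (1/2) *R pa + qa"
   by (simp_all add: vec_eq_iff field_simps)
  have "M \<in> Hex \<longleftrightarrow> M0 \<in> Sqr"
   using neighbours_differ(3)[OF hc M M0(1,2)] M0(3,4) unfolding e by blast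
  moreover have "M0 \<in> Sqr" using False M0(1) facet_cases by blast
  ultimately show ?thesis using hc M by blast
 qed
 then obtain p q M where h: "hexf F c p q" and M: "M facet_of A" "M \<noteq> F" "c + p \<in> M" "c + (1/2) *R p + q \<in> M"
  and Mh: "M \<in> Hex" by blast
 define rot where "rot = (\<lambda>(p::real^3, q). ((1/2) *R p + q, (1/2) *R q - (3/4) *R p))"
 have step: "\<exists>N' N. fplane M' (p' + (2/3) *R q' + (1/3) *R c) \<and> fplane N' ((2/3) *R c + (4/3) *R q')
   \<and> N facet_of A \<and> N \<noteq> F \<and> c - (1/2) *R p' + q' \<in> N \<and> c - p' \<in> N \<and> N \<in> Hex \<and> R2 = 5/2 * l2"
  if h': "hexf F c p' q'" and M': "M' facet_of A" "M' \<noteq> F" "c + p' \<in> M'" "c + (1/2) *R p' + q' \<in> M'" and hex: "M' \<in> Hex"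
  for p' q' M'
 proof -
  let ?p = "(1/2) *R p' + q'" and ?q = "(1/2) *R q' - (3/4) *R p'"
  have h1: "hexf F c ?p ?q" using hexf_rotate[OF h'] .
  have e: "c + ?p = c + (1/2) *R p' + q'" "c + (1/2) *R ?p + ?q = c - (1/2) *R p' + q'" "c - (1/2) *R ?p + ?q = c - p'"
   by (simp_all add: vec_eq_iff field_simps)
  obtain N' where N': "N' facet_of A" "N' \<noteq> F" "c + ?p \<in> N'" "c + (1/2) *R ?p + ?q \<in> N'"
   using neighbour_exists[OF h1] .
  let ?p2 = "(1/2) *R ?p + ?q" and ?q2 = "(1/2) *R ?q - (3/4) *R ?p"
  have h2: "hexf F c ?p2 ?q2" using hexf_rotate[OF h1] .
  have e2: "c + ?p2 = c - (1/2) *R p' + q'" "c + (1/2) *R ?p2 + ?q2 = c - p'"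
   by (simp_all add: vec_eq_iff field_simps)
  obtain N where N: "N facet_of A" "N \<noteq> F" "c + ?p2 \<in> N" "c + (1/2) *R ?p2 + ?q2 \<in> N"
   using neighbour_exists[OF h2] .
  have N'2: "c + (1/2) *R p' + q' \<in> N'" "c - (1/2) *R p' + q' \<in> N'" using N'(3,4) unfolding e .
  have N2: "c - (1/2) *R p' + q' \<in> N" "c - p' \<in> N" using N(3,4) unfolding e2 .
  note centres = neighbour_centres[OF h' M' N'(1,2) N'2 hex]
  have "N' \<in> Sqr" using neighbours_differ(3)[OF h' M' N'(1,2) N'2] hex by blast
  then have "N' \<notin> Hex" using Hex_Sqr_disjoint by blast
  moreover have "N' \<in> Hex \<longleftrightarrow> N \<in> Sqr"
   using neighbours_differ(3)[OF h1 N' N(1,2)] N2 unfolding e by blast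
  ultimately have "N \<in> Hex" using N(1) facet_cases by blast
  then show ?thesis using centres N N2 by blast
 qed
 let ?p2 = "- (1/2) *R p + q" and ?q2 = "- (3/4) *R p - (1/2) *R q"
 let ?p4 = "- (1/2) *R p - q" and ?q4 = "(3/4) *R p - (1/2) *R q"
 have rot2: "hexf F c (- (1/2) *R p' + q') (- (3/4) *R p' - (1/2) *R q')" if "hexf F c p' q'" for p' q'
 proof -
  have "(1/2) *R ((1/2) *R p' + q') + ((1/2) *R q' - (3/4) *R p') = - (1/2) *R p' + q'"
   "(1/2) *R ((1/2) *R q' - (3/4) *R p') - (3/4) *R ((1/2) *R p' + q') = - (3/4) *R p' - (1/2) *R q'"
   by (simp_all add: vec_eq_iff field_simps)
  then show ?thesis using hexf_rotate[OF hexf_rotate[OF that]] by simp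
 qed
 have h2: "hexf F c ?p2 ?q2" using rot2[OF h] .
 have "- (1/2) *R ?p2 + ?q2 = ?p4" "- (3/4) *R ?p2 - (1/2) *R ?q2 = ?q4"
  by (simp_all add: vec_eq_iff field_simps)
 then have h4: "hexf F c ?p4 ?q4" using rot2[OF h2] by simp
 obtain N1 M2 where s1: "fplane M (p + (2/3) *R q + (1/3) *R c)" "fplane N1 ((2/3) *R c + (4/3) *R q)"
   "M2 facet_of A" "M2 \<noteq> F" "c - (1/2) *R p + q \<in> M2" "c - p \<in> M2" "M2 \<in> Hex" "R2 = 5/2 * l2"
  using step[OF h M Mh] by blast
 have "c + ?p2 \<in> M2" "c + (1/2) *R ?p2 + ?q2 \<in> M2"
 proof -
  have "c + ?p2 = c - (1/2) *R p + q" "c + (1/2) *R ?p2 + ?q2 = c - p" by (simp_all add: vec_eq_iff field_simps)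
  then show "c + ?p2 \<in> M2" "c + (1/2) *R ?p2 + ?q2 \<in> M2" using s1(5,6) by (simp_all only:)
 qed
 then obtain N3 M4 where s2: "fplane M2 (?p2 + (2/3) *R ?q2 + (1/3) *R c)" "fplane N3 ((2/3) *R c + (4/3) *R ?q2)"
   "M4 facet_of A" "M4 \<noteq> F" "c - (1/2) *R ?p2 + ?q2 \<in> M4" "c - ?p2 \<in> M4" "M4 \<in> Hex"
  using step[OF h2 s1(3,4)] s1(7) by blast
 have "c + ?p4 \<in> M4" "c + (1/2) *R ?p4 + ?q4 \<in> M4"
 proof -
  have "c + ?p4 = c - (1/2) *R ?p2 + ?q2" "c + (1/2) *R ?p4 + ?q4 = c - ?p2" by (simp_all add: vec_eq_iff field_simps)
  then show "c + ?p4 \<in> M4" "c + (1/2) *R ?p4 + ?q4 \<in> M4" using s2(5,6) by (simp_all only:)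
 qed
 then obtain N5 where s3: "fplane M4 (?p4 + (2/3) *R ?q4 + (1/3) *R c)" "fplane N5 ((2/3) *R c + (4/3) *R ?q4)"
  using step[OF h4 s2(3,4)] s2(7) by blast
 note n = hexf_norms[OF h]
 have cc: "c \<bullet> c = 3/2 * l2" using n(6) s1(8) by simp
 have sy: "q \<bullet> p = 0" "p \<bullet> c = 0" "q \<bullet> c = 0" using n by (simp_all add: inner_commute)
 \<comment> \<open>Twice the centres of three neighbouring hexagons and, with reversed sign, of
   \<open>F\<close>, so that the sum is 0.\<close>
 define v0 v1 v2 v3 where "v0 = - 2 *R c" and "v1 = 2 *R p + (4/3) *R q + (2/3) *R c"
  and "v2 = - 2 *R p + (4/3) *R q + (2/3) *R c" and "v3 = - (8/3) *R q + (2/3) *R c"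
 note vdefs = v0_def v1_def v2_def v3_def
 have planes: "fplane M ((1/2) *R v1)" "fplane M2 ((1/2) *R v2)" "fplane M4 ((1/2) *R v3)"
  "fplane N1 ((1/2) *R (v1 + v2))" "fplane N3 ((1/2) *R (v2 + v3))" "fplane N5 ((1/2) *R (v1 + v3))"
  "fplane F ((1/2) *R (- v0))"
 proof -
  have e: "p + (2/3) *R q + (1/3) *R c = (1/2) *R v1" "?p2 + (2/3) *R ?q2 + (1/3) *R c = (1/2) *R v2"
   "?p4 + (2/3) *R ?q4 + (1/3) *R c = (1/2) *R v3" "(2/3) *R c + (4/3) *R q = (1/2) *R (v1 + v2)"
   "(2/3) *R c + (4/3) *R ?q2 = (1/2) *R (v2 + v3)" "(2/3) *R c + (4/3) *R ?q4 = (1/2) *R (v1 + v3)" "c = (1/2) *R (- v0)"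
   unfolding vdefs by (simp_all add: vec_eq_iff field_simps)
  show "fplane M ((1/2) *R v1)" using s1(1) unfolding e(1) .
  show "fplane M2 ((1/2) *R v2)" using s2(1) unfolding e(2) .
  show "fplane M4 ((1/2) *R v3)" using s3(1) unfolding e(3) .
  show "fplane N1 ((1/2) *R (v1 + v2))" using s1(2) unfolding e(4) .
  show "fplane N3 ((1/2) *R (v2 + v3))" using s2(2) unfolding e(5) .
  show "fplane N5 ((1/2) *R (v1 + v3))" using s3(2) unfolding e(6) .
  show "fplane F ((1/2) *R (- v0))" using hexf_fplane[OF h] e(7) by simp
 qed
 have sum0: "v0 + v1 + v2 + v3 = 0" unfolding vdefs by (simp add: vec_eq_iff field_simps)
 have ips: "v0 \<bullet> v0 = 6 * l2" "v1 \<bullet> v1 = 6 * l2" "v2 \<bullet> v2 = 6 * l2" "v3 \<bullet> v3 = 6 * l2"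
  "v0 \<bullet> v1 = - 2 * l2" "v0 \<bullet> v2 = - 2 * l2" "v0 \<bullet> v3 = - 2 * l2" "v1 \<bullet> v2 = - 2 * l2" "v1 \<bullet> v3 = - 2 * l2" "v2 \<bullet> v3 = - 2 * l2"
  unfolding vdefs by (simp_all add: inner_add_left inner_add_right inner_diff_left inner_diff_right n(1-5) sy cc field_simps)
 have e12: "v1 + v2 = - (v0 + v3)" "v2 + v3 = - (v0 + v1)" "v1 + v3 = - (v0 + v2)"
  using sum0 by (simp_all add: eq_neg_iff_add_eq_0 algebra_simps)
 define W where "W = {v0, v1, v2, v3, v0 + v1, v0 + v2, v0 + v3}"
 let ?C = "(\<lambda>v. (1/2) *R v) ` (W \<union> uminus ` W)"
 have sub_ip: "x \<noteq> y" if "x \<bullet> w \<noteq> y \<bullet> w" for x y w :: "real^3" using that by auto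
 have comm: "v1 \<bullet> v0 = - 2 * l2" "v2 \<bullet> v0 = - 2 * l2" "v3 \<bullet> v0 = - 2 * l2" "v2 \<bullet> v1 = - 2 * l2" "v3 \<bullet> v1 = - 2 * l2" "v3 \<bullet> v2 = - 2 * l2"
  using ips by (simp_all add: inner_commute)
 have cW: "card (W \<union> uminus ` W) = 14"
 proof -
  \<comment> \<open>Inner products with three of the vectors tell the 14 vectors apart.\<close>
  define \<phi> where "\<phi> v = (v \<bullet> v0 / (2 * l2), v \<bullet> v1 / (2 * l2), v \<bullet> v2 / (2 * l2))" for v
  have img: "\<phi> v0 = (3, -1, -1)" "\<phi> v1 = (-1, 3, -1)" "\<phi> v2 = (-1, -1, 3)" "\<phi> v3 = (-1, -1, -1)"
   "\<phi> (v0 + v1) = (2, 2, -2)" "\<phi> (v0 + v2) = (2, -2, 2)" "\<phi> (v0 + v3) = (2, -2, -2)"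
   using l2(3) by (simp_all add: \<phi>_def inner_add_left ips comm)
  have imgn: "\<phi> (- v) = (- fst (\<phi> v), - fst (snd (\<phi> v)), - snd (snd (\<phi> v)))" for v
   by (simp add: \<phi>_def)
  have "\<phi> ` (W \<union> uminus ` W) = {(3, -1, -1), (-1, 3, -1), (-1, -1, 3), (-1, -1, -1), (2, 2, -2), (2, -2, 2), (2, -2, -2),
    (-3, 1, 1), (1, -3, 1), (1, 1, -3), (1, 1, 1), (-2, -2, 2), (-2, 2, -2), (-2, 2, 2)}"
   unfolding W_def image_Un image_insert image_empty imgn img by auto
  then have "card (\<phi> ` (W \<union> uminus ` W)) = 14" by simp
  moreover have "finite (W \<union> uminus ` W)" by (simp add: W_def)
  moreover have "card (W \<union> uminus ` W) \<le> 14"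
  proof -
   have "card W \<le> 7" by (simp add: W_def card_insert_le_m1)
   moreover have "card (uminus ` W) \<le> card W" by (rule card_image_le) (simp add: W_def)
   ultimately show ?thesis using card_Un_le[of W "uminus ` W"] by linarith
  qed
  ultimately show ?thesis using card_image_le[of "W \<union> uminus ` W" \<phi>] by linarith
 qed
 have "A = {x. \<forall>c\<in>?C. c \<bullet> x \<le> c \<bullet> c}"
 proof (rule A_eq_halfspaces)
  show "finite ?C" by (simp add: W_def)
  show "card ?C = 14" using cW by (subst card_image) (auto simp: inj_on_def)
  fix d assume "d \<in> ?C"
  have neg: "\<exists>F. fplane F ((1/2) *R (- v))" if "fplane G ((1/2) *R v)" for G v
   using fplane_uminus[OF that] by (metis scaleR_minus_right)
  have pos: "\<exists>F. fplane F ((1/2) *R v)" if "fplane G ((1/2) *R (- v))" for G v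
   using neg[OF that] by simp
  have p12: "fplane N1 ((1/2) *R (- (v0 + v3)))" "fplane N3 ((1/2) *R (- (v0 + v1)))" "fplane N5 ((1/2) *R (- (v0 + v2)))"
   using planes(4,5,6) unfolding e12 by auto
  have "\<exists>F. fplane F ((1/2) *R v)" "\<exists>F. fplane F ((1/2) *R (- v))" if "v \<in> W" for v
   using that planes p12 neg pos unfolding W_def by blast+
  then show "\<exists>F. fplane F d" using \<open>d \<in> ?C\<close> by blast
 qed
 also have "\<dots> = {x. \<forall>v\<in>W. \<bar>v \<bullet> x\<bar> \<le> v \<bullet> v / 2}"
 proof -
  have "(\<forall>c\<in>?C. c \<bullet> x \<le> c \<bullet> c) \<longleftrightarrow> (\<forall>v\<in>W. v \<bullet> x \<le> v \<bullet> v / 2 \<and> - (v \<bullet> x) \<le> v \<bullet> v / 2)" for x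
   by (simp add: ball_Un ball_conj_distrib field_simps)
  then show ?thesis by (simp only: abs_le_iff)
 qed
 finally have "to_shape A (2 * l2) v0 v1 v2 v3"
  using l2(3) sum0 ips unfolding to_shape_def W_def by simp
 then show ?thesis by (rule that)
qed

end

section \<open>Planar areas\<close>

lemma distance_preserving_affine:
 fixes f :: "'a::real_inner \<Rightarrow> 'b::real_inner"
 assumes "distance_preserving f"
 obtains g where "linear g" "\<And>x y. g x \<bullet> g y = x \<bullet> y" "\<And>x. f x = f 0 + g x"
proof -
 define g where "g x = f x - f 0" for x
 have n: "norm (g x) = norm x" "norm (g x - g y) = norm (x - y)" for x y
  using assms by (auto simp: g_def distance_preserving_def dist_norm dest: spec[of _ x] spec[of _ 0])
 have ip: "g x \<bullet> g y = x \<bullet> y" for x y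
 proof -
  have "(g x - g y) \<bullet> (g x - g y) = (x - y) \<bullet> (x - y)" "g x \<bullet> g x = x \<bullet> x" "g y \<bullet> g y = y \<bullet> y"
   using n by (simp_all only: dot_square_norm)
  then show ?thesis by (simp add: inner_diff inner_commute)
 qed
 have z: "v = 0" if "v \<bullet> v = 0" for v :: 'b using that by simp
 have "linear g"
 proof (rule linearI)
  fix x y
  have "(g (x + y) - (g x + g y)) \<bullet> (g (x + y) - (g x + g y)) = 0"
   by (simp add: inner_diff inner_add ip)
  then show "g (x + y) = g x + g y" using z by force
 next
  fix c :: real and x
  have "(g (c *R x) - c *R g x) \<bullet> (g (c *R x) - c *R g x) = 0"
   by (simp add: inner_diff ip)
  then show "g (c *R x) = c *R g x" using z by force
 qed
 then show ?thesis using ip that by (simp add: g_def)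
qed

text \<open>Ensures that the \<open>SOME\<close> in \<open>planar_area\<close> picks an actual
  chart, about which nothing else is known.\<close>

lemma plane_chart_exists:
 fixes a :: "real^3"
 assumes "a \<noteq> 0" "S \<subseteq> {x. a \<bullet> x = b}"
 shows "\<exists>f :: real^2 \<Rightarrow> real^3. distance_preserving f \<and> S \<subseteq> range f"
proof -
 have "dim (UNIV :: (real^2) set) = dim {x. a \<bullet> x = 0}"
  using assms(1) by (simp add: dim_hyperplane)
 then obtain g :: "real^2 \<Rightarrow> real^3" and h where g: "linear g" "g ` UNIV = {x. a \<bullet> x = 0}" "\<And>x. norm (g x) = norm x"
  using isometries_subspaces[OF subspace_UNIV subspace_hyperplane[of a]] by (metis UNIV_I)
 define p where "p = (b / (a \<bullet> a)) *R a"
 define f where "f x = p + g x" for x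
 have "distance_preserving f"
  unfolding distance_preserving_def dist_norm f_def using g by (simp flip: linear_diff)
 moreover have "S \<subseteq> range f"
 proof
  fix x assume "x \<in> S"
  then have "a \<bullet> (x - p) = 0" using assms by (auto simp: inner_diff_right p_def)
  then obtain y where "x - p = g y" using g(2) by (metis (mono_tags, lifting) imageE mem_Collect_eq)
  then have "x = f y" by (simp add: f_def algebra_simps)
  then show "x \<in> range f" by blast
 qed
 ultimately show ?thesis by blast
qed

lemma planar_area_chart:
 assumes "a \<noteq> 0" "S \<subseteq> {x. a \<bullet> x = b}"
 obtains f :: "real^2 \<Rightarrow> real^3" where "distance_preserving f" "S \<subseteq> range f" "planar_area S = measure lebesgue (f -` S)"
 using someI_ex[OF plane_chart_exists[OF assms]] that unfolding planar_area_def Let_def by blast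

text \<open>The root of the Gram determinant: the area of the parallelogram spanned by
  \<open>x\<close> and \<open>y\<close>.\<close>

definition area_factor :: "'a::real_inner \<Rightarrow> 'a \<Rightarrow> real" where
 "area_factor x y = sqrt ((x \<bullet> x) * (y \<bullet> y) - (x \<bullet> y)\<^sup>2)"

lemma measure_planar_linear_image:
 fixes w1 w2 :: "real^2" and H :: "(real^2) set"
 assumes "H \<in> lmeasurable"
 shows "(\<lambda>z. z0 + (z$1) *R w1 + (z$2) *R w2) ` H \<in> lmeasurable"
  "measure lebesgue ((\<lambda>z. z0 + (z$1) *R w1 + (z$2) *R w2) ` H) = area_factor w1 w2 * measure lebesgue H"
proof -
 define T where "T = (\<lambda>z :: real^2. (z$1) *R w1 + (z$2) *R w2)"
 have lin: "linear T" unfolding T_def by (rule linearI) (simp_all add: algebra_simps)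
 have "det (matrix T) = w1$1 * w2$2 - w2$1 * w1$2"
  by (simp add: det_2 matrix_def T_def axis_def)
 moreover have "(w1 \<bullet> w1) * (w2 \<bullet> w2) - (w1 \<bullet> w2)\<^sup>2 = (w1$1 * w2$2 - w2$1 * w1$2)\<^sup>2"
  by (simp add: inner_vec_def sum_2 power2_eq_square algebra_simps)
 ultimately have d: "\<bar>det (matrix T)\<bar> = area_factor w1 w2" by (simp add: area_factor_def)
 have eq: "(\<lambda>z. z0 + (z$1) *R w1 + (z$2) *R w2) ` H = (+) z0 ` T ` H"
  by (simp add: image_image T_def add.assoc)
 have TH: "T ` H \<in> lmeasurable" using measurable_linear_image[OF lin assms] .
 then show "(\<lambda>z. z0 + (z$1) *R w1 + (z$2) *R w2) ` H \<in> lmeasurable"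
  unfolding eq by (rule measurable_translation)
 show "measure lebesgue ((\<lambda>z. z0 + (z$1) *R w1 + (z$2) *R w2) ` H) = area_factor w1 w2 * measure lebesgue H"
  unfolding eq measure_translation using measure_linear_image[OF lin assms] d by simp
qed

text \<open>The parametrization is pulled back through the unknown chart. The three points in
  \<open>pts\<close> have preimages there, whose differences divided by \<open>s\<close> have the
  same Gram matrix as \<open>e1\<close>, \<open>e2\<close>. The factor \<open>s\<close> allows these
  points to stay inside a small \<open>G\<close>.\<close>

lemma planar_area_parametrized:
 fixes e1 e2 u :: "real^3" and H :: "(real^2) set"
 assumes a: "a \<noteq> 0" "G \<subseteq> {x. a \<bullet> x = b}" and H: "H \<in> lmeasurable" and s: "s \<noteq> 0"
  and pts: "u \<in> G" "u + s *R e1 \<in> G" "u + s *R e2 \<in> G"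
  and sub: "\<And>z. z \<in> H \<Longrightarrow> u + (z$1) *R e1 + (z$2) *R e2 \<in> G"
 shows "compact G \<Longrightarrow> area_factor e1 e2 * measure lebesgue H \<le> planar_area G"
  "G \<subseteq> (\<lambda>z. u + (z$1) *R e1 + (z$2) *R e2) ` H \<Longrightarrow> planar_area G = area_factor e1 e2 * measure lebesgue H"
proof -
 obtain f :: "real^2 \<Rightarrow> real^3" where f: "distance_preserving f" "G \<subseteq> range f" "planar_area G = measure lebesgue (f -` G)"
  using planar_area_chart[OF a] .
 obtain g where g: "linear g" "\<And>x y. g x \<bullet> g y = x \<bullet> y" "\<And>x. f x = f 0 + g x"
  using distance_preserving_affine[OF f(1)] by blast
 have inj: "x = y" if "f x = f y" for x y
  using f(1) that by (metis distance_preserving_def dist_eq_0_iff)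
 obtain z0 x1 x2 where z: "u = f z0" "u + s *R e1 = f x1" "u + s *R e2 = f x2"
  using pts f(2) by blast
 define w1 w2 where "w1 = (1/s) *R (x1 - z0)" and "w2 = (1/s) *R (x2 - z0)"
 have e: "e1 = g w1" "e2 = g w2"
 proof -
  have "s *R e1 = g (x1 - z0)" "s *R e2 = g (x2 - z0)"
  proof -
   have "s *R e1 = f x1 - f z0" "s *R e2 = f x2 - f z0" using z by (simp_all add: algebra_simps)
   then show "s *R e1 = g (x1 - z0)" "s *R e2 = g (x2 - z0)"
    unfolding linear_diff[OF g(1)] g(3)[of x1] g(3)[of x2] g(3)[of z0] by (simp_all only: add_diff_cancel_left)
  qed
  then show "e1 = g w1" "e2 = g w2" using s by (simp_all add: w1_def w2_def linear_scale[OF g(1)] flip: \<open>s *R e1 = g (x1 - z0)\<close> \<open>s *R e2 = g (x2 - z0)\<close>)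
 qed
 have fac: "area_factor e1 e2 = area_factor w1 w2" by (simp add: area_factor_def e g(2))
 have par: "u + c *R e1 + d *R e2 = f (z0 + c *R w1 + d *R w2)" for c d
 proof -
  have "f (z0 + c *R w1 + d *R w2) = f 0 + g z0 + c *R g w1 + d *R g w2"
   by (subst g(3)) (simp add: linear_add[OF g(1)] linear_scale[OF g(1)])
  also have "f 0 + g z0 = u" unfolding z(1) g(3)[of z0] by (rule refl)
  finally show ?thesis by (simp add: e)
 qed
 let ?I = "(\<lambda>z. z0 + (z$1) *R w1 + (z$2) *R w2) ` H"
 note I = measure_planar_linear_image[OF H, of z0 w1 w2]
 have sub': "?I \<subseteq> f -` G" using sub par by auto
 {
  assume "compact G"
  have cont: "continuous_on UNIV f"
   using f(1) unfolding continuous_on_iff distance_preserving_def by auto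
  have "closed (f -` G)" using closed_vimage[OF compact_imp_closed[OF \<open>compact G\<close>] cont] .
  moreover have "bounded (f -` G)"
  proof -
   obtain B where B: "\<And>x. x \<in> G \<Longrightarrow> dist (f 0) x \<le> B"
    using compact_imp_bounded[OF \<open>compact G\<close>] bounded_any_center by metis
   have "dist 0 x \<le> B" if "x \<in> f -` G" for x
    using B[of "f x"] that f(1) by (simp add: distance_preserving_def)
   then show ?thesis using bounded_def by metis
  qed
  ultimately have "f -` G \<in> lmeasurable" by (simp add: compact_eq_bounded_closed lmeasurable_compact)
  then have "measure lebesgue ?I \<le> measure lebesgue (f -` G)"
   using sub' I(1) by (intro measure_mono_fmeasurable) auto
  then show "area_factor e1 e2 * measure lebesgue H \<le> planar_area G"
   using I(2) f(3) fac by simp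
 }
 {
  assume G: "G \<subseteq> (\<lambda>z. u + (z$1) *R e1 + (z$2) *R e2) ` H"
  have "f -` G \<subseteq> ?I"
  proof
   fix x assume "x \<in> f -` G"
   then obtain z where "z \<in> H" "f x = f (z0 + (z$1) *R w1 + (z$2) *R w2)" using G par by auto
   then show "x \<in> ?I" using inj by blast
  qed
  then have "f -` G = ?I" using sub' by blast
  then show "planar_area G = area_factor e1 e2 * measure lebesgue H"
   using I(2) f(3) fac by simp
 }
qed

section \<open>Areas of planar hexagons and of regular facets\<close>

definition hexagon_region :: "real \<Rightarrow> real \<Rightarrow> real \<Rightarrow> (real^2) set" where
 "hexagon_region A B C = {z. \<bar>z$1\<bar> \<le> A \<and> \<bar>z$2\<bar> \<le> B \<and> \<bar>z$1 + z$2\<bar> \<le> C}"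

lemma compact_hexagon_region: "compact (hexagon_region A B C)" and convex_hexagon_region: "convex (hexagon_region A B C)"
proof -
 have eq: "hexagon_region A B C = cbox (vector [-A, -B]) (vector [A, B]) \<inter> ({z. vector [1,1] \<bullet> z \<le> C} \<inter> {z. vector [1,1] \<bullet> z \<ge> - C})"
  by (auto simp: hexagon_region_def mem_box_cart forall_2 inner_vec_def sum_2 abs_le_iff)
 show "compact (hexagon_region A B C)"
  unfolding eq by (intro compact_Int_closed compact_cbox closed_Int closed_halfspace_le closed_halfspace_ge)
 show "convex (hexagon_region A B C)"
  unfolding eq by (intro convex_Int convex_box convex_halfspace_le convex_halfspace_ge)
qed

text \<open>The sign \<open>s\<close> treats the two opposite corners of a box cut off by a strip at
  once; \<open>\<alpha>\<close> and \<open>\<beta>\<close> in the proof are barycentric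
  coordinates.\<close>

lemma corner_triangle:
 fixes A B C :: real
 assumes "\<bar>s\<bar> = (1::real)" "C < A + B"
 shows "{z :: real^2. s * z$1 \<le> A \<and> s * z$2 \<le> B \<and> C \<le> s * (z$1 + z$2)}
  = convex hull {vector [s * A, s * B], vector [s * (C - B), s * B], vector [s * A, s * (C - A)]}"
  (is "?T = _")
proof
 have ss: "s * s = 1" using assms(1) by (metis abs_mult_self_eq mult_1)
 have ss': "s * (s * x) = x" for x using ss by (simp flip: mult.assoc)
 show "convex hull {vector [s * A, s * B], vector [s * (C - B), s * B], vector [s * A, s * (C - A)]} \<subseteq> ?T"
 proof (rule hull_minimal)
  have eq: "?T = {z. vector [s, 0] \<bullet> z \<le> A} \<inter> {z. vector [0, s] \<bullet> z \<le> B} \<inter> {z. vector [s, s] \<bullet> z \<ge> C}"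
   by (auto simp: inner_vec_def sum_2 algebra_simps)
  show "convex ?T" unfolding eq by (intro convex_Int convex_halfspace_le convex_halfspace_ge)
  show "{vector [s * A, s * B], vector [s * (C - B), s * B], vector [s * A, s * (C - A)]} \<subseteq> ?T"
   using assms(2) by (auto simp: ss' distrib_left)
 qed
 show "?T \<subseteq> convex hull {vector [s * A, s * B], vector [s * (C - B), s * B], vector [s * A, s * (C - A)]}"
 proof
  fix z assume "z \<in> ?T"
  then have z: "s * z$1 \<le> A" "s * z$2 \<le> B" "C \<le> s * z$1 + s * z$2" by (auto simp: distrib_left)
  define w where "w = A + B - C"
  have w: "w > 0" using assms(2) by (simp add: w_def)
  define \<alpha> \<beta> where "\<alpha> = (A - s * z$1) / w" and "\<beta> = (B - s * z$2) / w"
  have ab: "\<alpha> \<ge> 0" "\<beta> \<ge> 0" "\<alpha> * w = A - s * z$1" "\<beta> * w = B - s * z$2" using z w by (simp_all add: \<alpha>_def \<beta>_def)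
  have "(\<alpha> + \<beta>) * w \<le> 1 * w"
   using z unfolding distrib_right ab(3,4) by (simp add: w_def)
  then have ab1: "\<alpha> + \<beta> \<le> 1" using w by simp
  have e: "(1 - \<alpha> - \<beta>) * A + \<alpha> * (C - B) + \<beta> * A = A - \<alpha> * w" "(1 - \<alpha> - \<beta>) * B + \<alpha> * B + \<beta> * (C - A) = B - \<beta> * w"
   by (simp_all add: w_def algebra_simps)
  have "z = (1 - \<alpha> - \<beta>) *R vector [s * A, s * B] + \<alpha> *R vector [s * (C - B), s * B] + \<beta> *R vector [s * A, s * (C - A)]"
  proof -
   have "z$1 = s * (s * z$1)" "z$2 = s * (s * z$2)" by (simp_all add: ss')
   moreover have "s * z$1 = (1 - \<alpha> - \<beta>) * A + \<alpha> * (C - B) + \<beta> * A" "s * z$2 = (1 - \<alpha> - \<beta>) * B + \<alpha> * B + \<beta> * (C - A)"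
    unfolding e ab by simp_all
   ultimately have "z$1 = s * ((1 - \<alpha> - \<beta>) * A + \<alpha> * (C - B) + \<beta> * A)" "z$2 = s * ((1 - \<alpha> - \<beta>) * B + \<alpha> * B + \<beta> * (C - A))"
    by simp_all
   then show ?thesis by (simp add: vec_eq_iff forall_2 algebra_simps)
  qed
  then show "z \<in> convex hull {vector [s * A, s * B], vector [s * (C - B), s * B], vector [s * A, s * (C - A)]}"
   unfolding convex_hull_3 using ab ab1 by (intro CollectI exI[of _ "1 - \<alpha> - \<beta>"] exI[of _ \<alpha>] exI[of _ \<beta>]) auto
 qed
qed

lemma measure_Un_negligible_Int:
 "\<lbrakk>S \<in> lmeasurable; T \<in> lmeasurable; negligible (S \<inter> T)\<rbrakk>
  \<Longrightarrow> measure lebesgue (S \<union> T) = measure lebesgue S + measure lebesgue T"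
 by (simp add: measure_Un3 negligible_imp_measure0)

text \<open>The region is a box without two corner triangles with legs \<open>A + B - C\<close>; the
  assumptions \<open>A \<le> B + C\<close> and \<open>B \<le> A + C\<close> keep these triangles
  inside the box.\<close>

lemma measure_hexagon_region:
 assumes "0 \<le> A" "0 \<le> B" "A \<le> B + C" "B \<le> A + C" "C < A + B"
 shows "measure lebesgue (hexagon_region A B C) = 4 * A * B - (A + B - C)\<^sup>2"
proof -
 define T where "T s = {z :: real^2. s * z$1 \<le> A \<and> s * z$2 \<le> B \<and> C \<le> s * (z$1 + z$2)}" for s :: real
 let ?box = "cbox (vector [-A, -B]) (vector [A, B]) :: (real^2) set"
 let ?H = "hexagon_region A B C"
 have tri: "T s = convex hull {vector [s * A, s * B], vector [s * (C - B), s * B], vector [s * A, s * (C - A)]}" if "\<bar>s\<bar> = 1" for s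
  unfolding T_def by (rule corner_triangle[OF that assms(5)])
 have Tm: "T s \<in> lmeasurable" "measure lebesgue (T s) = (A + B - C)\<^sup>2 / 2" if s: "\<bar>s\<bar> = 1" for s
 proof -
  have "compact (T s)" unfolding tri[OF s] by (intro compact_convex_hull finite_imp_compact) simp
  then show "T s \<in> lmeasurable" by (rule lmeasurable_compact)
  have ss: "s * s = 1" using s by (metis abs_mult_self_eq mult_1)
  have "measure lebesgue (T s) = measure lborel (T s)"
   using \<open>compact (T s)\<close> by (simp add: borel_compact)
  also have "\<dots> = \<bar>(s * A - s * A) * (s * B - s * B) - (s * (C - B) - s * A) * (s * (C - A) - s * B)\<bar> / 2"
   unfolding tri[OF s] content_triangle by simp
  also have "(s * (C - B) - s * A) * (s * (C - A) - s * B) = (s * s) * (A + B - C)\<^sup>2"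
   by (simp add: power2_eq_square algebra_simps)
  finally show "measure lebesgue (T s) = (A + B - C)\<^sup>2 / 2" by (simp add: ss)
 qed
 have Hm: "?H \<in> lmeasurable" by (rule lmeasurable_compact[OF compact_hexagon_region])
 have cover: "?box = ?H \<union> (T 1 \<union> T (-1))"
  using assms by (auto simp: hexagon_region_def T_def mem_box_cart forall_2 abs_le_iff)
 have line: "negligible {z :: real^2. z$1 + z$2 = c}" for c
 proof -
  have "{z :: real^2. z$1 + z$2 = c} = {z. vector [1,1] \<bullet> z = c}" by (simp add: inner_vec_def sum_2)
  moreover have "(vector [1,1] :: real^2) \<noteq> 0" by (simp add: vec_eq_iff forall_2)
  ultimately show ?thesis using negligible_hyperplane by metis
 qed
 have T12: "negligible (T 1 \<inter> T (-1))"
 proof (rule negligible_subset[OF negligible_Un[OF line[of C] negligible_Un[OF line[of "-C"] line[of 0]]]])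
  show "T 1 \<inter> T (-1) \<subseteq> {z. z$1 + z$2 = C} \<union> ({z. z$1 + z$2 = - C} \<union> {z. z$1 + z$2 = 0})"
   using assms by (auto simp: T_def)
 qed
 have HT: "negligible (?H \<inter> (T 1 \<union> T (-1)))"
  by (rule negligible_subset[OF negligible_Un[OF line[of C] line[of "-C"]]])
   (auto simp: T_def hexagon_region_def abs_le_iff)
 have "measure lebesgue ?box = measure lebesgue ?H + measure lebesgue (T 1 \<union> T (-1))"
  unfolding cover using HT Hm Tm(1) by (intro measure_Un_negligible_Int) auto
 also have "measure lebesgue (T 1 \<union> T (-1)) = measure lebesgue (T 1) + measure lebesgue (T (-1))"
  using T12 Tm(1) by (intro measure_Un_negligible_Int) auto
 also have "\<dots> = (A + B - C)\<^sup>2" using Tm(2)[of 1] Tm(2)[of "-1"] by simp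
 also have "measure lebesgue ?box = 4 * A * B"
 proof -
  have "measure lborel ?box = 4 * A * B"
   using assms by (subst content_cbox_cart) (auto simp: interval_ne_empty_cart forall_2 UNIV_2)
  then show ?thesis by simp
 qed
 finally show ?thesis by simp
qed

text \<open>The area stays symbolic: formulas in terms of it compare similar copies, and an upper
  bound for it bounds the area of \<open>A\<close>.\<close>

definition hexagon_measure :: real where
 "hexagon_measure = measure lebesgue (convex hull {vector [1, 0], vector [0, 1], vector [-1, 1], vector [-1, 0], vector [0, -1], vector [1, -1] :: real^2})"

definition square_measure :: real where
 "square_measure = measure lebesgue (convex hull {vector [1, 1], vector [1, -1], vector [-1, -1], vector [-1, 1] :: real^2})"

lemma affine_image_convex_hull:
 fixes u e1 e2 :: "real^3"
 shows "(\<lambda>z :: real^2. u + (z$1) *R e1 + (z$2) *R e2) ` (convex hull S)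
  = convex hull ((\<lambda>z. u + (z$1) *R e1 + (z$2) *R e2) ` S)"
proof -
 have lin: "linear (\<lambda>z :: real^2. (z$1) *R e1 + (z$2) *R e2)"
  by (rule linearI) (simp_all add: algebra_simps)
 have "(\<lambda>z :: real^2. u + (z$1) *R e1 + (z$2) *R e2) ` X = (+) u ` (\<lambda>z. (z$1) *R e1 + (z$2) *R e2) ` X" for X
  by (simp add: image_image add.assoc)
 then show ?thesis
  by (simp only: convex_hull_linear_image[OF lin] convex_hull_translation)
qed

lemma hexagon_area:
 assumes "hexagon_frame c p q" "a \<noteq> 0" "convex hull (hexagon_points c p q) \<subseteq> {x. a \<bullet> x = b}"
 shows "planar_area (convex hull (hexagon_points c p q)) = sqrt 3 / 2 * (p \<bullet> p) * hexagon_measure"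
proof -
 let ?F = "convex hull (hexagon_points c p q)"
 let ?S = "{vector [1, 0], vector [0, 1], vector [-1, 1], vector [-1, 0], vector [0, -1], vector [1, -1] :: real^2}"
 let ?e = "(1/2) *R p + q"
 let ?T = "\<lambda>z :: real^2. c + (z$1) *R p + (z$2) *R ?e"
 have eq: "c + 1 *R p + 0 *R ?e = c + p" "c + 0 *R p + 1 *R ?e = c + (1/2) *R p + q"
  "c + (-1) *R p + 1 *R ?e = c - (1/2) *R p + q" "c + (-1) *R p + 0 *R ?e = c - p"
  "c + 0 *R p + (-1) *R ?e = c - (1/2) *R p - q" "c + 1 *R p + (-1) *R ?e = c + (1/2) *R p - q"
  by (simp_all add: vec_eq_iff field_simps)
 have "?T ` ?S = hexagon_points c p q"
  unfolding image_insert image_empty vector_2 eq hexagon_points_def by (simp add: insert_commute)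
 then have img: "?T ` (convex hull ?S) = ?F" unfolding affine_image_convex_hull by simp
 have Hm: "convex hull ?S \<in> lmeasurable"
  by (intro lmeasurable_compact compact_convex_hull finite_imp_compact) simp
 have mem: "?T z \<in> ?F" if "z \<in> convex hull ?S" for z using img that by blast
 have inh: "vector [1, 0] \<in> convex hull ?S" "vector [0, 1] \<in> convex hull ?S" "vector [-1, 0] \<in> convex hull ?S"
  by (rule hull_inc, simp)+
 have 0: "c \<in> ?F"
 proof -
  have "(1/2) *R vector [1, 0] + (1/2) *R vector [-1, 0] \<in> convex hull ?S"
   by (rule convexD[OF convex_convex_hull inh(1,3)]) auto
  moreover have "(1/2) *R vector [1, 0] + (1/2) *R vector [-1, 0] = (0 :: real^2)" by (simp add: vec_eq_iff forall_2)
  ultimately show ?thesis using mem[of 0] by simp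
 qed
 have pts: "c + 1 *R p \<in> ?F" "c + 1 *R ?e \<in> ?F"
  using mem[OF inh(1)] mem[OF inh(2)] by simp_all
 have "planar_area ?F = area_factor p ?e * measure lebesgue (convex hull ?S)"
  by (rule planar_area_parametrized(2)[OF assms(2,3) Hm _ 0 pts mem]) (use img in simp_all)
 also have "area_factor p ?e = sqrt (3/4 * (p \<bullet> p)\<^sup>2)"
  using assms(1) unfolding area_factor_def
  by (simp add: hexagon_frame_def inner_add inner_commute power2_eq_square field_simps)
 also have "\<dots> = sqrt 3 / 2 * (p \<bullet> p)" by (simp add: real_sqrt_mult real_sqrt_divide)
 finally show ?thesis by (simp add: hexagon_measure_def)
qed

lemma square_area:
 assumes "square_frame c p q" "a \<noteq> 0" "convex hull (square_points c p q) \<subseteq> {x. a \<bullet> x = b}"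
 shows "planar_area (convex hull (square_points c p q)) = 1 / 2 * (p \<bullet> p) * square_measure"
proof -
 let ?F = "convex hull (square_points c p q)"
 let ?S = "{vector [1, 1], vector [1, -1], vector [-1, -1], vector [-1, 1] :: real^2}"
 let ?d = "(1/2) *R (p + q)" and ?e = "(1/2) *R (p - q)"
 let ?T = "\<lambda>z :: real^2. c + (z$1) *R ?d + (z$2) *R ?e"
 have eq: "c + 1 *R ?d + 1 *R ?e = c + p" "c + 1 *R ?d + (-1) *R ?e = c + q"
  "c + (-1) *R ?d + (-1) *R ?e = c - p" "c + (-1) *R ?d + 1 *R ?e = c - q"
  by (simp_all add: vec_eq_iff field_simps)
 have "?T ` ?S = square_points c p q"
  unfolding image_insert image_empty vector_2 eq square_points_def by (simp add: insert_commute)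
 then have img: "?T ` (convex hull ?S) = ?F" unfolding affine_image_convex_hull by simp
 have Hm: "convex hull ?S \<in> lmeasurable"
  by (intro lmeasurable_compact compact_convex_hull finite_imp_compact) simp
 have mem: "?T z \<in> ?F" if "z \<in> convex hull ?S" for z using img that by blast
 have inh: "vector [1, 1] \<in> convex hull ?S" "vector [1, -1] \<in> convex hull ?S" "vector [-1, -1] \<in> convex hull ?S" "vector [-1, 1] \<in> convex hull ?S"
  by (rule hull_inc, simp)+
 have half: "(1/2) *R x + (1/2) *R y \<in> convex hull ?S" if "x \<in> convex hull ?S" "y \<in> convex hull ?S" for x y
  by (rule convexD[OF convex_convex_hull that]) auto
 have 0: "c \<in> ?F"
 proof -
  have "(1/2) *R vector [1, 1] + (1/2) *R vector [-1, -1] = (0 :: real^2)" by (simp add: vec_eq_iff forall_2)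
  then show ?thesis using mem[of 0] half[OF inh(1,3)] by simp
 qed
 have pts: "c + 1 *R ?d \<in> ?F" "c + 1 *R ?e \<in> ?F"
  using mem[OF half[OF inh(1,2)]] mem[OF half[OF inh(1,4)]] by simp_all
 have "planar_area ?F = area_factor ?d ?e * measure lebesgue (convex hull ?S)"
  by (rule planar_area_parametrized(2)[OF assms(2,3) Hm _ 0 pts mem]) (use img in simp_all)
 also have "area_factor ?d ?e = sqrt ((1/2)\<^sup>2 * (p \<bullet> p)\<^sup>2)"
  using assms(1) unfolding area_factor_def
  by (simp add: square_frame_def inner_add inner_diff inner_commute power2_eq_square field_simps)
 also have "\<dots> = 1 / 2 * (p \<bullet> p)" by (simp add: real_sqrt_mult real_sqrt_divide)
 finally show ?thesis by (simp add: square_measure_def)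
qed

lemma hexagon_measure_le: "hexagon_measure \<le> 3"
proof -
 let ?S = "{vector [1, 0], vector [0, 1], vector [-1, 1], vector [-1, 0], vector [0, -1], vector [1, -1] :: real^2}"
 have c: "compact (convex hull ?S)" by (intro compact_convex_hull finite_imp_compact) simp
 have "convex hull ?S \<subseteq> hexagon_region 1 1 1"
  by (intro hull_minimal convex_hexagon_region) (auto simp: hexagon_region_def)
 then have "measure lebesgue (convex hull ?S) \<le> measure lebesgue (hexagon_region 1 1 1)"
  using lmeasurable_compact[OF compact_hexagon_region[of 1 1 1]] lmeasurable_compact[OF c]
  by (intro measure_mono_fmeasurable) (auto simp: fmeasurableD)
 then show ?thesis using measure_hexagon_region[of 1 1 1] by (simp add: hexagon_measure_def)
qed

lemma square_measure_le: "square_measure \<le> 4"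
proof -
 let ?S = "{vector [1, 1], vector [1, -1], vector [-1, -1], vector [-1, 1] :: real^2}"
 let ?box = "cbox (vector [-1, -1]) (vector [1, 1]) :: (real^2) set"
 have c: "compact (convex hull ?S)" by (intro compact_convex_hull finite_imp_compact) simp
 have "convex hull ?S \<subseteq> ?box"
  by (intro hull_minimal convex_box) (auto simp: mem_box_cart forall_2)
 then have "measure lebesgue (convex hull ?S) \<le> measure lebesgue ?box"
  using lmeasurable_compact[OF c]
  by (intro measure_mono_fmeasurable) (auto simp: fmeasurableD)
 moreover have "measure lborel ?box = 4"
  by (subst content_cbox_cart) (auto simp: interval_ne_empty_cart forall_2 UNIV_2)
 ultimately show ?thesis by (simp add: square_measure_def)
qed

context archimedean
begin

text \<open>Areas are computed facet by facet, because the image of a regular hexagon or square is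
  again one. The identity map gives the area of \<open>A\<close> itself.\<close>

lemma surface_area_similar:
 assumes f: "linear f" "\<And>x. norm (f x) = s * norm x" "s > 0"
 shows "surface_area (f ` A) = s\<^sup>2 * (4 * sqrt 3 * l2 * hexagon_measure + 3/2 * l2 * square_measure)"
proof -
 have inj: "inj f"
 proof (rule injI)
  fix x y assume "f x = f y"
  then have "norm (f (x - y)) = 0" by (simp add: linear_diff[OF f(1)])
  then show "x = y" using f(2,3) by simp
 qed
 have ip: "f x \<bullet> f y = s\<^sup>2 * (x \<bullet> y)" for x y
 proof -
  have *: "f x \<bullet> f x = s\<^sup>2 * (x \<bullet> x)" for x using f(2)[of x] by (simp add: dot_square_norm power_mult_distrib)
  from *[of "x + y"] *[of x] *[of y] show ?thesis
   by (simp add: linear_add[OF f(1)] inner_add inner_commute algebra_simps)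
 qed
 have polyf: "polyhedron (f ` A)" by (simp add: f(1) poly polytope_linear_image polytope_imp_polyhedron)
 have fac: "{G. G facet_of f ` A} = (`) f ` {F. F facet_of A}"
 proof -
  have ad: "aff_dim (f ` F) = aff_dim F" for F by (rule aff_dim_injective_linear_image[OF f(1) inj])
  have "G facet_of f ` A \<longleftrightarrow> (\<exists>F. G = f ` F \<and> F facet_of A)" for G
  proof
   assume G: "G facet_of f ` A"
   then have "G \<subseteq> f ` A" by (rule facet_of_imp_subset)
   then obtain F where F: "G = f ` F" by (rule subset_imageE)
   then show "\<exists>F. G = f ` F \<and> F facet_of A" using G
    by (auto simp: facet_of_def face_of_linear_image[OF f(1) inj] ad)
  next
   assume "\<exists>F. G = f ` F \<and> F facet_of A"
   then show "G facet_of f ` A" by (auto simp: facet_of_def face_of_linear_image[OF f(1) inj] ad)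
  qed
  then show ?thesis by blast
 qed
 have plane: "\<exists>a b. a \<noteq> 0 \<and> f ` F \<subseteq> {x. a \<bullet> x = b}" if "F facet_of A" for F
 proof -
  have "f ` F facet_of f ` A" using fac that by blast
  then show ?thesis using facet_of_polyhedron[OF polyf] by (metis Int_lower2)
 qed
 have ih: "inj_on ((`) f) X" for X using inj by (meson inj_image_eq_iff inj_onI)
 have hex: "planar_area (f ` F) = s\<^sup>2 * (sqrt 3 / 2 * l2 * hexagon_measure)" if F: "F \<in> Hex" for F
 proof -
  obtain c p q where h: "hexf F c p q" using hexf_exists[OF F] .
  have fp: "f ` hexagon_points c p q = hexagon_points (f c) (f p) (f q)"
   by (simp add: hexagon_points_def linear_add[OF f(1)] linear_diff[OF f(1)] linear_scale[OF f(1)])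
  have fF: "f ` F = convex hull (hexagon_points (f c) (f p) (f q))"
   using h fp convex_hull_linear_image[OF f(1), of "hexagon_points c p q"] by (simp add: hexf_def)
  have fr: "hexagon_frame (f c) (f p) (f q)"
  proof -
   have "f p \<noteq> 0" using f(2)[of p] f(3) h by (auto simp: hexf_def hexagon_frame_def)
   then show ?thesis using h by (simp add: hexagon_frame_def hexf_def ip)
  qed
  obtain a b where ab: "a \<noteq> 0" "f ` F \<subseteq> {x. a \<bullet> x = b}" using plane[of F] F by (auto simp: Hex_def)
  show ?thesis unfolding fF using hexagon_area[OF fr ab(1)] ab(2) l2(1)[OF h] unfolding fF ip by simp
 qed
 have sqr: "planar_area (f ` F) = s\<^sup>2 * (1 / 4 * l2 * square_measure)" if F: "F \<in> Sqr" for F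
 proof -
  obtain c p q where h: "sqrf F c p q" using sqrf_exists[OF F] .
  have fp: "f ` square_points c p q = square_points (f c) (f p) (f q)"
   by (simp add: square_points_def linear_add[OF f(1)] linear_diff[OF f(1)])
  have fF: "f ` F = convex hull (square_points (f c) (f p) (f q))"
   using h fp convex_hull_linear_image[OF f(1), of "square_points c p q"] by (simp add: sqrf_def)
  have fr: "square_frame (f c) (f p) (f q)"
  proof -
   have "f p \<noteq> 0" using f(2)[of p] f(3) h by (auto simp: sqrf_def square_frame_def)
   then show ?thesis using h by (simp add: square_frame_def sqrf_def ip)
  qed
  obtain a b where ab: "a \<noteq> 0" "f ` F \<subseteq> {x. a \<bullet> x = b}" using plane[of F] F by (auto simp: Sqr_def)
  have pp: "p \<bullet> p = l2 / 2" using l2(2)[OF h] by simp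
  show ?thesis using square_area[OF fr ab(1)] ab(2) unfolding fF ip pp by simp
 qed
 have "surface_area (f ` A) = (\<Sum>F\<in>Hex \<union> Sqr. planar_area (f ` F))"
  unfolding surface_area_def fac facets_Hex_Sqr by (rule sum.reindex_cong[OF ih refl]) simp
 also have "\<dots> = (\<Sum>F\<in>Hex. planar_area (f ` F)) + (\<Sum>F\<in>Sqr. planar_area (f ` F))"
  by (rule sum.union_disjoint[OF finite_Hex finite_Sqr Hex_Sqr_disjoint])
 also have "(\<Sum>F\<in>Hex. planar_area (f ` F)) = (\<Sum>F\<in>Hex. s\<^sup>2 * (sqrt 3 / 2 * l2 * hexagon_measure))"
  by (rule sum.cong[OF refl hex])
 also have "(\<Sum>F\<in>Sqr. planar_area (f ` F)) = (\<Sum>F\<in>Sqr. s\<^sup>2 * (1 / 4 * l2 * square_measure))"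
  by (rule sum.cong[OF refl sqr])
 also have "(\<Sum>F\<in>Hex. s\<^sup>2 * (sqrt 3 / 2 * l2 * hexagon_measure)) + (\<Sum>F\<in>Sqr. s\<^sup>2 * (1 / 4 * l2 * square_measure))
   = 8 * (s\<^sup>2 * (sqrt 3 / 2 * l2 * hexagon_measure)) + 6 * (s\<^sup>2 * (1 / 4 * l2 * square_measure))"
  unfolding sum_constant card_Hex card_Sqr by simp
 finally show ?thesis by (simp add: algebra_simps)
qed

lemma surface_area_le: "surface_area A \<le> (12 * sqrt 3 + 6) * l2"
proof -
 have "surface_area ((\<lambda>x. x) ` A) = 1\<^sup>2 * (4 * sqrt 3 * l2 * hexagon_measure + 3/2 * l2 * square_measure)"
  by (rule surface_area_similar) (simp_all add: linear_ident)
 moreover have "4 * sqrt 3 * l2 * hexagon_measure \<le> 4 * sqrt 3 * l2 * 3" "3/2 * l2 * square_measure \<le> 3/2 * l2 * 4"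
  using hexagon_measure_le square_measure_le l2(3) by (simp_all add: mult_left_mono)
 ultimately show ?thesis by (simp add: algebra_simps)
qed

end

section \<open>The isoperimetric inequality near the symmetric weights\<close>

text \<open>The weighted inequality between geometric and arithmetic mean, for \<open>x\<close> and
  1.\<close>

lemma powr_le_Bernoulli:
 fixes x s :: real
 assumes "x > 0" "0 \<le> s" "s \<le> 1"
 shows "x powr s \<le> 1 + s * (x - 1)"
 using Youngs_inequality_0[of s "1 - s" x 1] assms by (simp add: algebra_simps)

text \<open>Taylor's formula to second order; for these \<open>y\<close> the cubic term with
  coefficient 1 dominates the remainder.\<close>

lemma sqrt_lower_bound:
 fixes y :: real
 assumes "\<bar>y\<bar> \<le> 1/4"
 shows "1 + y - y\<^sup>2 / 2 - \<bar>y\<bar>^3 \<le> sqrt (1 + 2 * y)"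
proof (rule real_le_rsqrt)
 define z where "z = \<bar>y\<bar>"
 have z: "0 \<le> z" "z \<le> 1/4" "y \<le> z" "- z \<le> y" "y\<^sup>2 = z\<^sup>2" using assms by (auto simp: z_def)
 have c3: "- (y^3) \<le> z^3" unfolding z_def using abs_ge_minus_self[of "y^3"] by (simp add: power_abs)
 have z2: "z\<^sup>2 \<le> z * (1/4)" unfolding power2_eq_square by (rule mult_left_mono[OF z(2,1)])
 let ?A = "1 + y - y\<^sup>2 / 2"
 have A: "?A \<ge> 7/10" using z z2 by simp
 have z3: "z^3 \<ge> 0" using z by simp
 have z3s: "z^3 \<le> 1/64"
  using power_mono[OF z(2,1), of 3] by (simp add: power3_eq_cube)
 have h1: "(7/10) * z^3 \<le> ?A * z^3" using A z3 by (rule mult_right_mono)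
 have h2: "z^3 * z^3 \<le> (1/64) * z^3" using z3s z3 by (rule mult_right_mono)
 have h3: "z * z^3 \<le> (1/4) * z^3" using z(2) z3 by (rule mult_right_mono)
 have "y * y = z * z" by (simp add: z_def)
 then have h4: "y^4 = z * z^3" by (simp add: power4_eq_xxxx power3_eq_cube mult.assoc)
 have "(?A - z^3)\<^sup>2 = ?A\<^sup>2 - 2 * (?A * z^3) + z^3 * z^3" by (simp add: power2_eq_square algebra_simps)
 also have "?A\<^sup>2 = 1 + 2 * y - y^3 + y^4 / 4"
  by (simp add: power2_eq_square power3_eq_cube power4_eq_xxxx field_simps)
 finally show "(1 + y - y\<^sup>2 / 2 - \<bar>y\<bar>^3)\<^sup>2 \<le> 1 + 2 * y"
  unfolding z_def[symmetric] using h1 h2 h3 h4 c3 z3 by linarith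
qed

text \<open>\<open>b\<close>, \<open>L\<close>, \<open>e\<close> are the parts of the weight of
  order 0, 1 and 2 in \<open>r\<close>. The discarded products have order at least 3 and add up to
  at most \<open>(6 + 3/4 + 3 + 1/2) * r^3\<close>.\<close>

lemma weighted_sqrt_lower_bound:
 fixes b L e y r :: real
 assumes r: "0 \<le> r" "r \<le> 1/20" and b: "1 \<le> b" "b \<le> 3"
  and L: "\<bar>L\<bar> \<le> 6 * r" and E: "\<bar>e\<bar> \<le> 12 * r\<^sup>2" and y: "\<bar>y\<bar> \<le> r / 2"
 shows "(b + L + e) * sqrt (1 + 2 * y) \<ge> b + L + b * y + e + L * y - b / 2 * y\<^sup>2 - 12 * r^3"
proof -
 have r2: "r\<^sup>2 \<le> r * (1/20)" unfolding power2_eq_square by (rule mult_left_mono[OF r(2,1)])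
 have r3: "r^3 \<ge> 0" using r by simp
 have pos: "0 \<le> b + L + e" "b + L + e \<le> 4" using L E b r r2 by (simp_all add: abs_le_iff)
 have y2: "y\<^sup>2 \<le> r\<^sup>2 / 4"
  using power_mono[OF y, of 2] by (simp add: power_divide)
 have y3: "\<bar>y\<bar>^3 \<le> r^3 / 8"
  using power_mono[OF y, of 3] by (simp add: power_divide)
 have r21: "r\<^sup>2 \<le> 1" using r r2 by simp
 have "\<bar>e * y\<bar> \<le> (12 * r\<^sup>2) * (r / 2)" unfolding abs_mult using E y by (intro mult_mono) auto
 then have 1: "\<bar>e * y\<bar> \<le> 6 * r^3" by (simp add: power2_eq_square power3_eq_cube)
 have "\<bar>L * y\<^sup>2\<bar> \<le> (6 * r) * (r\<^sup>2 / 4)" unfolding abs_mult using L y2 r by (intro mult_mono) auto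
 then have 2: "\<bar>L * y\<^sup>2\<bar> \<le> 3/2 * r^3" by (simp add: power2_eq_square power3_eq_cube)
 have "\<bar>e * y\<^sup>2\<bar> \<le> (12 * r\<^sup>2) * (r / 2)"
 proof -
  have "y\<^sup>2 \<le> r / 2" using y2 r2 r by simp
  then show ?thesis unfolding abs_mult using E r by (intro mult_mono) auto
 qed
 then have 3: "\<bar>e * y\<^sup>2\<bar> \<le> 6 * r^3" by (simp add: power2_eq_square power3_eq_cube)
 have "(b + L + e) * \<bar>y\<bar>^3 \<le> 4 * (r^3 / 8)" using pos y3 by (intro mult_mono) auto
 then have 4: "(b + L + e) * \<bar>y\<bar>^3 \<le> r^3 / 2" by simp
 have "\<bar>y\<bar> \<le> 1/4" using y r by simp
 then have "(b + L + e) * (1 + y - y\<^sup>2 / 2 - \<bar>y\<bar>^3) \<le> (b + L + e) * sqrt (1 + 2 * y)"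
  using pos sqrt_lower_bound by (intro mult_left_mono) auto
 moreover have "(b + L + e) * (1 + y - y\<^sup>2 / 2 - \<bar>y\<bar>^3)
   = (b + L + b * y + e + L * y - b / 2 * y\<^sup>2) + e * y - (L * y\<^sup>2) / 2 - (e * y\<^sup>2) / 2 - (b + L + e) * \<bar>y\<bar>^3"
  by (simp add: field_simps power2_eq_square)
 ultimately show ?thesis using 1 2 3 4 r3 unfolding abs_le_iff by linarith
qed

text \<open>The six edge weights of the complete graph on four vertices come in three pairs of opposite
 edges \<open>a\<^sub>k\<close>, \<open>b\<^sub>k\<close>; the polynomial counts weighted spanning trees.\<close>

definition tree_sum :: "real \<Rightarrow> real \<Rightarrow> real \<Rightarrow> real \<Rightarrow> real \<Rightarrow> real \<Rightarrow> real" where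
 "tree_sum a1 a2 a3 b1 b2 b3 =
   (a1 + b2 + b3) * ((a2 + b1 + b3) * (a3 + b1 + b2) - b1\<^sup>2)
   - b3 * (b3 * (a3 + b1 + b2) + b2 * b1) - b2 * (b3 * b1 + b2 * (a2 + b1 + b3))"

text \<open>One summand per pair of opposite facets: the coefficient is the area of the facet in the
  coordinates given by two other normals, the root is the length of its own normal. In
  \<open>surface_area_ge\<close> this sum appears with the factor \<open>2 / D\<close>.\<close>

definition area_sum :: "real \<Rightarrow> real \<Rightarrow> real \<Rightarrow> real \<Rightarrow> real \<Rightarrow> real \<Rightarrow> real \<Rightarrow> real \<Rightarrow> real \<Rightarrow> real \<Rightarrow> real \<Rightarrow> real \<Rightarrow> real" where
 "area_sum a1 a2 a3 b1 b2 b3 c1 c2 c3 d1 d2 d3 =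
   (b1 * b2 + b2 * b3 + b1 * b3) * sqrt (c1 + c2 + c3)
   + (b1 * a2 + a2 * a3 + b1 * a3) * sqrt (c1 + d2 + d3)
   + (a1 * b2 + b2 * a3 + a1 * a3) * sqrt (d1 + c2 + d3)
   + (a1 * a2 + a2 * b3 + a1 * b3) * sqrt (d1 + d2 + c3)
   + a1 * b1 * sqrt (c2 + d2 + c3 + d3)
   + a2 * b2 * sqrt (c1 + d1 + c3 + d3)
   + a3 * b3 * sqrt (c1 + d1 + c2 + d2)"

text \<open>Half-sums \<open>m\<close> and half-differences \<open>h\<close> of opposite weights
  diagonalise the quadratic part; the linear part vanishes because the weights have mean 1. The
  constant 16 counts the spanning trees of the complete graph.\<close>

lemma tree_sum_expand:
 fixes m1 m2 m3 h1 h2 h3 :: real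
 assumes "m1 + m2 + m3 = 0"
 shows "tree_sum (1 + m1 + h1) (1 + m2 + h2) (1 + m3 + h3) (1 + m1 - h1) (1 + m2 - h2) (1 + m3 - h3)
  = 16 - 2 * (m1\<^sup>2 + m2\<^sup>2 + m3\<^sup>2) - 4 * (h1\<^sup>2 + h2\<^sup>2 + h3\<^sup>2)
   - 2 * (m1 * m2 * m3) + 2 * (m1 * h1\<^sup>2 + m2 * h2\<^sup>2 + m3 * h3\<^sup>2) + 4 * (h1 * h2 * h3)"
proof -
 have m3: "m3 = - m1 - m2" using assms by simp
 show ?thesis unfolding tree_sum_def m3 by (simp add: power2_eq_square algebra_simps)
qed

lemma abs_triple_le:
 fixes x y z r :: real
 assumes "\<bar>x\<bar> \<le> r" "\<bar>y\<bar> \<le> r" "\<bar>z\<bar> \<le> r"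
 shows "\<bar>x * y * z\<bar> \<le> r^3"
 unfolding abs_mult power3_eq_cube using assms by (intro mult_mono) auto

lemma tree_sum_bounds:
 fixes m1 m2 m3 h1 h2 h3 r :: real
 assumes "m1 + m2 + m3 = 0" and r: "0 \<le> r" "r \<le> 1/100"
  and s: "m1\<^sup>2 + m2\<^sup>2 + m3\<^sup>2 + (h1\<^sup>2 + h2\<^sup>2 + h3\<^sup>2) \<le> r\<^sup>2"
  and m: "\<bar>m1\<bar> \<le> r" "\<bar>m2\<bar> \<le> r" "\<bar>m3\<bar> \<le> r" and h: "\<bar>h1\<bar> \<le> r" "\<bar>h2\<bar> \<le> r" "\<bar>h3\<bar> \<le> r"
 defines "X \<equiv> tree_sum (1 + m1 + h1) (1 + m2 + h2) (1 + m3 + h3) (1 + m1 - h1) (1 + m2 - h2) (1 + m3 - h3) / 16 - 1"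
 shows "X \<le> - (m1\<^sup>2 + m2\<^sup>2 + m3\<^sup>2) / 8 - (h1\<^sup>2 + h2\<^sup>2 + h3\<^sup>2) / 4 + r^3" "\<bar>X\<bar> \<le> r\<^sup>2"
proof -
 define C where "C = - 2 * (m1 * m2 * m3) + 2 * (m1 * h1\<^sup>2 + m2 * h2\<^sup>2 + m3 * h3\<^sup>2) + 4 * (h1 * h2 * h3)"
 \<comment> \<open>The coefficients of the cubic terms add up to
   \<open>2 + 2 * 3 + 4\<close>.\<close>
 have C: "\<bar>C\<bar> \<le> 12 * r^3"
  unfolding C_def power2_eq_square
  using abs_triple_le[OF m(1,2,3)] abs_triple_le[OF m(1) h(1,1)] abs_triple_le[OF m(2) h(2,2)]
   abs_triple_le[OF m(3) h(3,3)] abs_triple_le[OF h(1,2,3)]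
  by (simp add: abs_le_iff mult.assoc)
 have X: "X = - (m1\<^sup>2 + m2\<^sup>2 + m3\<^sup>2) / 8 - (h1\<^sup>2 + h2\<^sup>2 + h3\<^sup>2) / 4 + C / 16"
  unfolding X_def tree_sum_expand[OF assms(1)] C_def by (simp add: field_simps)
 have r3: "0 \<le> r^3" using r by simp
 have r4: "r^3 \<le> r\<^sup>2 * (1/100)"
  using mult_left_mono[OF r(2), of "r\<^sup>2"] by (simp add: power3_eq_cube power2_eq_square mult.assoc)
 have C16: "C / 16 \<le> r^3" "- (C / 16) \<le> r^3" using C r3 by (simp_all add: abs_le_iff)
 then show "X \<le> - (m1\<^sup>2 + m2\<^sup>2 + m3\<^sup>2) / 8 - (h1\<^sup>2 + h2\<^sup>2 + h3\<^sup>2) / 4 + r^3" unfolding X by linarith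
 have "0 \<le> m1\<^sup>2 + m2\<^sup>2 + m3\<^sup>2" "0 \<le> h1\<^sup>2 + h2\<^sup>2 + h3\<^sup>2" by simp_all
 moreover have "\<bar>- p / 8 - q / 4 + C / 16\<bar> \<le> r\<^sup>2" if "0 \<le> p" "0 \<le> q" "p + q \<le> r\<^sup>2" for p q
  unfolding abs_le_iff using C16 that r3 r4 zero_le_power2[of r] by linarith
 ultimately show "\<bar>X\<bar> \<le> r\<^sup>2" unfolding X using s by blast
qed

section \<open>Positivity of the second-order terms\<close>

lemma sqrt3_bounds: "1.73 \<le> sqrt 3" "sqrt 3 \<le> 1.74"
proof -
 show "1.73 \<le> sqrt 3" by (rule real_le_rsqrt) (simp add: power2_eq_square)
 show "sqrt 3 \<le> 1.74" by (rule real_le_lsqrt) (simp_all add: power2_eq_square)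
qed

text \<open>The second-order part of the deficit splits into binary forms, one for each opposite
  pair of weights: \<open>form_m\<close> in the half-sums of both families, \<open>form_h\<close> in
  the half-differences. The weights 7/10 and 5/14 that bound the mixed term fit below the diagonal
  entries with a margin of 1/20.\<close>

lemma form_m: "(5/2 - sqrt 3) * m\<^sup>2 - m * M + (sqrt 3 / 4 + 1/16) * M\<^sup>2 \<ge> 1/20 * m\<^sup>2 + 1/20 * M\<^sup>2" for m M :: real
proof -
 have "0 \<le> 7/10 * (m - 5/7 * M)\<^sup>2" by simp
 then have 1: "m * M \<le> 7/10 * m\<^sup>2 + 5/14 * M\<^sup>2" by (simp add: power2_eq_square field_simps)
 have 2: "(76/100) * m\<^sup>2 \<le> (5/2 - sqrt 3) * m\<^sup>2" using sqrt3_bounds by (intro mult_right_mono) auto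
 have 3: "(49/100) * M\<^sup>2 \<le> (sqrt 3 / 4 + 1/16) * M\<^sup>2" using sqrt3_bounds by (intro mult_right_mono) auto
 have "0 \<le> m\<^sup>2" "0 \<le> M\<^sup>2" by simp_all
 then show ?thesis using 1 2 3 by linarith
qed

lemma form_h: "(2 * sqrt 3 - 1) * h\<^sup>2 - 4/3 * sqrt 3 * (h * H) + (sqrt 3 / 3 + 1/4) * H\<^sup>2 \<ge> 1/20 * h\<^sup>2 + 1/20 * H\<^sup>2" for h H :: real
proof -
 have "0 \<le> 2 * (h - 3/5 * H)\<^sup>2" "0 \<le> 2 * (h + 3/5 * H)\<^sup>2" by simp_all
 then have "\<bar>h * H\<bar> \<le> 5/6 * h\<^sup>2 + 3/10 * H\<^sup>2" by (simp add: abs_le_iff power2_eq_square field_simps)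
 then have "4/3 * sqrt 3 * \<bar>h * H\<bar> \<le> 4/3 * 1.74 * (5/6 * h\<^sup>2 + 3/10 * H\<^sup>2)"
  using sqrt3_bounds by (intro mult_mono) auto
 moreover have "4/3 * sqrt 3 * (h * H) \<le> 4/3 * sqrt 3 * \<bar>h * H\<bar>" by (intro mult_left_mono) auto
 moreover have "4/3 * 1.74 * (5/6 * h\<^sup>2 + 3/10 * H\<^sup>2) = 29/15 * h\<^sup>2 + 87/125 * H\<^sup>2" by simp
 ultimately have 1: "4/3 * sqrt 3 * (h * H) \<le> 29/15 * h\<^sup>2 + 87/125 * H\<^sup>2" by linarith
 have 2: "(246/100) * h\<^sup>2 \<le> (2 * sqrt 3 - 1) * h\<^sup>2" using sqrt3_bounds by (intro mult_right_mono) auto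
 have 3: "(82/100) * H\<^sup>2 \<le> (sqrt 3 / 3 + 1/4) * H\<^sup>2" using sqrt3_bounds by (intro mult_right_mono) auto
 have "0 \<le> h\<^sup>2" "0 \<le> H\<^sup>2" by simp_all
 then have "1/20 * h\<^sup>2 + 1/20 * H\<^sup>2 \<le> (246/100) * h\<^sup>2 - (29/15 * h\<^sup>2 + 87/125 * H\<^sup>2) + (82/100) * H\<^sup>2" by linarith
 also have "\<dots> \<le> (2 * sqrt 3 - 1) * h\<^sup>2 - 4/3 * sqrt 3 * (h * H) + (sqrt 3 / 3 + 1/4) * H\<^sup>2"
  using 1 2 3 by (intro add_mono diff_mono)
 finally show ?thesis .
qed

text \<open>The factor \<open>sqrt 3\<close> is taken out so that the root has the form
  \<open>sqrt (1 + 2 * y)\<close>. The separate bound \<open>3 * r\<close> on the sum is available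
  because the half-sums cancel in it.\<close>

lemma hexagon_term_bound:
 fixes x1 x2 x3 z r :: real
 assumes r: "0 \<le> r" "r \<le> 1/100"
  and x: "\<bar>x1\<bar> \<le> 2 * r" "\<bar>x2\<bar> \<le> 2 * r" "\<bar>x3\<bar> \<le> 2 * r" "\<bar>x1 + x2 + x3\<bar> \<le> 3 * r" and z: "\<bar>z\<bar> \<le> 3 * r"
 shows "((1 + x1) * (1 + x2) + (1 + x2) * (1 + x3) + (1 + x1) * (1 + x3)) * sqrt (3 + z)
   \<ge> sqrt 3 * (3 + 2 * (x1 + x2 + x3) + z / 2 + (x1 * x2 + x2 * x3 + x1 * x3) + 2 * (x1 + x2 + x3) * (z / 6) - 3/2 * (z / 6)\<^sup>2 - 12 * r^3)"
proof -
 have pr: "\<bar>x * y\<bar> \<le> 4 * r\<^sup>2" if "\<bar>x\<bar> \<le> 2 * r" "\<bar>y\<bar> \<le> 2 * r" for x y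
  using mult_mono[OF that] r unfolding abs_mult by (simp add: power2_eq_square)
 have e: "\<bar>x1 * x2 + x2 * x3 + x1 * x3\<bar> \<le> 12 * r\<^sup>2"
  using pr[OF x(1,2)] pr[OF x(2,3)] pr[OF x(1,3)] by linarith
 have "sqrt (3 + z) = sqrt 3 * sqrt (1 + 2 * (z / 6))" by (simp flip: real_sqrt_mult)
 moreover have "(1 + x1) * (1 + x2) + (1 + x2) * (1 + x3) + (1 + x1) * (1 + x3)
   = 3 + 2 * (x1 + x2 + x3) + (x1 * x2 + x2 * x3 + x1 * x3)" by (simp add: algebra_simps)
 moreover have "(3 + 2 * (x1 + x2 + x3) + (x1 * x2 + x2 * x3 + x1 * x3)) * sqrt (1 + 2 * (z / 6))
  \<ge> 3 + 2 * (x1 + x2 + x3) + 3 * (z / 6) + (x1 * x2 + x2 * x3 + x1 * x3) + 2 * (x1 + x2 + x3) * (z / 6) - 3 / 2 * (z / 6)\<^sup>2 - 12 * r^3"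
  by (rule weighted_sqrt_lower_bound) (use r x z e in \<open>auto simp: abs_le_iff\<close>)
 then have "sqrt 3 * ((3 + 2 * (x1 + x2 + x3) + (x1 * x2 + x2 * x3 + x1 * x3)) * sqrt (1 + 2 * (z / 6)))
  \<ge> sqrt 3 * (3 + 2 * (x1 + x2 + x3) + z / 2 + (x1 * x2 + x2 * x3 + x1 * x3) + 2 * (x1 + x2 + x3) * (z / 6) - 3 / 2 * (z / 6)\<^sup>2 - 12 * r^3)"
  by (intro mult_left_mono) (simp_all)
 ultimately show ?thesis by (simp add: mult_ac)
qed

text \<open>The four weights under the root form two opposite pairs, whose half-sums add up to minus
  the third one; this is the origin of \<open>- 2 * z\<close>.\<close>

lemma square_term_bound:
 fixes x y z r :: real
 assumes r: "0 \<le> r" "r \<le> 1/100" and x: "\<bar>x\<bar> \<le> r" "\<bar>y\<bar> \<le> r" and z: "\<bar>z\<bar> \<le> r"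
 shows "(1 + x + y) * (1 + x - y) * sqrt (4 - 2 * z)
   \<ge> 2 * (1 + 2 * x + (x\<^sup>2 - y\<^sup>2) - z / 4 - x * z / 2 - z\<^sup>2 / 32 - 12 * r^3)"
proof -
 have "x\<^sup>2 \<le> r\<^sup>2" "y\<^sup>2 \<le> r\<^sup>2" using power_mono[OF x(1), of 2] power_mono[OF x(2), of 2] by auto
 then have e: "\<bar>x\<^sup>2 - y\<^sup>2\<bar> \<le> 12 * r\<^sup>2" using zero_le_power2[of x] zero_le_power2[of y] by linarith
 have "sqrt (4 - 2 * z) = sqrt (4 * (1 + 2 * (- z / 4)))" by simp
 also have "\<dots> = 2 * sqrt (1 + 2 * (- z / 4))" unfolding real_sqrt_mult by simp
 finally have sq: "sqrt (4 - 2 * z) = 2 * sqrt (1 + 2 * (- z / 4))" .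
 have p: "(1 + x + y) * (1 + x - y) = 1 + 2 * x + (x\<^sup>2 - y\<^sup>2)" by (simp add: power2_eq_square algebra_simps)
 have "(1 + 2 * x + (x\<^sup>2 - y\<^sup>2)) * sqrt (1 + 2 * (- z / 4))
  \<ge> 1 + 2 * x + 1 * (- z / 4) + (x\<^sup>2 - y\<^sup>2) + 2 * x * (- z / 4) - 1 / 2 * (- z / 4)\<^sup>2 - 12 * r^3"
  by (rule weighted_sqrt_lower_bound) (use r x z e in \<open>auto simp: abs_le_iff\<close>)
 moreover have "1 + 2 * x + 1 * (- z / 4) + (x\<^sup>2 - y\<^sup>2) + 2 * x * (- z / 4) - 1 / 2 * (- z / 4)\<^sup>2 - 12 * r^3
   = 1 + 2 * x + (x\<^sup>2 - y\<^sup>2) - z / 4 - x * z / 2 - z\<^sup>2 / 32 - 12 * r^3"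
  by (simp add: power2_eq_square field_simps)
 ultimately show ?thesis unfolding sq p by (simp add: mult_ac)
qed

text \<open>Over the four hexagonal terms the signs of each \<open>h\<close> and each
  \<open>H\<close> balance, so linear terms and mixed products with different indices cancel. The
  four errors with factor \<open>sqrt 3\<close> and the three with factor 2 amount to at most
  \<open>88 * r^3\<close> and \<open>72 * r^3\<close>.\<close>

lemma area_sum_lower_bound:
 fixes m1 m2 m3 h1 h2 h3 M1 M2 M3 H1 H2 H3 r :: real
 assumes m0: "m1 + m2 + m3 = 0" and M0: "M1 + M2 + M3 = 0" and r: "0 \<le> r" "r \<le> 1/100"
  and m: "\<bar>m1\<bar> \<le> r" "\<bar>m2\<bar> \<le> r" "\<bar>m3\<bar> \<le> r" and h: "\<bar>h1\<bar> \<le> r" "\<bar>h2\<bar> \<le> r" "\<bar>h3\<bar> \<le> r"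
  and M: "\<bar>M1\<bar> \<le> r" "\<bar>M2\<bar> \<le> r" "\<bar>M3\<bar> \<le> r" and H: "\<bar>H1\<bar> \<le> r" "\<bar>H2\<bar> \<le> r" "\<bar>H3\<bar> \<le> r"
 shows "area_sum (1 + m1 + h1) (1 + m2 + h2) (1 + m3 + h3) (1 + m1 - h1) (1 + m2 - h2) (1 + m3 - h3)
   (1 + M1 + H1) (1 + M2 + H2) (1 + M3 + H3) (1 + M1 - H1) (1 + M2 - H2) (1 + M3 - H3)
  \<ge> 12 * sqrt 3 + 6
   + sqrt 3 * (- 2 * (m1\<^sup>2 + m2\<^sup>2 + m3\<^sup>2) - 4/3 * (h1 * H1 + h2 * H2 + h3 * H3) - (H1\<^sup>2 + H2\<^sup>2 + H3\<^sup>2) / 6)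
   + 2 * (m1\<^sup>2 + m2\<^sup>2 + m3\<^sup>2) - 2 * (h1\<^sup>2 + h2\<^sup>2 + h3\<^sup>2) - (m1 * M1 + m2 * M2 + m3 * M3) - (M1\<^sup>2 + M2\<^sup>2 + M3\<^sup>2) / 16
   - 160 * r^3"
proof -
 have b: "m1 \<le> r" "- m1 \<le> r" "m2 \<le> r" "- m2 \<le> r" "m3 \<le> r" "- m3 \<le> r"
  "h1 \<le> r" "- h1 \<le> r" "h2 \<le> r" "- h2 \<le> r" "h3 \<le> r" "- h3 \<le> r"
  "H1 \<le> r" "- H1 \<le> r" "H2 \<le> r" "- H2 \<le> r" "H3 \<le> r" "- H3 \<le> r"
  using m h H unfolding abs_le_iff by blast+
 define u where "u x1 x2 x3 z = 3 + 2 * (x1 + x2 + x3) + z / 2 + (x1 * x2 + x2 * x3 + x1 * x3)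
  + 2 * (x1 + x2 + x3) * (z / 6) - 3/2 * (z / 6)\<^sup>2 - 12 * r^3" for x1 x2 x3 z
 define w where "w x y z = 2 * (1 + 2 * x + (x\<^sup>2 - y\<^sup>2) - z / 4 - x * z / 2 - z\<^sup>2 / 32 - 12 * r^3)" for x y z
 have t0: "((1 + (m1 - h1)) * (1 + (m2 - h2)) + (1 + (m2 - h2)) * (1 + (m3 - h3)) + (1 + (m1 - h1)) * (1 + (m3 - h3))) * sqrt (3 + (H1 + H2 + H3))
   \<ge> sqrt 3 * u (m1 - h1) (m2 - h2) (m3 - h3) (H1 + H2 + H3)"
  unfolding u_def by (intro hexagon_term_bound abs_leI) (use r b m0 in linarith)+
 have t1: "((1 + (m1 - h1)) * (1 + (m2 + h2)) + (1 + (m2 + h2)) * (1 + (m3 + h3)) + (1 + (m1 - h1)) * (1 + (m3 + h3))) * sqrt (3 + (H1 - H2 - H3))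
   \<ge> sqrt 3 * u (m1 - h1) (m2 + h2) (m3 + h3) (H1 - H2 - H3)"
  unfolding u_def by (intro hexagon_term_bound abs_leI) (use r b m0 in linarith)+
 have t2: "((1 + (m1 + h1)) * (1 + (m2 - h2)) + (1 + (m2 - h2)) * (1 + (m3 + h3)) + (1 + (m1 + h1)) * (1 + (m3 + h3))) * sqrt (3 + (- H1 + H2 - H3))
   \<ge> sqrt 3 * u (m1 + h1) (m2 - h2) (m3 + h3) (- H1 + H2 - H3)"
  unfolding u_def by (intro hexagon_term_bound abs_leI) (use r b m0 in linarith)+
 have t3: "((1 + (m1 + h1)) * (1 + (m2 + h2)) + (1 + (m2 + h2)) * (1 + (m3 - h3)) + (1 + (m1 + h1)) * (1 + (m3 - h3))) * sqrt (3 + (- H1 - H2 + H3))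
   \<ge> sqrt 3 * u (m1 + h1) (m2 + h2) (m3 - h3) (- H1 - H2 + H3)"
  unfolding u_def by (intro hexagon_term_bound abs_leI) (use r b m0 in linarith)+
 have q1: "(1 + m1 + h1) * (1 + m1 - h1) * sqrt (4 - 2 * M1) \<ge> w m1 h1 M1"
  and q2: "(1 + m2 + h2) * (1 + m2 - h2) * sqrt (4 - 2 * M2) \<ge> w m2 h2 M2"
  and q3: "(1 + m3 + h3) * (1 + m3 - h3) * sqrt (4 - 2 * M3) \<ge> w m3 h3 M3"
  unfolding w_def by (intro square_term_bound r m h M)+
 have eqs: "1 + M1 + H1 + (1 + M2 + H2) + (1 + M3 + H3) = 3 + (H1 + H2 + H3)"
  "1 + M1 + H1 + (1 + M2 - H2) + (1 + M3 - H3) = 3 + (H1 - H2 - H3)"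
  "1 + M1 - H1 + (1 + M2 + H2) + (1 + M3 - H3) = 3 + (- H1 + H2 - H3)"
  "1 + M1 - H1 + (1 + M2 - H2) + (1 + M3 + H3) = 3 + (- H1 - H2 + H3)"
  "1 + M2 + H2 + (1 + M2 - H2) + (1 + M3 + H3) + (1 + M3 - H3) = 4 - 2 * M1"
  "1 + M1 + H1 + (1 + M1 - H1) + (1 + M3 + H3) + (1 + M3 - H3) = 4 - 2 * M2"
  "1 + M1 + H1 + (1 + M1 - H1) + (1 + M2 + H2) + (1 + M2 - H2) = 4 - 2 * M3"
  using M0 by linarith+
 have "area_sum (1 + m1 + h1) (1 + m2 + h2) (1 + m3 + h3) (1 + m1 - h1) (1 + m2 - h2) (1 + m3 - h3)
   (1 + M1 + H1) (1 + M2 + H2) (1 + M3 + H3) (1 + M1 - H1) (1 + M2 - H2) (1 + M3 - H3)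
  \<ge> sqrt 3 * u (m1 - h1) (m2 - h2) (m3 - h3) (H1 + H2 + H3) + sqrt 3 * u (m1 - h1) (m2 + h2) (m3 + h3) (H1 - H2 - H3)
   + sqrt 3 * u (m1 + h1) (m2 - h2) (m3 + h3) (- H1 + H2 - H3) + sqrt 3 * u (m1 + h1) (m2 + h2) (m3 - h3) (- H1 - H2 + H3)
   + w m1 h1 M1 + w m2 h2 M2 + w m3 h3 M3"
 proof -
  have "area_sum (1 + m1 + h1) (1 + m2 + h2) (1 + m3 + h3) (1 + m1 - h1) (1 + m2 - h2) (1 + m3 - h3)
   (1 + M1 + H1) (1 + M2 + H2) (1 + M3 + H3) (1 + M1 - H1) (1 + M2 - H2) (1 + M3 - H3)
   = ((1 + (m1 - h1)) * (1 + (m2 - h2)) + (1 + (m2 - h2)) * (1 + (m3 - h3)) + (1 + (m1 - h1)) * (1 + (m3 - h3))) * sqrt (3 + (H1 + H2 + H3))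
   + ((1 + (m1 - h1)) * (1 + (m2 + h2)) + (1 + (m2 + h2)) * (1 + (m3 + h3)) + (1 + (m1 - h1)) * (1 + (m3 + h3))) * sqrt (3 + (H1 - H2 - H3))
   + ((1 + (m1 + h1)) * (1 + (m2 - h2)) + (1 + (m2 - h2)) * (1 + (m3 + h3)) + (1 + (m1 + h1)) * (1 + (m3 + h3))) * sqrt (3 + (- H1 + H2 - H3))
   + ((1 + (m1 + h1)) * (1 + (m2 + h2)) + (1 + (m2 + h2)) * (1 + (m3 - h3)) + (1 + (m1 + h1)) * (1 + (m3 - h3))) * sqrt (3 + (- H1 - H2 + H3))
   + (1 + m1 + h1) * (1 + m1 - h1) * sqrt (4 - 2 * M1) + (1 + m2 + h2) * (1 + m2 - h2) * sqrt (4 - 2 * M2)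
   + (1 + m3 + h3) * (1 + m3 - h3) * sqrt (4 - 2 * M3)"
   unfolding area_sum_def eqs by (simp only: add_diff_eq add.assoc)
  then show ?thesis using t0 t1 t2 t3 q1 q2 q3 by linarith
 qed
 moreover have "sqrt 3 * u (m1 - h1) (m2 - h2) (m3 - h3) (H1 + H2 + H3) + sqrt 3 * u (m1 - h1) (m2 + h2) (m3 + h3) (H1 - H2 - H3)
   + sqrt 3 * u (m1 + h1) (m2 - h2) (m3 + h3) (- H1 + H2 - H3) + sqrt 3 * u (m1 + h1) (m2 + h2) (m3 - h3) (- H1 - H2 + H3)
   = sqrt 3 * (12 - 2 * (m1\<^sup>2 + m2\<^sup>2 + m3\<^sup>2) - 4/3 * (h1 * H1 + h2 * H2 + h3 * H3) - (H1\<^sup>2 + H2\<^sup>2 + H3\<^sup>2) / 6 - 48 * r^3)"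
 proof -
  have m3: "m3 = - m1 - m2" using m0 by simp
  have "u (m1 - h1) (m2 - h2) (m3 - h3) (H1 + H2 + H3) + u (m1 - h1) (m2 + h2) (m3 + h3) (H1 - H2 - H3)
   + u (m1 + h1) (m2 - h2) (m3 + h3) (- H1 + H2 - H3) + u (m1 + h1) (m2 + h2) (m3 - h3) (- H1 - H2 + H3)
   = 12 - 2 * (m1\<^sup>2 + m2\<^sup>2 + m3\<^sup>2) - 4/3 * (h1 * H1 + h2 * H2 + h3 * H3) - (H1\<^sup>2 + H2\<^sup>2 + H3\<^sup>2) / 6 - 48 * r^3"
   unfolding u_def m3 by (simp add: power2_eq_square field_simps)
  then show ?thesis by (metis distrib_left)
 qed
 moreover have "w m1 h1 M1 + w m2 h2 M2 + w m3 h3 M3 = 6 + 2 * (m1\<^sup>2 + m2\<^sup>2 + m3\<^sup>2) - 2 * (h1\<^sup>2 + h2\<^sup>2 + h3\<^sup>2)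
   - (m1 * M1 + m2 * M2 + m3 * M3) - (M1\<^sup>2 + M2\<^sup>2 + M3\<^sup>2) / 16 - 72 * r^3"
 proof -
  have m3: "m3 = - m1 - m2" "M3 = - M1 - M2" using m0 M0 by simp_all
  show ?thesis unfolding w_def m3 by (simp add: power2_eq_square field_simps)
 qed
 moreover have "sqrt 3 * (48 * r^3) \<le> 88 * r^3"
 proof -
  have "sqrt 3 \<le> 87/50" using sqrt3_bounds(2) by simp
  then have "sqrt 3 * (48 * r^3) \<le> 87/50 * (48 * r^3)" using r by (intro mult_right_mono) simp_all
  moreover have "0 \<le> r^3" using r by simp
  ultimately show ?thesis by linarith
 qed
 ultimately show ?thesis by (simp add: algebra_simps)
qed

text \<open>Up to a constant the isoperimetric quotient is the area sum over \<open>D\<close>,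
  divided by \<open>(p / D) powr (2/3)\<close>, where \<open>D = sqrt g\<close>; this explains the
  exponents 2/3 and 1/6. Both sides agree at the symmetric point, and the quadratic terms are
  compared by \<open>form_m\<close> and \<open>form_h\<close>.\<close>

lemma isoperimetric_inequality_near_one:
 fixes m1 m2 m3 h1 h2 h3 M1 M2 M3 H1 H2 H3 r :: real
 assumes m0: "m1 + m2 + m3 = 0" and M0: "M1 + M2 + M3 = 0" and r: "0 \<le> r" "r \<le> 1/100000"
  and rr: "r\<^sup>2 = (m1\<^sup>2 + m2\<^sup>2 + m3\<^sup>2 + (h1\<^sup>2 + h2\<^sup>2 + h3\<^sup>2)) + (M1\<^sup>2 + M2\<^sup>2 + M3\<^sup>2 + (H1\<^sup>2 + H2\<^sup>2 + H3\<^sup>2))"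
 defines "p \<equiv> tree_sum (1 + m1 + h1) (1 + m2 + h2) (1 + m3 + h3) (1 + m1 - h1) (1 + m2 - h2) (1 + m3 - h3)"
  and "g \<equiv> tree_sum (1 + M1 + H1) (1 + M2 + H2) (1 + M3 + H3) (1 + M1 - H1) (1 + M2 - H2) (1 + M3 - H3)"
 shows "p > 0" "g > 0" "(12 * sqrt 3 + 6 + r\<^sup>2 / 50) * ((p / 16) powr (2/3) * (g / 16) powr (1/6))
  \<le> area_sum (1 + m1 + h1) (1 + m2 + h2) (1 + m3 + h3) (1 + m1 - h1) (1 + m2 - h2) (1 + m3 - h3)
   (1 + M1 + H1) (1 + M2 + H2) (1 + M3 + H3) (1 + M1 - H1) (1 + M2 - H2) (1 + M3 - H3)"
proof -
 have r': "r \<le> 1/100" using r by simp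
 have le: "\<bar>x\<bar> \<le> r" if "x\<^sup>2 \<le> r\<^sup>2" for x using that r abs_le_square_iff[of x r] by simp
 note sq = zero_le_power2[of m1] zero_le_power2[of m2] zero_le_power2[of m3] zero_le_power2[of h1] zero_le_power2[of h2] zero_le_power2[of h3]
  zero_le_power2[of M1] zero_le_power2[of M2] zero_le_power2[of M3] zero_le_power2[of H1] zero_le_power2[of H2] zero_le_power2[of H3]
 have m: "\<bar>m1\<bar> \<le> r" "\<bar>m2\<bar> \<le> r" "\<bar>m3\<bar> \<le> r" and h: "\<bar>h1\<bar> \<le> r" "\<bar>h2\<bar> \<le> r" "\<bar>h3\<bar> \<le> r"
  and M: "\<bar>M1\<bar> \<le> r" "\<bar>M2\<bar> \<le> r" "\<bar>M3\<bar> \<le> r" and H: "\<bar>H1\<bar> \<le> r" "\<bar>H2\<bar> \<le> r" "\<bar>H3\<bar> \<le> r"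
  by (rule le; use rr sq in linarith)+
 have s: "m1\<^sup>2 + m2\<^sup>2 + m3\<^sup>2 + (h1\<^sup>2 + h2\<^sup>2 + h3\<^sup>2) \<le> r\<^sup>2" "M1\<^sup>2 + M2\<^sup>2 + M3\<^sup>2 + (H1\<^sup>2 + H2\<^sup>2 + H3\<^sup>2) \<le> r\<^sup>2"
  using rr sq by linarith+
 define X Y where "X = p / 16 - 1" and "Y = g / 16 - 1"
 define pm ph PM PH where "pm = m1\<^sup>2 + m2\<^sup>2 + m3\<^sup>2" and "ph = h1\<^sup>2 + h2\<^sup>2 + h3\<^sup>2"
  and "PM = M1\<^sup>2 + M2\<^sup>2 + M3\<^sup>2" and "PH = H1\<^sup>2 + H2\<^sup>2 + H3\<^sup>2"
 have X: "X \<le> - pm / 8 - ph / 4 + r^3" "\<bar>X\<bar> \<le> r\<^sup>2"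
  using tree_sum_bounds[OF m0 r(1) r' s(1) m h] unfolding X_def p_def pm_def ph_def by blast+
 have Y: "Y \<le> - PM / 8 - PH / 4 + r^3" "\<bar>Y\<bar> \<le> r\<^sup>2"
  using tree_sum_bounds[OF M0 r(1) r' s(2) M H] unfolding Y_def g_def PM_def PH_def by blast+
 have r2: "r\<^sup>2 \<le> 1/100000" using mult_mono[OF r(2) r(2)] r by (simp add: power2_eq_square)
 have xb: "- (1/100000) \<le> X" "X \<le> 1/100000" "- (1/100000) \<le> Y" "Y \<le> 1/100000"
  using X(2) Y(2) r2 unfolding abs_le_iff by linarith+
 show p0: "p > 0" and g0: "g > 0" using xb unfolding X_def Y_def by simp_all
 have P: "(p / 16) powr (2/3) \<le> 1 + 2/3 * X" using powr_le_Bernoulli[of "p / 16" "2/3"] p0 by (simp add: X_def)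
 have G: "(g / 16) powr (1/6) \<le> 1 + 1/6 * Y" using powr_le_Bernoulli[of "g / 16" "1/6"] g0 by (simp add: Y_def)
 have nn: "0 \<le> 1 + 2/3 * X" "0 \<le> 1 + 1/6 * Y" using xb by linarith+
 have XY: "X * Y \<le> r\<^sup>2 * r\<^sup>2"
  using mult_mono[OF X(2) Y(2)] abs_ge_self[of "X * Y"] by (simp add: abs_mult)
 have r4: "r\<^sup>2 * r\<^sup>2 \<le> (1/100000) * r^3"
  using mult_right_mono[OF r(2), of "r^3"] r by (simp add: power2_eq_square power3_eq_cube mult.assoc)
 have r3: "0 \<le> r^3" "r^3 \<le> 1/100000 * r\<^sup>2"
  using r mult_right_mono[OF r(2), of "r\<^sup>2"] by (simp_all add: power2_eq_square power3_eq_cube mult.assoc)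
 define Z where "Z = - (pm / 12 + ph / 6 + PM / 48 + PH / 24) + r^3"
 have prod: "(p / 16) powr (2/3) * (g / 16) powr (1/6) \<le> 1 + Z"
 proof -
  have "(p / 16) powr (2/3) * (g / 16) powr (1/6) \<le> (1 + 2/3 * X) * (1 + 1/6 * Y)"
   using P G nn by (intro mult_mono) auto
  also have "\<dots> = 1 + 2/3 * X + 1/6 * Y + 1/9 * (X * Y)" by (simp add: field_simps)
  also have "\<dots> \<le> 1 + Z" unfolding Z_def using X(1) Y(1) XY r4 r3(1) by linarith
  finally show ?thesis .
 qed
 let ?U = "12 * sqrt 3 + 6"
 have U: "0 \<le> ?U" "?U \<le> 27" using sqrt3_bounds by auto
 have pos: "0 \<le> pm" "0 \<le> ph" "0 \<le> PM" "0 \<le> PH" using sq by (simp_all add: pm_def ph_def PM_def PH_def)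
 have Z1: "Z \<le> 1" using pos r3 r2 unfolding Z_def by linarith
 have "(?U + r\<^sup>2 / 50) * ((p / 16) powr (2/3) * (g / 16) powr (1/6)) \<le> (?U + r\<^sup>2 / 50) * (1 + Z)"
  using prod U by (intro mult_left_mono) auto
 also have "\<dots> = ?U + ?U * Z + r\<^sup>2 / 50 * (1 + Z)" by (simp add: algebra_simps)
 also have "\<dots> \<le> ?U + ?U * Z + r\<^sup>2 / 50 * 2" using Z1 by (intro add_left_mono mult_left_mono) auto
 also have "?U * Z = - (?U * (pm / 12 + ph / 6 + PM / 48 + PH / 24)) + ?U * r^3" by (simp add: Z_def algebra_simps)
 also have "?U * r^3 \<le> 27 * r^3" using U r3(1) by (intro mult_right_mono) auto
 finally have 1: "(?U + r\<^sup>2 / 50) * ((p / 16) powr (2/3) * (g / 16) powr (1/6))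
   \<le> ?U - ?U * (pm / 12 + ph / 6 + PM / 48 + PH / 24) + 27 * r^3 + r\<^sup>2 / 25" by simp
 define mM hH where "mM = m1 * M1 + m2 * M2 + m3 * M3" and "hH = h1 * H1 + h2 * H2 + h3 * H3"
 have F: "(5/2 - sqrt 3) * pm - mM + (sqrt 3 / 4 + 1/16) * PM \<ge> 1/20 * pm + 1/20 * PM"
  using form_m[of m1 M1] form_m[of m2 M2] form_m[of m3 M3] unfolding pm_def PM_def mM_def distrib_left by linarith
 have G: "(2 * sqrt 3 - 1) * ph - 4/3 * sqrt 3 * hH + (sqrt 3 / 3 + 1/4) * PH \<ge> 1/20 * ph + 1/20 * PH"
  using form_h[of h1 H1] form_h[of h2 H2] form_h[of h3 H3] unfolding ph_def PH_def hH_def distrib_left by linarith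
 have A: "area_sum (1 + m1 + h1) (1 + m2 + h2) (1 + m3 + h3) (1 + m1 - h1) (1 + m2 - h2) (1 + m3 - h3)
   (1 + M1 + H1) (1 + M2 + H2) (1 + M3 + H3) (1 + M1 - H1) (1 + M2 - H2) (1 + M3 - H3)
  \<ge> ?U + sqrt 3 * (- 2 * pm - 4/3 * hH - PH / 6) + 2 * pm - 2 * ph - mM - PM / 16 - 160 * r^3"
  using area_sum_lower_bound[OF m0 M0 r(1) r' m h M H] unfolding pm_def ph_def PM_def PH_def mM_def hH_def .
 \<comment> \<open>Grouping by opposite pairs exhibits the binary forms; their margin
   \<open>1/20 * r^2\<close> pays for \<open>r^2 / 25\<close> and for the cubic errors with
   coefficients 160 and 27.\<close>
 have Q: "sqrt 3 * (- 2 * pm - 4/3 * hH - PH / 6) + 2 * pm - 2 * ph - mM - PM / 16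
   + ?U * (pm / 12 + ph / 6 + PM / 48 + PH / 24)
   = ((5/2 - sqrt 3) * pm - mM + (sqrt 3 / 4 + 1/16) * PM) + ((2 * sqrt 3 - 1) * ph - 4/3 * sqrt 3 * hH + (sqrt 3 / 3 + 1/4) * PH)"
  by (simp add: field_simps)
 have rp: "r\<^sup>2 = pm + ph + PM + PH" using rr unfolding pm_def ph_def PM_def PH_def by linarith
 have "r\<^sup>2 / 25 + 187 * r^3 \<le> 1/20 * r\<^sup>2" using r3 by linarith
 also have "\<dots> = 1/20 * pm + 1/20 * PM + (1/20 * ph + 1/20 * PH)" unfolding rp by simp
 also have "\<dots> \<le> sqrt 3 * (- 2 * pm - 4/3 * hH - PH / 6) + 2 * pm - 2 * ph - mM - PM / 16
   + ?U * (pm / 12 + ph / 6 + PM / 48 + PH / 24)" unfolding Q using F G by linarith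
 finally have 2: "r\<^sup>2 / 25 + 187 * r^3 \<le> sqrt 3 * (- 2 * pm - 4/3 * hH - PH / 6) + 2 * pm - 2 * ph - mM - PM / 16
   + ?U * (pm / 12 + ph / 6 + PM / 48 + PH / 24)" .
 define W1 W2 where "W1 = sqrt 3 * (- 2 * pm - 4/3 * hH - PH / 6)" and "W2 = ?U * (pm / 12 + ph / 6 + PM / 48 + PH / 24)"
 show "(?U + r\<^sup>2 / 50) * ((p / 16) powr (2/3) * (g / 16) powr (1/6))
  \<le> area_sum (1 + m1 + h1) (1 + m2 + h2) (1 + m3 + h3) (1 + m1 - h1) (1 + m2 - h2) (1 + m3 - h3)
   (1 + M1 + H1) (1 + M2 + H2) (1 + M3 + H3) (1 + M1 - H1) (1 + M2 - H2) (1 + M3 - H3)"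
  using 1 2 A unfolding W1_def[symmetric] W2_def[symmetric] by linarith
qed

section \<open>Facets of nearby parallelohedra\<close>

datatype label = L0 | L1 | L2 | L3

lemma UNIV_label: "UNIV = {L0, L1, L2, L3}"
 by (auto intro: label.exhaust)

instance label :: finite
 by standard (simp add: UNIV_label)

lemma card_label: "card (UNIV :: label set) = 4"
 by (simp add: UNIV_label)

definition cuts :: "label set set" where "cuts = UNIV - {{}, UNIV}"

lemma finite_cuts: "finite cuts"
 by simp

lemma card_cuts: "card cuts = 14"
proof -
 have "card (UNIV :: label set set) = 16" using card_Pow[of "UNIV :: label set"] by (simp add: card_label)
 then show ?thesis unfolding cuts_def by (subst card_Diff_subset) auto
qed

lemma four_distinct:
 assumes "{i, j, m, l} = (UNIV :: label set)"
 shows "i \<noteq> j" "i \<noteq> m" "i \<noteq> l" "j \<noteq> m" "j \<noteq> l" "m \<noteq> l"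
proof -
 have "card {i, j, m, l} = 4" using assms card_label by simp
 then show "i \<noteq> j" "i \<noteq> m" "i \<noteq> l" "j \<noteq> m" "j \<noteq> l" "m \<noteq> l"
  by (auto simp: card_insert_if split: if_splits)
qed

lemma cuts_cases:
 assumes "{i, j, m, l} = (UNIV :: label set)" "S \<in> cuts"
 shows "S \<in> {{i}, {j}, {m}, {l}, {i,j}, {i,m}, {i,l}, {j,m}, {j,l}, {m,l}, {i,j,m}, {i,j,l}, {i,m,l}, {j,m,l}}"
proof -
 define X where "X b1 b2 b3 b4 = (if b1 then {i} else {}) \<union> ((if b2 then {j} else {})
  \<union> ((if b3 then {m} else {}) \<union> (if b4 then {l} else {})))" for b1 b2 b3 b4
 have "S = X (i \<in> S) (j \<in> S) (m \<in> S) (l \<in> S)"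
  using assms(1) unfolding X_def by (auto split: if_splits)
 moreover have "X b1 b2 b3 b4 \<in> {{i}, {j}, {m}, {l}, {i,j}, {i,m}, {i,l}, {j,m}, {j,l}, {m,l}, {i,j,m}, {i,j,l}, {i,m,l}, {j,m,l}}
   \<or> X b1 b2 b3 b4 = {} \<or> X b1 b2 b3 b4 = {i, j, m, l}" for b1 b2 b3 b4
  by (cases b1; cases b2; cases b3; cases b4) (simp_all add: X_def insert_commute)
 ultimately show ?thesis using assms by (metis DiffD2 cuts_def insert_iff)
qed

lemma complement_cut: "S \<in> cuts \<Longrightarrow> - S \<in> cuts"
 by (auto simp: cuts_def)

lemma cut_in:
 assumes "{i, j, m, l} = (UNIV :: label set)"
 shows "{i} \<in> cuts" "{i, j} \<in> cuts" "{i, j, m} \<in> cuts"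
proof -
 have "l \<notin> {i, j, m}" "m \<notin> {i, j}" using four_distinct[OF assms] by auto
 then show "{i} \<in> cuts" "{i, j} \<in> cuts" "{i, j, m} \<in> cuts" unfolding cuts_def by blast+
qed

locale to_frame =
 fixes v :: "label \<Rightarrow> real^3" and k :: real
 assumes k: "k > 0" and sum0: "v L0 + v L1 + v L2 + v L3 = 0"
  and gram: "\<And>i j. v i \<bullet> v j = (if i = j then 3 * k else - k)"
begin

definition "vS S = sum v S"
definition "bS S = (vS S \<bullet> vS S) / 2"

lemma sum_UNIV: "sum v UNIV = 0"
 unfolding UNIV_label using sum0 by (simp add: add.assoc)

lemma sum0': "{i, j, m, l} = UNIV \<Longrightarrow> v i + v j + v m + v l = 0"
proof -
 assume a: "{i, j, m, l} = (UNIV :: label set)"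
 have "sum v {i, j, m, l} = v i + v j + v m + v l" using four_distinct[OF a] by (simp add: add.assoc)
 then show ?thesis using sum_UNIV a by simp
qed

lemma vS_complement: "vS (- S) = - vS S"
proof -
 have "sum v UNIV = sum v (- S) + sum v S"
  using sum.subset_diff[of S UNIV v] by (simp add: Compl_eq_Diff_UNIV)
 then show ?thesis using sum_UNIV by (simp add: vS_def eq_neg_iff_add_eq_0)
qed

lemma bS_complement: "bS (- S) = bS S"
 by (simp add: bS_def vS_complement)

lemma vS_values:
 assumes "{i, j, m, l} = UNIV"
 shows "vS {i} = v i" "vS {i, j} = v i + v j" "vS {i, j, m} = - v l" "vS {m, l} = - (v i + v j)"
proof -
 note d = four_distinct[OF assms]
 show "vS {i} = v i" "vS {i, j} = v i + v j" using d by (simp_all add: vS_def)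
 have "vS {i, j, m} = v i + v j + v m" "vS {m, l} = v m + v l" using d by (simp_all add: vS_def add.assoc)
 then show "vS {i, j, m} = - v l" "vS {m, l} = - (v i + v j)"
  using sum0'[OF assms] by (simp_all add: eq_neg_iff_add_eq_0 algebra_simps)
qed

lemma perm4:
 assumes "{i, j, m, l} = UNIV"
 shows "{j, i, m, l} = UNIV" "{m, j, i, l} = UNIV" "{l, j, m, i} = UNIV"
  "{i, m, j, l} = UNIV" "{i, l, m, j} = UNIV" "{i, j, l, m} = UNIV"
  "{j, m, i, l} = UNIV" "{m, l, i, j} = UNIV" "{j, l, i, m} = UNIV"
  "{m, i, l, j} = UNIV" "{l, i, m, j} = UNIV"
 unfolding assms[symmetric] by (simp_all add: insert_commute)

lemma gram4:
 assumes a: "{i, j, m, l} = UNIV"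
 shows "v i \<bullet> v i = 3 * k" "v j \<bullet> v j = 3 * k" "v m \<bullet> v m = 3 * k" "v l \<bullet> v l = 3 * k"
  "v i \<bullet> v j = - k" "v j \<bullet> v i = - k" "v i \<bullet> v m = - k" "v m \<bullet> v i = - k" "v i \<bullet> v l = - k" "v l \<bullet> v i = - k"
  "v j \<bullet> v m = - k" "v m \<bullet> v j = - k" "v j \<bullet> v l = - k" "v l \<bullet> v j = - k" "v m \<bullet> v l = - k" "v l \<bullet> v m = - k"
 using four_distinct[OF a] by (simp_all add: gram)

lemma bS_values:
 assumes a: "{i, j, m, l} = UNIV"
 shows "bS {i} = 3/2 * k" "bS {i, j} = 2 * k" "bS {i, j, m} = 3/2 * k"
 unfolding bS_def vS_values[OF a] by (simp_all add: inner_add gram4[OF a])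

lemma bS_pos: "S \<in> cuts \<Longrightarrow> bS S > 0"
proof -
 have id: "{L0, L1, L2, L3} = UNIV" by (simp add: UNIV_label)
 assume "S \<in> cuts"
 from cuts_cases[OF id this] show ?thesis
  using k bS_values[OF id] bS_values[OF perm4(1)[OF id]] bS_values[OF perm4(2)[OF id]] bS_values[OF perm4(3)[OF id]]
   bS_values[OF perm4(4)[OF id]] bS_values[OF perm4(5)[OF id]] bS_values[OF perm4(6)[OF id]]
   bS_values[OF perm4(7)[OF id]] bS_values[OF perm4(8)[OF id]] bS_values[OF perm4(9)[OF id]]
   bS_values[OF perm4(10)[OF id]]
  by (auto simp: insert_commute)
qed

text \<open>The \<open>v i\<close> form a tight frame, so a vector is recovered from its four inner
  products without singling out a basis. The difference of both sides is orthogonal to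
  \<open>v L0 + v L1\<close>, \<open>v L0 + v L2\<close>, \<open>v L0 + v L3\<close>, which are
  pairwise orthogonal.\<close>

lemma tight_frame:
 "w = (1 / (4 * k)) *R ((v L0 \<bullet> w) *R v L0 + (v L1 \<bullet> w) *R v L1 + (v L2 \<bullet> w) *R v L2 + (v L3 \<bullet> w) *R v L3)"
proof -
 let ?u = "(1 / (4 * k)) *R ((v L0 \<bullet> w) *R v L0 + (v L1 \<bullet> w) *R v L1 + (v L2 \<bullet> w) *R v L2 + (v L3 \<bullet> w) *R v L3)"
 let ?d = "w - ?u"
 have id: "{L0, L1, L2, L3} = UNIV" by (simp add: UNIV_label)
 note g = gram4[OF id]
 have s: "v L0 \<bullet> w + v L1 \<bullet> w + v L2 \<bullet> w + v L3 \<bullet> w = 0"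
  using sum0 by (simp flip: inner_add_left)
 have w0: "v L0 \<bullet> w = - (v L1 \<bullet> w) - (v L2 \<bullet> w) - (v L3 \<bullet> w)" using s by linarith
 have d: "v L0 \<bullet> ?d = 0" "v L1 \<bullet> ?d = 0" "v L2 \<bullet> ?d = 0" "v L3 \<bullet> ?d = 0"
  using k by (simp_all add: inner_diff_right inner_add_right g w0 field_simps)
 have "?d = 0"
 proof (rule orthogonal_three_imp_zero[of "v L0 + v L1" "v L0 + v L2" "v L0 + v L3"])
  have "(v L0 + v i) \<bullet> (v L0 + v i) \<noteq> 0" if "i \<noteq> L0" for i
   using that k by (simp add: inner_add gram)
  then show "v L0 + v L1 \<noteq> 0" "v L0 + v L2 \<noteq> 0" "v L0 + v L3 \<noteq> 0" by force+
  show "(v L0 + v L1) \<bullet> (v L0 + v L2) = 0" "(v L0 + v L3) \<bullet> (v L0 + v L1) = 0" "(v L0 + v L3) \<bullet> (v L0 + v L2) = 0"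
   by (simp_all add: inner_add g)
  show "?d \<bullet> (v L0 + v L1) = 0" "?d \<bullet> (v L0 + v L2) = 0" "?d \<bullet> (v L0 + v L3) = 0"
   using d by (simp_all only: inner_add_right inner_commute[of ?d] add_0)
 qed
 then show ?thesis by simp
qed

lemma norm_le_by_frame:
 assumes "\<And>i. \<bar>v i \<bullet> x\<bar> \<le> c"
 shows "norm x \<le> (1 / (4 * k)) * (4 * (c * sqrt (3 * k)))"
proof -
 have "norm (v i) = sqrt (3 * k)" for i by (simp add: norm_eq_sqrt_inner gram)
 then have t: "norm ((v i \<bullet> x) *R v i) \<le> c * sqrt (3 * k)" for i
  using mult_right_mono[OF assms[of i], of "sqrt (3 * k)"] k by simp
 let ?s = "(v L0 \<bullet> x) *R v L0 + (v L1 \<bullet> x) *R v L1 + (v L2 \<bullet> x) *R v L2 + (v L3 \<bullet> x) *R v L3"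
 have "norm ?s \<le> c * sqrt (3 * k) + c * sqrt (3 * k) + c * sqrt (3 * k) + c * sqrt (3 * k)"
  by (intro norm_triangle_mono t)
 then have "(1 / (4 * k)) * norm ?s \<le> (1 / (4 * k)) * (4 * (c * sqrt (3 * k)))"
  using k by (intro mult_left_mono) simp_all
 moreover have "norm ((1 / (4 * k)) *R ?s) = (1 / (4 * k)) * norm ?s" using k by simp
 ultimately have "norm ((1 / (4 * k)) *R ?s) \<le> (1 / (4 * k)) * (4 * (c * sqrt (3 * k)))" by (simp only:)
 then show ?thesis unfolding tight_frame[of x, symmetric] .
qed

lemma tendsto_by_frame:
 assumes "\<And>i. ((\<lambda>n. v i \<bullet> w n) \<longlongrightarrow> v i \<bullet> w') F"
 shows "(w \<longlongrightarrow> w') F"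
proof -
 define G where "G w = (1 / (4 * k)) *R ((v L0 \<bullet> w) *R v L0 + (v L1 \<bullet> w) *R v L1 + (v L2 \<bullet> w) *R v L2 + (v L3 \<bullet> w) *R v L3)" for w
 have "((\<lambda>n. G (w n)) \<longlongrightarrow> G w') F"
  unfolding G_def by (intro tendsto_scaleR tendsto_const tendsto_add assms)
 moreover have "G w = w" for w unfolding G_def by (rule tight_frame[symmetric])
 ultimately show ?thesis by simp
qed

text \<open>A relative interior point of the face on which the inequalities in \<open>R\<close> are
  tight; the strict inequalities survive small perturbations.\<close>

definition strict_point where
 "strict_point R y \<longleftrightarrow> (\<forall>S\<in>R. vS S \<bullet> y = bS S) \<and> (\<forall>S\<in>cuts - R. vS S \<bullet> y < bS S)"

text \<open>The cell is a permutohedron: its vertices have the coefficients 3, 1, -1, -3, in some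
  order, over 8. For \<open>th = 1\<close> and \<open>th = -1\<close> the point would be such a
  vertex, and the values in between run along the edge common to the facets \<open>{i}\<close> and
  \<open>{i, j}\<close>.\<close>

lemma edge_points:
 assumes a: "{i, j, m, l} = UNIV" and th: "\<bar>th\<bar> < 1"
 defines "y \<equiv> (1/8) *R (3 *R v i + v j - (2 + th) *R v m - (2 - th) *R v l)"
 shows "strict_point {{i}, {i, j}} y"
proof -
 note d = four_distinct[OF a]
 have ip: "v i \<bullet> y = 3/2 * k" "v j \<bullet> y = 1/2 * k" "v m \<bullet> y = - ((2 + th) / 2) * k" "v l \<bullet> y = - ((2 - th) / 2) * k"
  unfolding y_def by (simp_all add: inner_add_right inner_diff_right gram4[OF a] field_simps)
 have sums: "vS {i} \<bullet> y = v i \<bullet> y" "vS {j} \<bullet> y = v j \<bullet> y" "vS {m} \<bullet> y = v m \<bullet> y" "vS {l} \<bullet> y = v l \<bullet> y"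
  "vS {i,j} \<bullet> y = v i \<bullet> y + v j \<bullet> y" "vS {i,m} \<bullet> y = v i \<bullet> y + v m \<bullet> y" "vS {i,l} \<bullet> y = v i \<bullet> y + v l \<bullet> y"
  "vS {j,m} \<bullet> y = v j \<bullet> y + v m \<bullet> y" "vS {j,l} \<bullet> y = v j \<bullet> y + v l \<bullet> y" "vS {m,l} \<bullet> y = v m \<bullet> y + v l \<bullet> y"
  "vS {i,j,m} \<bullet> y = v i \<bullet> y + v j \<bullet> y + v m \<bullet> y" "vS {i,j,l} \<bullet> y = v i \<bullet> y + v j \<bullet> y + v l \<bullet> y"
  "vS {i,m,l} \<bullet> y = v i \<bullet> y + v m \<bullet> y + v l \<bullet> y" "vS {j,m,l} \<bullet> y = v j \<bullet> y + v m \<bullet> y + v l \<bullet> y"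
  using d by (simp_all add: vS_def inner_add_left)
 have b: "bS {i} = 3/2 * k" "bS {j} = 3/2 * k" "bS {m} = 3/2 * k" "bS {l} = 3/2 * k"
  "bS {i,j} = 2 * k" "bS {i,m} = 2 * k" "bS {i,l} = 2 * k" "bS {j,m} = 2 * k" "bS {j,l} = 2 * k" "bS {m,l} = 2 * k"
  "bS {i,j,m} = 3/2 * k" "bS {i,j,l} = 3/2 * k" "bS {i,m,l} = 3/2 * k" "bS {j,m,l} = 3/2 * k"
  using bS_values[OF a] bS_values[OF perm4(1)[OF a]] bS_values[OF perm4(2)[OF a]] bS_values[OF perm4(3)[OF a]]
   bS_values[OF perm4(4)[OF a]] bS_values[OF perm4(5)[OF a]] bS_values[OF perm4(6)[OF a]]
   bS_values[OF perm4(7)[OF a]] bS_values[OF perm4(8)[OF a]] bS_values[OF perm4(9)[OF a]] bS_values[OF perm4(10)[OF a]]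
  by (simp_all add: insert_commute)
 have th': "-1 < th" "th < 1" using th by auto
 have tk: "- k < th * k" "th * k < k" using th' k mult_strict_right_mono[of "-1" th k] mult_strict_right_mono[of th 1 k] by auto
 have strict: "vS S \<bullet> y < bS S" if "S \<in> cuts" "S \<noteq> {i}" "S \<noteq> {i, j}" for S
  using cuts_cases[OF a that(1)] that(2,3) k tk th'
  by (elim insertE emptyE) (simp_all add: sums b ip field_simps)
 show ?thesis unfolding strict_point_def
  using strict by (auto simp: sums b ip)
qed

text \<open>Inner products of the sums \<open>vS\<close> depend only on the cardinalities of the two
  sets and of their intersection, which leaves a few numerical cases.\<close>

lemma facet_centres:
 assumes "S \<in> cuts" shows "strict_point {S} ((1/2) *R vS S)"
proof -
 have "vS R \<bullet> vS S < vS R \<bullet> vS R" if R: "R \<in> cuts" "R \<noteq> S" for R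
 proof -
  have f: "finite R" "finite S" by simp_all
  have g: "vS X \<bullet> vS Y = 4 * k * card (X \<inter> Y) - k * card X * card Y" for X Y
  proof -
   have fin: "finite X" "finite Y" by simp_all
   have "vS X \<bullet> vS Y = (\<Sum>i\<in>X. \<Sum>j\<in>Y. v i \<bullet> v j)" unfolding vS_def inner_sum_left inner_sum_right by (rule sum.swap)
   also have "\<dots> = (\<Sum>i\<in>X. \<Sum>j\<in>Y. (if i = j then 4 * k else 0) - k)"
    by (intro sum.cong refl) (simp add: gram)
   also have "\<dots> = (\<Sum>i\<in>X. (if i \<in> Y then 4 * k else 0)) - k * card X * card Y"
    using fin by (simp add: sum_subtractf sum.delta)
   also have "(\<Sum>i\<in>X. (if i \<in> Y then 4 * k else 0)) = 4 * k * card (X \<inter> Y)"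
    using fin by (simp add: sum.inter_restrict[symmetric])
   finally show ?thesis .
  qed
  have "vS R \<bullet> vS S = k * (4 * real (card (R \<inter> S)) - real (card R) * real (card S))"
   "vS R \<bullet> vS R = k * (4 * real (card R) - real (card R) * real (card R))"
   using g[of R S] g[of R R] by (simp_all add: algebra_simps)
  moreover have "4 * real (card (R \<inter> S)) - real (card R) * real (card S) < 4 * real (card R) - real (card R) * real (card R)"
  proof -
   have cR: "card R \<in> {1,2,3}" "card S \<in> {1,2,3}"
   proof -
    have "card X \<in> {1,2,3}" if "X \<in> cuts" for X
    proof -
     have X: "X \<noteq> {}" "X \<subset> UNIV" using that by (auto simp: cuts_def)
     have "card X < card (UNIV :: label set)" by (rule psubset_card_mono[OF finite X(2)])
     then have "card X < 4" by (simp add: card_label)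
     moreover have "card X \<noteq> 0" using X(1) by simp
     ultimately have "card X = 1 \<or> card X = 2 \<or> card X = 3" by linarith
     then show ?thesis by simp
    qed
    then show "card R \<in> {1,2,3}" "card S \<in> {1,2,3}" using R(1) assms by auto
   qed
   have le: "card (R \<inter> S) \<le> card R" "card (R \<inter> S) \<le> card S" using f by (auto intro: card_mono)
   have "card (R \<inter> S) < card R \<or> card (R \<inter> S) < card S"
   proof (rule ccontr)
    assume "\<not> ?thesis"
    then have "R \<inter> S = R" "R \<inter> S = S" using le f card_subset_eq[of R "R \<inter> S"] card_subset_eq[of S "R \<inter> S"] by auto
    then show False using R(2) by simp
   qed
   then show ?thesis using cR le by auto
  qed
  ultimately show ?thesis using k by (simp only: mult_less_cancel_left_pos)
 qed
 then show ?thesis unfolding strict_point_def bS_def by auto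
qed

end

section \<open>Independent systems of periods\<close>

context centered_tile
begin

lemma period_scale_nat: "m \<in> periods \<Longrightarrow> real n *R m \<in> periods"
proof (induction n)
 case (Suc n)
 have "real (Suc n) *R m = m + real n *R m" by (simp add: algebra_simps)
 then show ?case using period_add[OF Suc.prems Suc.IH[OF Suc.prems]] by (simp only:)
qed (simp add: zero_period)

lemma period_scale_int:
 assumes "m \<in> periods" "z \<in> \<int>" shows "z *R m \<in> periods"
proof -
 obtain i where i: "z = of_int i" using assms(2) by (auto simp: Ints_def)
 show ?thesis
 proof (cases "i \<ge> 0")
  case True
  then have "z = real (nat i)" using i by simp
  then show ?thesis using period_scale_nat[OF assms(1)] by simp
 next
  case False
  then have "z = - real (nat (- i))" using i by simp
  then have "z *R m = - (real (nat (- i)) *R m)" by simp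
  then show ?thesis using period_uminus[OF period_scale_nat[OF assms(1)]] by (simp only:)
 qed
qed

end

definition columns3 :: "real^3 \<Rightarrow> real^3 \<Rightarrow> real^3 \<Rightarrow> real^3^3" where
 "columns3 t1 t2 t3 = transpose (vector [t1, t2, t3])"

lemma columns3_mult: "columns3 t1 t2 t3 *v z = (z$1) *R t1 + (z$2) *R t2 + (z$3) *R t3"
 by (simp add: columns3_def vec_eq_iff forall_3 matrix_vector_mult_def sum_3 transpose_def mult.commute)

lemma det_columns3_nonzero:
 assumes "\<And>z1 z2 z3. z1 *R t1 + z2 *R t2 + z3 *R t3 = 0 \<Longrightarrow> z1 = 0 \<and> z2 = 0 \<and> z3 = 0"
 shows "det (columns3 t1 t2 t3) \<noteq> 0"
proof -
 have "z = 0" if "columns3 t1 t2 t3 *v z = 0" for z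
  using assms[of "z$1" "z$2" "z$3"] that unfolding columns3_mult by (simp add: vec_eq_iff forall_3)
 then have "\<exists>N. N ** columns3 t1 t2 t3 = mat 1" by (simp add: matrix_left_invertible_ker)
 then show ?thesis by (metis invertible_det_nz invertible_left_inverse)
qed

lemma (in centered_tile) int_span_columns3:
 assumes "t1 \<in> periods" "t2 \<in> periods" "t3 \<in> periods"
 shows "int_span (columns3 t1 t2 t3) \<subseteq> periods"
 unfolding int_span_def columns3_mult using assms by (auto intro!: period_add period_scale_int)

text \<open>A vanishing combination is paired with the combination of \<open>E1\<close>,
  \<open>E2\<close>, \<open>E3\<close> whose coefficients are the signs of the \<open>z\<close>.
  Dominance makes each of the three resulting terms nonnegative, and positive unless its coefficient
  is 0.\<close>

lemma diagonally_dominant_independent: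
 fixes t1 t2 t3 E1 E2 E3 :: "real^3"
 assumes "\<bar>E2 \<bullet> t1\<bar> + \<bar>E3 \<bullet> t1\<bar> < E1 \<bullet> t1" "\<bar>E1 \<bullet> t2\<bar> + \<bar>E3 \<bullet> t2\<bar> < E2 \<bullet> t2" "\<bar>E1 \<bullet> t3\<bar> + \<bar>E2 \<bullet> t3\<bar> < E3 \<bullet> t3"
  and z: "z1 *R t1 + z2 *R t2 + z3 *R t3 = 0"
 shows "z1 = 0 \<and> z2 = 0 \<and> z3 = 0"
proof -
 have e: "z1 * (E \<bullet> t1) + z2 * (E \<bullet> t2) + z3 * (E \<bullet> t3) = 0" for E
  using arg_cong[OF z, of "\<lambda>x. E \<bullet> x"] by (simp add: inner_add_right)
 have key: "z * (s * a + s1 * b + s2 * c) \<ge> 0 \<and> (z \<noteq> 0 \<longrightarrow> z * (s * a + s1 * b + s2 * c) > 0)"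
  if "\<bar>b\<bar> + \<bar>c\<bar> < a" "s = sgn z" "\<bar>s1\<bar> \<le> 1" "\<bar>s2\<bar> \<le> 1" for z s s1 s2 a b c :: real
 proof (cases "z = 0")
  case False
  have "\<bar>s1 * b\<bar> \<le> \<bar>b\<bar>" "\<bar>s2 * c\<bar> \<le> \<bar>c\<bar>"
   using that(3,4) by (simp_all add: abs_mult mult_left_le_one_le)
  then have "\<bar>s1 * b + s2 * c\<bar> < a" using that(1) by linarith
  then have "\<bar>z\<bar> * \<bar>s1 * b + s2 * c\<bar> < \<bar>z\<bar> * a" using False by simp
  moreover have "z * (s1 * b + s2 * c) \<ge> - (\<bar>z\<bar> * \<bar>s1 * b + s2 * c\<bar>)"
   using abs_ge_minus_self[of "z * (s1 * b + s2 * c)"] by (simp add: abs_mult)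
  moreover have "z * (s * a) = \<bar>z\<bar> * a" using that(2) by (simp add: abs_sgn mult.assoc[symmetric])
  moreover have "z * (s * a + s1 * b + s2 * c) = z * (s * a) + z * (s1 * b + s2 * c)" by (simp add: algebra_simps)
  ultimately have "z * (s * a + s1 * b + s2 * c) > 0" by linarith
  then show ?thesis by simp
 qed simp
 have s1: "\<bar>sgn x\<bar> \<le> (1::real)" for x :: real by (simp add: sgn_if)
 let ?s = "\<lambda>z::real. sgn z"
 have sum: "z1 * (?s z1 * (E1 \<bullet> t1) + ?s z2 * (E2 \<bullet> t1) + ?s z3 * (E3 \<bullet> t1))
   + z2 * (?s z2 * (E2 \<bullet> t2) + ?s z1 * (E1 \<bullet> t2) + ?s z3 * (E3 \<bullet> t2))
   + z3 * (?s z3 * (E3 \<bullet> t3) + ?s z1 * (E1 \<bullet> t3) + ?s z2 * (E2 \<bullet> t3)) = 0"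
 proof -
  have "?s z1 * (z1 * (E1 \<bullet> t1) + z2 * (E1 \<bullet> t2) + z3 * (E1 \<bullet> t3))
   + ?s z2 * (z1 * (E2 \<bullet> t1) + z2 * (E2 \<bullet> t2) + z3 * (E2 \<bullet> t3))
   + ?s z3 * (z1 * (E3 \<bullet> t1) + z2 * (E3 \<bullet> t2) + z3 * (E3 \<bullet> t3)) = 0"
   unfolding e by simp
  then show ?thesis by (simp add: algebra_simps)
 qed
 note k1 = key[OF assms(1) refl s1[of z2] s1[of z3], of z1] and k2 = key[OF assms(2) refl s1[of z1] s1[of z3], of z2]
  and k3 = key[OF assms(3) refl s1[of z1] s1[of z2], of z3]
 show ?thesis using sum k1 k2 k3 by argo
qed

lemma singleton_cut: "{i} \<in> cuts"
proof -
 have "{i} \<noteq> (UNIV :: label set)"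
 proof
  assume "{i} = (UNIV :: label set)"
  then have "card {i} = 4" using card_label by (simp only:)
  then show False by simp
 qed
 then show ?thesis by (simp add: cuts_def)
qed

lemma cut_forms:
 assumes "S \<in> cuts"
 obtains i j m l where "{i, j, m, l} = (UNIV :: label set)" "S = {i} \<or> S = {i, j} \<or> S = {i, j, m}"
proof -
 have id: "{L0, L1, L2, L3} = UNIV" by (simp add: UNIV_label)
 show ?thesis using cuts_cases[OF id assms]
 proof (elim insertE emptyE)
  assume "S = {L0}" then show ?thesis by (intro that[of L0 L1 L2 L3]) (auto simp: UNIV_label)
 next
  assume "S = {L1}" then show ?thesis by (intro that[of L1 L0 L2 L3]) (auto simp: UNIV_label)
 next
  assume "S = {L2}" then show ?thesis by (intro that[of L2 L0 L1 L3]) (auto simp: UNIV_label)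
 next
  assume "S = {L3}" then show ?thesis by (intro that[of L3 L0 L1 L2]) (auto simp: UNIV_label)
 next
  assume "S = {L0, L1}" then show ?thesis by (intro that[of L0 L1 L2 L3]) (auto simp: UNIV_label)
 next
  assume "S = {L0, L2}" then show ?thesis by (intro that[of L0 L2 L1 L3]) (auto simp: UNIV_label)
 next
  assume "S = {L0, L3}" then show ?thesis by (intro that[of L0 L3 L1 L2]) (auto simp: UNIV_label)
 next
  assume "S = {L1, L2}" then show ?thesis by (intro that[of L1 L2 L0 L3]) (auto simp: UNIV_label)
 next
  assume "S = {L1, L3}" then show ?thesis by (intro that[of L1 L3 L0 L2]) (auto simp: UNIV_label)
 next
  assume "S = {L2, L3}" then show ?thesis by (intro that[of L2 L3 L0 L1]) (auto simp: UNIV_label)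
 next
  assume "S = {L0, L1, L2}" then show ?thesis by (intro that[of L0 L1 L2 L3]) (auto simp: UNIV_label)
 next
  assume "S = {L0, L1, L3}" then show ?thesis by (intro that[of L0 L1 L3 L2]) (auto simp: UNIV_label)
 next
  assume "S = {L0, L2, L3}" then show ?thesis by (intro that[of L0 L2 L3 L1]) (auto simp: UNIV_label)
 next
  assume "S = {L1, L2, L3}" then show ?thesis by (intro that[of L1 L2 L3 L0]) (auto simp: UNIV_label)
 qed
qed

lemma four_labels: obtains j m l where "{i, j, m, l} = (UNIV :: label set)"
proof (cases i)
 case L0 then show ?thesis using that[of L1 L2 L3] by (simp add: UNIV_label)
next
 case L1 then show ?thesis using that[of L0 L2 L3] by (auto simp add: UNIV_label)
next
 case L2 then show ?thesis using that[of L0 L1 L3] by (auto simp add: UNIV_label)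
next
 case L3 then show ?thesis using that[of L0 L1 L2] by (auto simp add: UNIV_label)
qed

text \<open>\<open>lower\<close> and \<open>upper\<close> squeeze \<open>P n\<close> between the
  multiples \<open>1 - \<delta> n\<close> and \<open>1 + \<delta> n\<close> of the Voronoi cell;
  smallness is expressed by a limit instead of a radius.\<close>

locale to_sequence = to_frame +
 fixes P T :: "nat \<Rightarrow> (real^3) set" and \<delta> :: "nat \<Rightarrow> real"
 assumes tile: "\<And>n. centered_tile (P n) (T n)"
  and \<delta>: "\<And>n. 0 < \<delta> n" "\<And>n. \<delta> n < 1" "\<delta> \<longlonglongrightarrow> 0"
  and lower: "\<And>n x. (\<And>S. S \<in> cuts \<Longrightarrow> vS S \<bullet> x \<le> bS S) \<Longrightarrow> (1 - \<delta> n) *R x \<in> P n"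
  and upper: "\<And>n x S. \<lbrakk>x \<in> P n; S \<in> cuts\<rbrakk> \<Longrightarrow> vS S \<bullet> x \<le> (1 + \<delta> n) * bS S"
begin

text \<open>The facet centre scaled by \<open>1 + 2 * \<delta> n\<close> violates
  \<open>upper\<close>, so some facet of \<open>P n\<close> separates it. Its equation is scaled to
  the right-hand side \<open>bS S\<close>, as for the limit facet.\<close>

lemma facet_exists:
 assumes "S \<in> cuts"
 shows "\<exists>a. P n \<subseteq> {y. a \<bullet> y \<le> bS S} \<and> (P n \<inter> {y. a \<bullet> y = bS S}) facet_of P n
   \<and> a \<bullet> ((1 + 2 * \<delta> n) *R (1/2) *R vS S) > bS S"
proof -
 interpret Pn: centered_tile "P n" "T n" by (rule tile)
 let ?x = "(1 + 2 * \<delta> n) *R (1/2) *R vS S"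
 have b: "bS S > 0" by (rule bS_pos[OF assms])
 have "?x \<notin> P n"
 proof
  assume "?x \<in> P n"
  then have "vS S \<bullet> ?x \<le> (1 + \<delta> n) * bS S" using upper assms by blast
  moreover have "vS S \<bullet> ?x = (1 + 2 * \<delta> n) * bS S" by (simp add: bS_def)
  ultimately have "(1 + 2 * \<delta> n) * bS S \<le> (1 + \<delta> n) * bS S" by (simp only:)
  then show False using b \<delta>(1)[of n] mult_strict_right_mono[of "1 + \<delta> n" "1 + 2 * \<delta> n" "bS S"] by linarith
 qed
 then obtain a where a: "P n \<subseteq> {y. a \<bullet> y \<le> 1}" "(P n \<inter> {y. a \<bullet> y = 1}) facet_of P n" "a \<bullet> ?x > 1"
  using not_mem_polyhedron_facet[OF polytope_imp_polyhedron[OF Pn.polytope] Pn.zero_interior] by blast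
 have eq: "{y. (bS S *R a) \<bullet> y = bS S} = {y. a \<bullet> y = 1}" "{y. (bS S *R a) \<bullet> y \<le> bS S} = {y. a \<bullet> y \<le> 1}"
  using b by auto
 have "(bS S *R a) \<bullet> ?x > bS S"
  using mult_strict_left_mono[OF a(3) b] by (simp only: inner_scaleR_left mult_1_right)
 then show ?thesis using a(1,2) eq by metis
qed

definition nrm where "nrm S n = (SOME a. P n \<subseteq> {y. a \<bullet> y \<le> bS S} \<and> (P n \<inter> {y. a \<bullet> y = bS S}) facet_of P n
   \<and> a \<bullet> ((1 + 2 * \<delta> n) *R (1/2) *R vS S) > bS S)"

definition fct where "fct S n = P n \<inter> {y. nrm S n \<bullet> y = bS S}"

lemma nrm:
 assumes "S \<in> cuts"
 shows "x \<in> P n \<Longrightarrow> nrm S n \<bullet> x \<le> bS S" "fct S n facet_of P n" "nrm S n \<bullet> ((1 + 2 * \<delta> n) *R (1/2) *R vS S) > bS S"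
 using someI_ex[OF facet_exists[OF assms, of n]] unfolding nrm_def[symmetric] fct_def by blast+

text \<open>The half-space contains a shrunken disc of fixed radius \<open>r\<close> of the limit
  facet but misses the expanded centre. This squeezes the value at the centre between
  \<open>lo\<close> and \<open>hi\<close>, and a tangential part \<open>w n\<close> of the normal
  would raise the value on the disc in proportion to its length.\<close>

lemma nrm_tendsto:
 assumes S: "S \<in> cuts" shows "nrm S \<longlonglongrightarrow> vS S"
proof -
 let ?c = "(1/2) *R vS S" and ?b = "bS S"
 have b: "?b > 0" by (rule bS_pos[OF S])
 have cc: "?c \<bullet> ?c = ?b / 2" by (simp add: bS_def)
 let ?U = "\<Inter>R\<in>cuts - {S}. {x. vS R \<bullet> x < bS R}"
 have "open ?U" by (intro open_INT) (auto simp: open_halfspace_lt)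
 moreover have "?c \<in> ?U" using facet_centres[OF S] by (auto simp: strict_point_def)
 ultimately obtain r where r: "r > 0" "ball ?c r \<subseteq> ?U" by (rule openE)
 have inA: "(1 - \<delta> n) *R (?c + w) \<in> P n" if w: "w \<bullet> vS S = 0" "norm w < r" for w n
 proof -
  have "?c + w \<in> ball ?c r" using w(2) by (simp add: dist_norm)
  then have "vS R \<bullet> (?c + w) < bS R" if "R \<in> cuts" "R \<noteq> S" for R using r(2) that by blast
  moreover have "vS S \<bullet> (?c + w) = bS S" using w(1) by (simp add: inner_add_right bS_def inner_commute)
  ultimately have "vS R \<bullet> (?c + w) \<le> bS R" if "R \<in> cuts" for R using that by (cases "R = S") (auto intro: less_imp_le)
  then show ?thesis by (rule lower)
 qed
 define lo where "lo n = ?b / (1 + 2 * \<delta> n)" for n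
 define hi where "hi n = ?b / (1 - \<delta> n)" for n
 have lohi: "lo \<longlonglongrightarrow> ?b" "hi \<longlonglongrightarrow> ?b"
  unfolding lo_def hi_def by (rule tendsto_eq_intros refl \<delta>(3) | simp)+
 have ac_lo: "lo n < nrm S n \<bullet> ?c" for n
  using nrm(3)[OF S, of n] \<delta>(1)[of n] by (simp add: lo_def field_simps)
 have a_hi: "nrm S n \<bullet> (?c + w) \<le> hi n" if "w \<bullet> vS S = 0" "norm w < r" for w n
 proof -
  have "nrm S n \<bullet> ((1 - \<delta> n) *R (?c + w)) \<le> ?b" by (rule nrm(1)[OF S inA[OF that]])
  then have "(1 - \<delta> n) * (nrm S n \<bullet> (?c + w)) \<le> ?b" by simp
  then show ?thesis using \<delta>(2)[of n] by (simp add: hi_def field_simps)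
 qed
 have ac: "(\<lambda>n. nrm S n \<bullet> ?c) \<longlonglongrightarrow> ?b"
  by (rule tendsto_sandwich[OF _ _ lohi]) (use ac_lo a_hi[of 0] r(1) in \<open>auto intro!: always_eventually less_imp_le\<close>)
 define s where "s n = ((nrm S n - vS S) \<bullet> ?c) / (?c \<bullet> ?c)" for n
 define w where "w n = (nrm S n - vS S) - s n *R ?c" for n
 have sc: "s n * (?c \<bullet> ?c) = (nrm S n - vS S) \<bullet> ?c" for n unfolding s_def cc using b by simp
 have wc: "w n \<bullet> ?c = 0" for n
  unfolding w_def inner_diff_left[of "nrm S n - vS S"] inner_scaleR_left[of "s n"] sc by simp
 then have wv: "w n \<bullet> vS S = 0" for n by simp
 have aw: "nrm S n \<bullet> w n = w n \<bullet> w n" for n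
 proof -
  have "nrm S n = w n + vS S + s n *R ?c" by (simp add: w_def)
  then have "nrm S n \<bullet> w n = (w n + vS S + s n *R ?c) \<bullet> w n" by simp
  also have "\<dots> = w n \<bullet> w n + vS S \<bullet> w n + s n * (?c \<bullet> w n)" by (simp only: inner_add_left inner_scaleR_left)
  also have "\<dots> = w n \<bullet> w n" using wv[of n] wc[of n] by (simp add: inner_commute)
  finally show ?thesis .
 qed
 have wn: "norm (w n) \<le> (2 / r) * (hi n - lo n)" for n
 proof (cases "w n = 0")
  case True
  have "lo n \<le> hi n" using ac_lo[of n] a_hi[of 0 n] r(1) by simp
  then show ?thesis using True r(1) by simp
 next
  case False
  let ?w = "(r / 2 / norm (w n)) *R w n"
  have "norm ?w < r" "?w \<bullet> vS S = 0" using False r(1) wv[of n] by simp_all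
  then have "nrm S n \<bullet> (?c + ?w) \<le> hi n" using a_hi by blast
  then have "nrm S n \<bullet> ?w \<le> hi n - lo n" using ac_lo[of n] unfolding inner_add_right by linarith
  moreover have "nrm S n \<bullet> ?w = r / 2 * norm (w n)"
   using aw[of n] False by (simp add: dot_square_norm power2_eq_square)
  ultimately have "norm (w n) * r \<le> 2 * (hi n - lo n)" by (simp only:) (simp add: field_simps)
  then show ?thesis using r(1) by (simp add: field_simps)
 qed
 have "(\<lambda>n. (2 / r) * (hi n - lo n)) \<longlonglongrightarrow> (2 / r) * (?b - ?b)" by (intro tendsto_intros lohi)
 then have "w \<longlonglongrightarrow> 0" using wn by (intro Lim_null_comparison[of w]) (auto intro: always_eventually)
 moreover have "s \<longlonglongrightarrow> 0"
 proof -
  have cn: "?c \<bullet> ?c \<noteq> 0" using cc b by linarith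
  have vc: "vS S \<bullet> ?c = ?b" by (simp add: bS_def)
  have "s = (\<lambda>n. (nrm S n \<bullet> ?c - ?b) / (?c \<bullet> ?c))" unfolding s_def inner_diff_left vc ..
  moreover have "(\<lambda>n. (nrm S n \<bullet> ?c - ?b) / (?c \<bullet> ?c)) \<longlonglongrightarrow> (?b - ?b) / (?c \<bullet> ?c)"
   using cn by (intro tendsto_intros ac)
  ultimately show ?thesis by simp
 qed
 ultimately have "(\<lambda>n. w n + vS S + s n *R ?c) \<longlonglongrightarrow> 0 + vS S + 0 *R ?c" by (intro tendsto_intros)
 then show ?thesis by (simp add: w_def)
qed

lemma P_bounded: obtains B where "B > 0" "\<And>n x. x \<in> P n \<Longrightarrow> norm x \<le> B"
proof -
 have bd: "norm x \<le> (1 / (4 * k)) * (4 * (2 * (2 * k) * sqrt (3 * k)))" if x: "x \<in> P n" for x n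
 proof -
  have xm: "- x \<in> P n" using centered_tile.uminus_mem[OF tile x] .
  have vi: "\<bar>v i \<bullet> x\<bar> \<le> 2 * (2 * k)" for i
  proof -
   have c: "{i} \<in> cuts" by (rule singleton_cut)
   have "bS {i} = 3/2 * k" by (simp add: bS_def vS_def gram)
   then have "(1 + \<delta> n) * bS {i} \<le> 2 * (2 * k)"
    using mult_mono[of "1 + \<delta> n" 2 "bS {i}" "2 * k"] \<delta>(1,2)[of n] k by simp
   then show ?thesis using upper[OF x c] upper[OF xm c] by (simp add: vS_def abs_le_iff)
  qed
  then show ?thesis by (rule norm_le_by_frame)
 qed
 show ?thesis by (rule that[of "max 1 ((1 / (4 * k)) * (4 * (2 * (2 * k) * sqrt (3 * k))))"]) (use bd in \<open>auto simp: le_max_iff_disj\<close>)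
qed

lemma fvec_exists:
 assumes "S \<in> cuts"
 shows "\<exists>t. P n \<inter> (+) t ` P n = fct S n \<and> (\<forall>y\<in>fct S n. t - y \<in> fct S n)"
 using centered_tile.facet_neighbour[OF tile nrm(2)[OF assms]] by metis

definition fvec where "fvec S n = (SOME t. P n \<inter> (+) t ` P n = fct S n \<and> (\<forall>y\<in>fct S n. t - y \<in> fct S n))"

lemma fvec:
 assumes "S \<in> cuts"
 shows "P n \<inter> (+) (fvec S n) ` P n = fct S n" "y \<in> fct S n \<Longrightarrow> fvec S n - y \<in> fct S n"
  "fvec S n \<in> centered_tile.periods (T n)" "(1/2) *R fvec S n \<in> fct S n"
proof -
 interpret Pn: centered_tile "P n" "T n" by (rule tile)
 show 1: "P n \<inter> (+) (fvec S n) ` P n = fct S n" "y \<in> fct S n \<Longrightarrow> fvec S n - y \<in> fct S n" for y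
  using someI_ex[OF fvec_exists[OF assms, of n]] unfolding fvec_def[symmetric] by blast+
 show "fvec S n \<in> Pn.periods" by (rule Pn.facet_vector_period[OF nrm(2)[OF assms] 1(2)])
 show "(1/2) *R fvec S n \<in> fct S n"
  using Pn.symmetry_center_rel_interior[OF nrm(2)[OF assms] 1(2)] rel_interior_subset by blast
qed

lemma fvec_nrm: "S \<in> cuts \<Longrightarrow> nrm S n \<bullet> fvec S n = 2 * bS S"
 using fvec(4)[of S n] by (simp add: fct_def)

text \<open>The facet equation controls just this component; the others are found later from contact
  along edges.\<close>

lemma fvec_along: assumes "S \<in> cuts" shows "(\<lambda>n. vS S \<bullet> fvec S n) \<longlonglongrightarrow> 2 * bS S"
proof -
 obtain B where B: "B > 0" "\<And>n x. x \<in> P n \<Longrightarrow> norm x \<le> B" using P_bounded by blast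
 have tb: "norm (fvec S n) \<le> 2 * B" for n
  using B(2)[of "(1/2) *R fvec S n" n] fvec(4)[OF assms, of n] by (simp add: fct_def)
 have "(\<lambda>n. norm (nrm S n - vS S) * (2 * B)) \<longlonglongrightarrow> norm (vS S - vS S) * (2 * B)"
  by (intro tendsto_intros nrm_tendsto[OF assms])
 then have lim: "(\<lambda>n. norm (nrm S n - vS S) * (2 * B)) \<longlonglongrightarrow> 0" by simp
 have "norm ((nrm S n - vS S) \<bullet> fvec S n) \<le> norm (nrm S n - vS S) * (2 * B)" for n
  using Cauchy_Schwarz_ineq2[of "nrm S n - vS S" "fvec S n"] mult_left_mono[OF tb[of n], of "norm (nrm S n - vS S)"] by simp
 then have "(\<lambda>n. (nrm S n - vS S) \<bullet> fvec S n) \<longlonglongrightarrow> 0"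
  by (intro Lim_null_comparison[OF _ lim] always_eventually allI)
 then have "(\<lambda>n. nrm S n \<bullet> fvec S n - (nrm S n - vS S) \<bullet> fvec S n) \<longlonglongrightarrow> 2 * bS S - 0"
  unfolding fvec_nrm[OF assms] by (rule tendsto_diff[OF tendsto_const])
 then show ?thesis by (simp add: inner_diff_left)
qed

text \<open>Before the facet vectors are known to converge, membership of their halves in
  \<open>P n\<close> already confines the components across \<open>v i + v j\<close>. This is enough
  for three independent periods, which Minkowski's bound requires.\<close>

lemma fvec_dominant:
 assumes a: "{i, j, m, l} = UNIV"
 shows "eventually (\<lambda>n. \<bar>(v i + v m) \<bullet> fvec {i, j} n\<bar> + \<bar>(v i + v l) \<bullet> fvec {i, j} n\<bar> < (v i + v j) \<bullet> fvec {i, j} n) sequentially"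
proof -
 note ci = cut_in[OF a]
 have lim: "(\<lambda>n. (v i + v j) \<bullet> fvec {i, j} n) \<longlonglongrightarrow> 4 * k"
  using fvec_along[OF ci(2)] by (simp add: vS_values[OF a] bS_values[OF a])
 have ev1: "eventually (\<lambda>n. (v i + v j) \<bullet> fvec {i, j} n > 7/2 * k) sequentially"
  using order_tendstoD(1)[OF lim, of "7/2 * k"] k by simp
 have ev2: "eventually (\<lambda>n. \<delta> n < 1/6) sequentially" using order_tendstoD(2)[OF \<delta>(3), of "1/6"] by simp
 have s: "v l = - v i - v j - v m" using sum0'[OF a] by (simp add: eq_neg_iff_add_eq_0 algebra_simps)
 from ev1 ev2 show ?thesis
 proof eventually_elim
  case (elim n)
  let ?t = "fvec {i, j} n"
  have tP: "(1/2) *R ?t \<in> P n" using fvec(4)[OF ci(2), of n] by (simp add: fct_def)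
  have u: "vS R \<bullet> ?t \<le> 7/2 * k" if R: "R \<in> cuts" "bS R = 3/2 * k" for R
  proof -
   have "vS R \<bullet> ?t \<le> 2 * ((1 + \<delta> n) * (3/2 * k))" using upper[OF tP R(1)] unfolding R(2) inner_scaleR_right by linarith
   moreover have "(1 + \<delta> n) * (3/2 * k) \<le> (7/6) * (3/2 * k)" using elim(2) k by (intro mult_right_mono) auto
   ultimately show ?thesis by simp
  qed
  have i: "v i \<bullet> ?t \<le> 7/2 * k" using u[OF ci(1) bS_values(1)[OF a]] by (simp add: vS_values[OF a])
  have j: "v j \<bullet> ?t \<le> 7/2 * k"
   using u[OF cut_in(1)[OF perm4(1)[OF a]] bS_values(1)[OF perm4(1)[OF a]]] by (simp add: vS_values[OF perm4(1)[OF a]])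
  have l: "- (v l \<bullet> ?t) \<le> 7/2 * k" using u[OF ci(3) bS_values(3)[OF a]] by (simp add: vS_values[OF a])
  have m: "- (v m \<bullet> ?t) \<le> 7/2 * k"
   using u[OF cut_in(3)[OF perm4(6)[OF a]] bS_values(3)[OF perm4(6)[OF a]]] by (simp add: vS_values[OF perm4(6)[OF a]])
  have e: "v l \<bullet> ?t = - (v i \<bullet> ?t) - v j \<bullet> ?t - v m \<bullet> ?t" unfolding s by (simp add: inner_diff_left)
  show ?case using i j l m elim(1) unfolding inner_add_left e by linarith
 qed
qed

lemma independent_periods:
 "eventually (\<lambda>n. det (columns3 (fvec {L0, L1} n) (fvec {L0, L2} n) (fvec {L0, L3} n)) \<noteq> 0) sequentially"
proof -
 have a: "{L0, L1, L2, L3} = UNIV" "{L0, L2, L1, L3} = UNIV" "{L0, L3, L1, L2} = UNIV" by (auto simp: UNIV_label)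
 from fvec_dominant[OF a(1)] fvec_dominant[OF a(2)] fvec_dominant[OF a(3)] show ?thesis
 proof eventually_elim
  case (elim n)
  show ?case
   by (rule det_columns3_nonzero, rule diagonally_dominant_independent[OF elim(1-3)])
 qed
qed

lemma card_facets: "eventually (\<lambda>n. card {G. G facet_of P n} \<le> 14) sequentially"
 using independent_periods
proof eventually_elim
 case (elim n)
 interpret Pn: centered_tile "P n" "T n" by (rule tile)
 have c: "{L0, L1} \<in> cuts" "{L0, L2} \<in> cuts" "{L0, L3} \<in> cuts" by (auto simp: cuts_def UNIV_label)
 show ?case
  by (rule Pn.card_facets_le_14[OF elim Pn.int_span_columns3]) (rule fvec(3), rule c)+
qed

end

section \<open>Area and volume in terms of Selling parameters\<close>

unbundle cross3_syntax

text \<open>Turns a product of determinants into inner products, so that no coordinates have to be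
  chosen.\<close>

lemma det_rows_columns3:
 "det (vector [x1, x2, x3] :: real^3^3) * det (columns3 y1 y2 y3) =
  (x1 \<bullet> y1) * ((x2 \<bullet> y2) * (x3 \<bullet> y3) - (x2 \<bullet> y3) * (x3 \<bullet> y2))
  - (x1 \<bullet> y2) * ((x2 \<bullet> y1) * (x3 \<bullet> y3) - (x2 \<bullet> y3) * (x3 \<bullet> y1))
  + (x1 \<bullet> y3) * ((x2 \<bullet> y1) * (x3 \<bullet> y2) - (x2 \<bullet> y2) * (x3 \<bullet> y1))"
proof -
 let ?A = "vector [x1, x2, x3] :: real^3^3" and ?B = "columns3 y1 y2 y3"
 have e: "(?A ** ?B) $ a $ b = (vector [x1, x2, x3] $ a) \<bullet> (vector [y1, y2, y3] $ b)" for a b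
  by (simp add: matrix_matrix_mult_def columns3_def transpose_def inner_vec_def)
 have "det ?A * det ?B = det (?A ** ?B)" by (simp add: det_mul)
 also have "\<dots> = (x1 \<bullet> y1) * ((x2 \<bullet> y2) * (x3 \<bullet> y3) - (x2 \<bullet> y3) * (x3 \<bullet> y2))
  - (x1 \<bullet> y2) * ((x2 \<bullet> y1) * (x3 \<bullet> y3) - (x2 \<bullet> y3) * (x3 \<bullet> y1))
  + (x1 \<bullet> y3) * ((x2 \<bullet> y1) * (x3 \<bullet> y2) - (x2 \<bullet> y2) * (x3 \<bullet> y1))"
  unfolding det_3 e by (simp add: algebra_simps)
 finally show ?thesis .
qed

text \<open>Two vectors of the dual basis, given by cross products divided by the determinant; their
  own cross product is \<open>M0\<close> over the determinant, which gives the area factor.\<close>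

lemma dual_plane_vectors:
 fixes M0 M1 M2 :: "real^3"
 assumes D: "det (vector [M0, M1, M2] :: real^3^3) \<noteq> 0"
 obtains e1 e2 where "M0 \<bullet> e1 = 0" "M1 \<bullet> e1 = 1" "M2 \<bullet> e1 = 0" "M0 \<bullet> e2 = 0" "M1 \<bullet> e2 = 0" "M2 \<bullet> e2 = 1"
  "area_factor e1 e2 = norm M0 / \<bar>det (vector [M0, M1, M2] :: real^3^3)\<bar>"
proof -
 define D where "D = det (vector [M0, M1, M2] :: real^3^3)"
 have D0: "D \<noteq> 0" using D by (simp add: D_def)
 have t: "M1 \<bullet> (M2 \<times> M0) = D" "M2 \<bullet> (M0 \<times> M1) = D"
  unfolding D_def by (simp_all add: cross3_def inner_vec_def sum_3 det_3 algebra_simps)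
 let ?e1 = "(1 / D) *R (M2 \<times> M0)" and ?e2 = "(1 / D) *R (M0 \<times> M1)"
 have "(M2 \<times> M0) \<times> (M0 \<times> M1) = D *R M0"
  unfolding D_def by (simp add: cross3_def vec_eq_iff forall_3 det_3 algebra_simps)
 then have c: "?e1 \<times> ?e2 = (1 / D) *R M0" using D0 by (simp add: cross_mult_left cross_mult_right)
 have "area_factor ?e1 ?e2 = norm (?e1 \<times> ?e2)"
 proof -
  have "(x \<bullet> x) * (y \<bullet> y) - (x \<bullet> y)\<^sup>2 = (norm (x \<times> y))\<^sup>2" for x y :: "real^3"
   using norm_cross[of x y] by (simp only: power2_norm_eq_inner)
  then show ?thesis unfolding area_factor_def by (simp only: real_sqrt_abs abs_norm_cancel)
 qed
 also have "\<dots> = norm M0 / \<bar>D\<bar>" unfolding c by simp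
 finally have f: "area_factor ?e1 ?e2 = norm M0 / \<bar>D\<bar>" .
 show ?thesis
  by (rule that[of ?e1 ?e2]) (use t D0 f in \<open>simp_all add: D_def dot_cross_self\<close>)
qed

lemma sum_Pow_insert:
 assumes "finite A" "a \<notin> A"
 shows "sum f (Pow (insert a A)) = sum f (Pow A) + sum (\<lambda>X. f (insert a X)) (Pow A)"
proof -
 have "inj_on (insert a) (Pow A)" using assms(2) by (intro inj_onI) (metis PowD insert_ident subsetD)
 moreover have "Pow A \<inter> insert a ` Pow A = {}" using assms(2) by blast
 ultimately show ?thesis unfolding Pow_insert using assms(1) by (simp add: sum.union_disjoint sum.reindex)
qed

lemma sum_cuts:
 fixes f :: "label set \<Rightarrow> real"
 shows "sum f cuts = f {L0} + f {L1} + f {L2} + f {L3} + (f {L0, L1} + f {L0, L2} + f {L0, L3})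
  + (f (- {L0}) + f (- {L1}) + f (- {L2}) + f (- {L3}) + (f (- {L0, L1}) + f (- {L0, L2}) + f (- {L0, L3})))"
proof -
 have c: "- {L0} = {L1, L2, L3}" "- {L1} = {L0, L2, L3}" "- {L2} = {L0, L1, L3}" "- {L3} = {L0, L1, L2}"
  "- {L0, L1} = {L2, L3}" "- {L0, L2} = {L1, L3}" "- {L0, L3} = {L1, L2}" using UNIV_label by auto
 have "sum f cuts = sum f UNIV - f {} - f UNIV"
  unfolding cuts_def by (subst sum_diff) auto
 also have "UNIV = Pow {L0, L1, L2, L3}" using UNIV_label by blast
 finally show ?thesis unfolding c
  by (simp add: sum_Pow_insert UNIV_label)
qed

lemma double_sum_le:
 fixes a :: real
 assumes "a \<le> f0" "b \<le> f1" "c \<le> f2" "d \<le> f3" "e \<le> f4" "f \<le> f5" "g \<le> f6"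
  "a \<le> g0" "b \<le> g1" "c \<le> g2" "d \<le> g3" "e \<le> g4" "f \<le> g5" "g \<le> g6"
 shows "2 * (a + b + c + d + e + f + g) \<le> f0 + f1 + f2 + f3 + (f4 + f5 + f6) + (g0 + g1 + g2 + g3 + (g4 + g5 + g6))"
proof -
 have "a + b + c + d + (e + f + g) \<le> f0 + f1 + f2 + f3 + (f4 + f5 + f6)"
  "a + b + c + d + (e + f + g) \<le> g0 + g1 + g2 + g3 + (g4 + g5 + g6)"
  by (intro add_mono assms)+
 then have "a + b + c + d + (e + f + g) + (a + b + c + d + (e + f + g))
  \<le> f0 + f1 + f2 + f3 + (f4 + f5 + f6) + (g0 + g1 + g2 + g3 + (g4 + g5 + g6))" by (rule add_mono)
 then show ?thesis by (simp only: mult_2 add.assoc)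
qed

text \<open>In the case \<open>t = N\<close> the body is cut out like a Voronoi cell of the lattice
  of the \<open>t i\<close>, and the numbers \<open>- (t i \<bullet> t j)\<close> are the Selling
  parameters. Here \<open>N\<close> and \<open>t\<close> may differ, but the mixed parameters remain
  symmetric.\<close>

locale selling_tile = centered_tile P T for P T :: "(real^3) set" +
 fixes N t :: "label \<Rightarrow> real^3"
 assumes N_sum: "N L0 + N L1 + N L2 + N L3 = 0" and t_sum: "t L0 + t L1 + t L2 + t L3 = 0"
  and symm: "\<And>i j. N i \<bullet> t j = N j \<bullet> t i"
  and t_period: "\<And>i. t i \<in> centered_tile.periods T"
  and facets: "{G. G facet_of P} = (\<lambda>S. P \<inter> {x. sum N S \<bullet> x = (sum N S \<bullet> sum t S) / 2}) ` cuts"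
  and facets_inj: "inj_on (\<lambda>S. P \<inter> {x. sum N S \<bullet> x = (sum N S \<bullet> sum t S) / 2}) cuts"
  and P_def: "P = {x. \<forall>S\<in>cuts. sum N S \<bullet> x \<le> (sum N S \<bullet> sum t S) / 2}"
begin

definition "p i j = - (N i \<bullet> t j)"
definition "\<gamma> i j = - (N i \<bullet> N j)"
definition "Fc S = P \<inter> {x. sum N S \<bullet> x = (sum N S \<bullet> sum t S) / 2}"

lemma p_sym: "p i j = p j i" by (simp add: p_def symm)
lemma \<gamma>_sym: "\<gamma> i j = \<gamma> j i" by (simp add: \<gamma>_def inner_commute)

lemma sum4:
 fixes f :: "label \<Rightarrow> 'a::ab_group_add"
 assumes "f L0 + f L1 + f L2 + f L3 = 0" "{i, j, m, l} = (UNIV :: label set)"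
 shows "f i + f j + f m + f l = 0"
proof -
 have "sum f {i, j, m, l} = f i + f j + f m + f l" using four_distinct[OF assms(2)] by (simp add: add.assoc)
 moreover have "sum f {L0, L1, L2, L3} = f L0 + f L1 + f L2 + f L3" by (simp add: add.assoc)
 ultimately show ?thesis using assms UNIV_label by simp
qed

lemma sums:
 assumes a: "{i, j, m, l} = (UNIV :: label set)" and f: "f L0 + f L1 + f L2 + f L3 = (0 :: real^3)"
 shows "sum f {i} = f i" "sum f {i, j} = f i + f j" "sum f {i, j, m} = - f l" "sum f {m, l} = - (f i + f j)"
proof -
 note d = four_distinct[OF a] and s = sum4[OF f a]
 show "sum f {i} = f i" "sum f {i, j} = f i + f j" using d by simp_all
 have "sum f {i, j, m} = f i + f j + f m" "sum f {m, l} = f m + f l" using d by (simp_all add: add.assoc)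
 then show "sum f {i, j, m} = - f l" "sum f {m, l} = - (f i + f j)"
  using s by (simp_all add: eq_neg_iff_add_eq_0 algebra_simps)
qed

lemma diag:
 assumes a: "{i, j, m, l} = (UNIV :: label set)"
 shows "N i \<bullet> t i = p i j + p i m + p i l" "N i \<bullet> N i = \<gamma> i j + \<gamma> i m + \<gamma> i l"
proof -
 have "N i \<bullet> (t i + t j + t m + t l) = 0" "N i \<bullet> (N i + N j + N m + N l) = 0"
  by (simp_all only: sum4[OF t_sum a] sum4[OF N_sum a] inner_zero_right)
 then show "N i \<bullet> t i = p i j + p i m + p i l" "N i \<bullet> N i = \<gamma> i j + \<gamma> i m + \<gamma> i l"
  by (simp_all add: inner_add_right p_def \<gamma>_def)
qed

lemma perms:
 assumes "{i, j, m, l} = (UNIV :: label set)"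
 shows "{j, i, m, l} = (UNIV :: label set)" "{m, i, j, l} = (UNIV :: label set)" "{l, i, j, m} = (UNIV :: label set)"
 unfolding assms[symmetric] by (simp_all add: insert_commute)

lemma cut_value:
 assumes a: "{i, j, m, l} = (UNIV :: label set)"
 shows "(N i + N j) \<bullet> (t i + t j) = p i m + p i l + p j m + p j l"
  "(N i + N j) \<bullet> (N i + N j) = \<gamma> i m + \<gamma> i l + \<gamma> j m + \<gamma> j l"
 using diag[OF a] diag[OF perms(1)[OF a]] p_sym[of i j] \<gamma>_sym[of i j]
 by (simp_all add: inner_add p_def[of i j] p_def[of j i] \<gamma>_def[of i j] \<gamma>_def[of j i])

lemma memI:
 assumes a: "{i, j, m, l} = (UNIV :: label set)"
  and "\<bar>N i \<bullet> x\<bar> \<le> (p i j + p i m + p i l) / 2" "\<bar>N j \<bullet> x\<bar> \<le> (p j i + p j m + p j l) / 2"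
  "\<bar>N m \<bullet> x\<bar> \<le> (p m i + p m j + p m l) / 2" "\<bar>N l \<bullet> x\<bar> \<le> (p l i + p l j + p l m) / 2"
  "\<bar>N i \<bullet> x + N j \<bullet> x\<bar> \<le> (p i m + p i l + p j m + p j l) / 2"
  "\<bar>N i \<bullet> x + N m \<bullet> x\<bar> \<le> (p i j + p i l + p m j + p m l) / 2"
  "\<bar>N i \<bullet> x + N l \<bullet> x\<bar> \<le> (p i j + p i m + p l j + p l m) / 2"
 shows "x \<in> P"
proof -
 have one: "sum N S \<bullet> x \<le> (sum N S \<bullet> sum t S) / 2 \<and> sum N (- S) \<bullet> x \<le> (sum N (- S) \<bullet> sum t (- S)) / 2"
  if b: "{i, j, m, l} = (UNIV :: label set)" and "S = {i}" "\<bar>N i \<bullet> x\<bar> \<le> (p i j + p i m + p i l) / 2" for S i j m l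
 proof -
  have b': "{j, m, l, i} = (UNIV :: label set)" using b by (simp add: insert_commute)
  have "- S = {j, m, l}" using that(2) b four_distinct[OF b] by auto
  then show ?thesis using that(2,3) diag(1)[OF b] unfolding abs_le_iff by (auto simp: sums(3)[OF b' N_sum] sums(3)[OF b' t_sum])
 qed
 have two: "sum N S \<bullet> x \<le> (sum N S \<bullet> sum t S) / 2 \<and> sum N (- S) \<bullet> x \<le> (sum N (- S) \<bullet> sum t (- S)) / 2"
  if b: "{i, j, m, l} = (UNIV :: label set)" and "S = {i, j}" "\<bar>N i \<bullet> x + N j \<bullet> x\<bar> \<le> (p i m + p i l + p j m + p j l) / 2" for S i j m l
 proof -
  have c: "- {i, j} = {m, l}" using b four_distinct[OF b] by auto
  have "(N i + N j) \<bullet> x \<le> ((N i + N j) \<bullet> (t i + t j)) / 2" "- (N i + N j) \<bullet> x \<le> ((N i + N j) \<bullet> (t i + t j)) / 2"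
   using that(3) unfolding cut_value[OF b] abs_le_iff inner_minus_left inner_add_left[of _ _ x] by blast+
  moreover have "(- (N i + N j)) \<bullet> (- (t i + t j)) = (N i + N j) \<bullet> (t i + t j)" by (simp only: inner_minus_left inner_minus_right minus_minus)
  ultimately show ?thesis unfolding that(2) c sums(2)[OF b N_sum] sums(2)[OF b t_sum] sums(4)[OF b N_sum] sums(4)[OF b t_sum]
   by (simp only:)
 qed
 have a4: "{i, m, j, l} = (UNIV :: label set)" "{i, l, j, m} = (UNIV :: label set)" using a by (simp_all add: insert_commute)
 note all = one[OF a refl assms(2)] one[OF perms(1)[OF a] refl assms(3)] one[OF perms(2)[OF a] refl assms(4)]
  one[OF perms(3)[OF a] refl assms(5)] two[OF a refl assms(6)] two[OF a4(1) refl assms(7)] two[OF a4(2) refl assms(8)]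
 have c: "- {i} = {j, m, l}" "- {j} = {i, m, l}" "- {m} = {i, j, l}" "- {l} = {i, j, m}"
  "- {i, j} = {m, l}" "- {i, m} = {j, l}" "- {i, l} = {j, m}" using a four_distinct[OF a] by auto
 have "sum N S \<bullet> x \<le> (sum N S \<bullet> sum t S) / 2" if "S \<in> cuts" for S
  using cuts_cases[OF a that] all unfolding c by blast
 then show ?thesis unfolding P_def by blast
qed

text \<open>On the plane of the facet, with origin at its centre \<open>sum t S / 2\<close>, the
  inner products with \<open>M1\<close> and \<open>M2\<close> are coordinates. A region
  \<open>H\<close> in these coordinates that stays in \<open>P\<close> bounds the area from below;
  the opposite facet follows by central symmetry.\<close>

lemma facet_area_lower:
 fixes M1 M2 :: "real^3" and H :: "(real^2) set"
 assumes S: "S \<in> cuts" and D: "\<bar>det (vector [sum N S, M1, M2] :: real^3^3)\<bar> = D" "D > 0"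
  and H: "H \<in> lmeasurable" "s \<noteq> 0" "0 \<in> H" "vector [s, 0] \<in> H" "vector [0, s] \<in> H"
  and sub: "\<And>w. \<lbrakk>sum N S \<bullet> w = 0; vector [M1 \<bullet> w, M2 \<bullet> w] \<in> H\<rbrakk> \<Longrightarrow> (1/2) *R sum t S + w \<in> P"
 shows "norm (sum N S) / D * measure lebesgue H \<le> planar_area (Fc S)"
  "norm (sum N S) / D * measure lebesgue H \<le> planar_area (Fc (- S))"
proof -
 let ?M = "sum N S" and ?u = "(1/2) *R sum t S"
 have D0: "det (vector [?M, M1, M2] :: real^3^3) \<noteq> 0" using D by auto
 have M: "?M \<noteq> 0"
 proof
  assume "?M = 0"
  then have "det (vector [?M, M1, M2] :: real^3^3) = 0" by (simp add: det_3)
  then show False using D0 by simp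
 qed
 obtain e1 e2 where e: "?M \<bullet> e1 = 0" "M1 \<bullet> e1 = 1" "M2 \<bullet> e1 = 0" "?M \<bullet> e2 = 0" "M1 \<bullet> e2 = 0" "M2 \<bullet> e2 = 1"
  "area_factor e1 e2 = norm ?M / D" using dual_plane_vectors[OF D0] D(1) by metis
 have in_P: "?u + ((z$1) *R e1 + (z$2) *R e2) \<in> P" if "z \<in> H" for z :: "real^2"
 proof (rule sub)
  have "vector [M1 \<bullet> ((z$1) *R e1 + (z$2) *R e2), M2 \<bullet> ((z$1) *R e1 + (z$2) *R e2)] = z"
   by (simp add: inner_add_right e vec_eq_iff forall_2)
  then show "vector [M1 \<bullet> ((z$1) *R e1 + (z$2) *R e2), M2 \<bullet> ((z$1) *R e1 + (z$2) *R e2)] \<in> H" using that by (simp only:)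
 qed (simp add: inner_add_right e)
 have in_F: "?u + (z$1) *R e1 + (z$2) *R e2 \<in> Fc S" if "z \<in> H" for z :: "real^2"
  using in_P[OF that] e by (simp add: Fc_def inner_add_right add.assoc)
 have "sum f (- S) = - sum f S" if "f L0 + f L1 + f L2 + f L3 = 0" for f :: "label \<Rightarrow> real^3"
 proof -
  have "sum f UNIV = 0" using that by (simp add: UNIV_label add.assoc)
  moreover have "sum f UNIV = sum f (- S) + sum f S"
   using sum.subset_diff[of S UNIV f] by (simp add: Compl_eq_Diff_UNIV)
  ultimately show ?thesis by (simp add: eq_neg_iff_add_eq_0)
 qed
 note neg = this[OF N_sum] this[OF t_sum]
 have in_F': "- ?u + (z$1) *R (- e1) + (z$2) *R (- e2) \<in> Fc (- S)" if "z \<in> H" for z :: "real^2"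
 proof -
  have "- (?u + ((z$1) *R e1 + (z$2) *R e2)) \<in> P" by (rule uminus_mem[OF in_P[OF that]])
  moreover have "- ?u + (z$1) *R (- e1) + (z$2) *R (- e2) = - (?u + ((z$1) *R e1 + (z$2) *R e2))" by simp
  moreover have "sum N (- S) \<bullet> (- (?u + ((z$1) *R e1 + (z$2) *R e2))) = (sum N (- S) \<bullet> sum t (- S)) / 2"
   unfolding neg inner_minus_left inner_minus_right inner_add_right inner_scaleR_right e by simp
  ultimately show ?thesis unfolding Fc_def Int_iff mem_Collect_eq by (simp only: simp_thms)
 qed
 have closedF: "compact (Fc R)" for R
  unfolding Fc_def by (intro compact_Int_closed compact closed_hyperplane)
 show "norm ?M / D * measure lebesgue H \<le> planar_area (Fc S)"
  using planar_area_parametrized(1)[OF M _ H(1,2), of "Fc S" "(?M \<bullet> sum t S) / 2" ?u e1 e2, OF _ _ _ _ in_F closedF]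
   in_F[OF H(3)] in_F[OF H(4)] in_F[OF H(5)] e(7) by (simp add: Fc_def)
 have "area_factor (- e1) (- e2) = area_factor e1 e2" by (simp add: area_factor_def)
 then show "norm ?M / D * measure lebesgue H \<le> planar_area (Fc (- S))"
  using planar_area_parametrized(1)[OF _ _ H(1,2), of "- ?M" "Fc (- S)" "(?M \<bullet> sum t S) / 2" "- ?u" "- e1" "- e2", OF _ _ _ _ _ in_F' closedF]
   in_F'[OF H(3)] in_F'[OF H(4)] in_F'[OF H(5)] e(7) M by (simp add: Fc_def neg)
qed

text \<open>In the coordinates \<open>N j\<close>, \<open>N m\<close> the region is bounded by three
  strips whose half-widths \<open>A\<close>, \<open>B\<close>, \<open>C\<close> are half sums of two
  parameters. Its area, a sum of three products, counts weighted spanning trees of the triangle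
  \<open>j\<close>, \<open>m\<close>, \<open>l\<close>.\<close>

lemma hexagonal_facet_area:
 assumes a: "{i, j, m, l} = (UNIV :: label set)" and pos: "\<And>i j. i \<noteq> j \<Longrightarrow> p i j > 0"
  and D: "\<bar>det (vector [N i, N j, N m] :: real^3^3)\<bar> = D" "D > 0"
 shows "(p j m * p j l + p j m * p m l + p j l * p m l) * (norm (N i) / D) \<le> planar_area (Fc {i})"
  "(p j m * p j l + p j m * p m l + p j l * p m l) * (norm (N i) / D) \<le> planar_area (Fc (- {i}))"
proof -
 note d = four_distinct[OF a]
 have ps: "p j m > 0" "p j l > 0" "p m l > 0" "p i j > 0" "p i m > 0" "p i l > 0" using d by (auto intro: pos)
 define A B C where "A = (p j m + p j l) / 2" and "B = (p j m + p m l) / 2" and "C = (p j l + p m l) / 2"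
 define s where "s = min A (min B C)"
 have "A > 0" "B > 0" "C > 0" using ps by (simp_all add: A_def B_def C_def)
 then have s: "s > 0" "s \<le> A" "s \<le> B" "s \<le> C" by (auto simp: s_def)
 let ?H = "hexagon_region A B C"
 have "4 * A * B - (A + B - C)\<^sup>2 = p j m * p j l + p j m * p m l + p j l * p m l"
  by (simp add: A_def B_def C_def power2_eq_square field_simps)
 moreover have "measure lebesgue ?H = 4 * A * B - (A + B - C)\<^sup>2"
  using ps by (intro measure_hexagon_region) (auto simp: A_def B_def C_def field_simps)
 ultimately have mH: "measure lebesgue ?H = p j m * p j l + p j m * p m l + p j l * p m l" by simp
 have sub: "(1/2) *R sum t {i} + w \<in> P"
  if w: "sum N {i} \<bullet> w = 0" "vector [N j \<bullet> w, N m \<bullet> w] \<in> ?H" for w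
 proof -
  have h: "\<bar>N j \<bullet> w\<bar> \<le> A" "\<bar>N m \<bullet> w\<bar> \<le> B" "\<bar>N j \<bullet> w + N m \<bullet> w\<bar> \<le> C" using w(2) by (simp_all add: hexagon_region_def)
  have "(N i + N j + N m + N l) \<bullet> w = 0" by (simp only: sum4[OF N_sum a] inner_zero_left)
  then have l: "N l \<bullet> w = - (N j \<bullet> w) - N m \<bullet> w" and i: "N i \<bullet> w = 0" using w(1) by (simp_all add: inner_add_left)
  have v: "N i \<bullet> ((1/2) *R sum t {i} + w) = (p i j + p i m + p i l) / 2"
   "N j \<bullet> ((1/2) *R sum t {i} + w) = - p i j / 2 + N j \<bullet> w" "N m \<bullet> ((1/2) *R sum t {i} + w) = - p i m / 2 + N m \<bullet> w"
   "N l \<bullet> ((1/2) *R sum t {i} + w) = - p i l / 2 - N j \<bullet> w - N m \<bullet> w"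
   using diag(1)[OF a] by (simp_all add: inner_add_right i l p_def symm[of j i] symm[of m i] symm[of l i])
  have hh: "N j \<bullet> w \<le> A" "- A \<le> N j \<bullet> w" "N m \<bullet> w \<le> B" "- B \<le> N m \<bullet> w" "N j \<bullet> w + N m \<bullet> w \<le> C" "- C \<le> N j \<bullet> w + N m \<bullet> w"
   using h by (auto simp: abs_le_iff)
  note h2 = hh[unfolded A_def B_def C_def]
  note sy = p_sym[of j i] p_sym[of m i] p_sym[of l i] p_sym[of m j] p_sym[of l j] p_sym[of l m]
  show ?thesis
   by (rule memI[OF a]; unfold v sy; rule abs_leI; insert h2 ps; simp add: field_simps)
 qed
 have comp: "?H \<in> lmeasurable" by (rule lmeasurable_compact[OF compact_hexagon_region])
 have "vector [s, 0] \<in> ?H" "vector [0, s] \<in> ?H" "0 \<in> ?H" using s by (auto simp: hexagon_region_def)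
 then have pts: "s \<noteq> 0" "0 \<in> ?H" "vector [s, 0] \<in> ?H" "vector [0, s] \<in> ?H" using s by auto
 have D': "\<bar>det (vector [sum N {i}, N j, N m] :: real^3^3)\<bar> = D" using D(1) by simp
 show "(p j m * p j l + p j m * p m l + p j l * p m l) * (norm (N i) / D) \<le> planar_area (Fc {i})"
  "(p j m * p j l + p j m * p m l + p j l * p m l) * (norm (N i) / D) \<le> planar_area (Fc (- {i}))"
  using facet_area_lower[OF singleton_cut D' D(2) comp pts sub] unfolding mH by (simp_all add: mult.commute)
qed

text \<open>In the coordinates \<open>N i\<close>, \<open>N m\<close> the region is a box with sides
  \<open>p i j\<close> and \<open>p m l\<close>.\<close>

lemma parallelogram_facet_area:
 assumes a: "{i, j, m, l} = (UNIV :: label set)" and pos: "\<And>i j. i \<noteq> j \<Longrightarrow> p i j > 0"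
  and D: "\<bar>det (vector [N i + N j, N i, N m] :: real^3^3)\<bar> = D" "D > 0"
 shows "(p i j * p m l) * (norm (N i + N j) / D) \<le> planar_area (Fc {i, j})"
  "(p i j * p m l) * (norm (N i + N j) / D) \<le> planar_area (Fc (- {i, j}))"
proof -
 note d = four_distinct[OF a]
 have ps: "p j m > 0" "p j l > 0" "p m l > 0" "p i j > 0" "p i m > 0" "p i l > 0" using d by (auto intro: pos)
 define A B where "A = p i j / 2" and "B = p m l / 2"
 define s where "s = min A B"
 have "A > 0" "B > 0" using ps by (simp_all add: A_def B_def)
 then have s: "s > 0" "s \<le> A" "s \<le> B" by (auto simp: s_def)
 let ?H = "cbox (vector [-A, -B]) (vector [A, B]) :: (real^2) set"
 have memH: "z \<in> ?H \<longleftrightarrow> - A \<le> z$1 \<and> z$1 \<le> A \<and> - B \<le> z$2 \<and> z$2 \<le> B" for z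
  by (auto simp: mem_box_cart forall_2)
 have "measure lborel ?H = (\<Prod>i\<in>UNIV. (vector [A, B] :: real^2) $ i - (vector [-A, -B] :: real^2) $ i)"
  using s by (subst content_cbox_cart) (auto simp: interval_ne_empty_cart forall_2)
 also have "\<dots> = 4 * A * B" by (simp add: UNIV_2)
 finally have mH: "measure lebesgue ?H = p i j * p m l" by (simp add: A_def B_def)
 have tS: "sum t {i, j} = t i + t j" and NS: "sum N {i, j} = N i + N j" using sums(2)[OF a t_sum] sums(2)[OF a N_sum] by auto
 have sub: "(1/2) *R sum t {i, j} + w \<in> P"
  if w: "sum N {i, j} \<bullet> w = 0" "vector [N i \<bullet> w, N m \<bullet> w] \<in> ?H" for w
 proof -
  have hh: "N i \<bullet> w \<le> A" "- A \<le> N i \<bullet> w" "N m \<bullet> w \<le> B" "- B \<le> N m \<bullet> w" using w(2) unfolding memH by simp_all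
  have "(N i + N j + N m + N l) \<bullet> w = 0" by (simp only: sum4[OF N_sum a] inner_zero_left)
  then have l: "N l \<bullet> w = - (N m \<bullet> w)" and j: "N j \<bullet> w = - (N i \<bullet> w)" using w(1) unfolding NS by (simp_all add: inner_add_left)
  have v: "N i \<bullet> ((1/2) *R sum t {i, j} + w) = (p i m + p i l) / 2 + N i \<bullet> w"
   "N j \<bullet> ((1/2) *R sum t {i, j} + w) = (p j m + p j l) / 2 - N i \<bullet> w"
   "N m \<bullet> ((1/2) *R sum t {i, j} + w) = - (p i m + p j m) / 2 + N m \<bullet> w"
   "N l \<bullet> ((1/2) *R sum t {i, j} + w) = - (p i l + p j l) / 2 - N m \<bullet> w"
   using diag(1)[OF a] diag(1)[OF perms(1)[OF a]]
   by (simp_all add: tS inner_add_right j l p_def symm[of j i] symm[of m i] symm[of l i] symm[of m j] symm[of l j] add_divide_distrib)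
  note h2 = hh[unfolded A_def B_def]
  note sy = p_sym[of j i] p_sym[of m i] p_sym[of l i] p_sym[of m j] p_sym[of l j] p_sym[of l m]
  show ?thesis
   by (rule memI[OF a]; unfold v sy; rule abs_leI; insert h2 ps; simp add: field_simps)
 qed
 have comp: "?H \<in> lmeasurable" by (rule lmeasurable_cbox)
 have pts: "s \<noteq> 0" "0 \<in> ?H" "vector [s, 0] \<in> ?H" "vector [0, s] \<in> ?H" using s ps unfolding memH by auto
 have D': "\<bar>det (vector [sum N {i, j}, N i, N m] :: real^3^3)\<bar> = D" using D(1) unfolding NS .
 show "(p i j * p m l) * (norm (N i + N j) / D) \<le> planar_area (Fc {i, j})"
  "(p i j * p m l) * (norm (N i + N j) / D) \<le> planar_area (Fc (- {i, j}))"
  using facet_area_lower[OF cut_in(2)[OF a] D' D(2) comp pts sub] unfolding mH NS by (simp_all add: mult.commute)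
qed

definition "D = \<bar>det (vector [N L1, N L2, N L3] :: real^3^3)\<bar>"

abbreviation "pt \<equiv> tree_sum (p L0 L1) (p L0 L2) (p L0 L3) (p L2 L3) (p L1 L3) (p L1 L2)"
abbreviation "gt \<equiv> tree_sum (\<gamma> L0 L1) (\<gamma> L0 L2) (\<gamma> L0 L3) (\<gamma> L2 L3) (\<gamma> L1 L3) (\<gamma> L1 L2)"

lemma label_perms: "{L0, L1, L2, L3} = UNIV" "{L1, L0, L2, L3} = UNIV" "{L2, L0, L1, L3} = UNIV" "{L3, L0, L1, L2} = UNIV"
 "{L0, L2, L1, L3} = UNIV" "{L0, L3, L1, L2} = UNIV" using UNIV_label by auto

text \<open>The matrix of the products \<open>N i \<bullet> t j\<close> with \<open>L0\<close>
  removed is the reduced Laplacian of the complete graph with weights \<open>p\<close>, so this is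
  an instance of the matrix-tree theorem, checked by expansion.\<close>

lemma det_t: "det (vector [N L1, N L2, N L3] :: real^3^3) * det (columns3 (t L1) (t L2) (t L3)) = pt"
proof -
 note dg = diag(1)[OF label_perms(2)] diag(1)[OF label_perms(3)] diag(1)[OF label_perms(4)]
 have od: "N i \<bullet> t j = - p i j" for i j by (simp add: p_def)
 show ?thesis unfolding det_rows_columns3 dg unfolding od tree_sum_def
  by (simp add: p_sym[of L1 L0] p_sym[of L2 L0] p_sym[of L3 L0] p_sym[of L2 L1] p_sym[of L3 L1] p_sym[of L3 L2]
   algebra_simps power2_eq_square)
qed

lemma det_N: "D\<^sup>2 = gt"
proof -
 note dg = diag(2)[OF label_perms(2)] diag(2)[OF label_perms(3)] diag(2)[OF label_perms(4)]
 have od: "N i \<bullet> N j = - \<gamma> i j" for i j by (simp add: \<gamma>_def)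
 have "det (columns3 (N L1) (N L2) (N L3)) = det (vector [N L1, N L2, N L3] :: real^3^3)"
  unfolding columns3_def by (rule det_transpose)
 then have "D\<^sup>2 = det (vector [N L1, N L2, N L3] :: real^3^3) * det (columns3 (N L1) (N L2) (N L3))"
  unfolding D_def by (simp add: power2_eq_square)
 also have "\<dots> = gt" unfolding det_rows_columns3 dg unfolding od tree_sum_def
  by (simp add: \<gamma>_sym[of L1 L0] \<gamma>_sym[of L2 L0] \<gamma>_sym[of L3 L0] \<gamma>_sym[of L2 L1] \<gamma>_sym[of L3 L1] \<gamma>_sym[of L3 L2]
   algebra_simps power2_eq_square)
 finally show ?thesis .
qed

text \<open>The interior of \<open>P\<close> packs under the lattice generated by the periods
  \<open>t L1\<close>, \<open>t L2\<close>, \<open>t L3\<close>, and \<open>det_t\<close> evaluates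
  the determinant of this lattice.\<close>

lemma volume_le: assumes "pt > 0" shows "volume P \<le> pt / D"
proof -
 let ?M = "columns3 (t L1) (t L2) (t L3)"
 have nz: "det ?M \<noteq> 0" "D > 0" using det_t assms by (auto simp: D_def)
 have "measure lebesgue (interior P) \<le> \<bar>det ?M\<bar>"
 proof (rule measure_packing_le_det(2)[OF nz(1)])
  show "interior P \<in> sets lebesgue" by simp
  fix g assume g: "g \<in> int_span ?M" "g \<noteq> 0"
  have "g \<in> periods" using int_span_columns3[OF t_period t_period t_period] g(1) by blast
  then have "g \<in> T" using periods_subset by blast
  have "interior P \<inter> {x. x + g \<in> interior P} = {}"
  proof (rule ccontr)
   assume "\<not> ?thesis"
   then obtain x where "x \<in> interior P" "x + g \<in> interior P" by blast
   then show False using interiors_disjoint[OF zero_in \<open>g \<in> T\<close>, of "x + g"] g(2) by simp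
  qed
  then show "negligible (interior P \<inter> {x. x + g \<in> interior P})" by simp
 qed
 moreover have "measure lebesgue (interior P) = volume P"
  by (intro measure_interior compact_imp_bounded compact negligible_convex_frontier convex)
 moreover have "\<bar>det ?M\<bar> = pt / D"
  using arg_cong[OF det_t, of abs] assms nz(2) by (simp add: D_def abs_mult field_simps)
 ultimately show ?thesis by simp
qed

lemma surface_area_ge:
 assumes pos: "\<And>i j. i \<noteq> j \<Longrightarrow> p i j > 0" and D0: "D > 0"
 shows "2 * area_sum (p L0 L1) (p L0 L2) (p L0 L3) (p L2 L3) (p L1 L3) (p L1 L2)
   (\<gamma> L0 L1) (\<gamma> L0 L2) (\<gamma> L0 L3) (\<gamma> L2 L3) (\<gamma> L1 L3) (\<gamma> L1 L2) / D \<le> surface_area P"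
proof -
 have N0: "N L0 = - N L1 - N L2 - N L3" using N_sum by (simp add: eq_neg_iff_add_eq_0 algebra_simps)
 have dets: "\<bar>det (vector [N L0, N L1, N L2] :: real^3^3)\<bar> = D" (is ?thesis1) "\<bar>det (vector [N L1, N L0, N L2] :: real^3^3)\<bar> = D" (is ?thesis2)
  "\<bar>det (vector [N L2, N L0, N L1] :: real^3^3)\<bar> = D" (is ?thesis3) "\<bar>det (vector [N L3, N L0, N L1] :: real^3^3)\<bar> = D" (is ?thesis4)
  "\<bar>det (vector [N L0 + N L1, N L0, N L2] :: real^3^3)\<bar> = D" (is ?thesis5) "\<bar>det (vector [N L0 + N L2, N L0, N L1] :: real^3^3)\<bar> = D" (is ?thesis6)
  "\<bar>det (vector [N L0 + N L3, N L0, N L1] :: real^3^3)\<bar> = D" (is ?thesis7)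
 proof -
  let ?D = "det (vector [N L1, N L2, N L3] :: real^3^3)"
  \<comment> \<open>Because the normals add up to 0, any three of them span the same volume.\<close>
  have "det (vector [N L0, N L1, N L2] :: real^3^3) = - ?D" "det (vector [N L1, N L0, N L2] :: real^3^3) = ?D"
   "det (vector [N L2, N L0, N L1] :: real^3^3) = - ?D" "det (vector [N L3, N L0, N L1] :: real^3^3) = ?D"
   "det (vector [N L0 + N L1, N L0, N L2] :: real^3^3) = ?D" "det (vector [N L0 + N L2, N L0, N L1] :: real^3^3) = - ?D"
   "det (vector [N L0 + N L3, N L0, N L1] :: real^3^3) = ?D"
   unfolding N0 by (simp_all add: det_3 algebra_simps)
  then show ?thesis1 ?thesis2 ?thesis3 ?thesis4 ?thesis5 ?thesis6 ?thesis7
   unfolding D_def by simp_all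
 qed
 note hx = hexagonal_facet_area[OF label_perms(1) pos dets(1) D0] hexagonal_facet_area[OF label_perms(2) pos dets(2) D0]
  hexagonal_facet_area[OF label_perms(3) pos dets(3) D0] hexagonal_facet_area[OF label_perms(4) pos dets(4) D0]
 note sq = parallelogram_facet_area[OF label_perms(1) pos dets(5) D0] parallelogram_facet_area[OF label_perms(5) pos dets(6) D0]
  parallelogram_facet_area[OF label_perms(6) pos dets(7) D0]
 have nh: "norm (N i) = sqrt (\<gamma> i j + \<gamma> i m + \<gamma> i l)" if "{i, j, m, l} = (UNIV :: label set)" for i j m l
  unfolding norm_eq_sqrt_inner diag(2)[OF that] ..
 have ns: "norm (N i + N j) = sqrt (\<gamma> i m + \<gamma> i l + \<gamma> j m + \<gamma> j l)" if "{i, j, m, l} = (UNIV :: label set)" for i j m l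
  unfolding norm_eq_sqrt_inner cut_value(2)[OF that] ..
 note syg = \<gamma>_sym[of L1 L0] \<gamma>_sym[of L2 L0] \<gamma>_sym[of L3 L0] \<gamma>_sym[of L2 L1] \<gamma>_sym[of L3 L1] \<gamma>_sym[of L3 L2]
 have "surface_area P = sum (\<lambda>S. planar_area (Fc S)) cuts"
  unfolding surface_area_def facets Fc_def using facets_inj by (simp add: sum.reindex)
 also have "\<dots> \<ge> 2 * ((p L1 L2 * p L1 L3 + p L1 L2 * p L2 L3 + p L1 L3 * p L2 L3) * (norm (N L0) / D)
   + (p L0 L2 * p L0 L3 + p L0 L2 * p L2 L3 + p L0 L3 * p L2 L3) * (norm (N L1) / D)
   + (p L0 L1 * p L0 L3 + p L0 L1 * p L1 L3 + p L0 L3 * p L1 L3) * (norm (N L2) / D)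
   + (p L0 L1 * p L0 L2 + p L0 L1 * p L1 L2 + p L0 L2 * p L1 L2) * (norm (N L3) / D)
   + (p L0 L1 * p L2 L3) * (norm (N L0 + N L1) / D) + (p L0 L2 * p L1 L3) * (norm (N L0 + N L2) / D)
   + (p L0 L3 * p L1 L2) * (norm (N L0 + N L3) / D))" (is "_ \<ge> ?X")
  unfolding sum_cuts by (intro double_sum_le hx sq)
 also have "?X = 2 * area_sum (p L0 L1) (p L0 L2) (p L0 L3) (p L2 L3) (p L1 L3) (p L1 L2)
   (\<gamma> L0 L1) (\<gamma> L0 L2) (\<gamma> L0 L3) (\<gamma> L2 L3) (\<gamma> L1 L3) (\<gamma> L1 L2) / D"
  unfolding nh[OF label_perms(1)] nh[OF label_perms(2)] nh[OF label_perms(3)] nh[OF label_perms(4)]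
   ns[OF label_perms(1)] ns[OF label_perms(5)] ns[OF label_perms(6)] syg area_sum_def
  by (simp add: add_divide_distrib algebra_simps)
 finally show ?thesis .
qed

end

section \<open>Scaling and the lower bound for the isoperimetric quotient\<close>

lemma tree_sum_scale: "tree_sum (s * a1) (s * a2) (s * a3) (s * b1) (s * b2) (s * b3) = s ^ 3 * tree_sum a1 a2 a3 b1 b2 b3"
 by (simp add: tree_sum_def algebra_simps power2_eq_square power3_eq_cube)

lemma area_sum_scale:
 "area_sum (s * a1) (s * a2) (s * a3) (s * b1) (s * b2) (s * b3) (u * c1) (u * c2) (u * c3) (u * d1) (u * d2) (u * d3)
  = s\<^sup>2 * sqrt u * area_sum a1 a2 a3 b1 b2 b3 c1 c2 c3 d1 d2 d3"
 unfolding area_sum_def by (simp add: distrib_left[of u, symmetric] real_sqrt_mult) (simp add: algebra_simps power2_eq_square)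

text \<open>The scales of both families cancel: \<sigma> has degree 2 in the area and in the 2/3
  power of the volume, and the root of \<tau> is absorbed by \<open>D powr (1/3)\<close>.\<close>

lemma quotient_powr:
 fixes \<sigma> \<tau> tp tg D :: real
 assumes "\<sigma> > 0" "\<tau> > 0" "tp > 0" "tg > 0" "D > 0" "D\<^sup>2 = \<tau> ^ 3 * tg"
 shows "(2 * (\<sigma>\<^sup>2 * sqrt \<tau> * A) / D) / ((\<sigma> ^ 3 * tp / D) powr (2/3)) = 2 * A / (tp powr (2/3) * tg powr (1/6))"
proof -
 have s: "(\<sigma> ^ 3) powr (2/3) = \<sigma>\<^sup>2"
  using assms(1) by (simp add: powr_powr flip: powr_numeral)
 have "(\<sigma> ^ 3 * tp / D) powr (2/3) = \<sigma>\<^sup>2 * tp powr (2/3) / D powr (2/3)"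
  using assms by (simp add: powr_mult powr_divide s)
 moreover have "D = D powr (1/3) * D powr (2/3)" using assms(5) by (simp flip: powr_add)
 moreover have "D powr (1/3) = sqrt \<tau> * tg powr (1/6)"
 proof -
  have "D powr (1/3) = (D\<^sup>2) powr (1/6)" using assms(5) by (simp add: powr_powr flip: powr_numeral)
  also have "\<dots> = (\<tau> ^ 3) powr (1/6) * tg powr (1/6)" unfolding assms(6) using assms by (simp add: powr_mult)
  also have "(\<tau> ^ 3) powr (1/6) = \<tau> powr (1/2)" using assms(2) by (simp add: powr_powr flip: powr_numeral)
  finally show ?thesis using assms(2) by (simp add: powr_half_sqrt)
 qed
 ultimately show ?thesis
 proof -
  assume a: "(\<sigma> ^ 3 * tp / D) powr (2/3) = \<sigma>\<^sup>2 * tp powr (2/3) / D powr (2/3)"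
   and b: "D = D powr (1/3) * D powr (2/3)" and c: "D powr (1/3) = sqrt \<tau> * tg powr (1/6)"
  have pos: "D powr (2/3) > 0" "sqrt \<tau> > 0" "tg powr (1/6) > 0" "tp powr (2/3) > 0" "\<sigma>\<^sup>2 > 0" using assms by simp_all
  define x y z w where "x = D powr (2/3)" and "y = sqrt \<tau>" and "z = tg powr (1/6)" and "w = tp powr (2/3)"
  have D: "D = y * z * x" using b unfolding c x_def y_def z_def .
  show ?thesis unfolding a unfolding x_def[symmetric] y_def[symmetric] z_def[symmetric] w_def[symmetric] unfolding D
   using pos[folded x_def y_def z_def w_def] by (simp add: field_simps)
 qed
qed

context selling_tile
begin

definition "\<sigma> = (p L0 L1 + p L0 L2 + p L0 L3 + p L2 L3 + p L1 L3 + p L1 L2) / 6"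
definition "\<tau> = (\<gamma> L0 L1 + \<gamma> L0 L2 + \<gamma> L0 L3 + \<gamma> L2 L3 + \<gamma> L1 L3 + \<gamma> L1 L2) / 6"
definition "q i j = p i j / \<sigma> - 1"
definition "g i j = \<gamma> i j / \<tau> - 1"
text \<open>The factor 1/2 makes the square of \<open>dev\<close> the sum of the squares of all
  half-sums and half-differences of opposite weights; it is the \<open>r\<close> of
  \<open>isoperimetric_inequality_near_one\<close>.\<close>

definition "dev = sqrt (((q L0 L1)\<^sup>2 + (q L0 L2)\<^sup>2 + (q L0 L3)\<^sup>2 + (q L2 L3)\<^sup>2 + (q L1 L3)\<^sup>2 + (q L1 L2)\<^sup>2
  + ((g L0 L1)\<^sup>2 + (g L0 L2)\<^sup>2 + (g L0 L3)\<^sup>2 + (g L2 L3)\<^sup>2 + (g L1 L3)\<^sup>2 + (g L1 L2)\<^sup>2)) / 2)"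

lemma dev_nonneg: "dev \<ge> 0" by (simp add: dev_def)

lemma dev_sq: "dev\<^sup>2 = ((q L0 L1)\<^sup>2 + (q L0 L2)\<^sup>2 + (q L0 L3)\<^sup>2 + (q L2 L3)\<^sup>2 + (q L1 L3)\<^sup>2 + (q L1 L2)\<^sup>2
  + ((g L0 L1)\<^sup>2 + (g L0 L2)\<^sup>2 + (g L0 L3)\<^sup>2 + (g L2 L3)\<^sup>2 + (g L1 L3)\<^sup>2 + (g L1 L2)\<^sup>2)) / 2"
 unfolding dev_def by (rule real_sqrt_pow2) simp

lemma qg_sym: "q i j = q j i" "g i j = g j i"
 by (simp_all add: q_def g_def p_sym[of i j] \<gamma>_sym[of i j])

lemma qg_le:
 assumes "i \<noteq> j" shows "\<bar>q i j\<bar> \<le> 2 * dev" "\<bar>g i j\<bar> \<le> 2 * dev"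
proof -
 note n = zero_le_power2[of "q L0 L1"] zero_le_power2[of "q L0 L2"] zero_le_power2[of "q L0 L3"]
  zero_le_power2[of "q L2 L3"] zero_le_power2[of "q L1 L3"] zero_le_power2[of "q L1 L2"]
  zero_le_power2[of "g L0 L1"] zero_le_power2[of "g L0 L2"] zero_le_power2[of "g L0 L3"]
  zero_le_power2[of "g L2 L3"] zero_le_power2[of "g L1 L3"] zero_le_power2[of "g L1 L2"]
 have d: "(q L0 L1)\<^sup>2 + (q L0 L2)\<^sup>2 + (q L0 L3)\<^sup>2 + (q L2 L3)\<^sup>2 + (q L1 L3)\<^sup>2 + (q L1 L2)\<^sup>2
  + ((g L0 L1)\<^sup>2 + (g L0 L2)\<^sup>2 + (g L0 L3)\<^sup>2 + (g L2 L3)\<^sup>2 + (g L1 L3)\<^sup>2 + (g L1 L2)\<^sup>2) = 2 * dev\<^sup>2" using dev_sq by simp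
 have fq0: "(q L0 L1)\<^sup>2 \<le> 2 * dev\<^sup>2" using d n by linarith
 have fq1: "(q L0 L2)\<^sup>2 \<le> 2 * dev\<^sup>2" using d n by linarith
 have fq2: "(q L0 L3)\<^sup>2 \<le> 2 * dev\<^sup>2" using d n by linarith
 have fq3: "(q L2 L3)\<^sup>2 \<le> 2 * dev\<^sup>2" using d n by linarith
 have fq4: "(q L1 L3)\<^sup>2 \<le> 2 * dev\<^sup>2" using d n by linarith
 have fq5: "(q L1 L2)\<^sup>2 \<le> 2 * dev\<^sup>2" using d n by linarith
 have fg0: "(g L0 L1)\<^sup>2 \<le> 2 * dev\<^sup>2" using d n by linarith
 have fg1: "(g L0 L2)\<^sup>2 \<le> 2 * dev\<^sup>2" using d n by linarith
 have fg2: "(g L0 L3)\<^sup>2 \<le> 2 * dev\<^sup>2" using d n by linarith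
 have fg3: "(g L2 L3)\<^sup>2 \<le> 2 * dev\<^sup>2" using d n by linarith
 have fg4: "(g L1 L3)\<^sup>2 \<le> 2 * dev\<^sup>2" using d n by linarith
 have fg5: "(g L1 L2)\<^sup>2 \<le> 2 * dev\<^sup>2" using d n by linarith
 have "(q i j)\<^sup>2 \<le> 2 * dev\<^sup>2 \<and> (g i j)\<^sup>2 \<le> 2 * dev\<^sup>2"
  using assms by (cases i; cases j) (simp_all only: fq0 fq1 fq2 fq3 fq4 fq5 fg0 fg1 fg2 fg3 fg4 fg5
   qg_sym[of L1 L0] qg_sym[of L2 L0] qg_sym[of L3 L0] qg_sym[of L2 L1] qg_sym[of L3 L1] qg_sym[of L3 L2] simp_thms)
 moreover have "2 * dev\<^sup>2 \<le> (2 * dev)\<^sup>2" by (simp add: power_mult_distrib)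
 ultimately have "(q i j)\<^sup>2 \<le> (2 * dev)\<^sup>2" "(g i j)\<^sup>2 \<le> (2 * dev)\<^sup>2" by linarith+
 then show "\<bar>q i j\<bar> \<le> 2 * dev" "\<bar>g i j\<bar> \<le> 2 * dev"
  using dev_nonneg by (metis abs_le_square_iff abs_of_nonneg mult_nonneg_nonneg zero_le_numeral)+
qed

lemma pq:
 assumes "\<sigma> > 0" "\<tau> > 0" shows "p i j = \<sigma> * (1 + q i j)" "\<gamma> i j = \<tau> * (1 + g i j)"
 using assms by (simp_all add: q_def g_def)

text \<open>Area from below is divided by volume from above; \<open>16 powr (5/6)\<close> collects
  \<open>16 powr (2/3)\<close> and \<open>16 powr (1/6)\<close>, which come from dividing the two
  tree sums by 16.\<close>

theorem isoperimetric_lower: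
 assumes st: "\<sigma> > 0" "\<tau> > 0" and r: "dev \<le> 1/100000"
 shows "2 * (12 * sqrt 3 + 6 + dev\<^sup>2 / 50) / 16 powr (5/6) \<le> isoperimetric_quotient P"
proof -
 define m1 m2 m3 where "m1 = (q L0 L1 + q L2 L3) / 2" and "m2 = (q L0 L2 + q L1 L3) / 2" and "m3 = (q L0 L3 + q L1 L2) / 2"
 define h1 h2 h3 where "h1 = (q L0 L1 - q L2 L3) / 2" and "h2 = (q L0 L2 - q L1 L3) / 2" and "h3 = (q L0 L3 - q L1 L2) / 2"
 define M1 M2 M3 where "M1 = (g L0 L1 + g L2 L3) / 2" and "M2 = (g L0 L2 + g L1 L3) / 2" and "M3 = (g L0 L3 + g L1 L2) / 2"
 define H1 H2 H3 where "H1 = (g L0 L1 - g L2 L3) / 2" and "H2 = (g L0 L2 - g L1 L3) / 2" and "H3 = (g L0 L3 - g L1 L2) / 2"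
 note defs = m1_def m2_def m3_def h1_def h2_def h3_def and defs' = M1_def M2_def M3_def H1_def H2_def H3_def
 have qsum: "q L0 L1 + q L0 L2 + q L0 L3 + q L2 L3 + q L1 L3 + q L1 L2 = 0"
 proof -
  have "p L0 L1 + p L0 L2 + p L0 L3 + p L2 L3 + p L1 L3 + p L1 L2 = 6 * \<sigma>" by (simp add: \<sigma>_def)
  moreover have "q L0 L1 + q L0 L2 + q L0 L3 + q L2 L3 + q L1 L3 + q L1 L2 = (p L0 L1 + p L0 L2 + p L0 L3 + p L2 L3 + p L1 L3 + p L1 L2) / \<sigma> - 6"
   unfolding q_def by (simp add: add_divide_distrib)
  ultimately show ?thesis using st(1) by simp
 qed
 have gsum: "g L0 L1 + g L0 L2 + g L0 L3 + g L2 L3 + g L1 L3 + g L1 L2 = 0"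
 proof -
  have "\<gamma> L0 L1 + \<gamma> L0 L2 + \<gamma> L0 L3 + \<gamma> L2 L3 + \<gamma> L1 L3 + \<gamma> L1 L2 = 6 * \<tau>" by (simp add: \<tau>_def)
  moreover have "g L0 L1 + g L0 L2 + g L0 L3 + g L2 L3 + g L1 L3 + g L1 L2 = (\<gamma> L0 L1 + \<gamma> L0 L2 + \<gamma> L0 L3 + \<gamma> L2 L3 + \<gamma> L1 L3 + \<gamma> L1 L2) / \<tau> - 6"
   unfolding g_def by (simp add: add_divide_distrib)
  ultimately show ?thesis using st(2) by simp
 qed
 have m0: "m1 + m2 + m3 = 0" "M1 + M2 + M3 = 0"
  using qsum gsum unfolding defs defs' by (simp_all add: field_simps)
 have sq: "2 * ((x + y) / 2)\<^sup>2 + 2 * ((x - y) / 2)\<^sup>2 = x\<^sup>2 + y\<^sup>2" for x y :: real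
  by (simp add: power2_eq_square field_simps)
 have e0: "2 * m1\<^sup>2 + 2 * h1\<^sup>2 = (q L0 L1)\<^sup>2 + (q L2 L3)\<^sup>2" unfolding m1_def h1_def by (rule sq)
 have e1: "2 * m2\<^sup>2 + 2 * h2\<^sup>2 = (q L0 L2)\<^sup>2 + (q L1 L3)\<^sup>2" unfolding m2_def h2_def by (rule sq)
 have e2: "2 * m3\<^sup>2 + 2 * h3\<^sup>2 = (q L0 L3)\<^sup>2 + (q L1 L2)\<^sup>2" unfolding m3_def h3_def by (rule sq)
 have e3: "2 * M1\<^sup>2 + 2 * H1\<^sup>2 = (g L0 L1)\<^sup>2 + (g L2 L3)\<^sup>2" unfolding M1_def H1_def by (rule sq)
 have e4: "2 * M2\<^sup>2 + 2 * H2\<^sup>2 = (g L0 L2)\<^sup>2 + (g L1 L3)\<^sup>2" unfolding M2_def H2_def by (rule sq)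
 have e5: "2 * M3\<^sup>2 + 2 * H3\<^sup>2 = (g L0 L3)\<^sup>2 + (g L1 L2)\<^sup>2" unfolding M3_def H3_def by (rule sq)
 have d2: "2 * dev\<^sup>2 = (q L0 L1)\<^sup>2 + (q L0 L2)\<^sup>2 + (q L0 L3)\<^sup>2 + (q L2 L3)\<^sup>2 + (q L1 L3)\<^sup>2 + (q L1 L2)\<^sup>2
  + ((g L0 L1)\<^sup>2 + (g L0 L2)\<^sup>2 + (g L0 L3)\<^sup>2 + (g L2 L3)\<^sup>2 + (g L1 L3)\<^sup>2 + (g L1 L2)\<^sup>2)" using dev_sq by simp
 have rr: "dev\<^sup>2 = (m1\<^sup>2 + m2\<^sup>2 + m3\<^sup>2 + (h1\<^sup>2 + h2\<^sup>2 + h3\<^sup>2)) + (M1\<^sup>2 + M2\<^sup>2 + M3\<^sup>2 + (H1\<^sup>2 + H2\<^sup>2 + H3\<^sup>2))"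
 proof -
  have "2 * dev\<^sup>2 = (2 * m1\<^sup>2 + 2 * h1\<^sup>2) + (2 * m2\<^sup>2 + 2 * h2\<^sup>2) + (2 * m3\<^sup>2 + 2 * h3\<^sup>2)
   + ((2 * M1\<^sup>2 + 2 * H1\<^sup>2) + (2 * M2\<^sup>2 + 2 * H2\<^sup>2) + (2 * M3\<^sup>2 + 2 * H3\<^sup>2))"
   unfolding e0 e1 e2 e3 e4 e5 d2 by (simp only: add_ac)
  then show ?thesis by simp
 qed
 have mh: "m1 + h1 = q L0 L1" "m2 + h2 = q L0 L2" "m3 + h3 = q L0 L3" "m1 - h1 = q L2 L3" "m2 - h2 = q L1 L3" "m3 - h3 = q L1 L2"
  "M1 + H1 = g L0 L1" "M2 + H2 = g L0 L2" "M3 + H3 = g L0 L3" "M1 - H1 = g L2 L3" "M2 - H2 = g L1 L3" "M3 - H3 = g L1 L2"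
  unfolding defs defs' by (simp_all add: field_simps)
 note mh' = mh[THEN arg_cong[where f = "\<lambda>x. 1 + x"], unfolded add.assoc[symmetric] add_diff_eq]
 define tp where "tp = tree_sum (1 + q L0 L1) (1 + q L0 L2) (1 + q L0 L3) (1 + q L2 L3) (1 + q L1 L3) (1 + q L1 L2)"
 define tg where "tg = tree_sum (1 + g L0 L1) (1 + g L0 L2) (1 + g L0 L3) (1 + g L2 L3) (1 + g L1 L3) (1 + g L1 L2)"
 define A where "A = area_sum (1 + q L0 L1) (1 + q L0 L2) (1 + q L0 L3) (1 + q L2 L3) (1 + q L1 L3) (1 + q L1 L2)
  (1 + g L0 L1) (1 + g L0 L2) (1 + g L0 L3) (1 + g L2 L3) (1 + g L1 L3) (1 + g L1 L2)"
 note iso = isoperimetric_inequality_near_one[OF m0 dev_nonneg r rr, unfolded mh', folded tp_def tg_def A_def]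
 have pt: "pt = \<sigma> ^ 3 * tp" and gt: "gt = \<tau> ^ 3 * tg"
  unfolding pq[OF st] tree_sum_scale tp_def tg_def by (rule refl)+
 have ptp: "pt > 0" and gtp: "gt > 0" unfolding pt gt using st iso(1,2) by simp_all
 have Dp: "D > 0" using det_N gtp by (metis D_def abs_ge_zero less_eq_real_def power_zero_numeral)
 have ppos: "p i j > 0" if "i \<noteq> j" for i j
 proof -
  have "\<bar>q i j\<bar> < 1" using qg_le(1)[OF that] r by linarith
  then show ?thesis unfolding pq[OF st] using st by simp
 qed
 have "2 * area_sum (p L0 L1) (p L0 L2) (p L0 L3) (p L2 L3) (p L1 L3) (p L1 L2)
   (\<gamma> L0 L1) (\<gamma> L0 L2) (\<gamma> L0 L3) (\<gamma> L2 L3) (\<gamma> L1 L3) (\<gamma> L1 L2) / D \<le> surface_area P"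
  by (rule surface_area_ge[OF ppos Dp])
 then have S: "2 * (\<sigma>\<^sup>2 * sqrt \<tau> * A) / D \<le> surface_area P"
  unfolding pq[OF st] area_sum_scale A_def .
 have V: "volume P \<le> \<sigma> ^ 3 * tp / D" using volume_le[OF ptp] unfolding pt .
 have V0: "volume P > 0"
 proof -
  obtain e where e: "e > 0" "cball 0 e \<subseteq> P" using zero_interior mem_interior_cball by blast
  have "P \<in> lmeasurable" by (rule lmeasurable_compact[OF compact])
  then have "measure lebesgue (cball (0 :: real^3) e) \<le> volume P"
   using e(2) by (intro measure_mono_fmeasurable) auto
  moreover have "measure lebesgue (cball (0 :: real^3) e) > 0" using content_cball_pos[OF e(1)] by simp
  ultimately show ?thesis by linarith
 qed
 have S0: "A \<ge> 0"
 proof -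
  have "0 \<le> (12 * sqrt 3 + 6 + dev\<^sup>2 / 50) * ((tp / 16) powr (2/3) * (tg / 16) powr (1/6))" by simp
  then show ?thesis using iso(3) by linarith
 qed
 define U where "U = 12 * sqrt 3 + 6 + dev\<^sup>2 / 50"
 have "U * ((tp powr (2/3) / 16 powr (2/3)) * (tg powr (1/6) / 16 powr (1/6))) \<le> A"
  using iso(3) iso(1,2) by (simp add: powr_divide U_def)
 moreover have "16 powr (2/3) * 16 powr (1/6) = (16::real) powr (5/6)" by (simp flip: powr_add)
 ultimately have "U * (tp powr (2/3) * tg powr (1/6)) / 16 powr (5/6) \<le> A" by (simp add: field_simps)
 moreover have xy: "tp powr (2/3) * tg powr (1/6) > 0" using iso(1,2) by simp
 ultimately have "U / 16 powr (5/6) \<le> A / (tp powr (2/3) * tg powr (1/6))"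
  by (simp only: pos_le_divide_eq) (simp add: field_simps)
 then have "2 * U / 16 powr (5/6) \<le> 2 * A / (tp powr (2/3) * tg powr (1/6))" by simp
 also have "\<dots> = (2 * (\<sigma>\<^sup>2 * sqrt \<tau> * A) / D) / ((\<sigma> ^ 3 * tp / D) powr (2/3))"
  by (rule quotient_powr[symmetric]) (use st iso(1,2) Dp in simp_all, simp only: det_N gt)
 also have "\<dots> \<le> surface_area P / volume P powr (2/3)"
 proof (rule frac_le)
  show "2 * (\<sigma>\<^sup>2 * sqrt \<tau> * A) / D \<le> surface_area P" by (rule S)
  have "0 \<le> 2 * (\<sigma>\<^sup>2 * sqrt \<tau> * A) / D" using S0 st Dp by simp
  then show "0 \<le> surface_area P" using S by linarith
  show "0 < volume P powr (2/3)" using V0 by simp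
  show "volume P powr (2/3) \<le> (\<sigma> ^ 3 * tp / D) powr (2/3)" using V V0 by (intro powr_mono2) simp_all
 qed
 finally show ?thesis unfolding isoperimetric_quotient_def U_def .
qed

end

section \<open>Selling parameters of nearby parallelohedra\<close>

text \<open>Cramer's rule in perturbed form: near a regular limit system solutions exist and
  converge. It produces points on edges of \<open>P n\<close> and the coefficients in relations
  between normals.\<close>

lemma cramer_tendsto:
 fixes a b c d e f :: "nat \<Rightarrow> real"
 assumes lim: "a \<longlonglongrightarrow> a'" "b \<longlonglongrightarrow> b'" "c \<longlonglongrightarrow> c'" "d \<longlonglongrightarrow> d'" "e \<longlonglongrightarrow> e'" "f \<longlonglongrightarrow> f'"
  and sol: "a' * x + b' * y = e'" "c' * x + d' * y = f'" and det: "a' * d' - b' * c' \<noteq> 0"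
 obtains \<alpha> \<beta> where "\<alpha> \<longlonglongrightarrow> x" "\<beta> \<longlonglongrightarrow> y"
  "eventually (\<lambda>n. a n * \<alpha> n + b n * \<beta> n = e n \<and> c n * \<alpha> n + d n * \<beta> n = f n) sequentially"
proof -
 define D where "D n = a n * d n - b n * c n" for n
 have D: "D \<longlonglongrightarrow> a' * d' - b' * c'" unfolding D_def by (intro tendsto_intros lim)
 have "x * (a' * d' - b' * c') = e' * d' - b' * f'" "y * (a' * d' - b' * c') = a' * f' - e' * c'"
  unfolding sol[symmetric] by (simp_all add: algebra_simps)
 then have xy: "x = (e' * d' - b' * f') / (a' * d' - b' * c')" "y = (a' * f' - e' * c') / (a' * d' - b' * c')"
  by (simp_all only: nonzero_eq_divide_eq[OF det])
 show ?thesis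
 proof (rule that)
  show "(\<lambda>n. (e n * d n - b n * f n) / D n) \<longlonglongrightarrow> x" unfolding xy(1) by (intro tendsto_intros lim D det)
  show "(\<lambda>n. (a n * f n - e n * c n) / D n) \<longlonglongrightarrow> y" unfolding xy(2) by (intro tendsto_intros lim D det)
  show "eventually (\<lambda>n. a n * ((e n * d n - b n * f n) / D n) + b n * ((a n * f n - e n * c n) / D n) = e n
    \<and> c n * ((e n * d n - b n * f n) / D n) + d n * ((a n * f n - e n * c n) / D n) = f n) sequentially"
   using tendsto_imp_eventually_ne[OF D det]
  proof eventually_elim
   case (elim n)
   have "a n * (e n * d n - b n * f n) + b n * (a n * f n - e n * c n) = e n * D n"
    "c n * (e n * d n - b n * f n) + d n * (a n * f n - e n * c n) = f n * D n"
    by (simp_all add: D_def algebra_simps)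
   then show ?case using elim by (simp only: times_divide_eq_right add_divide_distrib[symmetric] nonzero_mult_div_cancel_right not_False_eq_True simp_thms)
  qed
 qed
qed

context to_sequence
begin

lemma normalized_cut_inj:
 assumes "S \<in> cuts" "R \<in> cuts" "S \<noteq> R"
 shows "(1 / bS S) *R vS S \<noteq> (1 / bS R) *R vS R"
proof
 assume e: "(1 / bS S) *R vS S = (1 / bS R) *R vS R"
 have "vS R \<bullet> ((1/2) *R vS S) < bS R" using facet_centres[OF assms(1)] assms by (auto simp: strict_point_def)
 moreover have "vS S \<bullet> ((1/2) *R vS S) = bS S" by (simp add: bS_def)
 moreover have "(1 / bS S) * (vS S \<bullet> ((1/2) *R vS S)) = (1 / bS R) * (vS R \<bullet> ((1/2) *R vS S))"
  using arg_cong[OF e, of "\<lambda>x. x \<bullet> ((1/2) *R vS S)"] by (simp only: inner_scaleR_left)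
 ultimately show False using bS_pos[OF assms(1)] bS_pos[OF assms(2)] by (simp add: field_simps)
qed

definition "un S n = (1 / bS S) *R nrm S n"

lemma un_tendsto: "S \<in> cuts \<Longrightarrow> un S \<longlonglongrightarrow> (1 / bS S) *R vS S"
 unfolding un_def by (intro tendsto_scaleR tendsto_const nrm_tendsto)

lemma fct_un: "S \<in> cuts \<Longrightarrow> fct S n \<subseteq> {x. un S n \<bullet> x = 1}"
 using bS_pos[of S] by (auto simp: fct_def un_def)

lemma facet_normal:
 assumes "S \<in> cuts" "fct S n \<subseteq> {x. a \<bullet> x = 1}" shows "a = un S n"
 using facet_normal_unique[OF nrm(2)[OF assms(1)] centered_tile.interior_nonempty[OF tile] assms(2) fct_un[OF assms(1)]] .

lemma eventually_un_distinct:
 "eventually (\<lambda>n. \<forall>S\<in>cuts. \<forall>R\<in>cuts. S \<noteq> R \<longrightarrow> un S n \<noteq> un R n) sequentially"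
proof (intro eventually_ball_finite finite_cuts ballI)
 fix S R assume SR: "S \<in> cuts" "R \<in> cuts"
 show "eventually (\<lambda>n. S \<noteq> R \<longrightarrow> un S n \<noteq> un R n) sequentially"
 proof (cases "S = R")
  case False
  have "(1 / bS S) *R vS S - (1 / bS R) *R vS R \<noteq> 0" using normalized_cut_inj[OF SR False] by simp
  from tendsto_imp_eventually_ne[OF tendsto_diff[OF un_tendsto[OF SR(1)] un_tendsto[OF SR(2)]] this]
  show ?thesis by eventually_elim auto
 qed simp
qed

lemma eventually_un_opposite:
 "eventually (\<lambda>n. \<forall>S\<in>cuts. \<forall>R\<in>cuts. R \<noteq> - S \<longrightarrow> un R n \<noteq> - un S n) sequentially"
proof (intro eventually_ball_finite finite_cuts ballI)
 fix S R assume SR: "S \<in> cuts" "R \<in> cuts"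
 show "eventually (\<lambda>n. R \<noteq> - S \<longrightarrow> un R n \<noteq> - un S n) sequentially"
 proof (cases "R = - S")
  case False
  have "(1 / bS R) *R vS R \<noteq> (1 / bS (- S)) *R vS (- S)"
   by (rule normalized_cut_inj[OF SR(2) complement_cut[OF SR(1)] False])
  then have "(1 / bS R) *R vS R + (1 / bS S) *R vS S \<noteq> 0"
   unfolding bS_complement vS_complement by (simp add: add_eq_0_iff2)
  from tendsto_imp_eventually_ne[OF tendsto_add[OF un_tendsto[OF SR(2)] un_tendsto[OF SR(1)]] this]
  show ?thesis by eventually_elim auto
 qed simp
qed

text \<open>The 14 facets found near those of the limit cell are distinct because the limits of
  their normals are, and Minkowski's bound excludes others.\<close>

lemma facets_eq:
 "eventually (\<lambda>n. {G. G facet_of P n} = (\<lambda>S. fct S n) ` cuts \<and> inj_on (\<lambda>S. fct S n) cuts) sequentially"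
 using eventually_un_distinct card_facets
proof eventually_elim
 case (elim n)
 interpret Pn: centered_tile "P n" "T n" by (rule tile)
 have inj: "inj_on (\<lambda>S. fct S n) cuts"
 proof (rule inj_onI)
  fix S R assume SR: "S \<in> cuts" "R \<in> cuts" "fct S n = fct R n"
  have "un S n = un R n" using facet_normal[OF SR(2)] fct_un[OF SR(1)] SR(3) by blast
  then show "S = R" using elim(1) SR by blast
 qed
 have "(\<lambda>S. fct S n) ` cuts \<subseteq> {G. G facet_of P n}" using nrm(2) by blast
 moreover have "finite {G. G facet_of P n}" by (rule finite_polytope_facets[OF Pn.polytope])
 ultimately show ?case using card_seteq[of "{G. G facet_of P n}" "(\<lambda>S. fct S n) ` cuts"] elim(2) inj
  by (simp add: card_image card_cuts)
qed

lemma P_eq: "eventually (\<lambda>n. P n = {x. \<forall>S\<in>cuts. nrm S n \<bullet> x \<le> bS S}) sequentially"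
 using facets_eq
proof eventually_elim
 case (elim n)
 interpret Pn: centered_tile "P n" "T n" by (rule tile)
 have "x \<in> P n" if x: "\<forall>S\<in>cuts. nrm S n \<bullet> x \<le> bS S" for x
 proof (rule ccontr)
  assume "x \<notin> P n"
  then obtain a where a: "P n \<subseteq> {y. a \<bullet> y \<le> 1}" "(P n \<inter> {y. a \<bullet> y = 1}) facet_of P n" "a \<bullet> x > 1"
   using not_mem_polyhedron_facet[OF polytope_imp_polyhedron[OF Pn.polytope] Pn.zero_interior] by blast
  then obtain S where S: "S \<in> cuts" "P n \<inter> {y. a \<bullet> y = 1} = fct S n" using elim by blast
  have "a = un S n" using facet_normal[OF S(1)] S(2) by blast
  then show False using a(3) x S(1) bS_pos[OF S(1)] by (force simp: un_def field_simps)
 qed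
 then show ?case using nrm(1) by blast
qed

text \<open>Among the 14 facets the one opposite to \<open>fct S n\<close> is identified by its
  normal: only the cut \<open>- S\<close> has a limit normal opposite to that of
  \<open>S\<close>.\<close>

lemma complement_facets:
 "eventually (\<lambda>n. \<forall>S\<in>cuts. nrm (- S) n = - nrm S n \<and> fvec (- S) n = - fvec S n) sequentially"
 using eventually_un_opposite facets_eq
proof eventually_elim
 case (elim n)
 interpret Pn: centered_tile "P n" "T n" by (rule tile)
 show ?case
 proof
  fix S assume S: "S \<in> cuts"
  have "uminus ` fct S n facet_of P n" by (rule Pn.uminus_facet[OF nrm(2)[OF S]])
  then obtain R where R: "R \<in> cuts" "uminus ` fct S n = fct R n" using elim(2) by blast
  have "fct R n \<subseteq> {x. - un S n \<bullet> x = 1}" using fct_un[OF S, of n] unfolding R(2)[symmetric] by auto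
  from facet_normal[OF R(1) this] have u: "un R n = - un S n" by simp
  then have RS: "R = - S" using elim(1) S R(1) by blast
  have "(1 / bS S) *R nrm (- S) n = (1 / bS S) *R - nrm S n" using u unfolding RS un_def bS_complement by simp
  then have 1: "nrm (- S) n = - nrm S n" using bS_pos[OF S] by (simp only: scaleR_cancel_left) simp
  have "fvec (- S) n = - fvec S n"
  proof (rule Pn.symmetry_vector_unique[OF nrm(2)[OF complement_cut[OF S]] fvec(2)[OF complement_cut[OF S]]])
   fix y assume "y \<in> fct (- S) n"
   then have "- y \<in> fct S n" unfolding RS[symmetric] R(2)[symmetric] by auto
   from fvec(2)[OF S this] have "- (fvec S n - - y) \<in> fct (- S) n" unfolding RS[symmetric] R(2)[symmetric] by blast
   then show "- fvec S n - y \<in> fct (- S) n" by simp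
  qed
  with 1 show "nrm (- S) n = - nrm S n \<and> fvec (- S) n = - fvec S n" ..
 qed
qed

text \<open>Solving the two facet equations of \<open>P n\<close> by a correction in the span of
  \<open>v i\<close> and \<open>v i + v j\<close> moves a point of the limit edge to a nearby point.
  All other inequalities were strict and remain so, hence the facets \<open>{i}\<close> and
  \<open>{i, j}\<close> still meet there.\<close>

lemma edge_sequence:
 assumes a: "{i, j, m, l} = UNIV" and th: "\<bar>th\<bar> < 1"
 defines "y \<equiv> (1/8) *R (3 *R v i + v j - (2 + th) *R v m - (2 - th) *R v l)"
 obtains Y where "Y \<longlonglongrightarrow> y" "eventually (\<lambda>n. Y n \<in> fct {i} n \<inter> fct {i, j} n) sequentially"
proof -
 note ci = cut_in[OF a] and g = gram4[OF a]
 have sp: "strict_point {{i}, {i, j}} y" unfolding y_def by (rule edge_points[OF a th])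
 have yi: "v i \<bullet> y = bS {i}" "(v i + v j) \<bullet> y = bS {i, j}"
  using sp unfolding strict_point_def by (simp_all add: vS_values[OF a])
 have n1: "nrm {i} \<longlonglongrightarrow> v i" and n2: "nrm {i, j} \<longlonglongrightarrow> v i + v j"
  using nrm_tendsto[OF ci(1)] nrm_tendsto[OF ci(2)] by (simp_all add: vS_values[OF a])
 obtain \<alpha> \<beta> where ab: "\<alpha> \<longlonglongrightarrow> 0" "\<beta> \<longlonglongrightarrow> 0"
  "eventually (\<lambda>n. (nrm {i} n \<bullet> v i) * \<alpha> n + (nrm {i} n \<bullet> (v i + v j)) * \<beta> n = bS {i} - nrm {i} n \<bullet> y
   \<and> (nrm {i, j} n \<bullet> v i) * \<alpha> n + (nrm {i, j} n \<bullet> (v i + v j)) * \<beta> n = bS {i, j} - nrm {i, j} n \<bullet> y) sequentially"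
 proof (rule cramer_tendsto[of "\<lambda>n. nrm {i} n \<bullet> v i" "3 * k" "\<lambda>n. nrm {i} n \<bullet> (v i + v j)" "2 * k"
   "\<lambda>n. nrm {i, j} n \<bullet> v i" "2 * k" "\<lambda>n. nrm {i, j} n \<bullet> (v i + v j)" "4 * k"
   "\<lambda>n. bS {i} - nrm {i} n \<bullet> y" 0 "\<lambda>n. bS {i, j} - nrm {i, j} n \<bullet> y" 0 0 0])
  have "v i \<bullet> v i = 3 * k" "v i \<bullet> (v i + v j) = 2 * k" "(v i + v j) \<bullet> v i = 2 * k" "(v i + v j) \<bullet> (v i + v j) = 4 * k"
   by (simp_all add: inner_add g)
  with tendsto_inner[OF n1 tendsto_const[of "v i"]] tendsto_inner[OF n1 tendsto_const[of "v i + v j"]]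
   tendsto_inner[OF n2 tendsto_const[of "v i"]] tendsto_inner[OF n2 tendsto_const[of "v i + v j"]]
  show "(\<lambda>n. nrm {i} n \<bullet> v i) \<longlonglongrightarrow> 3 * k" "(\<lambda>n. nrm {i} n \<bullet> (v i + v j)) \<longlonglongrightarrow> 2 * k"
   "(\<lambda>n. nrm {i, j} n \<bullet> v i) \<longlonglongrightarrow> 2 * k" "(\<lambda>n. nrm {i, j} n \<bullet> (v i + v j)) \<longlonglongrightarrow> 4 * k" by (simp_all only:)
  show "(\<lambda>n. bS {i} - nrm {i} n \<bullet> y) \<longlonglongrightarrow> 0" "(\<lambda>n. bS {i, j} - nrm {i, j} n \<bullet> y) \<longlonglongrightarrow> 0"
   using tendsto_diff[OF tendsto_const[of "bS {i}"] tendsto_inner[OF n1 tendsto_const[of y]]]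
    tendsto_diff[OF tendsto_const[of "bS {i, j}"] tendsto_inner[OF n2 tendsto_const[of y]]] unfolding yi by simp_all
  show "3 * k * (4 * k) - 2 * k * (2 * k) \<noteq> 0" using k by simp
 qed (auto intro: that)
 define Y where "Y n = y + \<alpha> n *R v i + \<beta> n *R (v i + v j)" for n
 have "Y \<longlonglongrightarrow> y + 0 *R v i + 0 *R (v i + v j)" unfolding Y_def by (intro tendsto_add tendsto_const tendsto_scaleR ab)
 then have Y: "Y \<longlonglongrightarrow> y" by simp
 have "eventually (\<lambda>n. \<forall>R\<in>cuts - {{i}, {i, j}}. nrm R n \<bullet> Y n < bS R) sequentially"
 proof (intro eventually_ball_finite ballI)
  fix R assume R: "R \<in> cuts - {{i}, {i, j}}"
  have "(\<lambda>n. nrm R n \<bullet> Y n) \<longlonglongrightarrow> vS R \<bullet> y" using R by (intro tendsto_inner nrm_tendsto Y) blast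
  then show "eventually (\<lambda>n. nrm R n \<bullet> Y n < bS R) sequentially"
   using order_tendstoD(2) sp R unfolding strict_point_def by blast
 qed simp
 with P_eq ab(3) have "eventually (\<lambda>n. Y n \<in> fct {i} n \<inter> fct {i, j} n) sequentially"
 proof eventually_elim
  case (elim n)
  have e: "nrm {i} n \<bullet> Y n = bS {i}" "nrm {i, j} n \<bullet> Y n = bS {i, j}"
   using elim(2) unfolding Y_def inner_add_right[of _ _ "\<beta> n *R (v i + v j)"] inner_add_right[of _ y] inner_scaleR_right
   by (simp_all only: mult.commute) linarith+
  have "nrm R n \<bullet> Y n \<le> bS R" if "R \<in> cuts" for R
   using that e elim(3) by (cases "R \<in> {{i}, {i, j}}") (auto intro: less_imp_le)
  then have "Y n \<in> P n" using elim(1) by blast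
  then show ?case using e by (simp add: fct_def)
 qed
 with Y show ?thesis by (rule that)
qed

text \<open>The reflection \<open>fvec S n - Y n\<close> of a facet point lies in
  \<open>P n\<close>, where \<open>upper\<close> applies to it.\<close>

lemma fvec_upper:
 assumes S: "S \<in> cuts" and R: "R \<in> cuts" and Y: "Y \<longlonglongrightarrow> y" "eventually (\<lambda>n. Y n \<in> fct S n) sequentially"
 obtains ub where "ub \<longlonglongrightarrow> bS R + vS R \<bullet> y" "eventually (\<lambda>n. vS R \<bullet> fvec S n \<le> ub n) sequentially"
proof (rule that[of "\<lambda>n. (1 + \<delta> n) * bS R + vS R \<bullet> Y n"])
 have "(\<lambda>n. (1 + \<delta> n) * bS R + vS R \<bullet> Y n) \<longlonglongrightarrow> (1 + 0) * bS R + vS R \<bullet> y" by (intro tendsto_intros \<delta>(3) Y(1))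
 then show "(\<lambda>n. (1 + \<delta> n) * bS R + vS R \<bullet> Y n) \<longlonglongrightarrow> bS R + vS R \<bullet> y" by simp
 show "eventually (\<lambda>n. vS R \<bullet> fvec S n \<le> (1 + \<delta> n) * bS R + vS R \<bullet> Y n) sequentially"
  using Y(2)
 proof eventually_elim
  case (elim n)
  have "fvec S n - Y n \<in> P n" using fvec(2)[OF S elim] by (simp add: fct_def)
  from upper[OF this R] show ?case by (simp add: inner_diff_right)
 qed
qed

lemma edge_y:
 assumes a: "{i, j, m, l} = UNIV"
 shows "v j \<bullet> ((1/8) *R (3 *R v i + v j - (2 + 0) *R v m - (2 - 0) *R v l)) = k / 2"
 by (simp add: inner_add_right inner_diff_right gram4[OF a] field_simps)

lemma fvec_singleton_lower:
 assumes a: "{i, j, m, l} = UNIV"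
 obtains lb where "lb \<longlonglongrightarrow> - k" "eventually (\<lambda>n. lb n \<le> v j \<bullet> fvec {i} n) sequentially"
proof -
 have a': "{i, m, l, j} = UNIV" using a by (simp add: insert_commute)
 obtain Y where Y: "Y \<longlonglongrightarrow> (1/8) *R (3 *R v i + v j - (2 + 0) *R v m - (2 - 0) *R v l)"
  "eventually (\<lambda>n. Y n \<in> fct {i} n \<inter> fct {i, j} n) sequentially"
  using edge_sequence[OF a, of 0] by auto
 have "eventually (\<lambda>n. Y n \<in> fct {i} n) sequentially" using Y(2) by eventually_elim blast
 \<comment> \<open>The cut \<open>{i, m, l}\<close> has the vector \<open>- v j\<close>, which turns
   the upper bound into a lower one.\<close>
 from fvec_upper[OF cut_in(1)[OF a] cut_in(3)[OF a'] Y(1) this]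
 obtain ub where ub: "ub \<longlonglongrightarrow> 3/2 * k + - (k / 2)" "eventually (\<lambda>n. - (v j \<bullet> fvec {i} n) \<le> ub n) sequentially"
  unfolding vS_values(3)[OF a'] bS_values(3)[OF a'] inner_minus_left edge_y[OF a] by blast
 show ?thesis
 proof (rule that[of "\<lambda>n. - ub n"])
  show "(\<lambda>n. - ub n) \<longlonglongrightarrow> - k" using tendsto_minus[OF ub(1)] by simp
  show "eventually (\<lambda>n. - ub n \<le> v j \<bullet> fvec {i} n) sequentially" using ub(2) by eventually_elim simp
 qed
qed

lemma inner_sum_zero: "{i, j, m, l} = UNIV \<Longrightarrow> v i \<bullet> x + v j \<bullet> x + v m \<bullet> x + v l \<bullet> x = 0"
 using sum0'[of i j m l] by (simp flip: inner_add_left)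

text \<open>The components along the four vectors add up to 0. One tends to \<open>3 * k\<close> and
  the other three are at least \<open>- k\<close> in the limit, so there is no slack.\<close>

lemma fvec_singleton_inner:
 assumes a: "{i, j, m, l} = UNIV"
 shows "(\<lambda>n. v j \<bullet> fvec {i} n) \<longlonglongrightarrow> - k"
proof -
 have a1: "{i, m, j, l} = UNIV" and a2: "{i, l, j, m} = UNIV" using a by (simp_all add: insert_commute)
 obtain lj where lj: "lj \<longlonglongrightarrow> - k" "eventually (\<lambda>n. lj n \<le> v j \<bullet> fvec {i} n) sequentially"
  using fvec_singleton_lower[OF a] by blast
 obtain lm where lm: "lm \<longlonglongrightarrow> - k" "eventually (\<lambda>n. lm n \<le> v m \<bullet> fvec {i} n) sequentially"
  using fvec_singleton_lower[OF a1] by blast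
 obtain ll where ll: "ll \<longlonglongrightarrow> - k" "eventually (\<lambda>n. ll n \<le> v l \<bullet> fvec {i} n) sequentially"
  using fvec_singleton_lower[OF a2] by blast
 have i: "(\<lambda>n. v i \<bullet> fvec {i} n) \<longlonglongrightarrow> 3 * k"
  using fvec_along[OF cut_in(1)[OF a]] by (simp add: vS_values[OF a] bS_values[OF a])
 show ?thesis
 proof (rule real_tendsto_sandwich[OF lj(2) _ lj(1)])
  show "eventually (\<lambda>n. v j \<bullet> fvec {i} n \<le> - (v i \<bullet> fvec {i} n) - lm n - ll n) sequentially"
   using lm(2) ll(2)
  proof eventually_elim
   case (elim n)
   show ?case using elim inner_sum_zero[OF a, of "fvec {i} n"] by linarith
  qed
  show "(\<lambda>n. - (v i \<bullet> fvec {i} n) - lm n - ll n) \<longlonglongrightarrow> - k"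
   using tendsto_diff[OF tendsto_diff[OF tendsto_minus[OF i] lm(1)] ll(1)] by simp
 qed
qed

lemma fvec_singleton: "fvec {i} \<longlonglongrightarrow> v i"
proof (rule tendsto_by_frame)
 fix a :: label
 obtain j m l where u: "{i, j, m, l} = UNIV" using four_labels .
 have "a = i \<or> a = j \<or> a = m \<or> a = l" using u by blast
 moreover have "{i, m, j, l} = UNIV" "{i, l, j, m} = UNIV" using u by (simp_all add: insert_commute)
 ultimately show "(\<lambda>n. v a \<bullet> fvec {i} n) \<longlonglongrightarrow> v a \<bullet> v i"
  using fvec_along[OF cut_in(1)[OF u]] fvec_singleton_inner[of i j m l] fvec_singleton_inner[of i m j l]
   fvec_singleton_inner[of i l j m] u
  by (auto simp: vS_values[OF u] bS_values[OF u] gram4[OF u])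
qed

lemma fvec_pair_upper:
 assumes a: "{i, j, m, l} = UNIV"
 obtains ub where "ub \<longlonglongrightarrow> 2 * k" "eventually (\<lambda>n. v j \<bullet> fvec {i, j} n \<le> ub n) sequentially"
proof -
 obtain Y where Y: "Y \<longlonglongrightarrow> (1/8) *R (3 *R v i + v j - (2 + 0) *R v m - (2 - 0) *R v l)"
  "eventually (\<lambda>n. Y n \<in> fct {i} n \<inter> fct {i, j} n) sequentially"
  using edge_sequence[OF a, of 0] by auto
 have "eventually (\<lambda>n. Y n \<in> fct {i, j} n) sequentially" using Y(2) by eventually_elim blast
 from fvec_upper[OF cut_in(2)[OF a] cut_in(1)[OF perm4(1)[OF a]] Y(1) this]
 obtain ub where ub: "ub \<longlonglongrightarrow> 3/2 * k + k / 2" "eventually (\<lambda>n. v j \<bullet> fvec {i, j} n \<le> ub n) sequentially"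
  unfolding vS_values(1)[OF perm4(1)[OF a]] bS_values(1)[OF perm4(1)[OF a]] edge_y[OF a] by blast
 show ?thesis by (rule that[OF _ ub(2)]) (use ub(1) in simp)
qed

text \<open>The components along \<open>v i\<close> and \<open>v j\<close> are at most
  \<open>2 * k\<close> in the limit and add up to \<open>4 * k\<close> there.\<close>

lemma fvec_pair_inner:
 assumes a: "{i, j, m, l} = UNIV"
 shows "(\<lambda>n. v j \<bullet> fvec {i, j} n) \<longlonglongrightarrow> 2 * k"
proof -
 obtain ub where ub: "ub \<longlonglongrightarrow> 2 * k" "eventually (\<lambda>n. v j \<bullet> fvec {i, j} n \<le> ub n) sequentially"
  using fvec_pair_upper[OF a] by blast
 obtain ub' where ub': "ub' \<longlonglongrightarrow> 2 * k" "eventually (\<lambda>n. v i \<bullet> fvec {j, i} n \<le> ub' n) sequentially"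
  using fvec_pair_upper[OF perm4(1)[OF a]] by blast
 have s: "(\<lambda>n. (v i + v j) \<bullet> fvec {i, j} n) \<longlonglongrightarrow> 4 * k"
  using fvec_along[OF cut_in(2)[OF a]] by (simp add: vS_values[OF a] bS_values[OF a])
 show ?thesis
 proof (rule real_tendsto_sandwich[OF _ ub(2) _ ub(1)])
  show "eventually (\<lambda>n. (v i + v j) \<bullet> fvec {i, j} n - ub' n \<le> v j \<bullet> fvec {i, j} n) sequentially"
   using ub'(2) by eventually_elim (simp add: inner_add_left insert_commute)
  show "(\<lambda>n. (v i + v j) \<bullet> fvec {i, j} n - ub' n) \<longlonglongrightarrow> 2 * k" using tendsto_diff[OF s ub'(1)] by simp
 qed
qed

lemma fvec_pair_opposite:
 assumes a: "{i, j, m, l} = UNIV"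
 shows "(\<lambda>n. v l \<bullet> fvec {i, j} n) \<longlonglongrightarrow> - 2 * k"
proof -
 have a': "{m, l, i, j} = UNIV" using a by (simp add: insert_commute)
 have "(\<lambda>n. - (v l \<bullet> fvec {m, l} n)) \<longlonglongrightarrow> - (2 * k)" by (intro tendsto_minus fvec_pair_inner[OF a'])
 moreover have "eventually (\<lambda>n. - (v l \<bullet> fvec {m, l} n) = v l \<bullet> fvec {i, j} n) sequentially"
  using complement_facets
 proof eventually_elim
  case (elim n)
  have "- {m, l} = {i, j}" using a four_distinct[OF a] by auto
  then show ?case using elim cut_in(2)[OF a'] by (metis inner_minus_right)
 qed
 ultimately show ?thesis by (auto intro: Lim_transform_eventually)
qed

lemma fvec_pair: assumes u: "{i, j, m, l} = UNIV" shows "fvec {i, j} \<longlonglongrightarrow> v i + v j"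
proof (rule tendsto_by_frame)
 fix a :: label
 have "a = i \<or> a = j \<or> a = m \<or> a = l" using u by blast
 moreover have "{j, i} = {i, j}" by blast
 ultimately show "(\<lambda>n. v a \<bullet> fvec {i, j} n) \<longlonglongrightarrow> v a \<bullet> (v i + v j)"
  using fvec_pair_inner[OF u] fvec_pair_inner[OF perm4(1)[OF u]] fvec_pair_opposite[OF u] fvec_pair_opposite[OF perm4(6)[OF u]]
  by (auto simp: inner_add_right gram4[OF u])
qed

text \<open>From some index on the tiles contain a common ball, so nonzero periods have norms
  bounded below. This turns limit relations between facet vectors into exact ones.\<close>

lemma small_period_zero:
 assumes m: "\<And>n. m n \<in> centered_tile.periods (T n)" "m \<longlonglongrightarrow> 0"
 shows "eventually (\<lambda>n. m n = 0) sequentially"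
proof -
 let ?U = "\<Inter>R\<in>cuts. {x. vS R \<bullet> x < bS R}"
 have "open ?U" by (intro open_INT) (auto simp: open_halfspace_lt)
 moreover have "0 \<in> ?U" using bS_pos by auto
 ultimately obtain r where r: "r > 0" "ball 0 r \<subseteq> ?U" by (rule openE)
 have ev1: "eventually (\<lambda>n. \<delta> n < 1/2) sequentially" using order_tendstoD(2)[OF \<delta>(3), of "1/2"] by simp
 have ev2: "eventually (\<lambda>n. norm (m n) < r / 2) sequentially"
  using order_tendstoD(2)[OF tendsto_norm_zero[OF m(2)], of "r / 2"] r(1) by simp
 from ev1 ev2 show ?thesis
 proof eventually_elim
  case (elim n)
  interpret Pn: centered_tile "P n" "T n" by (rule tile)
  have "x \<in> P n" if x: "norm x < r / 2" for x
  proof -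
   let ?x = "(1 / (1 - \<delta> n)) *R x"
   have "1 / (1 - \<delta> n) \<le> 2" using elim(1) by (simp add: field_simps)
   from mult_right_mono[OF this norm_ge_zero[of x]] have "norm ?x \<le> 2 * norm x" using \<delta>(2)[of n] by simp
   then have "?x \<in> ball 0 r" using x by simp
   then have "?x \<in> ?U" using r(2) by blast
   then have "vS R \<bullet> ?x \<le> bS R" if "R \<in> cuts" for R using that by (blast intro: less_imp_le)
   then have "(1 - \<delta> n) *R ?x \<in> P n" by (rule lower)
   then show ?thesis using \<delta>(2)[of n] by simp
  qed
  then have "ball 0 (r / 2) \<subseteq> P n" by auto
  then show "m n = 0" using Pn.separated[of "r / 2" "m n" 0] m(1)[of n] Pn.periods_subset Pn.zero_in elim(2) by auto
 qed
qed

lemma fvec_add: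
 assumes a: "{i, j, m, l} = UNIV"
 shows "eventually (\<lambda>n. fvec {i, j} n = fvec {i} n + fvec {j} n) sequentially"
proof -
 have "eventually (\<lambda>n. fvec {i, j} n - fvec {i} n - fvec {j} n = 0) sequentially"
 proof (rule small_period_zero)
  show "fvec {i, j} n - fvec {i} n - fvec {j} n \<in> centered_tile.periods (T n)" for n
   by (intro centered_tile.period_diff[OF tile] fvec(3) singleton_cut cut_in(2)[OF a])
  show "(\<lambda>n. fvec {i, j} n - fvec {i} n - fvec {j} n) \<longlonglongrightarrow> 0"
   using tendsto_diff[OF tendsto_diff[OF fvec_pair[OF a] fvec_singleton[of i]] fvec_singleton[of j]] by simp
 qed
 then show ?thesis by eventually_elim (simp add: algebra_simps)
qed

lemma fvec_sum_zero: "eventually (\<lambda>n. fvec {L0} n + fvec {L1} n + fvec {L2} n + fvec {L3} n = 0) sequentially"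
proof (rule small_period_zero)
 show "fvec {L0} n + fvec {L1} n + fvec {L2} n + fvec {L3} n \<in> centered_tile.periods (T n)" for n
  by (intro centered_tile.period_add[OF tile] fvec(3) singleton_cut)
 have "(\<lambda>n. fvec {L0} n + fvec {L1} n + fvec {L2} n + fvec {L3} n) \<longlonglongrightarrow> v L0 + v L1 + v L2 + v L3"
  by (intro tendsto_add fvec_singleton)
 then show "(\<lambda>n. fvec {L0} n + fvec {L1} n + fvec {L2} n + fvec {L3} n) \<longlonglongrightarrow> 0" using sum0 by simp
qed

end

section \<open>Relations between the normals and their scaling\<close>

context to_sequence
begin

lemma tight_frame4:
 assumes a: "{i, j, m, l} = UNIV"
 shows "w = (1 / (4 * k)) *R ((v i \<bullet> w) *R v i + (v j \<bullet> w) *R v j + (v m \<bullet> w) *R v m + (v l \<bullet> w) *R v l)"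
proof -
 let ?f = "\<lambda>a. (v a \<bullet> w) *R v a"
 have "sum ?f {i, j, m, l} = ?f i + ?f j + ?f m + ?f l" using four_distinct[OF a] by (simp add: add.assoc)
 moreover have "sum ?f {L0, L1, L2, L3} = ?f L0 + ?f L1 + ?f L2 + ?f L3" by (simp add: add.assoc)
 ultimately have "?f i + ?f j + ?f m + ?f l = ?f L0 + ?f L1 + ?f L2 + ?f L3"
  using a UNIV_label by (simp only:)
 then show ?thesis using tight_frame[of w] by (simp only:)
qed

text \<open>Three tiles, shifted by 0, \<open>fvec {i} n\<close> and \<open>fvec {i, j} n\<close>,
  meet along the common edge of the facets \<open>{i}\<close> and \<open>{i, j}\<close>; so this
  edge also lies on the facet \<open>{j}\<close> of the second tile. Its direction is orthogonal to
  all three normals, which are therefore dependent, and comparing offsets yields the second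
  relation.\<close>

lemma pair_relation:
 assumes a: "{i, j, m, l} = UNIV"
 obtains \<alpha> \<beta> where "\<alpha> \<longlonglongrightarrow> 1" "\<beta> \<longlonglongrightarrow> 1"
  "eventually (\<lambda>n. nrm {i, j} n = \<alpha> n *R nrm {i} n + \<beta> n *R nrm {j} n
   \<and> \<alpha> n * (nrm {i} n \<bullet> fvec {j} n) = \<beta> n * (nrm {j} n \<bullet> fvec {i} n)) sequentially"
proof -
 note ci = cut_in[OF a] and g = gram4[OF a] and d = four_distinct[OF a]
 have n1: "nrm {i} \<longlonglongrightarrow> v i" and n2: "nrm {j} \<longlonglongrightarrow> v j" and n3: "nrm {i, j} \<longlonglongrightarrow> v i + v j"
  using nrm_tendsto[OF singleton_cut] nrm_tendsto[OF ci(2)] vS_values(1)[OF a] vS_values(1)[OF perm4(1)[OF a]]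
  by (simp_all add: vS_values(2)[OF a]) (metis, metis)
 obtain \<alpha> \<beta> where ab: "\<alpha> \<longlonglongrightarrow> 1" "\<beta> \<longlonglongrightarrow> 1"
  "eventually (\<lambda>n. (nrm {i} n \<bullet> v i) * \<alpha> n + (nrm {j} n \<bullet> v i) * \<beta> n = nrm {i, j} n \<bullet> v i
   \<and> (nrm {i} n \<bullet> v j) * \<alpha> n + (nrm {j} n \<bullet> v j) * \<beta> n = nrm {i, j} n \<bullet> v j) sequentially"
 proof (rule cramer_tendsto[of "\<lambda>n. nrm {i} n \<bullet> v i" "3 * k" "\<lambda>n. nrm {j} n \<bullet> v i" "- k"
   "\<lambda>n. nrm {i} n \<bullet> v j" "- k" "\<lambda>n. nrm {j} n \<bullet> v j" "3 * k"
   "\<lambda>n. nrm {i, j} n \<bullet> v i" "2 * k" "\<lambda>n. nrm {i, j} n \<bullet> v j" "2 * k" 1 1])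
  have "(v i + v j) \<bullet> v i = 2 * k" "(v i + v j) \<bullet> v j = 2 * k" by (simp_all add: inner_add g)
  with tendsto_inner[OF n1 tendsto_const[of "v i"]] tendsto_inner[OF n2 tendsto_const[of "v i"]]
   tendsto_inner[OF n1 tendsto_const[of "v j"]] tendsto_inner[OF n2 tendsto_const[of "v j"]]
   tendsto_inner[OF n3 tendsto_const[of "v i"]] tendsto_inner[OF n3 tendsto_const[of "v j"]]
  show "(\<lambda>n. nrm {i} n \<bullet> v i) \<longlonglongrightarrow> 3 * k" "(\<lambda>n. nrm {j} n \<bullet> v i) \<longlonglongrightarrow> - k"
   "(\<lambda>n. nrm {i} n \<bullet> v j) \<longlonglongrightarrow> - k" "(\<lambda>n. nrm {j} n \<bullet> v j) \<longlonglongrightarrow> 3 * k"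
   "(\<lambda>n. nrm {i, j} n \<bullet> v i) \<longlonglongrightarrow> 2 * k" "(\<lambda>n. nrm {i, j} n \<bullet> v j) \<longlonglongrightarrow> 2 * k" by (simp_all only: g)
  show "3 * k * (3 * k) - - k * - k \<noteq> 0" using k by simp
 qed (auto intro: that)
 define y where "y th = (1/8) *R (3 *R v i + v j - (2 + th) *R v m - (2 - th) *R v l)" for th :: real
 \<comment> \<open>Two points of the open edge, at the parameters 1/2 and -1/2, supply its
   direction.\<close>
 obtain Y where Y: "Y \<longlonglongrightarrow> y (1/2)" "eventually (\<lambda>n. Y n \<in> fct {i} n \<inter> fct {i, j} n) sequentially"
  using edge_sequence[OF a, of "1/2"] unfolding y_def by auto
 obtain Z where Z: "Z \<longlonglongrightarrow> y (- (1/2))" "eventually (\<lambda>n. Z n \<in> fct {i} n \<inter> fct {i, j} n) sequentially"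
  using edge_sequence[OF a, of "- (1/2)"] unfolding y_def by auto
 have "(v l - v m) \<bullet> (y (1/2) - y (- (1/2))) = k"
  unfolding y_def by (simp add: inner_add_right inner_diff g field_simps)
 then have "(\<lambda>n. (v l - v m) \<bullet> (Y n - Z n)) \<longlonglongrightarrow> k"
  using tendsto_inner[OF tendsto_const[of "v l - v m"] tendsto_diff[OF Y(1) Z(1)]] by simp
 then have evW: "eventually (\<lambda>n. (v l - v m) \<bullet> (Y n - Z n) \<noteq> 0) sequentially"
  using k by (intro tendsto_imp_eventually_ne) auto
 have "eventually (\<lambda>n. nrm {i, j} n = \<alpha> n *R nrm {i} n + \<beta> n *R nrm {j} n
   \<and> \<alpha> n * (nrm {i} n \<bullet> fvec {j} n) = \<beta> n * (nrm {j} n \<bullet> fvec {i} n)) sequentially"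
  using ab(3) Y(2) Z(2) evW fvec_add[OF a]
 proof eventually_elim
  case (elim n)
  interpret Pn: centered_tile "P n" "T n" by (rule tile)
  \<comment> \<open>Moved back by \<open>fvec {i} n\<close>, the edge lies on the facet
    \<open>{j}\<close>, because \<open>fvec {i, j} n\<close> is the sum of the two single facet
    vectors.\<close>
  have shift: "nrm {j} n \<bullet> (x - fvec {i} n) = bS {j}" if x: "x \<in> fct {i} n \<inter> fct {i, j} n" for x
  proof -
   have "fvec {i} n - x \<in> P n" using fvec(2)[OF ci(1)] x by (auto simp: fct_def)
   from Pn.uminus_mem[OF this] have 1: "x - fvec {i} n \<in> P n" by simp
   have "x \<in> P n \<inter> (+) (fvec {i, j} n) ` P n" using fvec(1)[OF ci(2)] x by blast
   then have "x - fvec {i, j} n \<in> P n" by (simp add: translate_mem_iff)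
   then have "(x - fvec {i} n) - fvec {j} n \<in> P n" unfolding elim(5) by (simp add: diff_diff_add)
   then have "x - fvec {i} n \<in> P n \<inter> (+) (fvec {j} n) ` P n" using 1 translate_mem_iff by blast
   then show ?thesis unfolding fvec(1)[OF singleton_cut] by (simp add: fct_def)
  qed
  let ?W = "Y n - Z n" and ?D = "nrm {i, j} n - \<alpha> n *R nrm {i} n - \<beta> n *R nrm {j} n"
  have eY: "nrm {i} n \<bullet> Y n = bS {i}" "nrm {i, j} n \<bullet> Y n = bS {i, j}" "nrm {j} n \<bullet> Y n = bS {j} + nrm {j} n \<bullet> fvec {i} n"
   using elim(2) shift[OF elim(2)] by (simp_all add: fct_def inner_diff_right)
  have eZ: "nrm {i} n \<bullet> Z n = bS {i}" "nrm {i, j} n \<bullet> Z n = bS {i, j}" "nrm {j} n \<bullet> Z n = bS {j} + nrm {j} n \<bullet> fvec {i} n"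
   using elim(3) shift[OF elim(3)] by (simp_all add: fct_def inner_diff_right)
  have DW: "?D \<bullet> ?W = 0" using eY eZ by (simp add: inner_diff_left inner_diff_right)
  have Di: "v i \<bullet> ?D = 0" and Dj: "v j \<bullet> ?D = 0"
   using elim(1) by (simp_all add: inner_diff_right inner_commute mult.commute)
  have s: "v m \<bullet> ?D = - (v l \<bullet> ?D)" using inner_sum_zero[OF a, of ?D] Di Dj by linarith
  \<comment> \<open>By the choice of \<open>\<alpha>\<close>, \<open>\<beta>\<close> the defect
    \<open>?D\<close> is orthogonal to \<open>v i\<close> and \<open>v j\<close>, hence a multiple
    of \<open>v l - v m\<close>. The edge direction tends to a multiple of the same vector, yet is
    orthogonal to \<open>?D\<close>.\<close>
  have De: "?D = (1 / (4 * k)) *R ((v l \<bullet> ?D) *R (v l - v m))"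
   using tight_frame4[OF a, of ?D] unfolding Di Dj s by (simp add: scaleR_diff_right)
  have "(v l \<bullet> ?D) = 0"
  proof -
   have "((1 / (4 * k)) *R ((v l \<bullet> ?D) *R (v l - v m))) \<bullet> ?W = 0" using DW De by (simp only:)
   then have "(1 / (4 * k)) * ((v l \<bullet> ?D) * ((v l - v m) \<bullet> ?W)) = 0" by (simp only: inner_scaleR_left)
   then show ?thesis using k elim(4) by (simp only: mult_eq_0_iff divide_eq_0_iff) simp
  qed
  then have D0: "?D = 0" using De by simp
  then have rel: "nrm {i, j} n = \<alpha> n *R nrm {i} n + \<beta> n *R nrm {j} n" by (simp add: algebra_simps)
  have c: "nrm {i} n \<bullet> fvec {i} n = 2 * bS {i}" "nrm {j} n \<bullet> fvec {j} n = 2 * bS {j}"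
   by (rule fvec_nrm[OF singleton_cut])+
  have "2 * bS {i, j} = nrm {i, j} n \<bullet> (fvec {i} n + fvec {j} n)" using fvec_nrm[OF ci(2), of n] elim(5) by simp
  also have "\<dots> = \<alpha> n * (2 * bS {i}) + \<alpha> n * (nrm {i} n \<bullet> fvec {j} n) + \<beta> n * (nrm {j} n \<bullet> fvec {i} n) + \<beta> n * (2 * bS {j})"
   unfolding rel by (simp add: inner_add c algebra_simps)
  finally have 1: "2 * bS {i, j} = \<dots>" .
  have "bS {i, j} = \<alpha> n * bS {i} + \<beta> n * (bS {j} + nrm {j} n \<bullet> fvec {i} n)"
   using eY(2) unfolding rel inner_add_left inner_scaleR_left eY by simp
  then have 2: "bS {i, j} = \<alpha> n * bS {i} + \<beta> n * bS {j} + \<beta> n * (nrm {j} n \<bullet> fvec {i} n)" by (simp add: algebra_simps)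
  have "\<alpha> n * (nrm {i} n \<bullet> fvec {j} n) = \<beta> n * (nrm {j} n \<bullet> fvec {i} n)" using 1 2 by (simp add: algebra_simps)
  with rel show ?case by blast
 qed
 with ab(1,2) show ?thesis by (rule that)
qed

text \<open>In the limit the differences \<open>v a - v L0\<close> are dual to the normals up to the
  factor \<open>4 * k\<close>, so diagonal dominance holds eventually.\<close>

lemma normals_independent:
 "eventually (\<lambda>n. \<forall>x1 x2 x3. x1 *R nrm {L1} n + x2 *R nrm {L2} n + x3 *R nrm {L3} n = 0 \<longrightarrow> x1 = 0 \<and> x2 = 0 \<and> x3 = 0) sequentially"
proof -
 have lim: "(\<lambda>n. (v a - v L0) \<bullet> nrm {b} n) \<longlonglongrightarrow> (v a - v L0) \<bullet> v b" for a b
  using tendsto_inner[OF tendsto_const[of "v a - v L0"] nrm_tendsto[OF singleton_cut[of b]]] by (simp add: vS_def)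
 have dom: "eventually (\<lambda>n. \<bar>(v b - v L0) \<bullet> nrm {a} n\<bar> + \<bar>(v c - v L0) \<bullet> nrm {a} n\<bar> < (v a - v L0) \<bullet> nrm {a} n) sequentially"
  if "a \<noteq> L0" "b \<noteq> L0" "c \<noteq> L0" "a \<noteq> b" "a \<noteq> c" for a b c
 proof -
  have "(\<lambda>n. (v a - v L0) \<bullet> nrm {a} n - \<bar>(v b - v L0) \<bullet> nrm {a} n\<bar> - \<bar>(v c - v L0) \<bullet> nrm {a} n\<bar>)
   \<longlonglongrightarrow> (v a - v L0) \<bullet> v a - \<bar>(v b - v L0) \<bullet> v a\<bar> - \<bar>(v c - v L0) \<bullet> v a\<bar>"
   by (intro tendsto_diff tendsto_rabs lim)
  moreover have "(v a - v L0) \<bullet> v a - \<bar>(v b - v L0) \<bullet> v a\<bar> - \<bar>(v c - v L0) \<bullet> v a\<bar> = 4 * k"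
   using that by (simp add: inner_diff_left gram)
  ultimately have lim4: "(\<lambda>n. (v a - v L0) \<bullet> nrm {a} n - \<bar>(v b - v L0) \<bullet> nrm {a} n\<bar> - \<bar>(v c - v L0) \<bullet> nrm {a} n\<bar>) \<longlonglongrightarrow> 4 * k"
   by (simp only:)
  have "0 < 4 * k" using k by simp
  from order_tendstoD(1)[OF lim4 this] show ?thesis by eventually_elim linarith
 qed
 from dom[of L1 L2 L3] dom[of L2 L1 L3] dom[of L3 L1 L2]
 have "eventually (\<lambda>n. \<bar>(v L2 - v L0) \<bullet> nrm {L1} n\<bar> + \<bar>(v L3 - v L0) \<bullet> nrm {L1} n\<bar> < (v L1 - v L0) \<bullet> nrm {L1} n) sequentially"
  "eventually (\<lambda>n. \<bar>(v L1 - v L0) \<bullet> nrm {L2} n\<bar> + \<bar>(v L3 - v L0) \<bullet> nrm {L2} n\<bar> < (v L2 - v L0) \<bullet> nrm {L2} n) sequentially"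
  "eventually (\<lambda>n. \<bar>(v L1 - v L0) \<bullet> nrm {L3} n\<bar> + \<bar>(v L2 - v L0) \<bullet> nrm {L3} n\<bar> < (v L3 - v L0) \<bullet> nrm {L3} n) sequentially"
  by simp_all
 then show ?thesis
 proof eventually_elim
  case (elim n)
  then show ?case using diagonally_dominant_independent[OF elim] by blast
 qed
qed

text \<open>The balanced normals: the pairs 01 and 23 have opposite normals, which fixes the scaling.\<close>

lemma balanced_normals:
 obtains A :: "label \<Rightarrow> nat \<Rightarrow> real" where "\<And>i. A i \<longlonglongrightarrow> 1"
  "eventually (\<lambda>n. A L0 n *R nrm {L0} n + A L1 n *R nrm {L1} n + A L2 n *R nrm {L2} n + A L3 n *R nrm {L3} n = 0) sequentially"
proof -
 have u: "{L0, L1, L2, L3} = UNIV" "{L2, L3, L0, L1} = UNIV" using UNIV_label by auto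
 obtain a b where ab: "a \<longlonglongrightarrow> 1" "b \<longlonglongrightarrow> 1" "eventually (\<lambda>n. nrm {L0, L1} n = a n *R nrm {L0} n + b n *R nrm {L1} n
   \<and> a n * (nrm {L0} n \<bullet> fvec {L1} n) = b n * (nrm {L1} n \<bullet> fvec {L0} n)) sequentially"
  using pair_relation[OF u(1)] by blast
 obtain c d where cd: "c \<longlonglongrightarrow> 1" "d \<longlonglongrightarrow> 1" "eventually (\<lambda>n. nrm {L2, L3} n = c n *R nrm {L2} n + d n *R nrm {L3} n
   \<and> c n * (nrm {L2} n \<bullet> fvec {L3} n) = d n * (nrm {L3} n \<bullet> fvec {L2} n)) sequentially"
  using pair_relation[OF u(2)] by blast
 define A where "A i = (case i of L0 \<Rightarrow> a | L1 \<Rightarrow> b | L2 \<Rightarrow> c | L3 \<Rightarrow> d)" for i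
 show ?thesis
 proof (rule that)
  show "A i \<longlonglongrightarrow> 1" for i using ab cd by (cases i) (simp_all add: A_def)
  show "eventually (\<lambda>n. A L0 n *R nrm {L0} n + A L1 n *R nrm {L1} n + A L2 n *R nrm {L2} n + A L3 n *R nrm {L3} n = 0) sequentially"
   using ab(3) cd(3) complement_facets
  proof eventually_elim
   case (elim n)
   have "- {L0, L1} = {L2, L3}" using UNIV_label by auto
   then have "nrm {L2, L3} n = - nrm {L0, L1} n" using elim(3) cut_in(2)[OF u(1)] by metis
   then have "nrm {L0, L1} n + nrm {L2, L3} n = 0" by simp
   then have "(a n *R nrm {L0} n + b n *R nrm {L1} n) + (c n *R nrm {L2} n + d n *R nrm {L3} n) = 0"
    using elim(1,2) by (simp only:)
   then show ?case by (simp add: A_def add.assoc)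
  qed
 qed
qed

text \<open>A pair and its complement have opposite normals, which gives a vanishing combination of
  the four single normals. Such a combination is unique up to a factor, because three of the normals
  are independent; hence one scaling \<open>A\<close> serves all pairs.\<close>

lemma pair_balanced:
 assumes a: "{i, j, m, l} = UNIV" and A: "\<And>i. A i \<longlonglongrightarrow> 1"
  and bal: "eventually (\<lambda>n. A L0 n *R nrm {L0} n + A L1 n *R nrm {L1} n + A L2 n *R nrm {L2} n + A L3 n *R nrm {L3} n = 0) sequentially"
 shows "eventually (\<lambda>n. (\<exists>s>0. nrm {i, j} n = s *R (A i n *R nrm {i} n + A j n *R nrm {j} n))
   \<and> A i n * (nrm {i} n \<bullet> fvec {j} n) = A j n * (nrm {j} n \<bullet> fvec {i} n)) sequentially"
proof -
 have a': "{m, l, i, j} = UNIV" using a by (simp add: insert_commute)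
 note d = four_distinct[OF a]
 obtain bi bj where b1: "bi \<longlonglongrightarrow> 1" "bj \<longlonglongrightarrow> 1" "eventually (\<lambda>n. nrm {i, j} n = bi n *R nrm {i} n + bj n *R nrm {j} n
   \<and> bi n * (nrm {i} n \<bullet> fvec {j} n) = bj n * (nrm {j} n \<bullet> fvec {i} n)) sequentially"
  using pair_relation[OF a] by blast
 obtain bm bl where b2: "bm \<longlonglongrightarrow> 1" "bl \<longlonglongrightarrow> 1" "eventually (\<lambda>n. nrm {m, l} n = bm n *R nrm {m} n + bl n *R nrm {l} n
   \<and> bm n * (nrm {m} n \<bullet> fvec {l} n) = bl n * (nrm {l} n \<bullet> fvec {m} n)) sequentially"
  using pair_relation[OF a'] by blast
 define B where "B x = (if x = i then bi else if x = j then bj else if x = m then bm else bl)" for x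
 have Bv: "B i = bi" "B j = bj" "B m = bm" "B l = bl" using d by (auto simp: B_def)
 have Blim: "B x \<longlonglongrightarrow> 1" for x using b1 b2 by (simp add: B_def)
 have pos: "eventually (\<lambda>n. A L0 n > 0) sequentially" "eventually (\<lambda>n. B L0 n > 0) sequentially"
  using order_tendstoD(1)[OF A[of L0], of 0] order_tendstoD(1)[OF Blim[of L0], of 0] by simp_all
 from bal b1(3) b2(3) pos complement_facets normals_independent show ?thesis
 proof eventually_elim
  case (elim n)
  let ?f = "\<lambda>x. B x n *R nrm {x} n"
  have "- {i, j} = {m, l}" using a d by auto
  then have "nrm {m, l} n = - nrm {i, j} n" using elim(6) cut_in(2)[OF a] by metis
  then have "?f i + ?f j + (?f m + ?f l) = 0" using elim(2,3) unfolding Bv by simp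
  moreover have "sum ?f {i, j, m, l} = ?f i + ?f j + (?f m + ?f l)" using d by (simp add: add.assoc)
  moreover have "sum ?f {L0, L1, L2, L3} = ?f L0 + ?f L1 + ?f L2 + ?f L3" by (simp add: add.assoc)
  ultimately have Bs: "?f L0 + ?f L1 + ?f L2 + ?f L3 = 0" using a UNIV_label by (simp only:)
  define s where "s = B L0 n / A L0 n"
  have s: "s > 0" "s * A L0 n = B L0 n" using elim(4,5) by (simp_all add: s_def)
  let ?g = "\<lambda>x. A x n *R nrm {x} n"
  have "s *R (?g L0 + ?g L1 + ?g L2 + ?g L3) - (?f L0 + ?f L1 + ?f L2 + ?f L3) = 0" using Bs elim(1) by simp
  then have "(s * A L0 n - B L0 n) *R nrm {L0} n + ((s * A L1 n - B L1 n) *R nrm {L1} n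
    + (s * A L2 n - B L2 n) *R nrm {L2} n + (s * A L3 n - B L3 n) *R nrm {L3} n) = 0"
   by (simp add: scaleR_add_right scaleR_diff_left algebra_simps)
  then have "(s * A L1 n - B L1 n) *R nrm {L1} n + (s * A L2 n - B L2 n) *R nrm {L2} n + (s * A L3 n - B L3 n) *R nrm {L3} n = 0"
   using s(2) by simp
  then have z: "s * A L1 n - B L1 n = 0 \<and> s * A L2 n - B L2 n = 0 \<and> s * A L3 n - B L3 n = 0" using elim(7) by blast
  have e: "B x n = s * A x n" for x using z s(2) by (cases x) simp_all
  have bb: "bi n = s * A i n" "bj n = s * A j n" using e[of i] e[of j] unfolding Bv by auto
  have 1: "nrm {i, j} n = s *R (A i n *R nrm {i} n + A j n *R nrm {j} n)"
   using elim(2) unfolding bb by (simp add: scaleR_add_right)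
  have "s * (A i n * (nrm {i} n \<bullet> fvec {j} n)) = s * (A j n * (nrm {j} n \<bullet> fvec {i} n))"
   using elim(2) unfolding bb by (simp add: mult.assoc)
  then have "A i n * (nrm {i} n \<bullet> fvec {j} n) = A j n * (nrm {j} n \<bullet> fvec {i} n)" using s(1) by simp
  with 1 s(1) show ?case by blast
 qed
qed

text \<open>Up to relabelling a cut is a single label, a pair, or the complement of a single label.
  Positive factors do not change a half-space, so the balanced normals describe the same
  facets.\<close>

theorem eventually_selling_tile:
 obtains N t :: "nat \<Rightarrow> label \<Rightarrow> real^3" where "\<And>i. (\<lambda>n. N n i) \<longlonglongrightarrow> v i" "\<And>i. (\<lambda>n. t n i) \<longlonglongrightarrow> v i"
  "eventually (\<lambda>n. selling_tile (P n) (T n) (N n) (t n)) sequentially"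
proof -
 obtain A where A: "\<And>i :: label. A i \<longlonglongrightarrow> (1::real)"
  "eventually (\<lambda>n. A L0 n *R nrm {L0} n + A L1 n *R nrm {L1} n + A L2 n *R nrm {L2} n + A L3 n *R nrm {L3} n = 0) sequentially"
  using balanced_normals by blast
 define N where "N n i = A i n *R nrm {i} n" for n i
 define t where "t n i = fvec {i} n" for n i
 have Nlim: "(\<lambda>n. N n i) \<longlonglongrightarrow> v i" for i
  using tendsto_scaleR[OF A(1)[of i] nrm_tendsto[OF singleton_cut[of i]]] by (simp add: N_def vS_def)
 have tlim: "(\<lambda>n. t n i) \<longlonglongrightarrow> v i" for i using fvec_singleton by (simp add: t_def)
 have pairs: "eventually (\<lambda>n. \<forall>i\<in>UNIV. \<forall>j\<in>UNIV. i \<noteq> j \<longrightarrow> (\<exists>s>0. nrm {i, j} n = s *R (N n i + N n j))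
   \<and> N n i \<bullet> t n j = N n j \<bullet> t n i \<and> fvec {i, j} n = t n i + t n j) sequentially"
 proof (intro eventually_ball_finite finite ballI)
  fix i j :: label
  show "eventually (\<lambda>n. i \<noteq> j \<longrightarrow> (\<exists>s>0. nrm {i, j} n = s *R (N n i + N n j))
   \<and> N n i \<bullet> t n j = N n j \<bullet> t n i \<and> fvec {i, j} n = t n i + t n j) sequentially"
  proof (cases "i = j")
   case False
   obtain m l where a: "{i, j, m, l} = UNIV"
   proof -
    obtain x y z where u: "{i, x, y, z} = (UNIV :: label set)" using four_labels .
    have "j = x \<or> j = y \<or> j = z" using UNIV_I[of j] False unfolding u[symmetric] by auto
    moreover have "{i, y, x, z} = (UNIV :: label set)" "{i, z, x, y} = (UNIV :: label set)" using u by (simp_all add: insert_commute)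
    ultimately show ?thesis using that u by blast
   qed
   from pair_balanced[OF a A] fvec_add[OF a] show ?thesis
    by eventually_elim (simp add: N_def t_def)
  qed simp
 qed
 have pos: "eventually (\<lambda>n. \<forall>i\<in>UNIV. A i n > 0) sequentially"
  using order_tendstoD(1)[OF A(1), of 0] by (intro eventually_ball_finite finite ballI) simp
 have "eventually (\<lambda>n. selling_tile (P n) (T n) (N n) (t n)) sequentially"
  using pairs pos A(2) fvec_sum_zero complement_facets facets_eq P_eq
 proof eventually_elim
  case (elim n)
  interpret Pn: centered_tile "P n" "T n" by (rule tile)
  have Ns: "N n L0 + N n L1 + N n L2 + N n L3 = 0" using elim(3) by (simp add: N_def)
  have ts: "t n L0 + t n L1 + t n L2 + t n L3 = 0" using elim(4) by (simp add: t_def)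
  have neg: "sum f (- S) = - sum f S" if "f L0 + f L1 + f L2 + f L3 = 0" for f :: "label \<Rightarrow> real^3" and S
  proof -
   have "sum f UNIV = 0" using that by (simp add: UNIV_label add.assoc)
   moreover have "sum f UNIV = sum f (- S) + sum f S"
    using sum.subset_diff[of S UNIV f] by (simp add: Compl_eq_Diff_UNIV)
   ultimately show ?thesis by (simp add: eq_neg_iff_add_eq_0)
  qed
  have single: "(\<exists>s>0. nrm {i} n = s *R sum (N n) {i}) \<and> fvec {i} n = sum (t n) {i}" for i
  proof -
   have "A i n > 0" using elim(2) by simp
   then have "nrm {i} n = (1 / A i n) *R sum (N n) {i}" "1 / A i n > 0" by (simp_all add: N_def)
   then have "\<exists>s>0. nrm {i} n = s *R sum (N n) {i}" by blast
   then show ?thesis by (simp add: t_def)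
  qed
  have key: "(\<exists>s>0. nrm S n = s *R sum (N n) S) \<and> fvec S n = sum (t n) S" if S: "S \<in> cuts" for S
  proof -
   obtain i j m l where a: "{i, j, m, l} = UNIV" and "S = {i} \<or> S = {i, j} \<or> S = {i, j, m}" by (rule cut_forms[OF S])
   then consider "S = {i}" | "S = {i, j}" | "S = {i, j, m}" by blast
   then show ?thesis
   proof cases
    case 1 then show ?thesis using single by simp
   next
    case 2 then show ?thesis using elim(1) four_distinct[OF a] by simp
   next
    case 3
    have SS: "S = - {l}" unfolding 3 using a four_distinct[OF a] by auto
    obtain s where "s > 0" "nrm {l} n = s *R sum (N n) {l}" using single by blast
    moreover have "nrm S n = - nrm {l} n" "fvec S n = - fvec {l} n" using elim(5) singleton_cut SS by auto
    moreover have "fvec {l} n = sum (t n) {l}" using single by blast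
    ultimately show ?thesis unfolding SS neg[of "N n", OF Ns] neg[of "t n", OF ts] by (auto simp: SS)
   qed
  qed
  have cut: "(nrm S n \<bullet> x \<le> bS S) = (sum (N n) S \<bullet> x \<le> (sum (N n) S \<bullet> sum (t n) S) / 2)"
   "(nrm S n \<bullet> x = bS S) = (sum (N n) S \<bullet> x = (sum (N n) S \<bullet> sum (t n) S) / 2)" if S: "S \<in> cuts" for S x
  proof -
   obtain s where s: "s > 0" "nrm S n = s *R sum (N n) S" using key[OF S] by blast
   have "2 * bS S = s * (sum (N n) S \<bullet> sum (t n) S)" using fvec_nrm[OF S, of n] key[OF S] s(2) by simp
   then have b: "bS S = s * ((sum (N n) S \<bullet> sum (t n) S) / 2)" by simp
   show "(nrm S n \<bullet> x \<le> bS S) = (sum (N n) S \<bullet> x \<le> (sum (N n) S \<bullet> sum (t n) S) / 2)"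
    "(nrm S n \<bullet> x = bS S) = (sum (N n) S \<bullet> x = (sum (N n) S \<bullet> sum (t n) S) / 2)"
    unfolding b s(2) inner_scaleR_left using s(1) by simp_all
  qed
  have F: "fct S n = P n \<inter> {x. sum (N n) S \<bullet> x = (sum (N n) S \<bullet> sum (t n) S) / 2}" if "S \<in> cuts" for S
   using cut(2)[OF that] by (auto simp: fct_def)
  show ?case
  proof
   show "N n L0 + N n L1 + N n L2 + N n L3 = 0" "t n L0 + t n L1 + t n L2 + t n L3 = 0" by (rule Ns, rule ts)
   show "N n i \<bullet> t n j = N n j \<bullet> t n i" for i j using elim(1) by (cases "i = j") auto
   show "t n i \<in> Pn.periods" for i unfolding t_def by (rule fvec(3)[OF singleton_cut])
   show "{G. G facet_of P n} = (\<lambda>S. P n \<inter> {x. sum (N n) S \<bullet> x = (sum (N n) S \<bullet> sum (t n) S) / 2}) ` cuts"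
    using elim(6) F by (auto simp: image_iff)
   have "inj_on (\<lambda>S. fct S n) cuts" using elim(6) by blast
   then show "inj_on (\<lambda>S. P n \<inter> {x. sum (N n) S \<bullet> x = (sum (N n) S \<bullet> sum (t n) S) / 2}) cuts"
    using inj_on_cong[of cuts "\<lambda>S. fct S n" "\<lambda>S. P n \<inter> {x. sum (N n) S \<bullet> x = (sum (N n) S \<bullet> sum (t n) S) / 2}"] F by blast
   show "P n = {x. \<forall>S\<in>cuts. sum (N n) S \<bullet> x \<le> (sum (N n) S \<bullet> sum (t n) S) / 2}"
    using elim(7) cut(1) by (simp only:) blast
  qed
 qed
 with Nlim tlim show ?thesis by (rule that)
qed

end

section \<open>Closeness to the truncated octahedron\<close>

lemma closed_int_span:
 fixes M :: "real^'n^'n"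
 assumes "det M \<noteq> 0" shows "closed (int_span M)"
proof -
 have "{z :: real^'n. \<forall>i. z $ i \<in> \<int>} = (\<Inter>i. (\<lambda>z. z $ i) -` \<int>)" by auto
 moreover have "closed ((\<lambda>z :: real^'n. z $ i) -` \<int>)" for i
  by (rule closed_vimage) (auto intro!: continuous_intros)
 then have "closed (\<Inter>i. (\<lambda>z :: real^'n. z $ i) -` \<int>)" by (intro closed_INT ballI)
 ultimately have "closed {z :: real^'n. \<forall>i. z $ i \<in> \<int>}" by (simp only:)
 moreover have "linear ((*v) M)" by simp
 moreover have "inj ((*v) M)" using assms by (simp add: inj_matrix_vector_mult invertible_det_nz)
 ultimately have "closed ((*v) M ` {z. \<forall>i. z $ i \<in> \<int>})" by (rule closed_injective_linear_image)
 then show ?thesis by (simp add: int_span_def setcompr_eq_image)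
qed

lemma nearest_lattice_point:
 fixes M :: "real^'n^'n"
 assumes "det M \<noteq> 0"
 obtains g where "g \<in> int_span M" "\<And>h. h \<in> int_span M \<Longrightarrow> 2 * (h \<bullet> (x - g)) \<le> h \<bullet> h"
proof -
 have z: "0 \<in> int_span M" unfolding int_span_def by clarsimp (metis Ints_0 matrix_vector_mult_0_right zero_index)
 obtain g where g: "g \<in> int_span M" "\<And>y. y \<in> int_span M \<Longrightarrow> dist x g \<le> dist x y"
  using distance_attains_inf[OF closed_int_span[OF assms]] z by blast
 show ?thesis
 proof (rule that[OF g(1)])
  fix h assume h: "h \<in> int_span M"
  have "g - (- h) \<in> int_span M" by (rule int_span_diff[OF g(1) int_span_uminus[OF h]])
  then have "norm (x - g) \<le> norm ((x - g) - h)" using g(2)[of "g + h"] by (simp add: dist_norm diff_diff_add)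
  then have "(x - g) \<bullet> (x - g) \<le> ((x - g) - h) \<bullet> ((x - g) - h)" by (simp add: norm_le)
  then show "2 * (h \<bullet> (x - g)) \<le> h \<bullet> h" by (simp add: inner_diff inner_commute)
 qed
qed

locale to_body = to_frame +
 fixes A :: "(real^3) set"
 assumes A_eq: "A = {x. \<forall>S\<in>cuts. vS S \<bullet> x \<le> bS S}"
begin

lemma det_frame: "\<bar>det (columns3 (v L1) (v L2) (v L3))\<bar> = 4 * (k * sqrt k)"
proof -
 let ?d = "det (columns3 (v L1) (v L2) (v L3))"
 have "det (vector [v L1, v L2, v L3] :: real^3^3) = ?d" unfolding columns3_def by (rule det_transpose[symmetric])
 then have "?d * ?d = 16 * (k * k * k)"
  using det_rows_columns3[of "v L1" "v L2" "v L3" "v L1" "v L2" "v L3"] by (simp add: gram algebra_simps)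
 also have "\<dots> = (4 * (k * sqrt k)) * (4 * (k * sqrt k))" using k by (simp add: algebra_simps)
 finally have "?d\<^sup>2 = (4 * (k * sqrt k))\<^sup>2" by (simp only: power2_eq_square)
 then have "\<bar>?d\<bar> = \<bar>4 * (k * sqrt k)\<bar>" by (simp only: power2_eq_iff abs_eq_iff)
 then show ?thesis using k by simp
qed

lemma det_frame_nonzero: "det (columns3 (v L1) (v L2) (v L3)) \<noteq> 0"
 using det_frame k by auto

lemma vS_int_span: "vS S \<in> int_span (columns3 (v L1) (v L2) (v L3))"
proof -
 define c where "c i = (if i \<in> S then 1 else 0 :: real)" for i
 have "vS S = sum (\<lambda>i. c i *R v i) UNIV" unfolding vS_def c_def
  by (simp add: if_distrib[of "\<lambda>x. x *R _"] sum.If_cases cong: if_cong)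
 also have "\<dots> = c L0 *R v L0 + c L1 *R v L1 + c L2 *R v L2 + c L3 *R v L3" by (simp add: UNIV_label add.assoc)
 also have "v L0 = - v L1 - v L2 - v L3" using sum0 by (simp add: eq_neg_iff_add_eq_0 algebra_simps)
 finally have "vS S = columns3 (v L1) (v L2) (v L3) *v vector [c L1 - c L0, c L2 - c L0, c L3 - c L0]"
  unfolding columns3_mult by (simp add: algebra_simps)
 moreover have "\<forall>i. (vector [c L1 - c L0, c L2 - c L0, c L3 - c L0] :: real^3) $ i \<in> \<int>"
  by (simp add: forall_3 c_def)
 ultimately show ?thesis unfolding int_span_def by blast
qed

lemma A_bounded: obtains R where "R > 0" "\<And>x. x \<in> A \<Longrightarrow> norm x \<le> R"
proof -
 let ?M = "columns3 (v L1) (v L2) (v L3)"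
 have bd: "norm x \<le> (1 / (4 * k)) * (4 * ((3/2 * k) * sqrt (3 * k)))" if x: "x \<in> A" for x
 proof -
  have vi: "\<bar>v i \<bullet> x\<bar> \<le> 3/2 * k" for i
  proof -
   have "vS {i} \<bullet> x \<le> bS {i}" "vS (- {i}) \<bullet> x \<le> bS (- {i})"
    using x singleton_cut complement_cut[OF singleton_cut] unfolding A_eq by blast+
   moreover have "bS {i} = 3/2 * k" by (simp add: bS_def vS_def gram)
   ultimately show ?thesis unfolding vS_complement bS_complement by (simp add: vS_def abs_le_iff)
  qed
  then show ?thesis by (rule norm_le_by_frame)
 qed
 show ?thesis by (rule that[of "max 1 ((1 / (4 * k)) * (4 * ((3/2 * k) * sqrt (3 * k))))"]) (use bd in \<open>auto simp: le_max_iff_disj\<close>)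
qed

lemma closed_A: "closed A"
proof -
 have "A = (\<Inter>S\<in>cuts. {x. vS S \<bullet> x \<le> bS S})" unfolding A_eq by blast
 then show ?thesis by (simp add: closed_INT closed_halfspace_le)
qed

lemma compact_A: "compact A"
proof -
 obtain R where "\<And>x. x \<in> A \<Longrightarrow> norm x \<le> R" using A_bounded by blast
 then have "bounded A" unfolding bounded_iff by blast
 then show ?thesis using closed_A by (simp add: compact_eq_bounded_closed)
qed

lemma zero_mem_A: "0 \<in> A" unfolding A_eq using bS_pos by (auto intro: less_imp_le)

text \<open>Subtracting a nearest lattice point brings any point into \<open>A\<close>, since all
  cut vectors belong to the lattice; so \<open>A\<close> covers space under the lattice, whose
  determinant is the left-hand side.\<close>

lemma volume_A_ge: "4 * (k * sqrt k) \<le> volume A"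
proof -
 let ?M = "columns3 (v L1) (v L2) (v L3)"
 have "\<bar>det ?M\<bar> \<le> volume A"
 proof (rule det_le_measure_covering[OF det_frame_nonzero lmeasurable_compact[OF compact_A]])
  fix x
  obtain g where g: "g \<in> int_span ?M" "\<And>h. h \<in> int_span ?M \<Longrightarrow> 2 * (h \<bullet> (x - g)) \<le> h \<bullet> h"
   using nearest_lattice_point[OF det_frame_nonzero] by blast
  have "vS S \<bullet> (x - g) \<le> bS S" for S using g(2)[OF vS_int_span[of S]] unfolding bS_def by (simp add: field_simps)
  then show "\<exists>g\<in>int_span ?M. x - g \<in> A" using g(1) unfolding A_eq by blast
 qed
 then show ?thesis by (simp only: det_frame)
qed

lemma volume_A_pos: "volume A > 0"
proof -
 have "0 < 4 * (k * sqrt k)" using k by simp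
 then show ?thesis using volume_A_ge by linarith
qed

end

section \<open>Fitting a rotation to the normals\<close>

lemma abs_sqrt_diff_one:
 fixes a :: real
 assumes "a \<ge> 0" "\<bar>a * a - 1\<bar> \<le> e" shows "\<bar>a - 1\<bar> \<le> e"
proof -
 have "\<bar>a * a - 1\<bar> = \<bar>a - 1\<bar> * (a + 1)"
 proof -
  have "a * a - 1 = (a - 1) * (a + 1)" by (simp add: algebra_simps)
  then have "\<bar>a * a - 1\<bar> = \<bar>a - 1\<bar> * \<bar>a + 1\<bar>" by (simp only: abs_mult)
  then show ?thesis using assms(1) by simp
 qed
 moreover have "\<bar>a - 1\<bar> * 1 \<le> \<bar>a - 1\<bar> * (a + 1)" using assms(1) by (intro mult_left_mono) auto
 ultimately have "\<bar>a - 1\<bar> \<le> \<bar>a * a - 1\<bar>" by simp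
 then show ?thesis using assms(2) by (rule order_trans)
qed

lemma abs_mult_le:
 fixes x y a b :: real
 assumes "\<bar>x\<bar> \<le> a" "\<bar>y\<bar> \<le> b" shows "\<bar>x * y\<bar> \<le> a * b"
 unfolding abs_mult using assms by (intro mult_mono) auto

text \<open>By Gram-Schmidt orthonormalization.\<close>

lemma nearly_orthonormal:
 fixes m1 m2 m3 :: "real^3"
 assumes e: "e \<le> 1/100" "\<bar>m1 \<bullet> m1 - 1\<bar> \<le> e" "\<bar>m2 \<bullet> m2 - 1\<bar> \<le> e" "\<bar>m3 \<bullet> m3 - 1\<bar> \<le> e"
  "\<bar>m1 \<bullet> m2\<bar> \<le> e" "\<bar>m1 \<bullet> m3\<bar> \<le> e" "\<bar>m2 \<bullet> m3\<bar> \<le> e"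
 obtains u1 u2 u3 where "u1 \<bullet> u1 = 1" "u2 \<bullet> u2 = 1" "u3 \<bullet> u3 = 1" "u1 \<bullet> u2 = 0" "u1 \<bullet> u3 = 0" "u2 \<bullet> u3 = 0"
  "norm (m1 - u1) \<le> 8 * e" "norm (m2 - u2) \<le> 8 * e" "norm (m3 - u3) \<le> 8 * e"
  "sgn (det (columns3 u1 u2 u3)) = sgn (det (columns3 m1 m2 m3))"
proof -
 have e0: "e \<ge> 0" using e(2) by linarith
 have ee: "e * e \<le> e / 100" using mult_left_mono[OF e(1) e0] by simp
 define a where "a = norm m1"
 have aa: "a * a = m1 \<bullet> m1" by (simp add: a_def power2_norm_eq_inner flip: power2_eq_square)
 have "a \<ge> 0" by (simp add: a_def)
 from abs_sqrt_diff_one[OF this, of e] have a1: "\<bar>a - 1\<bar> \<le> e" using e(2) unfolding aa by blast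
 have "1 - a \<le> e" using a1 by (simp add: abs_le_iff)
 then have a: "a \<ge> 99/100" "a > 0" using e(1) by simp_all
 define u1 where "u1 = (1 / a) *R m1"
 have m1: "m1 = a *R u1" using a by (simp add: u1_def)
 have u11: "u1 \<bullet> u1 = 1" using a by (simp add: u1_def aa[symmetric])
 have div: "\<bar>x / y\<bar> \<le> 2 * z" if "\<bar>x\<bar> \<le> z" "y \<ge> 1/2" for x y z :: real
 proof -
  have "\<bar>x / y\<bar> = \<bar>x\<bar> / y" using that by simp
  also have "\<dots> \<le> z / (1/2)" using that by (intro frac_le) auto
  finally show ?thesis by simp
 qed
 define b where "b = m2 \<bullet> u1"
 have b: "\<bar>b\<bar> \<le> 2 * e" using div[OF e(5), of a] a unfolding b_def u1_def by (simp add: inner_commute)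
 define c where "c = m3 \<bullet> u1"
 have c: "\<bar>c\<bar> \<le> 2 * e" using div[OF e(6), of a] a unfolding c_def u1_def by (simp add: inner_commute)
 have bb: "b * b \<le> e / 25" "b * b \<ge> 0" "c * c \<le> e / 25" "c * c \<ge> 0" "\<bar>b * c\<bar> \<le> e / 25"
  using abs_mult_le[OF b b] abs_mult_le[OF c c] abs_mult_le[OF b c] ee by auto
 define w where "w = m2 - b *R u1"
 have wu: "w \<bullet> u1 = 0" by (simp add: w_def inner_diff_left u11 b_def)
 have ww: "w \<bullet> w = m2 \<bullet> m2 - b * b"
  unfolding w_def by (simp add: inner_diff u11 inner_commute[of u1 m2] flip: b_def)
 define d where "d = norm w"
 have dd: "d * d = w \<bullet> w" by (simp add: d_def power2_norm_eq_inner flip: power2_eq_square)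
 have "\<bar>d * d - 1\<bar> \<le> 2 * e" using e(3) bb e0 unfolding dd ww abs_le_iff by linarith
 moreover have "d \<ge> 0" by (simp add: d_def)
 ultimately have d1: "\<bar>d - 1\<bar> \<le> 2 * e" using abs_sqrt_diff_one[of d "2 * e"] by blast
 have "1 - d \<le> 2 * e" using d1 by (simp add: abs_le_iff)
 then have d: "d \<ge> 1/2" "d > 0" using e(1) by simp_all
 define u2 where "u2 = (1 / d) *R w"
 have u22: "u2 \<bullet> u2 = 1" "u2 \<bullet> u1 = 0" using d wu by (simp_all add: u2_def dd[symmetric])
 have m2: "m2 = b *R u1 + d *R u2" using d by (simp add: u2_def w_def)
 define h where "h = m3 \<bullet> u2"
 have "m3 \<bullet> m2 = b * c + d * h" unfolding m2 by (simp add: inner_add_right c_def h_def)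
 then have "h = (m3 \<bullet> m2 - b * c) / d" using d by (simp add: field_simps)
 moreover have "\<bar>m3 \<bullet> m2 - b * c\<bar> \<le> 2 * e" using e(7) bb(5) e0 unfolding inner_commute[of m3 m2] abs_le_iff by linarith
 ultimately have h: "\<bar>h\<bar> \<le> 4 * e" using div[of "m3 \<bullet> m2 - b * c" "2 * e" d] d by simp
 have hh: "h * h \<le> 4 * e / 25" "h * h \<ge> 0" using abs_mult_le[OF h h] ee by auto
 define z where "z = m3 - c *R u1 - h *R u2"
 have zu: "z \<bullet> u1 = 0" "z \<bullet> u2 = 0" by (simp_all add: z_def inner_diff_left u11 u22 c_def h_def inner_commute[of u1 u2])
 have zz: "z \<bullet> z = m3 \<bullet> m3 - c * c - h * h"
  unfolding z_def by (simp add: inner_diff u11 u22 inner_commute[of u1 u2] inner_commute[of u1 m3] inner_commute[of u2 m3] flip: c_def h_def)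
 define f where "f = norm z"
 have ff: "f * f = z \<bullet> z" by (simp add: f_def power2_norm_eq_inner flip: power2_eq_square)
 have "\<bar>f * f - 1\<bar> \<le> 2 * e" using e(4) bb hh e0 unfolding ff zz abs_le_iff by linarith
 moreover have "f \<ge> 0" by (simp add: f_def)
 ultimately have f1: "\<bar>f - 1\<bar> \<le> 2 * e" using abs_sqrt_diff_one[of f "2 * e"] by blast
 have "1 - f \<le> 2 * e" using f1 by (simp add: abs_le_iff)
 then have f: "f > 0" using e(1) by simp
 define u3 where "u3 = (1 / f) *R z"
 have u33: "u3 \<bullet> u3 = 1" "u3 \<bullet> u1 = 0" "u3 \<bullet> u2 = 0" using f zu by (simp_all add: u3_def ff[symmetric])
 have m3: "m3 = c *R u1 + h *R u2 + f *R u3" using f by (simp add: u3_def z_def)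
 have n: "norm u1 = 1" "norm u2 = 1" "norm u3 = 1" using u11 u22(1) u33(1) by (simp_all add: norm_eq_1)
 show ?thesis
 proof (rule that[of u1 u2 u3])
  show "u1 \<bullet> u1 = 1" "u2 \<bullet> u2 = 1" "u3 \<bullet> u3 = 1" "u1 \<bullet> u2 = 0" "u1 \<bullet> u3 = 0" "u2 \<bullet> u3 = 0"
   using u11 u22 u33 by (simp_all add: inner_commute)
  have eq: "m1 - u1 = (a - 1) *R u1" "m2 - u2 = b *R u1 + (d - 1) *R u2" "m3 - u3 = c *R u1 + h *R u2 + (f - 1) *R u3"
   unfolding m1 m2 m3 by (simp_all add: scaleR_diff_left)
  have ns: "norm (x *R u1) = \<bar>x\<bar>" "norm (x *R u2) = \<bar>x\<bar>" "norm (x *R u3) = \<bar>x\<bar>" for x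
   by (simp_all add: n)
  have "norm (m1 - u1) \<le> e" using a1 unfolding eq ns .
  then show "norm (m1 - u1) \<le> 8 * e" using e0 by simp
  have "norm (m2 - u2) \<le> \<bar>b\<bar> + \<bar>d - 1\<bar>"
   using norm_triangle_ineq[of "b *R u1" "(d - 1) *R u2"] unfolding eq ns .
  also have "\<dots> \<le> 2 * e + 2 * e" by (rule add_mono[OF b d1])
  also have "\<dots> \<le> 8 * e" using e0 by simp
  finally show "norm (m2 - u2) \<le> 8 * e" .
  have "norm (m3 - u3) \<le> norm (c *R u1 + h *R u2) + \<bar>f - 1\<bar>"
   using norm_triangle_ineq[of "c *R u1 + h *R u2" "(f - 1) *R u3"] unfolding eq ns .
  also have "\<dots> \<le> (\<bar>c\<bar> + \<bar>h\<bar>) + \<bar>f - 1\<bar>"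
   using norm_triangle_ineq[of "c *R u1" "h *R u2"] unfolding ns by (rule add_right_mono)
  also have "\<dots> \<le> (2 * e + 4 * e) + 2 * e" by (rule add_mono[OF add_mono[OF c h] f1])
  also have "\<dots> = 8 * e" by simp
  finally show "norm (m3 - u3) \<le> 8 * e" .
  have "det (columns3 m1 m2 m3) = a * d * f * det (columns3 u1 u2 u3)"
   unfolding m1 m2 m3 columns3_def det_transpose by (simp add: det_3 algebra_simps)
  then show "sgn (det (columns3 u1 u2 u3)) = sgn (det (columns3 m1 m2 m3))"
   using a d f by (simp add: sgn_mult)
 qed
qed

lemma orthonormal_columns3:
 assumes "u1 \<bullet> u1 = 1" "u2 \<bullet> u2 = 1" "u3 \<bullet> u3 = 1" "u1 \<bullet> u2 = 0" "u1 \<bullet> u3 = 0" "u2 \<bullet> u3 = 0"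
 shows "orthogonal_matrix (columns3 u1 u2 u3)"
 unfolding orthogonal_matrix
 using assms by (simp add: vec_eq_iff forall_3 columns3_def transpose_def matrix_matrix_mult_def mat_def inner_vec_def mult.commute)

lemma rotation_between_frames:
 assumes u: "u1 \<bullet> u1 = 1" "u2 \<bullet> u2 = 1" "u3 \<bullet> u3 = 1" "u1 \<bullet> u2 = 0" "u1 \<bullet> u3 = 0" "u2 \<bullet> u3 = 0"
  and e: "e1 \<bullet> e1 = 1" "e2 \<bullet> e2 = 1" "e3 \<bullet> e3 = 1" "e1 \<bullet> e2 = 0" "e1 \<bullet> e3 = 0" "e2 \<bullet> e3 = 0"
  and s: "det (columns3 u1 u2 u3) * det (columns3 e1 e2 e3) > 0"
 obtains Q :: "real^3^3" where "rotation_matrix Q" "Q *v e1 = u1" "Q *v e2 = u2" "Q *v e3 = u3"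
proof -
 let ?U = "columns3 u1 u2 u3" and ?E = "columns3 e1 e2 e3"
 have o: "orthogonal_matrix ?U" "orthogonal_matrix ?E" using orthonormal_columns3 u e by auto
 let ?Q = "?U ** transpose ?E"
 have oQ: "orthogonal_matrix ?Q" using o by (intro orthogonal_matrix_mul) (simp_all add: orthogonal_matrix_transpose)
 have "det ?Q = 1"
 proof -
  have "det ?Q = det ?U * det ?E" by (simp add: det_mul)
  moreover have "det ?Q = 1 \<or> det ?Q = -1" by (rule det_orthogonal_matrix[OF oQ])
  ultimately show ?thesis using s by auto
 qed
 then have r: "rotation_matrix ?Q" using oQ by (simp add: rotation_matrix_def)
 have E: "transpose ?E *v x = vector [e1 \<bullet> x, e2 \<bullet> x, e3 \<bullet> x]" for x
  by (simp add: columns3_def vec_eq_iff forall_3 matrix_vector_mult_def inner_vec_def)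
 have "?Q *v x = (e1 \<bullet> x) *R u1 + (e2 \<bullet> x) *R u2 + (e3 \<bullet> x) *R u3" for x
  unfolding matrix_vector_mul_assoc[symmetric] E columns3_mult by simp
 then have "?Q *v e1 = u1" "?Q *v e2 = u2" "?Q *v e3 = u3" using e by (simp_all add: inner_commute)
 with r show ?thesis by (rule that)
qed

text \<open>\<open>oriented\<close> selects a rotation instead of a reflection when the normals are
  compared with the \<open>v i\<close>.\<close>

locale close_tile = to_body v k A + selling_tile P T N t
 for v :: "label \<Rightarrow> real^3" and k :: real and A P T :: "(real^3) set" and N t :: "label \<Rightarrow> real^3" +
 assumes st: "\<sigma> > 0" "\<tau> > 0" and dev_small: "dev \<le> 1/100000"
  and oriented: "det (columns3 (N L0 + N L1) (N L0 + N L2) (N L0 + N L3))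
   * det (columns3 (v L0 + v L1) (v L0 + v L2) (v L0 + v L3)) > 0"
begin

definition "M i = sqrt (k / \<tau>) *R N i"

lemma M_inner: "M i \<bullet> M j = (k / \<tau>) * (N i \<bullet> N j)"
 using k st by (simp add: M_def mult.assoc[symmetric])

lemma M_off: "M i \<bullet> M j = - k * (1 + g i j)"
proof -
 have "N i \<bullet> N j = - \<tau> * (1 + g i j)" using pq(2)[OF st, of i j] by (simp add: \<gamma>_def)
 then show ?thesis unfolding M_inner using st by simp
qed

lemma M_diag: assumes "{i, j, m, l} = (UNIV :: label set)" shows "M i \<bullet> M i = k * (3 + g i j + g i m + g i l)"
proof -
 have "N i \<bullet> N i = \<tau> * (3 + g i j + g i m + g i l)" unfolding diag(2)[OF assms] pq(2)[OF st] by (simp add: algebra_simps)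
 then show ?thesis unfolding M_inner using st by simp
qed

text \<open>Sums of two vectors are compared because the sums \<open>v L0 + v a\<close> over the
  other three labels are orthogonal with squared length \<open>4 * k\<close>. Every single deviation
  that enters is at most \<open>2 * dev\<close>.\<close>

lemma M_pairs:
 assumes a: "{i, j, m, l} = (UNIV :: label set)"
 shows "\<bar>(M i + M j) \<bullet> (M i + M j) - 4 * k\<bar> \<le> 8 * k * dev" "\<bar>(M i + M j) \<bullet> (M i + M m)\<bar> \<le> 8 * k * dev"
proof -
 note d = four_distinct[OF a]
 have a': "{j, i, m, l} = (UNIV :: label set)" using a by (simp add: insert_commute)
 have "(M i + M j) \<bullet> (M i + M j) - 4 * k = k * (g i m + g i l + g j m + g j l)"
  unfolding inner_add M_diag[OF a] M_diag[OF a'] M_off[of i j] M_off[of j i] qg_sym(2)[of j i] by (simp add: algebra_simps)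
 moreover have "\<bar>k * (g i m + g i l + g j m + g j l)\<bar> \<le> k * (8 * dev)"
  using k qg_le(2)[OF d(2)] qg_le(2)[OF d(3)] qg_le(2)[OF d(4)] qg_le(2)[OF d(5)] by (intro abs_mult_le) auto
 ultimately show "\<bar>(M i + M j) \<bullet> (M i + M j) - 4 * k\<bar> \<le> 8 * k * dev" by simp
 have "(M i + M j) \<bullet> (M i + M m) = k * (g i l - g j m)"
  unfolding inner_add M_diag[OF a] M_off[of i m] M_off[of j i] M_off[of j m] qg_sym(2)[of j i] by (simp add: algebra_simps)
 moreover have "\<bar>k * (g i l - g j m)\<bar> \<le> k * (8 * dev)"
  using k dev_nonneg qg_le(2)[OF d(3)] qg_le(2)[OF d(4)] by (intro abs_mult_le) auto
 ultimately show "\<bar>(M i + M j) \<bullet> (M i + M m)\<bar> \<le> 8 * k * dev" by simp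
qed

text \<open>The pair sums are orthonormalised after scaling, and the rotation takes the orthonormal
  frame of the \<open>v i\<close> to the result.\<close>

lemma rotation_exists:
 obtains Q :: "real^3^3" where "rotation_matrix Q" "\<And>i. norm (M i - Q *v v i) \<le> 80 * sqrt k * dev"
proof -
 define s where "s = 1 / (2 * sqrt k)"
 have sk: "s > 0" "s * s = 1 / (4 * k)" using k by (simp_all add: s_def)
 let ?m = "\<lambda>a. s *R (M L0 + M a)" and ?e = "\<lambda>a. s *R (v L0 + v a)"
 have scale: "(s *R x) \<bullet> (s *R y) = (x \<bullet> y) / (4 * k)" for x y :: "real^3"
  using sk(2) by (simp add: mult.assoc[symmetric])
 have b1: "\<bar>?m a \<bullet> ?m a - 1\<bar> \<le> 2 * dev" if "{L0, a, m, l} = UNIV" for a m l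
 proof -
  have "?m a \<bullet> ?m a - 1 = ((M L0 + M a) \<bullet> (M L0 + M a) - 4 * k) / (4 * k)"
   unfolding scale using k by (simp add: diff_divide_distrib)
  then have "\<bar>?m a \<bullet> ?m a - 1\<bar> = \<bar>(M L0 + M a) \<bullet> (M L0 + M a) - 4 * k\<bar> / (4 * k)" using k by simp
  also have "\<dots> \<le> 8 * k * dev / (4 * k)" using M_pairs(1)[OF that] k by (intro divide_right_mono) auto
  finally show ?thesis using k by simp
 qed
 have b2: "\<bar>?m a \<bullet> ?m m\<bar> \<le> 2 * dev" if "{L0, a, m, l} = UNIV" for a m l
 proof -
  have "\<bar>?m a \<bullet> ?m m\<bar> = \<bar>(M L0 + M a) \<bullet> (M L0 + M m)\<bar> / (4 * k)" unfolding scale using k by simp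
  also have "\<dots> \<le> 8 * k * dev / (4 * k)" using M_pairs(2)[OF that] k by (intro divide_right_mono) auto
  finally show ?thesis using k by simp
 qed
 have pm: "{L0, L1, L2, L3} = UNIV" "{L0, L2, L1, L3} = UNIV" "{L0, L3, L1, L2} = UNIV" "{L0, L1, L3, L2} = UNIV" "{L0, L2, L3, L1} = UNIV"
  using UNIV_label by auto
 have small: "2 * dev \<le> 1/100" using dev_small by simp
 obtain u1 u2 u3 where u: "u1 \<bullet> u1 = 1" "u2 \<bullet> u2 = 1" "u3 \<bullet> u3 = 1" "u1 \<bullet> u2 = 0" "u1 \<bullet> u3 = 0" "u2 \<bullet> u3 = 0"
  and n: "norm (?m L1 - u1) \<le> 8 * (2 * dev)" "norm (?m L2 - u2) \<le> 8 * (2 * dev)" "norm (?m L3 - u3) \<le> 8 * (2 * dev)"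
  and sg: "sgn (det (columns3 u1 u2 u3)) = sgn (det (columns3 (?m L1) (?m L2) (?m L3)))"
  by (rule nearly_orthonormal[OF small b1[OF pm(1)] b1[OF pm(2)] b1[OF pm(3)] b2[OF pm(1)] b2[OF pm(4)] b2[OF pm(5)]])
 have fe: "?e a \<bullet> ?e b = (if a = b then 1 else 0)" if "a \<noteq> L0" "b \<noteq> L0" for a b
  unfolding scale using that k by (simp add: inner_add gram)
 have scale_det: "det (columns3 (c *R x) (c *R y) (c *R z)) = c ^ 3 * det (columns3 x y z)" for c x y z
  unfolding columns3_def det_transpose by (simp add: det_3 algebra_simps power3_eq_cube)
 have mm: "?m a = (s * sqrt (k / \<tau>)) *R (N L0 + N a)" for a by (simp add: M_def scaleR_add_right)
 have c0: "s * sqrt (k / \<tau>) > 0" using sk(1) k st by simp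
 have "det (columns3 (?m L1) (?m L2) (?m L3)) * det (columns3 (?e L1) (?e L2) (?e L3)) =
   ((s * sqrt (k / \<tau>)) ^ 3 * s ^ 3) * (det (columns3 (N L0 + N L1) (N L0 + N L2) (N L0 + N L3))
   * det (columns3 (v L0 + v L1) (v L0 + v L2) (v L0 + v L3)))"
  unfolding mm scale_det by (simp only: mult_ac)
 also have "\<dots> > 0" by (rule mult_pos_pos[OF mult_pos_pos[OF zero_less_power[OF c0] zero_less_power[OF sk(1)]] oriented])
 finally have "sgn (det (columns3 u1 u2 u3) * det (columns3 (?e L1) (?e L2) (?e L3))) = 1"
  unfolding sgn_mult sg by (simp flip: sgn_mult)
 then have dp: "det (columns3 u1 u2 u3) * det (columns3 (?e L1) (?e L2) (?e L3)) > 0" by (simp only: sgn_1_pos)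
 obtain Q :: "real^3^3" where Q: "rotation_matrix Q" "Q *v ?e L1 = u1" "Q *v ?e L2 = u2" "Q *v ?e L3 = u3"
  by (rule rotation_between_frames[OF u _ _ _ _ _ _ dp])
   (use fe[of L1 L1] fe[of L2 L2] fe[of L3 L3] fe[of L1 L2] fe[of L1 L3] fe[of L2 L3] in simp_all)
 have pair: "norm ((M L0 + M a) - Q *v (v L0 + v a)) \<le> 32 * sqrt k * dev" if "norm (?m a - Q *v ?e a) \<le> 8 * (2 * dev)" for a
 proof -
  have "?m a - Q *v ?e a = s *R ((M L0 + M a) - Q *v (v L0 + v a))"
   by (simp only: matrix_vector_mult_scaleR scaleR_diff_right)
  then have "s * norm ((M L0 + M a) - Q *v (v L0 + v a)) \<le> 16 * dev" using that sk(1) by simp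
  then show ?thesis using k unfolding s_def by (simp add: field_simps)
 qed
 let ?d = "\<lambda>i. M i - Q *v v i"
 have pd: "norm (?d L0 + ?d L1) \<le> 32 * sqrt k * dev" "norm (?d L0 + ?d L2) \<le> 32 * sqrt k * dev" "norm (?d L0 + ?d L3) \<le> 32 * sqrt k * dev"
 proof -
  have eq: "?d L0 + ?d a = (M L0 + M a) - Q *v (v L0 + v a)" for a by (simp add: matrix_vector_right_distrib)
  have e: "norm (?m L1 - Q *v ?e L1) \<le> 8 * (2 * dev)" "norm (?m L2 - Q *v ?e L2) \<le> 8 * (2 * dev)" "norm (?m L3 - Q *v ?e L3) \<le> 8 * (2 * dev)"
   using n unfolding Q(2,3,4) by blast+
  show "norm (?d L0 + ?d L1) \<le> 32 * sqrt k * dev" "norm (?d L0 + ?d L2) \<le> 32 * sqrt k * dev" "norm (?d L0 + ?d L3) \<le> 32 * sqrt k * dev"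
   unfolding eq by (rule pair[OF e(1)], rule pair[OF e(2)], rule pair[OF e(3)])
 qed
 have "M L0 + M L1 + M L2 + M L3 = sqrt (k / \<tau>) *R (N L0 + N L1 + N L2 + N L3)" by (simp add: M_def scaleR_add_right)
 then have "M L0 + M L1 + M L2 + M L3 = 0" using N_sum by simp
 moreover have "Q *v v L0 + Q *v v L1 + Q *v v L2 + Q *v v L3 = 0"
  using arg_cong[OF sum0, of "\<lambda>x. Q *v x"] by (simp add: matrix_vector_right_distrib)
 moreover have "?d L0 + ?d L1 + ?d L2 + ?d L3 = (M L0 + M L1 + M L2 + M L3) - (Q *v v L0 + Q *v v L1 + Q *v v L2 + Q *v v L3)"
  by simp
 ultimately have ds: "?d L0 + ?d L1 + ?d L2 + ?d L3 = 0" by (simp only: diff_zero)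
 \<comment> \<open>Both families sum to 0, so the three pair errors with constant 32 determine the
   error at \<open>L0\<close>, with constant \<open>96 / 2 = 48\<close>, and then the others, with
   constant \<open>32 + 48 = 80\<close>.\<close>
 have "2 *R ?d L0 = (?d L0 + ?d L1) + (?d L0 + ?d L2) + (?d L0 + ?d L3)"
 proof -
  have "(?d L0 + ?d L1) + (?d L0 + ?d L2) + (?d L0 + ?d L3) = 2 *R ?d L0 + (?d L0 + ?d L1 + ?d L2 + ?d L3)"
   by (simp only: scaleR_2 add_ac)
  then show ?thesis unfolding ds by simp
 qed
 then have "norm (2 *R ?d L0) \<le> 96 * sqrt k * dev"
  using pd norm_triangle_ineq[of "(?d L0 + ?d L1) + (?d L0 + ?d L2)" "?d L0 + ?d L3"] norm_triangle_ineq[of "?d L0 + ?d L1" "?d L0 + ?d L2"]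
  by (simp only:)
 then have d0: "norm (?d L0) \<le> 48 * sqrt k * dev" by simp
 have da: "norm (?d a) \<le> 80 * sqrt k * dev" if "norm (?d L0 + ?d a) \<le> 32 * sqrt k * dev" for a
  using that d0 norm_triangle_ineq4[of "?d L0 + ?d a" "?d L0"] by simp
 have "48 * sqrt k * dev \<le> 80 * sqrt k * dev" using k dev_nonneg by (intro mult_right_mono) auto
 then have "norm (M i - Q *v v i) \<le> 80 * sqrt k * dev" for i
  using da[OF pd(1)] da[OF pd(2)] da[OF pd(3)] order_trans[OF d0] by (cases i; simp)
 with Q(1) show ?thesis by (rule that)
qed

text \<open>The offset of the cut after the parameters \<open>p\<close> are scaled to mean
  \<open>k\<close>, their value for the \<open>v i\<close>.\<close>

definition "cutp S = (sum N S \<bullet> sum t S) / 2 * (k / \<sigma>)"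

lemma cutp_close: assumes "S \<in> cuts" shows "\<bar>cutp S - bS S\<bar> \<le> 4 * k * dev"
proof -
 have one: "\<bar>cutp {i} - bS {i}\<bar> \<le> 4 * k * dev" for i
 proof -
  obtain j m l where a: "{i, j, m, l} = (UNIV :: label set)" using four_labels .
  note d = four_distinct[OF a]
  have "cutp {i} - bS {i} = (k / 2) * (q i j + q i m + q i l)"
   unfolding cutp_def bS_values[OF a] using diag(1)[OF a] unfolding pq(1)[OF st] using st by (simp add: field_simps)
  moreover have "\<bar>(k / 2) * (q i j + q i m + q i l)\<bar> \<le> (k / 2) * (8 * dev)"
   using k dev_nonneg qg_le(1)[OF d(1)] qg_le(1)[OF d(2)] qg_le(1)[OF d(3)] by (intro abs_mult_le) auto
  ultimately show ?thesis by simp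
 qed
 have two: "\<bar>cutp {i, j} - bS {i, j}\<bar> \<le> 4 * k * dev" if a: "{i, j, m, l} = (UNIV :: label set)" for i j m l
 proof -
  note d = four_distinct[OF a]
  have "sum N {i, j} \<bullet> sum t {i, j} = p i m + p i l + p j m + p j l"
   using cut_value(1)[OF a] sums(2)[OF a N_sum] sums(2)[OF a t_sum] by simp
  then have "cutp {i, j} - bS {i, j} = (k / 2) * (q i m + q i l + q j m + q j l)"
   unfolding cutp_def bS_values[OF a] pq(1)[OF st] using st by (simp add: field_simps)
  moreover have "\<bar>(k / 2) * (q i m + q i l + q j m + q j l)\<bar> \<le> (k / 2) * (8 * dev)"
   using k dev_nonneg qg_le(1)[OF d(2)] qg_le(1)[OF d(3)] qg_le(1)[OF d(4)] qg_le(1)[OF d(5)] by (intro abs_mult_le) auto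
  ultimately show ?thesis by simp
 qed
 obtain i j m l where a: "{i, j, m, l} = UNIV" and "S = {i} \<or> S = {i, j} \<or> S = {i, j, m}" by (rule cut_forms[OF assms])
 then consider "S = {i}" | "S = {i, j}" | "S = {i, j, m}" by blast
 then show ?thesis
 proof cases
  case 3
  have l: "{l, i, j, m} = (UNIV :: label set)" using a by (simp add: insert_commute)
  have "cutp S = cutp {l}" unfolding 3 cutp_def sums(3)[OF a N_sum] sums(3)[OF a t_sum] by simp
  moreover have "bS S = bS {l}" unfolding 3 bS_values[OF a] bS_values(1)[OF l] ..
  ultimately show ?thesis using one by simp
 qed (use one two[OF a] in auto)
qed

text \<open>\<open>\<epsilon>\<close> is the total error of the inequalities relative to the least
  offset \<open>3/2 * k\<close>: \<open>320 * sqrt k * R * dev\<close> for the normals on vectors of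
  norm at most \<open>R\<close>, and \<open>4 * k * dev\<close> for the offsets. The outer factor
  comes from \<open>(1 + \<epsilon>) / (1 - \<epsilon>) \<le> 1 + 4 * \<epsilon>\<close>, valid for
  \<open>\<epsilon> \<le> 1/2\<close>.\<close>

lemma sandwich:
 assumes R: "R > 0" "\<And>x. x \<in> A \<Longrightarrow> norm x \<le> R"
  and eps: "\<epsilon> = (320 * sqrt k * R + 4 * k) / (3/2 * k) * dev" "\<epsilon> \<le> 1/2"
 obtains Q :: "real^3^3" and lam where "rotation_matrix Q" "lam > 0"
  "\<And>x. x \<in> A \<Longrightarrow> lam *R (Q *v ((1 - \<epsilon>) *R x)) \<in> P"
  "\<And>y. lam *R (Q *v y) \<in> P \<Longrightarrow> \<exists>x\<in>A. y = (1 + 4 * \<epsilon>) *R x"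
proof -
 obtain Q :: "real^3^3" where Q: "rotation_matrix Q" "\<And>i. norm (M i - Q *v v i) \<le> 80 * sqrt k * dev"
  using rotation_exists by blast
 define \<kappa> where "\<kappa> = 320 * sqrt k * dev"
 have kap: "\<kappa> \<ge> 0" using k dev_nonneg by (simp add: \<kappa>_def)
 have oQ: "(Q *v x) \<bullet> (Q *v y) = x \<bullet> y" "norm (Q *v x) = norm x" for x y
 proof -
  have "orthogonal_transformation ((*v) Q)"
   using Q(1) by (simp add: rotation_matrix_def orthogonal_transformation_matrix)
  then show "(Q *v x) \<bullet> (Q *v y) = x \<bullet> y" "norm (Q *v x) = norm x"
   by (simp_all add: orthogonal_transformation_def orthogonal_transformation_norm)
 qed
 have close: "\<bar>sum M S \<bullet> (Q *v y) - vS S \<bullet> y\<bar> \<le> \<kappa> * norm y" for S y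
 proof -
  have "Q *v vS S = sum (\<lambda>i. Q *v v i) S" unfolding vS_def by (simp add: linear_sum[of "(*v) Q"])
  then have "sum M S - Q *v vS S = sum (\<lambda>i. M i - Q *v v i) S" by (simp add: sum_subtractf)
  then have "norm (sum M S - Q *v vS S) \<le> sum (\<lambda>i. norm (M i - Q *v v i)) S" by (simp add: norm_sum)
  also have "\<dots> \<le> sum (\<lambda>i. 80 * sqrt k * dev) S" using Q(2) by (rule sum_mono)
  also have "\<dots> \<le> \<kappa>"
  proof -
   have "card S \<le> 4" using card_mono[of UNIV S] card_label by simp
   then have "real (card S) * (80 * sqrt k * dev) \<le> 4 * (80 * sqrt k * dev)"
    using k dev_nonneg by (intro mult_right_mono) auto
   then show ?thesis by (simp add: \<kappa>_def)
  qed
  finally have n: "norm (sum M S - Q *v vS S) \<le> \<kappa>" .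
  have "sum M S \<bullet> (Q *v y) - vS S \<bullet> y = (sum M S - Q *v vS S) \<bullet> (Q *v y)" by (simp add: inner_diff_left oQ)
  also have "\<bar>\<dots>\<bar> \<le> norm (sum M S - Q *v vS S) * norm (Q *v y)" by (rule Cauchy_Schwarz_ineq2)
  also have "\<dots> \<le> \<kappa> * norm y" unfolding oQ using n by (intro mult_right_mono) auto
  finally show ?thesis .
 qed
 \<comment> \<open>Chosen so that the rescaling of normals by \<open>sqrt (k / \<tau>)\<close>
   matches that of offsets by \<open>k / \<sigma>\<close>.\<close>
 define lam where "lam = \<sigma> / sqrt (k * \<tau>)"
 have lampos: "lam > 0" using st k by (simp add: lam_def)
 have mem: "lam *R (Q *v y) \<in> P \<longleftrightarrow> (\<forall>S\<in>cuts. sum M S \<bullet> (Q *v y) \<le> cutp S)" for y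
 proof -
  have "(sum N S \<bullet> (lam *R (Q *v y)) \<le> (sum N S \<bullet> sum t S) / 2) = (sum M S \<bullet> (Q *v y) \<le> cutp S)" for S
  proof -
   have "sum M S = sqrt (k / \<tau>) *R sum N S" unfolding M_def by (simp add: scaleR_sum_right)
   then have "sum M S \<bullet> (Q *v y) = sqrt (k / \<tau>) * (sum N S \<bullet> (Q *v y))" by simp
   moreover have "sqrt (k / \<tau>) = lam * (k / \<sigma>)"
   proof -
    have "sqrt k * sqrt k = k" using k by simp
    then show ?thesis unfolding lam_def using k st by (simp add: real_sqrt_divide real_sqrt_mult field_simps)
   qed
   ultimately have e: "sum M S \<bullet> (Q *v y) = (sum N S \<bullet> (lam *R (Q *v y))) * (k / \<sigma>)" by simp
   have "k / \<sigma> > 0" using k st by simp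
   then show ?thesis unfolding e cutp_def by (simp only: mult_le_cancel_right_pos)
  qed
  then show ?thesis by (subst P_def) blast
 qed
 have e0: "\<epsilon> \<ge> 0" unfolding eps(1) using k R(1) dev_nonneg by simp
 have b32: "bS S \<ge> 3/2 * k" if Sc: "S \<in> cuts" for S
 proof -
  obtain i j m l where a: "{i, j, m, l} = UNIV" and "S = {i} \<or> S = {i, j} \<or> S = {i, j, m}" by (rule cut_forms[OF Sc])
  then show ?thesis using bS_values[OF a] k by auto
 qed
 have "\<epsilon> * (3/2 * k) = \<kappa> * R + 4 * k * dev" unfolding eps(1) \<kappa>_def using k by (simp add: field_simps)
 then have main: "\<kappa> * R + 4 * k * dev \<le> \<epsilon> * bS S" if "S \<in> cuts" for S
  using mult_left_mono[OF b32[OF that] e0] by linarith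
 have kd: "4 * k * dev \<ge> 0" "\<kappa> * R \<ge> 0" using k dev_nonneg kap R(1) by simp_all
 show ?thesis
 proof (rule that[OF Q(1) lampos])
  fix x assume x: "x \<in> A"
  have "sum M S \<bullet> (Q *v ((1 - \<epsilon>) *R x)) \<le> cutp S" if S: "S \<in> cuts" for S
  proof -
   have "\<kappa> * norm x \<le> \<kappa> * R" using R(2)[OF x] kap by (rule mult_left_mono)
   moreover have "vS S \<bullet> x \<le> bS S" using x S unfolding A_eq by blast
   ultimately have "sum M S \<bullet> (Q *v x) \<le> bS S + \<kappa> * R" using close[of S x] by linarith
   then have "(1 - \<epsilon>) * (sum M S \<bullet> (Q *v x)) \<le> (1 - \<epsilon>) * (bS S + \<kappa> * R)" using eps(2) by (intro mult_left_mono) auto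
   also have "\<dots> = bS S + \<kappa> * R - \<epsilon> * bS S - \<epsilon> * (\<kappa> * R)" by (simp add: algebra_simps)
   also have "\<dots> \<le> bS S - 4 * k * dev" using main[OF S] mult_nonneg_nonneg[OF e0 kd(2)] by linarith
   also have "\<dots> \<le> cutp S" using cutp_close[OF S] by linarith
   finally show ?thesis by (simp add: matrix_vector_mult_scaleR)
  qed
  then show "lam *R (Q *v ((1 - \<epsilon>) *R x)) \<in> P" unfolding mem by blast
 next
  fix y assume y: "lam *R (Q *v y) \<in> P"
  \<comment> \<open>The gauge of \<open>A\<close> at \<open>y\<close>. If it exceeds 1, the error of
    the normals at \<open>y\<close> is proportional to it, and the inequality at the maximising cut
    bounds \<open>\<rho>\<close> itself.\<close>
  define \<rho> where "\<rho> = Max ((\<lambda>S. vS S \<bullet> y / bS S) ` cuts)"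
  have fin: "finite ((\<lambda>S. vS S \<bullet> y / bS S) ` cuts)" "(\<lambda>S. vS S \<bullet> y / bS S) ` cuts \<noteq> {}"
   using singleton_cut by auto
  have le: "vS S \<bullet> y \<le> \<rho> * bS S" if "S \<in> cuts" for S
  proof -
   have "vS S \<bullet> y / bS S \<le> \<rho>" unfolding \<rho>_def using fin(1) that by (intro Max_ge) auto
   then show ?thesis using bS_pos[OF that] by (simp add: pos_divide_le_eq)
  qed
  obtain S where S: "S \<in> cuts" "vS S \<bullet> y = \<rho> * bS S"
  proof -
   have "\<rho> \<in> (\<lambda>S. vS S \<bullet> y / bS S) ` cuts" unfolding \<rho>_def by (rule Max_in[OF fin])
   then obtain S where "S \<in> cuts" "\<rho> = vS S \<bullet> y / bS S" by blast
   then show ?thesis using that[of S] bS_pos[of S] by simp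
  qed
  have rho: "\<rho> \<le> 1 + 4 * \<epsilon>"
  proof (cases "\<rho> \<le> 1")
   case True then show ?thesis using e0 by linarith
  next
   case False
   have "vS R \<bullet> ((1 / \<rho>) *R y) \<le> bS R" if "R \<in> cuts" for R
    using le[OF that] False by (simp add: pos_divide_le_eq mult.commute)
   then have "(1 / \<rho>) *R y \<in> A" unfolding A_eq by blast
   from R(2)[OF this] have "norm y \<le> \<rho> * R" using False by (simp add: pos_divide_le_eq mult.commute)
   then have "\<kappa> * norm y \<le> \<kappa> * (\<rho> * R)" using kap by (rule mult_left_mono)
   moreover have "sum M S \<bullet> (Q *v y) \<le> bS S + 4 * k * dev"
    using y S(1) cutp_close[OF S(1)] unfolding mem by force
   ultimately have "\<rho> * bS S \<le> bS S + 4 * k * dev + \<rho> * (\<kappa> * R)" using close[of S y] S(2) by (simp add: algebra_simps)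
   also have "\<dots> \<le> bS S + \<epsilon> * bS S + \<rho> * (\<epsilon> * bS S)"
   proof -
    have "\<rho> * (\<kappa> * R) \<le> \<rho> * (\<epsilon> * bS S)" using main[OF S(1)] kd False by (intro mult_left_mono) linarith+
    then show ?thesis using main[OF S(1)] kd by linarith
   qed
   finally have "(\<rho> * (1 - \<epsilon>)) * bS S \<le> (1 + \<epsilon>) * bS S" by (simp add: algebra_simps)
   then have "\<rho> * (1 - \<epsilon>) \<le> 1 + \<epsilon>" using bS_pos[OF S(1)] by (simp only: mult_le_cancel_right_pos)
   also have "\<dots> \<le> (1 + 4 * \<epsilon>) * (1 - \<epsilon>)"
   proof -
    have "2 * (\<epsilon> * \<epsilon>) \<le> \<epsilon>" using mult_left_mono[OF eps(2) e0] by simp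
    then show ?thesis by (simp add: algebra_simps)
   qed
   finally show ?thesis using eps(2) by (simp only: mult_le_cancel_right_pos)
  qed
  let ?x = "(1 / (1 + 4 * \<epsilon>)) *R y"
  have pos: "1 + 4 * \<epsilon> > 0" using e0 by linarith
  have "vS R \<bullet> ?x \<le> bS R" if "R \<in> cuts" for R
  proof -
   have "vS R \<bullet> y \<le> (1 + 4 * \<epsilon>) * bS R"
    using le[OF that] mult_right_mono[OF rho, of "bS R"] bS_pos[OF that] by linarith
   then show ?thesis using pos by (simp add: pos_divide_le_eq mult.commute)
  qed
  then have "?x \<in> A" unfolding A_eq by blast
  moreover have "y = (1 + 4 * \<epsilon>) *R ?x" using pos by simp
  ultimately show "\<exists>x\<in>A. y = (1 + 4 * \<epsilon>) *R x" by blast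
 qed
qed

end

section \<open>Similarity distance\<close>

declare transpose_matrix_vector [simp del]

lemma rotation_matrix_transpose: "rotation_matrix Q \<Longrightarrow> rotation_matrix (transpose Q)"
 by (simp add: rotation_matrix_def orthogonal_matrix_transpose det_transpose)

lemma rotation_matrix_inverse:
 fixes Q :: "real^'n^'n"
 assumes "rotation_matrix Q" shows "transpose Q *v (Q *v x) = x" "Q *v (transpose Q *v x) = x"
 using assms by (simp_all only: rotation_matrix_def orthogonal_matrix_def matrix_vector_mul_assoc matrix_vector_mul_lid)

lemma rotation_orthogonal: "rotation_matrix Q \<Longrightarrow> orthogonal_transformation ((*v) Q)" for Q :: "real^3^3"
 by (simp add: rotation_matrix_def orthogonal_transformation_matrix matrix_of_matrix_vector_mul)

lemma norm_rotation: "rotation_matrix Q \<Longrightarrow> norm (Q *v x) = norm x" for Q :: "real^3^3"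
 by (rule orthogonal_transformation_norm[OF rotation_orthogonal])

lemma volume_scale: "0 \<le> r \<Longrightarrow> volume ((*R) r ` K) = r ^ 3 * volume K"
 using measure_lebesgue_affine[of r 0 K] by simp

lemma volume_similar:
 assumes "rotation_matrix Q" "0 \<le> r" "K \<in> lmeasurable"
 shows "volume ((\<lambda>x. r *R (Q *v x)) ` K) = r ^ 3 * volume K"
proof -
 have "(\<lambda>x. r *R (Q *v x)) ` K = (*R) r ` (*v) Q ` K" by (simp add: image_image)
 then show ?thesis
  using volume_scale[OF assms(2)] measure_orthogonal_image[OF rotation_orthogonal[OF assms(1)] assms(3)] by simp
qed

lemma hausdorff_distance_le:
 assumes "X \<noteq> {}" "Y \<noteq> {}" "\<And>x. x \<in> X \<Longrightarrow> infdist x Y \<le> e" "\<And>y. y \<in> Y \<Longrightarrow> infdist y X \<le> e"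
 shows "hausdorff_distance X Y \<le> e"
 unfolding hausdorff_distance_def by (intro max.boundedI cSUP_least assms)

lemma infdist_le_hausdorff:
 assumes "bounded X" "bounded Y" "X \<noteq> {}" "Y \<noteq> {}"
 shows "x \<in> X \<Longrightarrow> infdist x Y \<le> hausdorff_distance X Y" "y \<in> Y \<Longrightarrow> infdist y X \<le> hausdorff_distance X Y"
proof -
 have bdd: "bdd_above ((\<lambda>a. infdist a B) ` A)" if AB: "bounded A" "B \<noteq> {}" for A B :: "'a set"
 proof -
  obtain b where b: "b \<in> B" using AB(2) by blast
  obtain e where e: "\<forall>a\<in>A. dist b a \<le> e" using AB(1) bounded_any_center by blast
  show ?thesis using e infdist_le[OF b] by (intro bdd_aboveI2[of _ _ e]) (metis dist_commute order_trans)
 qed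
 show "x \<in> X \<Longrightarrow> infdist x Y \<le> hausdorff_distance X Y" "y \<in> Y \<Longrightarrow> infdist y X \<le> hausdorff_distance X Y"
  unfolding hausdorff_distance_def
  by (rule max.coboundedI1, rule cSUP_upper[OF _ bdd[OF assms(1,4)]], assumption)
   (rule max.coboundedI2, rule cSUP_upper[OF _ bdd[OF assms(2,3)]], assumption)
qed

lemma hausdorff_distance_nonneg:
 assumes "bounded X" "bounded Y" "X \<noteq> {}" "Y \<noteq> {}" shows "0 \<le> hausdorff_distance X Y"
proof -
 obtain x where "x \<in> X" using assms(3) by blast
 then show ?thesis using infdist_le_hausdorff(1)[OF assms] infdist_nonneg order_trans by blast
qed

context
 fixes P A :: "(real^3) set"
 assumes P: "bounded P" "P \<noteq> {}" and A: "bounded A" "A \<noteq> {}"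
begin

lemma rotated_normalized_bounded: "bounded ((*v) (Q :: real^3^3) ` volume_normalized A P)"
 unfolding volume_normalized_def
 by (intro bounded_linear_image[OF _ matrix_vector_mul_bounded_linear] bounded_scaling P)

lemma rotated_normalized_nonempty: "(*v) (Q :: real^3^3) ` volume_normalized A P \<noteq> {}"
 using P by (simp add: volume_normalized_def)

lemma similarity_distance_le:
 assumes "rotation_matrix Q"
 shows "similarity_distance P A \<le> hausdorff_distance ((*v) Q ` volume_normalized A P) A"
 unfolding similarity_distance_def
proof (rule cINF_lower)
 show "bdd_below ((\<lambda>Q. hausdorff_distance ((*v) Q ` volume_normalized A P) A) ` {Q. rotation_matrix Q})"
  using hausdorff_distance_nonneg[OF rotated_normalized_bounded A(1) rotated_normalized_nonempty A(2)]
  by (intro bdd_belowI2[of _ 0]) blast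
qed (use assms in simp)

lemma similarity_distance_nonneg: "0 \<le> similarity_distance P A"
 unfolding similarity_distance_def
proof (rule cINF_greatest)
 have "rotation_matrix (mat 1 :: real^3^3)" by (simp add: rotation_matrix_def orthogonal_matrix_id)
 then show "{Q :: real^3^3. rotation_matrix Q} \<noteq> {}" by blast
qed (use hausdorff_distance_nonneg[OF rotated_normalized_bounded A(1) rotated_normalized_nonempty A(2)] in blast)

end

lemma similarity_distance_similar:
 assumes A: "compact A" "A \<noteq> {}" "volume A > 0" and s: "similar P A"
 shows "similarity_distance P A = 0"
proof -
 obtain Q :: "real^3^3" and r where Q: "rotation_matrix Q" "r > 0" "P = (\<lambda>x. r *R (Q *v x)) ` A"
  using s unfolding similar_def by blast
 have bA: "bounded A" using A(1) by (rule compact_imp_bounded)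
 have P': "P = (*R) r ` (*v) Q ` A" unfolding Q(3) by (simp add: image_image)
 have bP: "bounded P" "P \<noteq> {}"
  unfolding P' using A(2) by (auto intro!: bounded_scaling bounded_linear_image[OF bA matrix_vector_mul_bounded_linear])
 have "volume P = r ^ 3 * volume A"
  unfolding Q(3) by (rule volume_similar) (use Q A lmeasurable_compact in auto)
 then have "volume A / volume P = (1 / r) ^ 3" using A(3) by (simp add: power_divide)
 then have "root 3 (volume A / volume P) = 1 / r" using Q(2) real_root_power_cancel[of 3 "1 / r"] by simp
 then have "volume_normalized A P = (*v) Q ` A"
  unfolding volume_normalized_def P' using Q(2) by (simp add: image_image)
 then have "(*v) (transpose Q) ` volume_normalized A P = A"
  by (simp only: image_image rotation_matrix_inverse(1)[OF Q(1)] image_ident)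
 then have "similarity_distance P A \<le> hausdorff_distance A A"
  using similarity_distance_le[OF bP bA A(2) rotation_matrix_transpose[OF Q(1)]] by simp
 also have "\<dots> \<le> 0" by (rule hausdorff_distance_le) (use A(2) in auto)
 finally show ?thesis using similarity_distance_nonneg[OF bP bA A(2)] by simp
qed

lemma root3_bounds:
 assumes "0 < a" "0 < b" "x * a ^ 3 \<le> 1" "1 \<le> x * b ^ 3"
 shows "root 3 x * a \<le> 1" "1 \<le> root 3 x * b"
proof -
 have e: "root 3 (x * c ^ 3) = root 3 x * c" if "0 < c" for c
  using that by (simp add: real_root_mult real_root_power_cancel)
 show "root 3 x * a \<le> 1" using real_root_le_iff[of 3 "x * a ^ 3" 1] assms e[of a] by simp
 show "1 \<le> root 3 x * b" using real_root_le_iff[of 3 1 "x * b ^ 3"] assms e[of b] by simp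
qed

text \<open>The sandwich also confines the volume, hence the factor \<open>\<mu>\<close> that
  replaces \<open>lam\<close> after normalisation: \<open>\<mu> * (1 - \<epsilon>) \<le> 1 \<le>
  \<mu> * (1 + 4 * \<epsilon>)\<close>. So the normalised body, turned back, lies between two
  multiples of \<open>A\<close> that enclose \<open>A\<close> as well.\<close>

lemma (in to_body) similarity_distance_sandwich:
 assumes P: "compact P" and Q: "rotation_matrix Q" and lam: "lam > 0"
  and R: "R > 0" "\<And>x. x \<in> A \<Longrightarrow> norm x \<le> R" and eps: "0 \<le> \<epsilon>" "\<epsilon> \<le> 1/2"
  and inner: "\<And>x. x \<in> A \<Longrightarrow> lam *R (Q *v ((1 - \<epsilon>) *R x)) \<in> P"
  and outer: "\<And>y. lam *R (Q *v y) \<in> P \<Longrightarrow> \<exists>x\<in>A. y = (1 + 4 * \<epsilon>) *R x"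
 shows "similarity_distance P A \<le> 10 * \<epsilon> * R"
proof -
 define Y where "Y = (\<lambda>x. (1 / lam) *R (transpose Q *v x)) ` P"
 have PY: "P = (\<lambda>y. lam *R (Q *v y)) ` Y"
  unfolding Y_def image_image using lam by (simp add: matrix_vector_mult_scaleR rotation_matrix_inverse[OF Q])
 have YP: "lam *R (Q *v y) \<in> P" if "y \<in> Y" for y using PY that by blast
 have Y_mem: "y \<in> Y" if "lam *R (Q *v y) \<in> P" for y
 proof -
  have "(1 / lam) *R (transpose Q *v (lam *R (Q *v y))) = y"
   using lam by (simp add: matrix_vector_mult_scaleR rotation_matrix_inverse[OF Q])
  then show ?thesis unfolding Y_def using that by (metis (no_types, lifting) imageI)
 qed
 have cY: "compact Y"
  unfolding Y_def by (intro compact_continuous_image P continuous_intros)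
 have mY: "Y \<in> lmeasurable" and mA: "A \<in> lmeasurable" using cY compact_A lmeasurable_compact by auto
 have VP: "volume P = lam ^ 3 * volume Y" by (subst PY) (rule volume_similar[OF Q _ mY], use lam in simp)
 have "(*R) (1 - \<epsilon>) ` A \<subseteq> Y" using Y_mem[OF inner] by blast
 moreover have "(*R) (1 - \<epsilon>) ` A \<in> lmeasurable" "(*R) (1 + 4 * \<epsilon>) ` A \<in> lmeasurable"
  using compact_scaling[OF compact_A] lmeasurable_compact by blast+
 moreover have "Y \<subseteq> (*R) (1 + 4 * \<epsilon>) ` A" using outer[OF YP] by blast
 ultimately have "volume ((*R) (1 - \<epsilon>) ` A) \<le> volume Y" "volume Y \<le> volume ((*R) (1 + 4 * \<epsilon>) ` A)"
  using mY by (auto intro: measure_mono_fmeasurable)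
 then have vY: "(1 - \<epsilon>) ^ 3 * volume A \<le> volume Y" "volume Y \<le> (1 + 4 * \<epsilon>) ^ 3 * volume A"
  using eps by (simp_all add: volume_scale)
 have "(1 - \<epsilon>) ^ 3 * volume A > 0" using eps volume_A_pos by simp
 then have vY0: "volume Y > 0" using vY by linarith
 define \<mu> where "\<mu> = root 3 (volume A / volume Y)"
 have mu: "\<mu> * (1 - \<epsilon>) \<le> 1" "1 \<le> \<mu> * (1 + 4 * \<epsilon>)"
  unfolding \<mu>_def using eps vY vY0 by (intro root3_bounds; simp add: pos_divide_le_eq pos_le_divide_eq mult.commute)+
 have mu0: "\<mu> > 0" using volume_A_pos vY0 by (simp add: \<mu>_def)
 have nrmP: "(*v) (transpose Q) ` volume_normalized A P = (*R) \<mu> ` Y"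
 proof -
  have "volume A / volume P = (volume A / volume Y) * (1 / lam) ^ 3" unfolding VP by (simp add: power_divide)
  then have "root 3 (volume A / volume P) = \<mu> * (1 / lam)"
   using real_root_power_cancel[of 3 "1 / lam"] lam by (simp only: real_root_mult \<mu>_def) simp
  then have "volume_normalized A P = (\<lambda>y. \<mu> *R (Q *v y)) ` Y"
   unfolding volume_normalized_def by (subst (2) PY) (use lam in \<open>simp add: image_image\<close>)
  then show ?thesis by (simp add: image_image matrix_vector_mult_scaleR rotation_matrix_inverse[OF Q])
 qed
 have A0: "A \<noteq> {}" "bounded A" using zero_mem_A compact_A compact_imp_bounded by auto
 have Y0: "Y \<noteq> {}" using Y_mem[OF inner[OF zero_mem_A]] by blast
 have P0: "P \<noteq> {}" "bounded P" using inner[OF zero_mem_A] P compact_imp_bounded by auto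
 have "similarity_distance P A \<le> hausdorff_distance ((*R) \<mu> ` Y) A"
  using similarity_distance_le[OF P0(2,1) A0(2,1) rotation_matrix_transpose[OF Q]] unfolding nrmP .
 also have "\<dots> \<le> 10 * \<epsilon> * R"
 proof (rule hausdorff_distance_le)
  \<comment> \<open>The two factors differ by \<open>5 * \<epsilon> * \<mu>\<close>, and
    \<open>\<mu> \<le> 2\<close> since \<open>\<epsilon> \<le> 1/2\<close>.\<close>
  have m2: "\<mu> * (1 + 4 * \<epsilon>) - 1 \<le> 10 * \<epsilon>"
  proof -
   have "\<mu> \<le> 2" using mu(1) mult_left_mono[of "1/2" "1 - \<epsilon>" \<mu>] eps mu0 by linarith
   then have "\<mu> * (5 * \<epsilon>) \<le> 2 * (5 * \<epsilon>)" using eps by (intro mult_right_mono) auto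
   then show ?thesis using mu(1) by (simp add: algebra_simps)
  qed
  have m3: "1 - \<mu> * (1 - \<epsilon>) \<le> 10 * \<epsilon>"
  proof (cases "\<mu> \<le> 1")
   case True
   have "\<mu> * (5 * \<epsilon>) \<le> 1 * (5 * \<epsilon>)" using True eps by (intro mult_right_mono) auto
   then show ?thesis using mu(2) eps by (simp add: algebra_simps)
  next
   case False
   have "1 * (1 - \<epsilon>) \<le> \<mu> * (1 - \<epsilon>)" using False eps by (intro mult_right_mono) auto
   then have "1 - \<mu> * (1 - \<epsilon>) \<le> \<epsilon>" by (simp add: algebra_simps)
   moreover have "\<epsilon> \<le> 10 * \<epsilon>" using eps by simp
   ultimately show ?thesis by (rule order_trans)
  qed
  show "infdist z A \<le> 10 * \<epsilon> * R" if zY: "z \<in> (*R) \<mu> ` Y" for z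
  proof -
   obtain y where y: "y \<in> Y" "z = \<mu> *R y" using zY by blast
   obtain x where x: "x \<in> A" "y = (1 + 4 * \<epsilon>) *R x" using outer[OF YP[OF y(1)]] by blast
   have "z - x = (\<mu> * (1 + 4 * \<epsilon>) - 1) *R x" unfolding y x by (simp add: scaleR_diff_left)
   then have "dist z x = (\<mu> * (1 + 4 * \<epsilon>) - 1) * norm x" unfolding dist_norm using mu(2) by simp
   also have "\<dots> \<le> (10 * \<epsilon>) * R" using m2 R(2)[OF x(1)] eps by (intro mult_mono) auto
   finally show ?thesis using infdist_le[OF x(1), of z] by linarith
  qed
  show "infdist x ((*R) \<mu> ` Y) \<le> 10 * \<epsilon> * R" if x: "x \<in> A" for x
  proof -
   let ?z = "\<mu> *R ((1 - \<epsilon>) *R x)"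
   have z: "?z \<in> (*R) \<mu> ` Y" using Y_mem[OF inner[OF x]] by blast
   have "x - ?z = (1 - \<mu> * (1 - \<epsilon>)) *R x" by (simp add: algebra_simps)
   then have "dist x ?z = (1 - \<mu> * (1 - \<epsilon>)) * norm x" unfolding dist_norm using mu(1) by simp
   also have "\<dots> \<le> (10 * \<epsilon>) * R" using m3 R(2)[OF x] eps by (intro mult_mono) auto
   finally show ?thesis using infdist_le[OF z, of x] by linarith
  qed
 qed (use A0 Y0 in auto)
 finally show ?thesis .
qed

context close_tile
begin

lemma similarity_distance_le_dev:
 assumes R: "R > 0" "\<And>x. x \<in> A \<Longrightarrow> norm x \<le> R"
  and eps: "\<epsilon> = (320 * sqrt k * R + 4 * k) / (3/2 * k) * dev" "\<epsilon> \<le> 1/2"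
 shows "similarity_distance P A \<le> 10 * \<epsilon> * R"
proof -
 obtain Q :: "real^3^3" and lam where q: "rotation_matrix Q" "lam > 0"
  "\<And>x. x \<in> A \<Longrightarrow> lam *R (Q *v ((1 - \<epsilon>) *R x)) \<in> P"
  "\<And>y. lam *R (Q *v y) \<in> P \<Longrightarrow> \<exists>x\<in>A. y = (1 + 4 * \<epsilon>) *R x"
  using sandwich[OF R eps] by blast
 have "\<epsilon> \<ge> 0" unfolding eps(1) using k R(1) dev_nonneg by simp
 then show ?thesis using similarity_distance_sandwich[OF compact q(1,2) R _ eps(2) q(3,4)] by blast
qed

text \<open>For \<open>dev = 0\<close> the sandwich holds with \<open>\<epsilon> = 0\<close>, where
  its two inclusions become an equality.\<close>

lemma dev_zero_similar:
 assumes "dev = 0" shows "similar P A"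
proof -
 obtain R where R: "R > 0" "\<And>x. x \<in> A \<Longrightarrow> norm x \<le> R" using A_bounded by blast
 obtain Q :: "real^3^3" and lam where q: "rotation_matrix Q" "lam > 0"
  "\<And>x. x \<in> A \<Longrightarrow> lam *R (Q *v ((1 - 0) *R x)) \<in> P"
  "\<And>y. lam *R (Q *v y) \<in> P \<Longrightarrow> \<exists>x\<in>A. y = (1 + 4 * 0) *R x"
  by (rule sandwich[OF R, of 0]) (use assms in auto)
 have "P = (\<lambda>x. lam *R (Q *v x)) ` A"
 proof
  show "P \<subseteq> (\<lambda>x. lam *R (Q *v x)) ` A"
  proof
   fix x assume x: "x \<in> P"
   let ?y = "(1 / lam) *R (transpose Q *v x)"
   have e: "lam *R (Q *v ?y) = x" using q(2) by (simp add: matrix_vector_mult_scaleR rotation_matrix_inverse[OF q(1)])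
   then have "?y \<in> A" using q(4)[of ?y] x by auto
   then show "x \<in> (\<lambda>x. lam *R (Q *v x)) ` A" using e by force
  qed
  show "(\<lambda>x. lam *R (Q *v x)) ` A \<subseteq> P" using q(3) by auto
 qed
 then show ?thesis unfolding similar_def using q(1,2) by blast
qed

end

context archimedean
begin

lemma isoperimetric_quotient_similar:
 assumes "similar P A" "volume A > 0" shows "isoperimetric_quotient P = isoperimetric_quotient A"
proof -
 obtain Q :: "real^3^3" and r where Q: "rotation_matrix Q" "r > 0" "P = (\<lambda>x. r *R (Q *v x)) ` A"
  using assms(1) unfolding similar_def by blast
 let ?X = "4 * sqrt 3 * l2 * hexagon_measure + 3/2 * l2 * square_measure"
 have lin: "linear (\<lambda>x. r *R (Q *v x))" by (intro linear_compose_scale_right) simp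
 have S: "surface_area P = r\<^sup>2 * ?X"
  unfolding Q(3) by (rule surface_area_similar[OF lin]) (use Q(2) norm_rotation[OF Q(1)] in auto)
 have "surface_area ((\<lambda>x. x) ` A) = 1\<^sup>2 * ?X" by (rule surface_area_similar) (simp_all add: linear_ident)
 then have SA: "surface_area A = ?X" by simp
 have V: "volume P = r ^ 3 * volume A"
  unfolding Q(3) by (rule volume_similar) (use Q compact_A lmeasurable_compact in auto)
 have "(r ^ 3) powr (2/3) = r\<^sup>2" using Q(2) by (simp add: powr_powr flip: powr_numeral)
 then have "volume P powr (2/3) = r\<^sup>2 * volume A powr (2/3)" unfolding V using Q(2) assms(2) by (simp add: powr_mult)
 then show ?thesis unfolding isoperimetric_quotient_def S SA using Q(2) by simp
qed

end

section \<open>The stability theorem\<close>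

lemma (in to_frame) vS_forms:
 assumes "S \<in> cuts"
 shows "\<exists>w\<in>{v L0, v L1, v L2, v L3, v L0 + v L1, v L0 + v L2, v L0 + v L3}. vS S = w \<or> vS S = - w"
proof -
 have e: "v L2 + v L3 = - (v L0 + v L1)" "v L1 + v L3 = - (v L0 + v L2)" "v L1 + v L2 = - (v L0 + v L3)"
  using sum0 by (simp_all add: eq_neg_iff_add_eq_0 algebra_simps)
 have e': "v L1 + v L0 = v L0 + v L1" "v L2 + v L0 = v L0 + v L2" "v L3 + v L0 = v L0 + v L3"
  "v L3 + v L2 = - (v L0 + v L1)" "v L3 + v L1 = - (v L0 + v L2)" "v L2 + v L1 = - (v L0 + v L3)"
  unfolding e[symmetric] by (simp_all only: add.commute)
 obtain i j m l where a: "{i, j, m, l} = UNIV" and "S = {i} \<or> S = {i, j} \<or> S = {i, j, m}" by (rule cut_forms[OF assms])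
 then have d: "vS S = v i \<or> vS S = v i + v j \<or> vS S = - v l" using vS_values[OF a] by auto
 let ?W = "{v L0, v L1, v L2, v L3, v L0 + v L1, v L0 + v L2, v L0 + v L3}"
 have two: "\<exists>w\<in>?W. v i + v j = w \<or> v i + v j = - w"
  using four_distinct(1)[OF a] by (cases i; cases j) (simp_all add: e e')
 have one: "\<exists>w\<in>?W. v x = w \<or> v x = - w" "\<exists>w\<in>?W. - v x = w \<or> - v x = - w" for x by (cases x; simp)+
 from d show ?thesis
 proof (elim disjE)
  assume "vS S = v i" then show ?thesis using one(1)[of i] by (simp only:)
 next
  assume "vS S = v i + v j" then show ?thesis using two by (simp only:)
 next
  assume "vS S = - v l" then show ?thesis using one(2)[of l] by (simp only:)
 qed
qed

lemma (in archimedean) to_body_exists: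
 obtains v where "to_body v (2 * l2) A"
proof -
 obtain v0 v1 v2 v3 where s: "to_shape A (2 * l2) v0 v1 v2 v3" by (rule classification)
 define v where "v i = (case i of L0 \<Rightarrow> v0 | L1 \<Rightarrow> v1 | L2 \<Rightarrow> v2 | L3 \<Rightarrow> v3)" for i
 have vv: "v L0 = v0" "v L1 = v1" "v L2 = v2" "v L3 = v3" by (simp_all add: v_def)
 have gr: "v0 \<bullet> v0 = 3 * (2 * l2)" "v1 \<bullet> v1 = 3 * (2 * l2)" "v2 \<bullet> v2 = 3 * (2 * l2)" "v3 \<bullet> v3 = 3 * (2 * l2)"
  "v0 \<bullet> v1 = - (2 * l2)" "v0 \<bullet> v2 = - (2 * l2)" "v0 \<bullet> v3 = - (2 * l2)"
  "v1 \<bullet> v2 = - (2 * l2)" "v1 \<bullet> v3 = - (2 * l2)" "v2 \<bullet> v3 = - (2 * l2)"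
  using s unfolding to_shape_def by blast+
 interpret F: to_frame v "2 * l2"
 proof
  show "2 * l2 > 0" "v L0 + v L1 + v L2 + v L3 = 0" using s unfolding to_shape_def vv by blast+
  fix i j
  show "v i \<bullet> v j = (if i = j then 3 * (2 * l2) else - (2 * l2))"
   using gr by (cases i; cases j) (simp_all add: vv inner_commute[of v1 v0] inner_commute[of v2 v0] inner_commute[of v3 v0]
    inner_commute[of v2 v1] inner_commute[of v3 v1] inner_commute[of v3 v2])
 qed
 have A: "A = {x. \<forall>w\<in>{v L0, v L1, v L2, v L3, v L0 + v L1, v L0 + v L2, v L0 + v L3}. \<bar>w \<bullet> x\<bar> \<le> w \<bullet> w / 2}"
  using s unfolding to_shape_def vv by blast
 have "A = {x. \<forall>S\<in>cuts. F.vS S \<bullet> x \<le> F.bS S}"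
 proof (intro set_eqI iffI)
  fix x assume x: "x \<in> A"
  have "F.vS S \<bullet> x \<le> F.bS S" if S: "S \<in> cuts" for S
  proof -
   obtain w where w: "w \<in> {v L0, v L1, v L2, v L3, v L0 + v L1, v L0 + v L2, v L0 + v L3}" "F.vS S = w \<or> F.vS S = - w"
    using F.vS_forms[OF S] by blast
   have "\<bar>w \<bullet> x\<bar> \<le> w \<bullet> w / 2" using x w(1) unfolding A by blast
   moreover have "F.vS S \<bullet> x \<le> \<bar>w \<bullet> x\<bar>" "F.vS S \<bullet> F.vS S = w \<bullet> w" using w(2) by auto
   ultimately show ?thesis unfolding F.bS_def by linarith
  qed
  then show "x \<in> {x. \<forall>S\<in>cuts. F.vS S \<bullet> x \<le> F.bS S}" by blast
 next
  fix x assume x: "x \<in> {x. \<forall>S\<in>cuts. F.vS S \<bullet> x \<le> F.bS S}"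
  have b: "\<bar>F.vS S \<bullet> x\<bar> \<le> F.vS S \<bullet> F.vS S / 2" if S: "S \<in> cuts" for S
  proof -
   have "F.vS S \<bullet> x \<le> F.bS S" "F.vS (- S) \<bullet> x \<le> F.bS (- S)" using x S complement_cut[OF S] by blast+
   then show ?thesis unfolding F.vS_complement F.bS_complement by (simp add: F.bS_def abs_le_iff)
  qed
  have c: "{L0} \<in> cuts" "{L1} \<in> cuts" "{L2} \<in> cuts" "{L3} \<in> cuts" by (rule singleton_cut)+
  have c2: "{L0, L1} \<in> cuts" "{L0, L2} \<in> cuts" "{L0, L3} \<in> cuts" by (auto simp: cuts_def UNIV_label)
  have e: "F.vS {i} = v i" "i \<noteq> j \<Longrightarrow> F.vS {i, j} = v i + v j" for i j by (simp_all add: F.vS_def)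
  show "x \<in> A" unfolding A
   using b[OF c(1)] b[OF c(2)] b[OF c(3)] b[OF c(4)] b[OF c2(1)] b[OF c2(2)] b[OF c2(3)]
   by (simp only: e label.distinct simp_thms mem_Collect_eq ball_simps insert_iff empty_iff)
 qed
 then have "to_body v (2 * l2) A" by unfold_locales
 then show ?thesis by (rule that)
qed

locale arch_body = arch: archimedean A + to_body v k A for A :: "(real^3) set" and v :: "label \<Rightarrow> real^3" and k :: real +
 assumes k_eq: "k = 2 * arch.l2"
begin

text \<open>For \<open>A\<close> the bounds are taken in the opposite direction, area from above and
  volume from below; the result is the value of \<open>isoperimetric_lower\<close> at deviation
  0.\<close>

lemma isoperimetric_quotient_A_le: "isoperimetric_quotient A \<le> 2 * (12 * sqrt 3 + 6) / 16 powr (5/6)"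
proof -
 let ?U = "12 * sqrt 3 + 6 :: real"
 have "(4 * (k * sqrt k)) powr (2/3) = 4 powr (2/3) * (k * sqrt k) powr (2/3)" using k by (simp add: powr_mult)
 moreover have "k * sqrt k = k powr (3/2)"
  using k by (simp flip: powr_half_sqrt add: powr_mult_base)
 then have "(k * sqrt k) powr (2/3) = k" using k by (simp add: powr_powr)
 ultimately have e: "(4 * (k * sqrt k)) powr (2/3) = 4 powr (2/3) * k" by simp
 have "(4 * (k * sqrt k)) powr (2/3) \<le> volume A powr (2/3)" using volume_A_ge k by (intro powr_mono2) auto
 then have V: "4 powr (2/3) * k \<le> volume A powr (2/3)" unfolding e .
 have S: "surface_area A \<le> ?U * (k / 2)" using arch.surface_area_le k_eq by simp
 have "isoperimetric_quotient A \<le> ?U * (k / 2) / (4 powr (2/3) * k)"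
  unfolding isoperimetric_quotient_def
  by (rule frac_le[OF _ S _ V]) (use k in simp_all)
 also have "\<dots> = ?U / (2 * 4 powr (2/3))" using k by simp
 also have "\<dots> = 2 * ?U / 16 powr (5/6)"
 proof -
  have "(16::real) powr (5/6) = (4 powr 2) powr (5/6)" by simp
  also have "\<dots> = 4 powr (5/3)" by (simp only: powr_powr) simp
  also have "\<dots> = 4 powr (1 + 2/3)" by simp
  also have "\<dots> = 4 * 4 powr (2/3)" unfolding powr_add by simp
  finally show ?thesis by (simp add: field_simps)
 qed
 finally show ?thesis .
qed

text \<open>The deficit is at least twice the number \<open>dev^2 / (50 * 16 powr (5/6))\<close>,
  whereas \<open>c\<close> times the squared distance is at most once that number. The surplus turns
  equality into \<open>dev = 0\<close>, hence into similarity.\<close>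

lemma stability_gap:
 assumes ct: "close_tile v k A P T N t" and R: "R > 0" "\<And>x. x \<in> A \<Longrightarrow> norm x \<le> R"
  and K: "K = (320 * sqrt k * R + 4 * k) / (3/2 * k)" "K * selling_tile.dev N t \<le> 1/2"
  and c: "c = 1 / (50 * 16 powr (5/6) * (10 * K * R)\<^sup>2)"
 shows "isoperimetric_quotient P - isoperimetric_quotient A \<ge> c * (similarity_distance P A)\<^sup>2 \<and>
   (isoperimetric_quotient P - isoperimetric_quotient A = c * (similarity_distance P A)\<^sup>2 \<longleftrightarrow> similar P A)"
proof -
 interpret C: close_tile v k A P T N t by (rule ct)
 let ?d = "similarity_distance P A" and ?I = "isoperimetric_quotient P - isoperimetric_quotient A"
 have K0: "K > 0" unfolding K(1) using k R(1) by (simp add: add_nonneg_pos)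
 have pw: "(16::real) powr (5/6) > 0" by simp
 have C0: "10 * K * R > 0" using K0 R(1) by simp
 have "50 * 16 powr (5/6) * (10 * K * R)\<^sup>2 > 0" using pw zero_less_power[OF C0, of 2] by (intro mult_pos_pos) simp_all
 then have c0: "c > 0" unfolding c by (rule divide_pos_pos[OF zero_less_one])
 have bA: "bounded A" "A \<noteq> {}" using compact_A compact_imp_bounded zero_mem_A by auto
 have bP: "bounded P" "P \<noteq> {}" using C.compact compact_imp_bounded C.zero_mem by auto
 have d0: "?d \<ge> 0" by (rule similarity_distance_nonneg[OF bP bA])
 have "?d \<le> 10 * (K * C.dev) * R"
  by (rule C.similarity_distance_le_dev[OF R]) (use K in simp_all)
 then have "?d \<le> (10 * K * R) * C.dev" by (simp add: mult_ac)
 then have "?d\<^sup>2 \<le> ((10 * K * R) * C.dev)\<^sup>2" using d0 by (rule power_mono)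
 then have "c * ?d\<^sup>2 \<le> c * ((10 * K * R)\<^sup>2 * C.dev\<^sup>2)" using c0 by (simp add: power_mult_distrib)
 also have "\<dots> = C.dev\<^sup>2 / (50 * 16 powr (5/6))" unfolding c using K0 R(1) by simp
 finally have up: "c * ?d\<^sup>2 \<le> C.dev\<^sup>2 / (50 * 16 powr (5/6))" .
 have "2 * (12 * sqrt 3 + 6 + C.dev\<^sup>2 / 50) / 16 powr (5/6) \<le> isoperimetric_quotient P"
  by (rule C.isoperimetric_lower[OF C.st C.dev_small])
 moreover have "2 * (12 * sqrt 3 + 6 + C.dev\<^sup>2 / 50) / 16 powr (5/6)
   = 2 * (12 * sqrt 3 + 6) / 16 powr (5/6) + 2 * (C.dev\<^sup>2 / (50 * 16 powr (5/6)))"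
  by (simp add: add_divide_distrib distrib_left)
 ultimately have low: "2 * (C.dev\<^sup>2 / (50 * 16 powr (5/6))) \<le> ?I" using isoperimetric_quotient_A_le by linarith
 have nn: "C.dev\<^sup>2 / (50 * 16 powr (5/6)) \<ge> 0" by simp
 have "?I = c * ?d\<^sup>2 \<longleftrightarrow> similar P A"
 proof
  assume "?I = c * ?d\<^sup>2"
  then have "C.dev\<^sup>2 / (50 * 16 powr (5/6)) \<le> 0" using low up by linarith
  then have "C.dev\<^sup>2 \<le> 0" using pw by (simp add: divide_le_0_iff)
  then have "C.dev = 0" by simp
  then show "similar P A" by (rule C.dev_zero_similar)
 next
  assume s: "similar P A"
  have "?d = 0" by (rule similarity_distance_similar[OF compact_A bA(2) volume_A_pos s])
  then show "?I = c * ?d\<^sup>2" using arch.isoperimetric_quotient_similar[OF s volume_A_pos] by simp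
 qed
 then show ?thesis using low up nn by linarith
qed

text \<open>If the point were outside, a hyperplane with normal \<open>a\<close> would separate it
  from \<open>P\<close> and, up to the Hausdorff distance, from \<open>A\<close>. The least value of
  \<open>a\<close> on \<open>A\<close> is at most \<open>- (\<rho> * norm a)\<close> because of the
  ball in \<open>A\<close>, so the factor \<open>1 - \<delta>\<close> raises it by at least
  \<open>\<delta> * \<rho> * norm a\<close>, which makes up for that loss.\<close>

lemma scaled_subset_of_hausdorff:
 assumes \<rho>: "\<rho> > 0" "cball 0 \<rho> \<subseteq> A" and P: "compact P" "convex P" "P \<noteq> {}"
  and \<delta>: "0 < \<delta>" "\<delta> < 1" and d: "hausdorff_distance P A < \<rho> * \<delta>" and x: "x \<in> A"
 shows "(1 - \<delta>) *R x \<in> P"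
proof (rule ccontr)
 let ?z = "(1 - \<delta>) *R x"
 assume "?z \<notin> P"
 then obtain a b where ab: "a \<bullet> ?z < b" "\<And>y. y \<in> P \<Longrightarrow> b < a \<bullet> y"
  using separating_hyperplane_closed_point[OF P(2) compact_imp_closed[OF P(1)]] by blast
 have bA: "bounded A" "A \<noteq> {}" using compact_A compact_imp_bounded zero_mem_A by auto
 have far: "b - norm a * (\<rho> * \<delta>) < a \<bullet> x'" if x': "x' \<in> A" for x'
 proof -
  obtain y where y: "y \<in> P" "infdist x' P = dist x' y" using infdist_attains_inf[OF compact_imp_closed[OF P(1)] P(3)] by blast
  have "dist x' y \<le> \<rho> * \<delta>"
   using infdist_le_hausdorff(2)[OF compact_imp_bounded[OF P(1)] bA(1) P(3) bA(2) x'] d y(2) by linarith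
  then have "norm a * norm (y - x') \<le> norm a * (\<rho> * \<delta>)" by (intro mult_left_mono) (simp_all add: dist_norm norm_minus_commute)
  then have "a \<bullet> (y - x') \<le> norm a * (\<rho> * \<delta>)" using norm_cauchy_schwarz[of a "y - x'"] by linarith
  then show ?thesis using ab(2)[OF y(1)] by (simp add: inner_diff_right)
 qed
 obtain x0 where x0: "x0 \<in> A" "\<And>x'. x' \<in> A \<Longrightarrow> a \<bullet> x0 \<le> a \<bullet> x'"
 proof -
  have "continuous_on A (\<lambda>x. a \<bullet> x)" by (intro continuous_intros)
  from continuous_attains_inf[OF compact_A bA(2) this] show ?thesis using that by blast
 qed
 have low: "a \<bullet> x0 \<le> - (\<rho> * norm a)"
 proof (cases "a = 0")
  case False
  have "- (\<rho> / norm a) *R a \<in> A" using \<rho> False by (intro subsetD[OF \<rho>(2)]) simp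
  from x0(2)[OF this] show ?thesis using False by (simp add: dot_square_norm power2_eq_square)
 qed simp
 have "(1 - \<delta>) * (a \<bullet> x0) \<le> (1 - \<delta>) * (a \<bullet> x)" using \<delta> x0(2)[OF x] by (intro mult_left_mono) auto
 then have "(1 - \<delta>) * (a \<bullet> x0) < b" using ab(1) by simp
 moreover have "(1 - \<delta>) * (a \<bullet> x0) = a \<bullet> x0 - \<delta> * (a \<bullet> x0)" by (simp add: algebra_simps)
 moreover have "\<delta> * (a \<bullet> x0) \<le> \<delta> * (- (\<rho> * norm a))" using low \<delta> by (intro mult_left_mono) auto
 moreover have "\<delta> * (- (\<rho> * norm a)) = - (norm a * (\<rho> * \<delta>))" by simp
 ultimately show False using far[OF x0(1)] by linarith
qed

text \<open>The difference between \<open>x\<close> and its nearest point in \<open>A\<close> is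
  \<open>\<delta>\<close> times a point of the ball inside \<open>A\<close>; the inequality of the
  cut applies to both of these points of \<open>A\<close>.\<close>

lemma upper_of_hausdorff:
 assumes \<rho>: "\<rho> > 0" "cball 0 \<rho> \<subseteq> A" and P: "compact P" "P \<noteq> {}"
  and \<delta>: "0 < \<delta>" and d: "hausdorff_distance P A < \<rho> * \<delta>" and x: "x \<in> P" and S: "S \<in> cuts"
 shows "vS S \<bullet> x \<le> (1 + \<delta>) * bS S"
proof -
 have bA: "bounded A" "A \<noteq> {}" using compact_A compact_imp_bounded zero_mem_A by auto
 obtain y where y: "y \<in> A" "infdist x A = dist x y" using infdist_attains_inf[OF closed_A bA(2)] by blast
 have "dist x y \<le> \<rho> * \<delta>"
  using infdist_le_hausdorff(1)[OF compact_imp_bounded[OF P(1)] bA(1) P(2) bA(2) x] d y(2) by linarith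
 then have "norm ((1 / \<delta>) *R (x - y)) \<le> \<rho>" using \<delta> by (simp add: dist_norm pos_divide_le_eq)
 then have "(1 / \<delta>) *R (x - y) \<in> A" using \<rho>(2) by auto
 then have "vS S \<bullet> ((1 / \<delta>) *R (x - y)) \<le> bS S" using S unfolding A_eq by blast
 then have "vS S \<bullet> (x - y) \<le> \<delta> * bS S" using \<delta> by (simp add: pos_divide_le_eq mult.commute)
 moreover have "vS S \<bullet> y \<le> bS S" using y(1) S unfolding A_eq by blast
 ultimately show ?thesis by (simp add: inner_diff_right algebra_simps)
qed

lemma tile_exists:
 assumes "P \<in> centered_parallelohedra" obtains T where "centered_tile P T"
proof -
 obtain T where T: "face_to_face_translation_tiling P T" and P: "polytope P" "interior P \<noteq> {}" "uminus ` P = P"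
  using assms by (auto simp: centered_parallelohedra_def parallelohedron_def)
 have "T \<noteq> {}" using T unfolding face_to_face_translation_tiling_def by blast
 then obtain u where u: "u \<in> T" by blast
 have "centered_tile P ((+) (- u) ` T)"
 proof
  show "face_to_face_translation_tiling P ((+) (- u) ` T)" by (rule face_to_face_tiling_translate[OF T])
  show "0 \<in> (+) (- u) ` T" using u by (rule rev_image_eqI) simp
 qed (rule P)+
 then show ?thesis by (rule that)
qed

lemma eventually_close_tile:
 fixes P :: "nat \<Rightarrow> (real^3) set"
 assumes P: "\<And>n. P n \<in> centered_parallelohedra" and \<rho>: "\<rho> > 0" "cball 0 \<rho> \<subseteq> A"
  and \<delta>: "\<And>n. 0 < \<delta> n" "\<And>n. \<delta> n < 1" "\<delta> \<longlonglongrightarrow> 0" and d: "\<And>n. hausdorff_distance (P n) A < \<rho> * \<delta> n"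
  and e: "e > 0"
 shows "eventually (\<lambda>n. \<exists>T N t. close_tile v k A (P n) T N t \<and> selling_tile.dev N t < e) sequentially"
proof -
 have "\<forall>n. \<exists>T. centered_tile (P n) T" using tile_exists[OF P] by metis
 then obtain T where T: "\<And>n. centered_tile (P n) (T n)" by metis
 have cP: "compact (P n)" "convex (P n)" "P n \<noteq> {}" for n
  using centered_tile.compact[OF T] centered_tile.convex[OF T] centered_tile.zero_mem[OF T] by auto
 interpret Q: to_sequence v k P T \<delta>
 proof (rule to_sequence.intro[OF to_frame_axioms], rule to_sequence_axioms.intro)
  show "centered_tile (P n) (T n)" for n by (rule T)
  show "0 < \<delta> n" "\<delta> n < 1" for n by (rule \<delta>)+
  show "\<delta> \<longlonglongrightarrow> 0" by (rule \<delta>)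
  show "(1 - \<delta> n) *R x \<in> P n" if "\<And>S. S \<in> cuts \<Longrightarrow> vS S \<bullet> x \<le> bS S" for n x
   by (rule scaled_subset_of_hausdorff[OF \<rho> cP \<delta>(1,2) d]) (use that in \<open>simp add: A_eq\<close>)
  show "vS S \<bullet> x \<le> (1 + \<delta> n) * bS S" if "x \<in> P n" "S \<in> cuts" for n x S
   by (rule upper_of_hausdorff[OF \<rho> cP(1,3) \<delta>(1) d that])
 qed
 obtain N t where Nt: "\<And>i. (\<lambda>n. N n i) \<longlonglongrightarrow> v i" "\<And>i. (\<lambda>n. t n i) \<longlonglongrightarrow> v i"
  "eventually (\<lambda>n. selling_tile (P n) (T n) (N n) (t n)) sequentially"
  using Q.eventually_selling_tile by blast
 \<comment> \<open>The parameters are repeated as plain functions of \<open>n\<close>, because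
   \<open>selling_tile\<close> holds only from some index on, while their limits concern the whole
   sequence.\<close>
 define p where "p n i j = - (N n i \<bullet> t n j)" for n i j
 define c where "c n i j = - (N n i \<bullet> N n j)" for n i j
 define \<sigma> where "\<sigma> n = (p n L0 L1 + p n L0 L2 + p n L0 L3 + p n L2 L3 + p n L1 L3 + p n L1 L2) / 6" for n
 define \<tau> where "\<tau> n = (c n L0 L1 + c n L0 L2 + c n L0 L3 + c n L2 L3 + c n L1 L3 + c n L1 L2) / 6" for n
 define q where "q n i j = p n i j / \<sigma> n - 1" for n i j
 define g where "g n i j = c n i j / \<tau> n - 1" for n i j
 define dv where "dv n = sqrt (((q n L0 L1)\<^sup>2 + (q n L0 L2)\<^sup>2 + (q n L0 L3)\<^sup>2 + (q n L2 L3)\<^sup>2 + (q n L1 L3)\<^sup>2 + (q n L1 L2)\<^sup>2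
  + ((g n L0 L1)\<^sup>2 + (g n L0 L2)\<^sup>2 + (g n L0 L3)\<^sup>2 + (g n L2 L3)\<^sup>2 + (g n L1 L3)\<^sup>2 + (g n L1 L2)\<^sup>2)) / 2)" for n
 have plim: "(\<lambda>n. p n i j) \<longlonglongrightarrow> k" and clim: "(\<lambda>n. c n i j) \<longlonglongrightarrow> k" if "i \<noteq> j" for i j
  using tendsto_minus[OF tendsto_inner[OF Nt(1)[of i] Nt(2)[of j]]] tendsto_minus[OF tendsto_inner[OF Nt(1)[of i] Nt(1)[of j]]] that
  by (simp_all add: p_def c_def gram)
 have "\<sigma> \<longlonglongrightarrow> (k + k + k + k + k + k) / 6" "\<tau> \<longlonglongrightarrow> (k + k + k + k + k + k) / 6"
  unfolding \<sigma>_def \<tau>_def by (intro tendsto_divide tendsto_add tendsto_const plim clim; simp)+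
 then have slim: "\<sigma> \<longlonglongrightarrow> k" "\<tau> \<longlonglongrightarrow> k" by simp_all
 have qlim: "(\<lambda>n. q n i j) \<longlonglongrightarrow> 0" and glim: "(\<lambda>n. g n i j) \<longlonglongrightarrow> 0" if "i \<noteq> j" for i j
 proof -
  have "k \<noteq> 0" using k by simp
  then have "(\<lambda>n. q n i j) \<longlonglongrightarrow> k / k - 1" "(\<lambda>n. g n i j) \<longlonglongrightarrow> k / k - 1"
   unfolding q_def g_def by (intro tendsto_diff tendsto_divide tendsto_const plim clim slim that; simp)+
  then show "(\<lambda>n. q n i j) \<longlonglongrightarrow> 0" "(\<lambda>n. g n i j) \<longlonglongrightarrow> 0" using k by simp_all
 qed
 have "dv \<longlonglongrightarrow> sqrt ((0\<^sup>2 + 0\<^sup>2 + 0\<^sup>2 + 0\<^sup>2 + 0\<^sup>2 + 0\<^sup>2 + (0\<^sup>2 + 0\<^sup>2 + 0\<^sup>2 + 0\<^sup>2 + 0\<^sup>2 + 0\<^sup>2)) / 2)"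
  unfolding dv_def by (intro tendsto_real_sqrt tendsto_divide tendsto_add tendsto_power tendsto_const qlim glim; simp)
 then have dlim: "dv \<longlonglongrightarrow> 0" by simp
 let ?F = "det (columns3 (v L0 + v L1) (v L0 + v L2) (v L0 + v L3))"
 have "(\<lambda>n. det (columns3 (N n L0 + N n L1) (N n L0 + N n L2) (N n L0 + N n L3)) * ?F) \<longlonglongrightarrow> ?F * ?F"
  unfolding columns3_def det_transpose unfolding det_3 vector_3 by (intro tendsto_intros Nt)
 moreover have "?F * ?F > 0"
 proof -
  have "det (vector [v L0 + v L1, v L0 + v L2, v L0 + v L3] :: real^3^3) = ?F"
   unfolding columns3_def by (rule det_transpose[symmetric])
  then have "?F * ?F = (4 * k) * ((4 * k) * (4 * k))"
   using det_rows_columns3[of "v L0 + v L1" "v L0 + v L2" "v L0 + v L3" "v L0 + v L1" "v L0 + v L2" "v L0 + v L3"]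
   by (simp add: inner_add gram)
  then show ?thesis using k by simp
 qed
 ultimately have ev: "eventually (\<lambda>n. det (columns3 (N n L0 + N n L1) (N n L0 + N n L2) (N n L0 + N n L3)) * ?F > 0) sequentially"
  by (rule order_tendstoD(1))
 have "1 / 100000 > (0::real)" by simp
 from Nt(3) ev order_tendstoD(1)[OF slim(1) k] order_tendstoD(1)[OF slim(2) k] order_tendstoD(2)[OF dlim this] order_tendstoD(2)[OF dlim e]
 show ?thesis
 proof eventually_elim
  case (elim n)
  interpret S: selling_tile "P n" "T n" "N n" "t n" by (rule elim(1))
  have eqs: "S.\<sigma> = \<sigma> n" "S.\<tau> = \<tau> n"
   unfolding S.\<sigma>_def S.\<tau>_def \<sigma>_def \<tau>_def p_def c_def S.p_def S.\<gamma>_def by (rule refl)+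
  have "S.dev = dv n"
   unfolding S.dev_def dv_def S.q_def S.g_def q_def g_def eqs p_def c_def S.p_def S.\<gamma>_def by (rule refl)
  then have dev: "S.dev < 1 / 100000" "S.dev < e" using elim(5,6) by simp_all
  have "close_tile v k A (P n) (T n) (N n) (t n)"
   using elim(2-4) dev(1) by unfold_locales (simp_all add: eqs)
  with dev(2) show ?case by blast
 qed
qed

text \<open>Without a radius \<open>e\<close> there would be counterexamples arbitrarily near
  \<open>A\<close>; along such a sequence the deviation becomes small, and
  \<open>stability_gap\<close> applies to a member of it.\<close>

theorem neighbourhood_estimate:
 obtains c e where "c > 0" "e > 0"
  "\<And>P. \<lbrakk>P \<in> centered_parallelohedra; hausdorff_distance P A < e\<rbrakk> \<Longrightarrow>
    isoperimetric_quotient P - isoperimetric_quotient A \<ge> c * (similarity_distance P A)\<^sup>2 \<and>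
    (isoperimetric_quotient P - isoperimetric_quotient A = c * (similarity_distance P A)\<^sup>2 \<longleftrightarrow> similar P A)"
proof -
 obtain R where R: "R > 0" "\<And>x. x \<in> A \<Longrightarrow> norm x \<le> R" using A_bounded by blast
 define K where "K = (320 * sqrt k * R + 4 * k) / (3/2 * k)"
 have K0: "K > 0" unfolding K_def using k R(1) by (simp add: add_nonneg_pos)
 define c where "c = 1 / (50 * 16 powr (5/6) * (10 * K * R)\<^sup>2)"
 have c0: "c > 0" unfolding c_def using K0 R(1) by simp
 define good where "good P \<longleftrightarrow> isoperimetric_quotient P - isoperimetric_quotient A \<ge> c * (similarity_distance P A)\<^sup>2 \<and>
    (isoperimetric_quotient P - isoperimetric_quotient A = c * (similarity_distance P A)\<^sup>2 \<longleftrightarrow> similar P A)" for P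
 obtain \<rho> where \<rho>: "\<rho> > 0" "cball 0 \<rho> \<subseteq> A" using arch.zero_int mem_interior_cball by blast
 have "\<exists>e>0. \<forall>P\<in>centered_parallelohedra. hausdorff_distance P A < e \<longrightarrow> good P"
 proof (rule ccontr)
  assume neg: "\<not> ?thesis"
  \<comment> \<open>The shift by 2 keeps \<open>\<delta> n\<close> strictly between 0 and 1 already
    at \<open>n = 0\<close>.\<close>
  define \<delta> where "\<delta> n = 1 / (real n + 2)" for n
  have d: "0 < \<delta> n" "\<delta> n < 1" for n by (simp_all add: \<delta>_def)
  have dl: "\<delta> \<longlonglongrightarrow> 0"
  proof -
   have "(\<lambda>n. 1 / real (n + 2)) \<longlonglongrightarrow> 0" by (rule LIMSEQ_ignore_initial_segment[OF lim_1_over_n])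
   then show ?thesis by (simp add: \<delta>_def[abs_def] add.commute)
  qed
  have "\<exists>P. P \<in> centered_parallelohedra \<and> hausdorff_distance P A < \<rho> * \<delta> n \<and> \<not> good P" for n
   using neg \<rho>(1) d(1)[of n] mult_pos_pos by blast
  then obtain P where P: "\<And>n. P n \<in> centered_parallelohedra" "\<And>n. hausdorff_distance (P n) A < \<rho> * \<delta> n" "\<And>n. \<not> good (P n)"
   by metis
  have "1 / (2 * K) > 0" using K0 by simp
  from eventually_close_tile[OF P(1) \<rho> d dl P(2) this]
  obtain n T N t where "close_tile v k A (P n) T N t" "selling_tile.dev N t < 1 / (2 * K)"
   using eventually_happens'[OF sequentially_bot] by blast
  moreover from this(2) have "K * selling_tile.dev N t \<le> 1/2" using K0 by (simp add: field_simps)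
  ultimately have "good (P n)" unfolding good_def using stability_gap[OF _ R K_def _ c_def] by blast
  then show False using P(3) by blast
 qed
 then obtain e where "e > 0" "\<And>P. \<lbrakk>P \<in> centered_parallelohedra; hausdorff_distance P A < e\<rbrakk> \<Longrightarrow> good P" by blast
 with c0 show ?thesis unfolding good_def by (rule that)
qed

end

theorem theorem1:
  fixes P_Arch :: "(real^3) set"
  assumes "P_Arch \<in> centered_parallelohedra"
    and "archimedean_truncated_octahedron P_Arch"
  shows "\<exists>U c_sim. hausdorff_neighborhood centered_parallelohedra P_Arch U \<and> c_sim > 0 \<and>
    (\<forall>P\<in>U.
       isoperimetric_quotient P - isoperimetric_quotient P_Arch
         \<ge> c_sim * (similarity_distance P P_Arch)\<^sup>2 \<and>
       (isoperimetric_quotient P - isoperimetric_quotient P_Arch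
         = c_sim * (similarity_distance P P_Arch)\<^sup>2 \<longleftrightarrow> similar P P_Arch))"
proof -
 interpret a: archimedean P_Arch
  using assms by unfold_locales (auto simp: centered_parallelohedra_def parallelohedron_def)
 obtain v where v: "to_body v (2 * a.l2) P_Arch" by (rule a.to_body_exists)
 interpret b: to_body v "2 * a.l2" P_Arch by (rule v)
 interpret arch_body P_Arch v "2 * a.l2" by unfold_locales (rule refl)
 obtain c e where ce: "c > 0" "e > 0"
  "\<And>P. \<lbrakk>P \<in> centered_parallelohedra; hausdorff_distance P P_Arch < e\<rbrakk> \<Longrightarrow>
    isoperimetric_quotient P - isoperimetric_quotient P_Arch \<ge> c * (similarity_distance P P_Arch)\<^sup>2 \<and>
    (isoperimetric_quotient P - isoperimetric_quotient P_Arch = c * (similarity_distance P P_Arch)\<^sup>2 \<longleftrightarrow> similar P P_Arch)"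
  using neighbourhood_estimate by blast
 show ?thesis
  by (intro exI[of _ "{P \<in> centered_parallelohedra. hausdorff_distance P P_Arch < e}"] exI[of _ c] conjI)
   (use ce in \<open>auto simp: hausdorff_neighborhood_def\<close>)
qed

end
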